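(* There is an isomorphism of functors $\mathrm{id}\to D_A^{\tilde G}$ on the factor $\mathcal R_r(\tilde G)$. In particular, $D_A^{\tilde G}(\tilde\pi)=\tilde\pi$ functorially for any supercuspidal representation $\tilde\pi\in\mathcal R(\tilde G)$.
   Context: **Setting.** $F$ is a non-archimedean local field and $\tilde G$ is an affine algebraic $F$-group whose identity component $G$ is reductive (no assumption on the finite component group). $\mathcal R(\tilde G)$ is the category of smooth finite-length complex representations of $\tilde G(F)$ (likewise $\mathcal R(G)$, etc.); $V_\pi$ is the space of $\pi$; $\mathrm{Res}:\mathcal R(\tilde G)\to\mathcal R(G)$ is restriction to $G(F)$. A representation $\tilde\pi\in\mathcal R(\tilde G)$ is called supercuspidal if $\mathrm{Res}(\tilde\pi)$ is supercuspidal. Fix a minimal parabolic pair $(M_0,P_0)$ of $G$ over $F$, let $A_0$ be the maximal split central torus of $M_0$, $S\subset X^*(A_0)$ the set of simple relative roots, $r=|S|$. For $J\subset S$ let $P_J=M_JU_J\supset P_0$ be the standard parabolic whose Lie algebra is the sum of the $A_0$-weight spaces for weights that are integral combinations of $S$ with non-negative coefficients on $S\smallsetminus J$ (so $P_S=G$, $P_\varnothing=P_0$). Let $i_P^G$, $r_P^G$ denote normalized parabolic induction and restriction (Jacquet module). **The categories $\mathcal R_t$.** $\mathcal R_t(G)\subset\mathcal R(G)$ is the full subcategory of those $\pi$ such that every irreducible subquotient of $\pi$ is a subquotient of $i_{P_I}^G(\tau)$ for some $I\subset S$ with $|I|=t$ and some irreducible supercuspidal representation $\tau$ of $M_I(F)$.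 $\mathcal R_t(\tilde G)$ is the preimage of $\mathcal R_t(G)$ under $\mathrm{Res}$. One has $\mathcal R(\tilde G)=\prod_{t=0}^r\mathcal R_t(\tilde G)$; the factor $\mathcal R_r(\tilde G)$ contains all supercuspidal representations. **The functor $D_A^{\tilde G}$.** Let $\tilde N$ be the normalizer of $(M_0,P_0)$ in $\tilde G$. Then $\tilde G(F)=G(F)\tilde N(F)$, $\tilde N(F)\cap G(F)=M_0(F)$, and $\tilde N(F)$ acts on $S$ with $M_0(F)$ acting trivially. For $\tilde\pi\in\mathcal R(\tilde G)$ and $\pi=\mathrm{Res}(\tilde\pi)$ put $$X_J(\pi)=i_{P_J}^Gr_{P_J}^G\pi=\{f:G(F)\to (V_\pi)_{U_J(F)}\text{ smooth}\mid f(pg)=\pi(p)f(g),\ p\in P_J(F)\},$$ with $G(F)$ acting by right translation; $\Lambda_J=\bigwedge^{|S\smallsetminus J|}\mathbb C^{S\smallsetminus J}$; $Y_J=X_J\otimes_{\mathbb C}\Lambda_J$; $Y_t=\bigoplus_{|J|=t}Y_J$. For $I\subset J$ with $J\smallsetminus I=\{i\}$ let $\psi^J_I:Y_J\to Y_I$ be the tensor product of composition with the projection $(V_\pi)_{U_J(F)}\to(V_\pi)_{U_I(F)}$ and the map $\Lambda_J\to\Lambda_I$, $\omega\mapsto\omega\wedge e_i$; let $d_t:Y_t\to Y_{t-1}$ be the sum of all $\psi_I^J$ with $I\subset J$, $|J|=t$, $|I|=t-1$. The group $\tilde G(F)$ acts on $Y_t(\pi)$ as follows: $g\in G(F)$ acts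 by right translation on the factors $X_J(\pi)$ and trivially on $\Lambda_J$; $n\in\tilde N(F)$, inducing the permutation $a$ of $S$, sends $x\otimes z\in X_J(\pi)\otimes\Lambda_J$ to $\big(h\mapsto\tilde\pi(n)x(n^{-1}hn)\big)\otimes\lambda_J(a)(z)\in X_{aJ}(\pi)\otimes\Lambda_{aJ}$, where $\lambda_J(a):\Lambda_J\to\Lambda_{aJ}$ is induced by the bijection $a:S\smallsetminus J\to S\smallsetminus aJ$. This is a well-defined action commuting with the $d_t$, giving functors $Y_t^{\tilde G}:\mathcal R(\tilde G)\to\mathcal R(\tilde G)$. On $\mathcal R_t(\tilde G)$ define $D_A^{\tilde G}=\mathrm{cok}(d_{t+1}:Y_{t+1}^{\tilde G}\to Y_t^{\tilde G})$ (with $Y_{r+1}=0$), and take the product over $t$ to get $D_A^{\tilde G}:\mathcal R(\tilde G)\to\mathcal R(\tilde G)$. *)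

theory Defs
  imports
    "HOL-Analysis.Analysis"
    "HOL-Algebra.Solvable_Groups"
    "HOL-Algebra.Module"
    "HOL-Algebra.Algebraic_Closure_Type"
begin

section \<open>Local fields and the topology on matrices\<close>

text \<open>A nontrivial non-archimedean absolute value with locally compact metric topology.\<close>

definition field_top :: "('f::field \<Rightarrow> real) \<Rightarrow> 'f topology" where
  "field_top v = Metric_space.mtopology UNIV (\<lambda>x y. v (x - y))"

definition nonarch_local_field :: "('f::field \<Rightarrow> real) \<Rightarrow> bool" where
  "nonarch_local_field v \<longleftrightarrow>
     (\<forall>x. 0 \<le> v x) \<and> (\<forall>x. v x = 0 \<longleftrightarrow> x = 0) \<and>
     (\<forall>x y. v (x * y) = v x * v y) \<and> (\<forall>x y. v (x + y) \<le> max (v x) (v y)) \<and>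
     (\<exists>x. x \<noteq> 0 \<and> v x \<noteq> 1) \<and>
     locally_compact_space (field_top v)"

definition mat_top :: "('f::field \<Rightarrow> real) \<Rightarrow> ('f^'n^'n) topology" where
  "mat_top v = pullback_topology UNIV (\<lambda>A (i, j). A $ i $ j) (product_topology (\<lambda>_. field_top v) UNIV)"

section \<open>Linear algebraic groups\<close>

text \<open>An affine algebraic \<open>F\<close>-group is a Zariski closed subgroup of \<open>GL\<^sub>n\<close> over the
  algebraic closure \<open>K\<close> of \<open>F\<close> whose vanishing ideal is generated by polynomials over \<open>F\<close>.
  This is the language of varieties: all groups are smooth, as is automatic for a group
  with reductive identity component. As \<open>K\<close> is infinite, polynomials in the matrix entries are
  represented by the functions they define; \<open>polyfun R\<close> are those with coefficients
  in the subring \<open>R\<close>.\<close>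

inductive_set polyfun :: "'k set \<Rightarrow> ('k::field^'n^'n \<Rightarrow> 'k) set" for R where
  const: "c \<in> R \<Longrightarrow> (\<lambda>A. c) \<in> polyfun R"
| entry: "(\<lambda>A. A $ i $ j) \<in> polyfun R"
| add: "p \<in> polyfun R \<Longrightarrow> q \<in> polyfun R \<Longrightarrow> (\<lambda>A. p A + q A) \<in> polyfun R"
| mult: "p \<in> polyfun R \<Longrightarrow> q \<in> polyfun R \<Longrightarrow> (\<lambda>A. p A * q A) \<in> polyfun R"

definition GL :: "('k::field^'n^'n) set" where
  "GL = {g. invertible g}"

definition zariski :: "('k::field^'n^'n) topology" where
  "zariski = topology_generated_by {{A. p A \<noteq> 0} | p. p \<in> polyfun UNIV}"

definition matgrp :: "('k::field^'n^'n) set \<Rightarrow> ('k^'n^'n) monoid" where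
  "matgrp H = \<lparr>carrier = H, mult = (**), one = mat 1\<rparr>"

definition alg_group :: "('k::field^'n^'n) set \<Rightarrow> bool" where
  "alg_group H \<longleftrightarrow> subgroup H (matgrp GL) \<and> closedin (subtopology zariski GL) H"

definition vanishing :: "('k::field^'n^'n) set \<Rightarrow> ('k^'n^'n \<Rightarrow> 'k) set" where
  "vanishing H = {p \<in> polyfun UNIV. \<forall>g\<in>H. p g = 0}"

definition emb :: "'f::field^'n^'n \<Rightarrow> 'f alg_closure^'n^'n" where
  "emb = map_matrix to_ac"

definition F_group :: "('f::field alg_closure^'n^'n) set \<Rightarrow> bool" where
  "F_group H \<longleftrightarrow> alg_group H \<and>
     (\<forall>p\<in>vanishing H. \<exists>(m::nat) c q.
        (\<forall>i<m. c i \<in> polyfun UNIV \<and> q i \<in> vanishing H \<inter> polyfun (range to_ac)) \<and>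
        p = (\<lambda>A. \<Sum>i<m. c i A * q i A))"

definition Fpts :: "('f::field alg_closure^'n^'n) set \<Rightarrow> ('f^'n^'n) set" where
  "Fpts H = {g. emb g \<in> H}"

definition Fpts_top :: "('f::field \<Rightarrow> real) \<Rightarrow> ('f alg_closure^'n^'n) set \<Rightarrow> ('f^'n^'n) topology" where
  "Fpts_top v H = subtopology (mat_top v) (Fpts H)"

definition conj_set :: "'k::field^'n^'n \<Rightarrow> ('k^'n^'n) set \<Rightarrow> ('k^'n^'n) set" where
  "conj_set g H = (\<lambda>h. g ** h ** matrix_inv g) ` H"

definition identity_component :: "('k::field^'n^'n) set \<Rightarrow> ('k^'n^'n) set" where
  "identity_component H = connected_component_of_set (subtopology zariski H) (mat 1)"

definition unipotent :: "'k::field^'n^'n \<Rightarrow> bool" where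
  "unipotent g \<longleftrightarrow> (\<exists>m. (((**) (g - mat 1)) ^^ m) (mat 1) = 0)"

text \<open>The unipotent radical, i.e. the largest connected closed normal unipotent subgroup; it
  is the union of all of them.\<close>

definition unip_radical :: "('k::field^'n^'n) set \<Rightarrow> ('k^'n^'n) set" where
  "unip_radical H = \<Union>{U. alg_group U \<and> connectedin zariski U \<and> U \<subseteq> H \<and>
     (\<forall>h\<in>H. conj_set h U = U) \<and> (\<forall>u\<in>U. unipotent u)}"

definition reductive_F_group :: "('f::field alg_closure^'n^'n) set \<Rightarrow> bool" where
  "reductive_F_group H \<longleftrightarrow> F_group H \<and> connectedin zariski H \<and> unip_radical H = {mat 1}"

definition solvable_connected :: "('k::field^'n^'n) set \<Rightarrow> ('k^'n^'n) set \<Rightarrow> bool" where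
  "solvable_connected G B \<longleftrightarrow> alg_group B \<and> B \<subseteq> G \<and> connectedin zariski B \<and> solvable (matgrp B)"

definition borel :: "('k::field^'n^'n) set \<Rightarrow> ('k^'n^'n) set \<Rightarrow> bool" where
  "borel G B \<longleftrightarrow> solvable_connected G B \<and> (\<forall>B'. solvable_connected G B' \<and> B \<subseteq> B' \<longrightarrow> B' = B)"

definition parabolic_F ::
  "('f::field alg_closure^'n^'n) set \<Rightarrow> ('f alg_closure^'n^'n) set \<Rightarrow> bool" where
  "parabolic_F G P \<longleftrightarrow> F_group P \<and> P \<subseteq> G \<and> (\<exists>B. borel G B \<and> B \<subseteq> P)"

definition levi_F ::
  "('f::field alg_closure^'n^'n) set \<Rightarrow> ('f alg_closure^'n^'n) set \<Rightarrow> bool" where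
  "levi_F P M \<longleftrightarrow> F_group M \<and> M \<subseteq> P \<and>
     P = {m ** u | m u. m \<in> M \<and> u \<in> unip_radical P} \<and> M \<inter> unip_radical P = {mat 1}"

definition minimal_parabolic_pair ::
  "('f::field alg_closure^'n^'n) set \<Rightarrow> ('f alg_closure^'n^'n) set \<Rightarrow> ('f alg_closure^'n^'n) set \<Rightarrow> bool"
  where
  "minimal_parabolic_pair G M\<^sub>0 P\<^sub>0 \<longleftrightarrow> parabolic_F G P\<^sub>0 \<and>
     (\<forall>P. parabolic_F G P \<and> P \<subseteq> P\<^sub>0 \<longrightarrow> P = P\<^sub>0) \<and> levi_F P\<^sub>0 M\<^sub>0"

definition split_torus :: "('f::field alg_closure^'n^'n) set \<Rightarrow> bool" where
  "split_torus T \<longleftrightarrow> F_group T \<and> connectedin zariski T \<and>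
     (\<exists>h::'f^'n^'n. invertible h \<and>
        (\<forall>t\<in>T. \<forall>i j. i \<noteq> j \<longrightarrow> (emb h ** t ** emb (matrix_inv h)) $ i $ j = 0))"

definition center :: "('k::field^'n^'n) set \<Rightarrow> ('k^'n^'n) set" where
  "center H = {z\<in>H. \<forall>h\<in>H. z ** h = h ** z}"

text \<open>There is only one maximal split torus in the center: it contains all the others.\<close>

definition maximal_split_central_torus ::
  "('f::field alg_closure^'n^'n) set \<Rightarrow> ('f alg_closure^'n^'n) set \<Rightarrow> bool" where
  "maximal_split_central_torus M A \<longleftrightarrow> split_torus A \<and> A \<subseteq> center M \<and>
     (\<forall>T. split_torus T \<and> T \<subseteq> center M \<longrightarrow> T \<subseteq> A)"

section \<open>Lie algebras, roots and standard parabolic subgroups\<close>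

definition mscale :: "'k::field \<Rightarrow> 'k^'n^'n \<Rightarrow> 'k^'n^'n" where
  "mscale c = map_matrix ((*) c)"

text \<open>The tangent space at the identity: for a polynomial \<open>p\<close> vanishing on the
  group, the coefficient of \<open>t\<close> in the polynomial \<open>q(t) = p(1 + tZ)\<close> is the derivative of \<open>p\<close> at \<open>1\<close>
  in the direction \<open>Z\<close>.\<close>

definition lie :: "('k::field^'n^'n) set \<Rightarrow> ('k^'n^'n) set" where
  "lie H = {Z. \<forall>p\<in>vanishing H. \<forall>q::'k poly.
     (\<forall>t. poly q t = p (mat 1 + mscale t Z)) \<longrightarrow> poly.coeff q 1 = 0}"

text \<open>Characters are regular functions on \<open>A\<close>, i.e. quotients of polynomials by powers of \<open>det\<close>.
  They are extended by \<open>undefined\<close> outside \<open>A\<close>, so that equality of characters is equality of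
  functions. The group of characters is written multiplicatively.\<close>

definition characters :: "('k::field^'n^'n) set \<Rightarrow> ('k^'n^'n \<Rightarrow> 'k) set" where
  "characters A = {\<phi> \<in> extensional A.
     (\<forall>a\<in>A. \<phi> a \<noteq> 0) \<and> (\<forall>a\<in>A. \<forall>b\<in>A. \<phi> (a ** b) = \<phi> a * \<phi> b) \<and>
     (\<exists>p\<in>polyfun UNIV. \<exists>m::nat. \<forall>a\<in>A. \<phi> a = p a / det a ^ m)}"

definition char_comb :: "('k::field^'n^'n) set \<Rightarrow> ('k^'n^'n \<Rightarrow> 'k) set \<Rightarrow>
    (('k^'n^'n \<Rightarrow> 'k) \<Rightarrow> int) \<Rightarrow> 'k^'n^'n \<Rightarrow> 'k" where
  "char_comb A S m = (\<lambda>a\<in>A. \<Prod>\<alpha>\<in>S. \<alpha> a powi m \<alpha>)"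

definition weight_space :: "('k::field^'n^'n) set \<Rightarrow> ('k^'n^'n) set \<Rightarrow> ('k^'n^'n \<Rightarrow> 'k) \<Rightarrow> ('k^'n^'n) set"
  where
  "weight_space A \<gg> \<phi> = {Z\<in>\<gg>. \<forall>a\<in>A. a ** Z ** matrix_inv a = mscale (\<phi> a) Z}"

definition roots :: "('k::field^'n^'n) set \<Rightarrow> ('k^'n^'n) set \<Rightarrow> ('k^'n^'n \<Rightarrow> 'k) set" where
  "roots H A = {\<phi> \<in> characters A. \<phi> \<noteq> (\<lambda>a\<in>A. 1) \<and> weight_space A (lie H) \<phi> \<noteq> {0}}"

text \<open>\<open>S\<close> is the base of the relative root system whose positive roots are the roots of \<open>P\<^sub>0\<close>.\<close>

definition simple_roots :: "('k::field^'n^'n) set \<Rightarrow> ('k^'n^'n) set \<Rightarrow> ('k^'n^'n) set \<Rightarrow>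
    ('k^'n^'n \<Rightarrow> 'k) set \<Rightarrow> bool" where
  "simple_roots G P\<^sub>0 A S \<longleftrightarrow> finite S \<and> S \<subseteq> roots G A \<and>
     (\<forall>m. char_comb A S m = (\<lambda>a\<in>A. 1) \<longrightarrow> (\<forall>\<alpha>\<in>S. m \<alpha> = 0)) \<and>
     (\<forall>\<phi>\<in>roots G A. \<exists>m. \<phi> = char_comb A S m \<and> ((\<forall>\<alpha>\<in>S. 0 \<le> m \<alpha>) \<or> (\<forall>\<alpha>\<in>S. m \<alpha> \<le> 0))) \<and>
     roots P\<^sub>0 A = {\<phi> \<in> roots G A. \<exists>m. \<phi> = char_comb A S m \<and> (\<forall>\<alpha>\<in>S. 0 \<le> m \<alpha>)}"

record (overloaded) ('f, 'n) datum =
  absv :: "'f::field \<Rightarrow> real"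
  Gt :: "('f alg_closure^'n^'n) set"
  M0 :: "('f alg_closure^'n^'n) set"
  P0 :: "('f alg_closure^'n^'n) set"
  A0 :: "('f alg_closure^'n^'n) set"
  simple :: "('f alg_closure^'n^'n \<Rightarrow> 'f alg_closure) set"

abbreviation G0 :: "('f::field, 'n::finite) datum \<Rightarrow> ('f alg_closure^'n^'n) set" where
  "G0 D \<equiv> identity_component (Gt D)"

abbreviation srank :: "('f::field, 'n::finite) datum \<Rightarrow> nat" where
  "srank D \<equiv> card (simple D)"

text \<open>The standard parabolic subgroup is the parabolic subgroup containing \<open>P\<^sub>0\<close> with the
  prescribed Lie algebra; there is exactly one, so it is the union of all such.\<close>

definition std_lie :: "('f::field, 'n::finite) datum \<Rightarrow> ('f alg_closure^'n^'n \<Rightarrow> 'f alg_closure) set \<Rightarrow>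
    ('f alg_closure^'n^'n) set" where
  "std_lie D J = module.span mscale
     (\<Union>{weight_space (A0 D) (lie (G0 D)) (char_comb (A0 D) (simple D) m) | m. \<forall>\<alpha>\<in>simple D - J. 0 \<le> m \<alpha>})"

definition std_parabolic :: "('f::field, 'n::finite) datum \<Rightarrow>
    ('f alg_closure^'n^'n \<Rightarrow> 'f alg_closure) set \<Rightarrow> ('f alg_closure^'n^'n) set" where
  "std_parabolic D J = \<Union>{P. parabolic_F (G0 D) P \<and> P0 D \<subseteq> P \<and> lie P = std_lie D J}"

definition std_levi :: "('f::field, 'n::finite) datum \<Rightarrow>
    ('f alg_closure^'n^'n \<Rightarrow> 'f alg_closure) set \<Rightarrow> ('f alg_closure^'n^'n) set" where
  "std_levi D J = (THE M. levi_F (std_parabolic D J) M \<and> M0 D \<subseteq> M)"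

abbreviation std_unip :: "('f::field, 'n::finite) datum \<Rightarrow>
    ('f alg_closure^'n^'n \<Rightarrow> 'f alg_closure) set \<Rightarrow> ('f alg_closure^'n^'n) set" where
  "std_unip D J \<equiv> unip_radical (std_parabolic D J)"

section \<open>Smooth representations\<close>

text \<open>A representation is a complex module together with an action; the ring fields \<open>mult\<close> and
  \<open>one\<close> inherited by the record \<open>module\<close> are not used. The group is not part of
  the record, so that restriction to a subgroup does not change the record.\<close>

record ('g, 'v) rep = "(complex, 'v) module" +
  act :: "'g \<Rightarrow> 'v \<Rightarrow> 'v"

abbreviation \<CC> :: "complex ring" where
  "\<CC> \<equiv> ring_of_type_algebra"

definition rep_hom :: "('f::field alg_closure^'n^'n) set \<Rightarrow> ('f^'n^'n, 'v) rep \<Rightarrow>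
    ('f^'n^'n, 'w) rep \<Rightarrow> ('v \<Rightarrow> 'w) \<Rightarrow> bool" where
  "rep_hom H \<pi> \<sigma> f \<longleftrightarrow> f \<in> carrier \<pi> \<rightarrow> carrier \<sigma> \<and>
     (\<forall>x\<in>carrier \<pi>. \<forall>y\<in>carrier \<pi>. f (x \<oplus>\<^bsub>\<pi>\<^esub> y) = f x \<oplus>\<^bsub>\<sigma>\<^esub> f y) \<and>
     (\<forall>c. \<forall>x\<in>carrier \<pi>. f (c \<odot>\<^bsub>\<pi>\<^esub> x) = c \<odot>\<^bsub>\<sigma>\<^esub> f x) \<and>
     (\<forall>g\<in>Fpts H. \<forall>x\<in>carrier \<pi>. f (act \<pi> g x) = act \<sigma> g (f x))"

definition rep_iso :: "('f::field alg_closure^'n^'n) set \<Rightarrow> ('f^'n^'n, 'v) rep \<Rightarrow>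
    ('f^'n^'n, 'w) rep \<Rightarrow> ('v \<Rightarrow> 'w) \<Rightarrow> bool" where
  "rep_iso H \<pi> \<sigma> f \<longleftrightarrow> rep_hom H \<pi> \<sigma> f \<and> bij_betw f (carrier \<pi>) (carrier \<sigma>)"

definition smooth_rep :: "('f::field \<Rightarrow> real) \<Rightarrow> ('f alg_closure^'n^'n) set \<Rightarrow>
    ('f^'n^'n, 'v) rep \<Rightarrow> bool" where
  "smooth_rep v H \<pi> \<longleftrightarrow> Module.module \<CC> \<pi> \<and>
     (\<forall>g\<in>Fpts H. act \<pi> g \<in> carrier \<pi> \<rightarrow> carrier \<pi> \<and>
        (\<forall>x\<in>carrier \<pi>. \<forall>y\<in>carrier \<pi>. act \<pi> g (x \<oplus>\<^bsub>\<pi>\<^esub> y) = act \<pi> g x \<oplus>\<^bsub>\<pi>\<^esub> act \<pi> g y) \<and>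
        (\<forall>c. \<forall>x\<in>carrier \<pi>. act \<pi> g (c \<odot>\<^bsub>\<pi>\<^esub> x) = c \<odot>\<^bsub>\<pi>\<^esub> act \<pi> g x)) \<and>
     (\<forall>x\<in>carrier \<pi>. act \<pi> (mat 1) x = x) \<and>
     (\<forall>g\<in>Fpts H. \<forall>h\<in>Fpts H. \<forall>x\<in>carrier \<pi>. act \<pi> (g ** h) x = act \<pi> g (act \<pi> h x)) \<and>
     (\<forall>x\<in>carrier \<pi>. openin (Fpts_top v H) {g\<in>Fpts H. act \<pi> g x = x})"

definition subrep :: "('f::field alg_closure^'n^'n) set \<Rightarrow> ('f^'n^'n, 'v) rep \<Rightarrow> 'v set \<Rightarrow> bool" where
  "subrep H \<pi> W \<longleftrightarrow> submodule W \<CC> \<pi> \<and> (\<forall>g\<in>Fpts H. act \<pi> g ` W \<subseteq> W)"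

text \<open>\<open>coset_map \<sigma> W f\<close> maps the coset of \<open>x\<close> to the coset \<open>f x + W\<close> in \<open>\<sigma>/W\<close>.\<close>

definition coset_map :: "('g, 'w) rep \<Rightarrow> 'w set \<Rightarrow> ('v \<Rightarrow> 'w) \<Rightarrow> 'v set \<Rightarrow> 'w set" where
  "coset_map \<sigma> W f c = (\<Union>x\<in>c. W +>\<^bsub>\<sigma>\<^esub> f x)"

definition quot :: "('g, 'v) rep \<Rightarrow> 'v set \<Rightarrow> ('g, 'v set) rep" where
  "quot \<pi> W = \<lparr>carrier = a_rcosets\<^bsub>\<pi>\<^esub> W, mult = undefined, one = undefined,
     zero = W, add = (<+>\<^bsub>\<pi>\<^esub>), smult = (\<lambda>c. coset_map \<pi> W (\<lambda>x. c \<odot>\<^bsub>\<pi>\<^esub> x)),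
     act = (\<lambda>g. coset_map \<pi> W (act \<pi> g))\<rparr>"

abbreviation subquot :: "('g, 'v) rep \<Rightarrow> 'v set \<Rightarrow> 'v set \<Rightarrow> ('g, 'v set) rep" where
  "subquot \<pi> W W' \<equiv> quot (\<pi>\<lparr>carrier := W\<rparr>) W'"

definition irreducible_rep :: "('f::field alg_closure^'n^'n) set \<Rightarrow> ('f^'n^'n, 'v) rep \<Rightarrow> bool" where
  "irreducible_rep H \<pi> \<longleftrightarrow> carrier \<pi> \<noteq> {\<zero>\<^bsub>\<pi>\<^esub>} \<and>
     (\<forall>W. subrep H \<pi> W \<longrightarrow> W = {\<zero>\<^bsub>\<pi>\<^esub>} \<or> W = carrier \<pi>)"

definition finite_length :: "('f::field alg_closure^'n^'n) set \<Rightarrow> ('f^'n^'n, 'v) rep \<Rightarrow> bool" where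
  "finite_length H \<pi> \<longleftrightarrow> (\<exists>(m::nat) W. W 0 = {\<zero>\<^bsub>\<pi>\<^esub>} \<and> W m = carrier \<pi> \<and>
     (\<forall>i\<le>m. subrep H \<pi> (W i)) \<and>
     (\<forall>i<m. W i \<subseteq> W (Suc i) \<and> irreducible_rep H (subquot \<pi> (W (Suc i)) (W i))))"

text \<open>The objects of the category of smooth representations of finite length.\<close>

definition R_cat :: "('f::field \<Rightarrow> real) \<Rightarrow> ('f alg_closure^'n^'n) set \<Rightarrow>
    ('f^'n^'n, 'v) rep \<Rightarrow> bool" where
  "R_cat v H \<pi> \<longleftrightarrow> smooth_rep v H \<pi> \<and> finite_length H \<pi>"

text \<open>The coinvariants of \<open>U(F)\<close> are the quotient by \<open>aug U \<pi>\<close>.\<close>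

definition aug :: "('f::field alg_closure^'n^'n) set \<Rightarrow> ('f^'n^'n, 'v) rep \<Rightarrow> 'v set" where
  "aug U \<pi> = \<Inter>{W. submodule W \<CC> \<pi> \<and> (\<forall>u\<in>Fpts U. \<forall>x\<in>carrier \<pi>. act \<pi> u x \<ominus>\<^bsub>\<pi>\<^esub> x \<in> W)}"

text \<open>Supercuspidality is the vanishing of all proper Jacquet modules.\<close>

definition supercuspidal :: "('f::field \<Rightarrow> real) \<Rightarrow> ('f alg_closure^'n^'n) set \<Rightarrow>
    ('f^'n^'n, 'v) rep \<Rightarrow> bool" where
  "supercuspidal v H \<pi> \<longleftrightarrow> R_cat v H \<pi> \<and>
     (\<forall>P. parabolic_F H P \<and> P \<noteq> H \<longrightarrow> aug (unip_radical P) \<pi> = carrier \<pi>)"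

definition open_subgroup :: "('f::field \<Rightarrow> real) \<Rightarrow> ('f alg_closure^'n^'n) set \<Rightarrow>
    ('f^'n^'n) set \<Rightarrow> bool" where
  "open_subgroup v H K \<longleftrightarrow> subgroup K (matgrp (Fpts H)) \<and> openin (Fpts_top v H) K"

text \<open>Unnormalized smooth induction: only the action of \<open>P(F)\<close> on \<open>\<sigma>\<close> matters.\<close>

definition ind :: "('f::field \<Rightarrow> real) \<Rightarrow> ('f alg_closure^'n^'n) set \<Rightarrow> ('f alg_closure^'n^'n) set \<Rightarrow>
    ('f^'n^'n, 'v) rep \<Rightarrow> ('f^'n^'n, 'f^'n^'n \<Rightarrow> 'v) rep" where
  "ind v H P \<sigma> = \<lparr>carrier = {f \<in> Fpts H \<rightarrow>\<^sub>E carrier \<sigma>.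
       (\<forall>p\<in>Fpts P. \<forall>g\<in>Fpts H. f (p ** g) = act \<sigma> p (f g)) \<and>
       (\<exists>K. open_subgroup v H K \<and> (\<forall>g\<in>Fpts H. \<forall>k\<in>K. f (g ** k) = f g))},
     mult = undefined, one = undefined,
     zero = (\<lambda>g\<in>Fpts H. \<zero>\<^bsub>\<sigma>\<^esub>), add = (\<lambda>f f'. \<lambda>g\<in>Fpts H. f g \<oplus>\<^bsub>\<sigma>\<^esub> f' g),
     smult = (\<lambda>c f. \<lambda>g\<in>Fpts H. c \<odot>\<^bsub>\<sigma>\<^esub> f g),
     act = (\<lambda>x f. \<lambda>g\<in>Fpts H. f (g ** x))\<rparr>"

definition coset_index :: "('f::field^'n^'n) set \<Rightarrow> ('f^'n^'n) set \<Rightarrow> nat" where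
  "coset_index K L = card ((\<lambda>k. (**) k ` L) ` K)"

text \<open>The modulus character \<open>\<delta>\<^sub>P(p) = |det Ad(p) on Lie U|\<close>, the factor by which conjugation
  by \<open>p\<close> changes a Haar measure of \<open>U(F)\<close>, expressed as the generalized index \<open>[pKp\<^sup>-\<^sup>1 : K]\<close> of any
  compact open subgroup \<open>K\<close> of \<open>U(F)\<close>.\<close>

definition modulus :: "('f::field \<Rightarrow> real) \<Rightarrow> ('f alg_closure^'n^'n) set \<Rightarrow> 'f^'n^'n \<Rightarrow> real" where
  "modulus v P p =
     (let U = unip_radical P;
          K = (SOME K. open_subgroup v U K \<and> compactin (Fpts_top v U) K);
          K' = conj_set p K
      in real (coset_index K' (K \<inter> K')) / real (coset_index K (K \<inter> K')))"

definition levi_part :: "('f::field alg_closure^'n^'n) set \<Rightarrow> ('f alg_closure^'n^'n) set \<Rightarrow>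
    'f^'n^'n \<Rightarrow> 'f^'n^'n" where
  "levi_part P M p = (THE m. m \<in> Fpts M \<and> (\<exists>u\<in>Fpts (unip_radical P). p = m ** u))"

text \<open>Normalized parabolic induction from the Levi subgroup \<open>M\<close> of \<open>P\<close>.\<close>

definition parabolic_ind :: "('f::field \<Rightarrow> real) \<Rightarrow> ('f alg_closure^'n^'n) set \<Rightarrow>
    ('f alg_closure^'n^'n) set \<Rightarrow> ('f alg_closure^'n^'n) set \<Rightarrow>
    ('f^'n^'n, 'v) rep \<Rightarrow> ('f^'n^'n, 'f^'n^'n \<Rightarrow> 'v) rep" where
  "parabolic_ind v H P M \<tau> = ind v H P
     (\<tau>\<lparr>act := \<lambda>p x. complex_of_real (sqrt (modulus v P p)) \<odot>\<^bsub>\<tau>\<^esub> act \<tau> (levi_part P M p) x\<rparr>)"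

section \<open>The categories \<open>\<R>\<^sub>t\<close>\<close>

text \<open>The representation \<open>\<tau>\<close> ranges over the type \<open>'v set\<close> on which subquotients of \<open>\<pi>\<close> live.
  This is no restriction: an irreducible \<open>\<tau>\<close> has countable dimension, so it is isomorphic to a
  representation on any type that carries some nonzero complex vector space.\<close>

definition Rt_conn :: "('f::field, 'n::finite) datum \<Rightarrow> nat \<Rightarrow> ('f^'n^'n, 'v) rep \<Rightarrow> bool" where
  "Rt_conn D t \<pi> \<longleftrightarrow> R_cat (absv D) (G0 D) \<pi> \<and>
     (\<forall>W W'. subrep (G0 D) \<pi> W \<and> subrep (G0 D) \<pi> W' \<and> W' \<subseteq> W \<and>
         irreducible_rep (G0 D) (subquot \<pi> W W') \<longrightarrow>
       (\<exists>I (\<tau> :: ('f^'n^'n, 'v set) rep) Z Z' f. I \<subseteq> simple D \<and> card I = t \<and>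
          supercuspidal (absv D) (std_levi D I) \<tau> \<and> irreducible_rep (std_levi D I) \<tau> \<and>
          (let \<iota> = parabolic_ind (absv D) (G0 D) (std_parabolic D I) (std_levi D I) \<tau>
           in subrep (G0 D) \<iota> Z \<and> subrep (G0 D) \<iota> Z' \<and> Z' \<subseteq> Z \<and>
              rep_iso (G0 D) (subquot \<pi> W W') (subquot \<iota> Z Z') f)))"

definition Rt :: "('f::field, 'n::finite) datum \<Rightarrow> nat \<Rightarrow> ('f^'n^'n, 'v) rep \<Rightarrow> bool" where
  "Rt D t \<pi> \<longleftrightarrow> R_cat (absv D) (Gt D) \<pi> \<and> Rt_conn D t \<pi>"

definition supercuspidal_ext :: "('f::field, 'n::finite) datum \<Rightarrow> ('f^'n^'n, 'v) rep \<Rightarrow> bool" where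
  "supercuspidal_ext D \<pi> \<longleftrightarrow> R_cat (absv D) (Gt D) \<pi> \<and> supercuspidal (absv D) (G0 D) \<pi>"

section \<open>The complex \<open>Y\<close>\<close>

definition X_rep :: "('f::field, 'n::finite) datum \<Rightarrow> ('f^'n^'n, 'v) rep \<Rightarrow>
    ('f alg_closure^'n^'n \<Rightarrow> 'f alg_closure) set \<Rightarrow> ('f^'n^'n, 'f^'n^'n \<Rightarrow> 'v set) rep" where
  "X_rep D \<pi> J = ind (absv D) (G0 D) (std_parabolic D J) (quot \<pi> (aug (std_unip D J) \<pi>))"

text \<open>Let \<open>T = S - J\<close>. The top exterior power \<open>\<Lambda>\<^sub>J\<close> of \<open>\<complex>\<^sup>T\<close> is spanned by
  the elements \<open>e\<^sub>l = e\<^bsub>l!0\<^esub> \<and> e\<^bsub>l!1\<^esub> \<and> \<dots>\<close> for the orderings \<open>l\<close> of \<open>T\<close>, with the only relations that a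
  transposition of two entries of \<open>l\<close> changes the sign of \<open>e\<^sub>l\<close>. Hence an element of
  \<open>X\<^sub>J \<otimes> \<Lambda>\<^sub>J\<close> is the same as an alternating function \<open>y\<close> from the orderings of \<open>T\<close> to
  \<open>X\<^sub>J\<close>: it stands for the element that equals \<open>y l \<otimes> e\<^sub>l\<close> for every \<open>l\<close>.\<close>

definition orderings :: "'a set \<Rightarrow> 'a list set" where
  "orderings T = {l. distinct l \<and> set l = T}"

definition YJ :: "('f::field, 'n::finite) datum \<Rightarrow> ('f^'n^'n, 'v) rep \<Rightarrow>
    ('f alg_closure^'n^'n \<Rightarrow> 'f alg_closure) set \<Rightarrow>
    (('f alg_closure^'n^'n \<Rightarrow> 'f alg_closure) list \<Rightarrow> 'f^'n^'n \<Rightarrow> 'v set) set" where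
  "YJ D \<pi> J = {y \<in> orderings (simple D - J) \<rightarrow>\<^sub>E carrier (X_rep D \<pi> J).
     \<forall>l\<in>orderings (simple D - J). \<forall>i j. i < j \<and> j < length l \<longrightarrow>
       y (l[i := l ! j, j := l ! i]) = (-1) \<odot>\<^bsub>X_rep D \<pi> J\<^esub> y l}"

definition levels :: "('f::field, 'n::finite) datum \<Rightarrow> nat \<Rightarrow>
    ('f alg_closure^'n^'n \<Rightarrow> 'f alg_closure) set set" where
  "levels D t = {J. J \<subseteq> simple D \<and> card J = t}"

definition Ntilde :: "('f::field, 'n::finite) datum \<Rightarrow> ('f^'n^'n) set" where
  "Ntilde D = {n \<in> Fpts (Gt D). conj_set (emb n) (M0 D) = M0 D \<and> conj_set (emb n) (P0 D) = P0 D}"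

text \<open>The action of the normalizer on the simple roots, extended trivially to other matrices.\<close>

definition perm :: "('f::field, 'n::finite) datum \<Rightarrow> 'f^'n^'n \<Rightarrow>
    ('f alg_closure^'n^'n \<Rightarrow> 'f alg_closure) \<Rightarrow> 'f alg_closure^'n^'n \<Rightarrow> 'f alg_closure" where
  "perm D n \<alpha> = (if n \<in> Ntilde D
     then (\<lambda>a\<in>A0 D. \<alpha> (matrix_inv (emb n) ** a ** emb n)) else \<alpha>)"

type_synonym ('f, 'n, 'v) Yelt =
  "('f alg_closure^'n^'n \<Rightarrow> 'f alg_closure) set \<Rightarrow>
   ('f alg_closure^'n^'n \<Rightarrow> 'f alg_closure) list \<Rightarrow> 'f^'n^'n \<Rightarrow> 'v set"

definition G_act :: "('f::field, 'n::finite) datum \<Rightarrow> nat \<Rightarrow> ('f^'n^'n, 'v) rep \<Rightarrow> 'f^'n^'n \<Rightarrow>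
    ('f, 'n, 'v) Yelt \<Rightarrow> ('f, 'n, 'v) Yelt" where
  "G_act D t \<pi> g y = (\<lambda>J\<in>levels D t. \<lambda>l\<in>orderings (simple D - J). act (X_rep D \<pi> J) g (y J l))"

text \<open>With \<open>a\<close> the permutation induced by \<open>n\<close> and \<open>b = a\<^sup>-\<^sup>1\<close>, the component at \<open>J\<close> of the translate
  by \<open>n\<close> comes from the component at \<open>b J\<close>, and \<open>\<lambda>(a)\<close> maps \<open>e\<^bsub>b l\<^esub>\<close> to \<open>e\<^sub>l\<close>.\<close>

definition N_act :: "('f::field, 'n::finite) datum \<Rightarrow> nat \<Rightarrow> ('f^'n^'n, 'v) rep \<Rightarrow> 'f^'n^'n \<Rightarrow>
    ('f, 'n, 'v) Yelt \<Rightarrow> ('f, 'n, 'v) Yelt" where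
  "N_act D t \<pi> n y = (let b = perm D (matrix_inv n) in
     (\<lambda>J\<in>levels D t. \<lambda>l\<in>orderings (simple D - J). \<lambda>h\<in>Fpts (G0 D).
        coset_map \<pi> (aug (std_unip D J) \<pi>) (act \<pi> n)
          (y (b ` J) (map b l) (matrix_inv n ** h ** n))))"

text \<open>Every \<open>x\<close> in the group of rational points is a product \<open>g n\<close> as below, because any two minimal
  parabolic pairs are conjugate under \<open>G(F)\<close>; the default value only makes the function total.\<close>

definition factorization :: "('f::field, 'n::finite) datum \<Rightarrow> 'f^'n^'n \<Rightarrow> ('f^'n^'n) \<times> ('f^'n^'n)" where
  "factorization D x =
     (if \<exists>g\<in>Fpts (G0 D). \<exists>n\<in>Ntilde D. x = g ** n
      then (SOME (g, n). g \<in> Fpts (G0 D) \<and> n \<in> Ntilde D \<and> x = g ** n) else (mat 1, x))"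

definition Y_rep :: "('f::field, 'n::finite) datum \<Rightarrow> nat \<Rightarrow> ('f^'n^'n, 'v) rep \<Rightarrow>
    ('f^'n^'n, ('f, 'n, 'v) Yelt) rep" where
  "Y_rep D t \<pi> = \<lparr>carrier = (\<Pi>\<^sub>E J\<in>levels D t. YJ D \<pi> J),
     mult = undefined, one = undefined,
     zero = (\<lambda>J\<in>levels D t. \<lambda>l\<in>orderings (simple D - J). \<zero>\<^bsub>X_rep D \<pi> J\<^esub>),
     add = (\<lambda>y z. \<lambda>J\<in>levels D t. \<lambda>l\<in>orderings (simple D - J). y J l \<oplus>\<^bsub>X_rep D \<pi> J\<^esub> z J l),
     smult = (\<lambda>c y. \<lambda>J\<in>levels D t. \<lambda>l\<in>orderings (simple D - J). c \<odot>\<^bsub>X_rep D \<pi> J\<^esub> y J l),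
     act = (\<lambda>x y. case factorization D x of (g, n) \<Rightarrow> G_act D t \<pi> g (N_act D t \<pi> n y))\<rparr>"

text \<open>The map \<open>\<psi>\<close> from \<open>Y\<^sub>J\<close> to \<open>Y\<^sub>I\<close> for \<open>J = I \<union> {i}\<close>. If \<open>l\<close> arises from the ordering \<open>m\<close> by
  removing \<open>i\<close>, then \<open>e\<^sub>l \<and> e\<^sub>i\<close> is \<open>e\<^sub>m\<close> up to the sign of moving \<open>i\<close> past the entries following it in \<open>m\<close>.\<close>

definition psi :: "('f::field, 'n::finite) datum \<Rightarrow> ('f^'n^'n, 'v) rep \<Rightarrow>
    ('f alg_closure^'n^'n \<Rightarrow> 'f alg_closure) set \<Rightarrow> ('f alg_closure^'n^'n \<Rightarrow> 'f alg_closure) \<Rightarrow>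
    (('f alg_closure^'n^'n \<Rightarrow> 'f alg_closure) list \<Rightarrow> 'f^'n^'n \<Rightarrow> 'v set) \<Rightarrow>
    (('f alg_closure^'n^'n \<Rightarrow> 'f alg_closure) list \<Rightarrow> 'f^'n^'n \<Rightarrow> 'v set)" where
  "psi D \<pi> I i y = (\<lambda>m\<in>orderings (simple D - I).
     (-1) ^ length (tl (dropWhile (\<lambda>j. j \<noteq> i) m)) \<odot>\<^bsub>X_rep D \<pi> I\<^esub>
       (\<lambda>g\<in>Fpts (G0 D). coset_map \<pi> (aug (std_unip D I) \<pi>) (\<lambda>x. x) (y (remove1 i m) g)))"

definition d_map :: "('f::field, 'n::finite) datum \<Rightarrow> nat \<Rightarrow> ('f^'n^'n, 'v) rep \<Rightarrow>
    ('f, 'n, 'v) Yelt \<Rightarrow> ('f, 'n, 'v) Yelt" where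
  "d_map D t \<pi> y = (\<lambda>I\<in>levels D (t - 1). \<lambda>m\<in>orderings (simple D - I).
     finsum (X_rep D \<pi> I) (\<lambda>i. psi D \<pi> I i (y (insert i I)) m) (simple D - I))"

definition Y_mor :: "('f::field, 'n::finite) datum \<Rightarrow> nat \<Rightarrow> ('f^'n^'n, 'v) rep \<Rightarrow> ('v \<Rightarrow> 'v) \<Rightarrow>
    ('f, 'n, 'v) Yelt \<Rightarrow> ('f, 'n, 'v) Yelt" where
  "Y_mor D t \<sigma> f y = (\<lambda>J\<in>levels D t. \<lambda>l\<in>orderings (simple D - J). \<lambda>g\<in>Fpts (G0 D).
     coset_map \<sigma> (aug (std_unip D J) \<sigma>) f (y J l g))"

section \<open>The functor \<open>D\<^sub>A\<close>\<close>

definition d_image :: "('f::field, 'n::finite) datum \<Rightarrow> nat \<Rightarrow> ('f^'n^'n, 'v) rep \<Rightarrow>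
    ('f, 'n, 'v) Yelt set" where
  "d_image D t \<pi> = d_map D (Suc t) \<pi> ` carrier (Y_rep D (Suc t) \<pi>)"

text \<open>The functor on the factor of index \<open>t\<close>.\<close>

definition DA_block :: "('f::field, 'n::finite) datum \<Rightarrow> nat \<Rightarrow> ('f^'n^'n, 'v) rep \<Rightarrow>
    ('f^'n^'n, ('f, 'n, 'v) Yelt set) rep" where
  "DA_block D t \<pi> = quot (Y_rep D t \<pi>) (d_image D t \<pi>)"

definition DA_block_mor :: "('f::field, 'n::finite) datum \<Rightarrow> nat \<Rightarrow> ('f^'n^'n, 'v) rep \<Rightarrow> ('v \<Rightarrow> 'v) \<Rightarrow>
    ('f, 'n, 'v) Yelt set \<Rightarrow> ('f, 'n, 'v) Yelt set" where
  "DA_block_mor D t \<sigma> f = coset_map (Y_rep D t \<sigma>) (d_image D t \<sigma>) (Y_mor D t \<sigma> f)"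

text \<open>The component of index \<open>t\<close> of \<open>\<pi>\<close> in the product decomposition of the category is the sum of all
  subrepresentations that belong to the factor of index \<open>t\<close>. A nonzero representation belongs to at
  most one factor; the zero representation belongs to all of them, and is harmlessly given the
  index \<open>r\<close> by taking the greatest index.\<close>

definition block_index :: "('f::field, 'n::finite) datum \<Rightarrow> ('f^'n^'n, 'v) rep \<Rightarrow> nat" where
  "block_index D \<sigma> = (GREATEST t. t \<le> srank D \<and> Rt D t \<sigma>)"

definition component :: "('f::field, 'n::finite) datum \<Rightarrow> nat \<Rightarrow> ('f^'n^'n, 'v) rep \<Rightarrow>
    ('f^'n^'n, 'v) rep" where
  "component D t \<pi> = \<pi>\<lparr>carrier := \<Inter>{W. subrep (Gt D) \<pi> W \<and>
     (\<forall>W'. subrep (Gt D) \<pi> W' \<and> (\<exists>s\<le>srank D. Rt D s (\<pi>\<lparr>carrier := W'\<rparr>)) \<and>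
        block_index D (\<pi>\<lparr>carrier := W'\<rparr>) = t \<longrightarrow> W' \<subseteq> W)}\<rparr>"

type_synonym ('f, 'n, 'v) DAelt = "nat \<Rightarrow> ('f, 'n, 'v) Yelt set"

definition DA :: "('f::field, 'n::finite) datum \<Rightarrow> ('f^'n^'n, 'v) rep \<Rightarrow>
    ('f^'n^'n, ('f, 'n, 'v) DAelt) rep" where
  "DA D \<pi> = (let B = (\<lambda>t. DA_block D t (component D t \<pi>)); T = {..srank D} in
     \<lparr>carrier = (\<Pi>\<^sub>E t\<in>T. carrier (B t)), mult = undefined, one = undefined,
      zero = (\<lambda>t\<in>T. \<zero>\<^bsub>B t\<^esub>), add = (\<lambda>c c'. \<lambda>t\<in>T. c t \<oplus>\<^bsub>B t\<^esub> c' t),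
      smult = (\<lambda>z c. \<lambda>t\<in>T. z \<odot>\<^bsub>B t\<^esub> c t), act = (\<lambda>x c. \<lambda>t\<in>T. act (B t) x (c t))\<rparr>)"

definition DA_mor :: "('f::field, 'n::finite) datum \<Rightarrow> ('f^'n^'n, 'v) rep \<Rightarrow> ('v \<Rightarrow> 'v) \<Rightarrow>
    ('f, 'n, 'v) DAelt \<Rightarrow> ('f, 'n, 'v) DAelt" where
  "DA_mor D \<pi>' f c = (\<lambda>t\<in>{..srank D}. DA_block_mor D t (component D t \<pi>') f (c t))"

text \<open>An isomorphism from the identity to \<open>D\<^sub>A\<close> on the full subcategory of the objects in \<open>C\<close>. The type
  \<open>'v\<close> serves as universe: objects are representations whose underlying set is any subset of \<open>'v\<close>.\<close>

definition id_iso_DA :: "('f::field, 'n::finite) datum \<Rightarrow> (('f^'n^'n, 'v) rep \<Rightarrow> bool) \<Rightarrow>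
    (('f^'n^'n, 'v) rep \<Rightarrow> 'v \<Rightarrow> ('f, 'n, 'v) DAelt) \<Rightarrow> bool" where
  "id_iso_DA D C \<eta> \<longleftrightarrow>
     (\<forall>\<pi>. C \<pi> \<longrightarrow> rep_iso (Gt D) \<pi> (DA D \<pi>) (\<eta> \<pi>)) \<and>
     (\<forall>\<pi> \<pi>' f. C \<pi> \<and> C \<pi>' \<and> rep_hom (Gt D) \<pi> \<pi>' f \<longrightarrow>
        (\<forall>x\<in>carrier \<pi>. DA_mor D \<pi>' f (\<eta> \<pi> x) = \<eta> \<pi>' (f x)))"

end

theory Submission
  imports Defs
begin

text \<open>Let \<open>r\<close> be the number of simple roots and \<open>\<pi>\<close> an object of the factor of index \<open>r\<close>. There \<open>D\<^sub>A \<pi>\<close> is the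
cokernel of \<open>0 \<rightarrow> Y\<^sub>r\<close>, that is \<open>Y\<^sub>r\<close> itself. The set \<open>S\<close> of all simple roots is the only subset with \<open>r\<close>
elements, the parabolic subgroup \<open>P\<^sub>S\<close> is \<open>G\<close>, and its unipotent radical is trivial because \<open>G\<close> is reductive.
So \<open>Y\<^sub>r\<close> consists of the functions \<open>f\<close> on \<open>G(F)\<close> with \<open>f(gh) = \<pi>(g) f(h)\<close>. Such a function is determined by
\<open>f(1)\<close>, and \<open>x \<mapsto> (g \<mapsto> \<pi>(g) x)\<close> is an isomorphism from \<open>\<pi>\<close> to \<open>Y\<^sub>r\<close>, which is obviously functorial. It
respects the action of \<open>n\<close> in the normalizer because \<open>\<pi>(n) \<pi>(n\<^sup>-\<^sup>1hn) x = \<pi>(h) \<pi>(n) x\<close>. This is lemma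
\<open>Y_rep_top\<close>. The components of \<open>\<pi>\<close> in the other factors are zero (\<open>component_top_factor\<close>), and so are their
complexes (\<open>Y_rep_zero\<close>).

Two inputs come from the structure of the groups. That \<open>P\<^sub>S = G\<close> means that the Lie algebra of \<open>G\<close> is spanned by
the weight spaces of the split torus \<open>A\<^sub>0\<close> (\<open>weight_decomposition\<close>, \<open>std_parabolic_simple\<close>). That the normalizer
acts on the complex at all means that it permutes the simple roots: it permutes the roots of \<open>P\<^sub>0\<close>, and the simple
ones are those of height \<open>1\<close> (\<open>char_conj_simple_bij\<close>).

For the second claim, a supercuspidal representation has to be recognized as an object of the factor of index
\<open>r\<close>. Each irreducible subquotient \<open>\<tau>\<close> of it is its own parabolic induction from the Levi subgroup \<open>G\<close> of
\<open>P\<^sub>S = G\<close>, so the point is that \<open>\<tau>\<close> is again supercuspidal. This is the exactness of Jacquet modules: an element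
of a subrepresentation \<open>W\<close> that dies in the coinvariants of \<open>\<pi>\<close> under \<open>U(F)\<close> dies in those of \<open>W\<close>
(\<open>aug_restrict\<close>). The classical reason is that \<open>U(F)\<close> is a union of compact subgroups, over which one may
average. Here finitely many elements of \<open>U(F)\<close> are handled directly. By Kolchin's theorem all long products of
factors \<open>u - 1\<close> vanish, so the group generated by them consists of sums with terms from a finite set of
words in these factors (\<open>normal_unipotent_groups_nilpotent\<close>). As the absolute value is non-archimedean, this group is bounded
(\<open>generated_bounded\<close>), and as the field is locally compact, its orbits in a smooth representation are finite
(\<open>finite_orbit\<close>). So it acts on any finite set of vectors through a finite group, and one averages over that
(\<open>exists_balanced_family\<close>).\<close>

section \<open>Groups of unipotent matrices\<close>

lemma funpow_mult_vec:
  fixes M :: "'k::field^'n^'n"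
  shows "(((**) M ^^ k) N) *v x = (((*v) M) ^^ k) (N *v x)"
  by (induction k) (simp_all add: matrix_vector_mul_assoc[symmetric])

lemma exists_projection_matrix:
  fixes S :: "('k::field^'n) set"
  assumes "vec.subspace S"
  obtains P :: "'k^'n^'n" where "\<And>x. P *v x \<in> S" and "\<And>x. x \<in> S \<Longrightarrow> P *v x = x"
proof -
  have "\<exists>g. g ` UNIV \<subseteq> S \<and> Vector_Spaces.linear (*s) (*s) g \<and> (\<forall>v\<in>S. g (id v) = v)"
    by (rule vec.linear_exists_left_inverse_on) (use vec.linear_id in \<open>auto simp: assms id_def\<close>)
  then obtain g where g: "range g \<subseteq> S" "Vector_Spaces.linear (*s) (*s) g" "\<And>v. v \<in> S \<Longrightarrow> g v = v"
    by auto
  show ?thesis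
    by (rule that[of "matrix g"]) (use g matrix_works[OF g(2)] in auto)
qed

lemma dim_image_less_if_kernel:
  fixes S :: "('k::field^'n) set"
  assumes S: "vec.subspace S" and x: "x \<in> S" "x \<noteq> 0" "M *v x = 0"
  shows "vec.dim ((*v) M ` S) < vec.dim S"
proof -
  have "vec.independent {x}" using x by simp
  then obtain B where B: "{x} \<subseteq> B" "B \<subseteq> S" "vec.independent B" "S \<subseteq> vec.span B"
    using vec.maximal_independent_subset_extend[of "{x}" S] x(1) by (metis empty_subsetI insert_subset)
  have fin: "finite B" using B(3) vec.finiteI_independent by blast
  have spB: "vec.span B = S"
    using B S by (meson antisym vec.span_minimal)
  have "(*v) M ` S = vec.span ((*v) M ` B)"
    using spB vec.span_image by metis
  also have "\<dots> = vec.span (insert 0 ((*v) M ` (B - {x})))"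
    using B(1) x(3) by (intro arg_cong[where f = vec.span]) force
  also have "\<dots> = vec.span ((*v) M ` (B - {x}))" by simp
  finally have "vec.dim ((*v) M ` S) = vec.dim ((*v) M ` (B - {x}))" by simp
  also have "\<dots> \<le> card ((*v) M ` (B - {x}))" using fin by (intro vec.dim_le_card') simp
  also have "\<dots> \<le> card (B - {x})" using fin by (intro card_image_le) simp
  also have "\<dots> < card B" using fin B(1) by (intro psubset_card_mono) auto
  also have "card B = vec.dim S"
    using B spB vec.dim_span_eq_card_independent by metis
  finally show ?thesis .
qed

text \<open>The matrix \<open>M\<close> has the same trace as its restriction to its own range, which is represented by
  \<open>M ** Q\<close> with a projection \<open>Q\<close> to the range; as \<open>M\<close> is nilpotent, the restriction has smaller rank.\<close>

lemma trace_nilpotent_eq_0: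
  fixes M :: "'k::field^'n^'n"
  assumes "\<And>x. (((*v) M) ^^ k) x = 0"
  shows "trace M = 0"
  using assms
proof (induction "vec.dim (range ((*v) M))" arbitrary: M rule: less_induct)
  case less
  show ?case
  proof (cases "M = 0")
    case True
    then show ?thesis by (simp add: trace_def)
  next
    case False
    define R where "R = range ((*v) M)"
    have R: "vec.subspace R" unfolding R_def
      by (metis vec.span_image vec.span_UNIV vec.subspace_span)
    obtain Q where Q: "\<And>x. Q *v x \<in> R" "\<And>x. x \<in> R \<Longrightarrow> Q *v x = x"
      using exists_projection_matrix[OF R] by blast
    have "Q ** M = M" using Q(2) by (simp add: matrix_eq R_def matrix_vector_mul_assoc[symmetric])
    then have tr: "trace M = trace (M ** Q)" using trace_mul_sym[of Q M] by simp
    have pow: "(((*v) (M ** Q)) ^^ j) x = (((*v) M) ^^ j) x" if "x \<in> R" for j x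
      using that
    proof (induction j arbitrary: x)
      case (Suc j)
      have "M *v x \<in> R" by (simp add: R_def)
      then show ?case
        using Suc Q by (simp add: funpow_swap1 matrix_vector_mul_assoc[symmetric] del: funpow.simps) (simp add: funpow_Suc_right del: funpow.simps)
    qed simp
    obtain k0 where k0: "k = Suc k0"
    proof (cases k)
      case 0
      then have "M = 0" using less.prems by (simp add: matrix_eq)
      then show ?thesis using False by simp
    qed (use that in blast)
    have nil: "(((*v) (M ** Q)) ^^ k) x = 0" for x
    proof -
      have "(((*v) (M ** Q)) ^^ k) x = (((*v) (M ** Q)) ^^ k0) (M *v (Q *v x))"
        by (simp add: k0 funpow_swap1 matrix_vector_mul_assoc)
      also have "\<dots> = (((*v) M) ^^ k0) (M *v (Q *v x))" by (rule pow) (simp add: R_def)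
      also have "\<dots> = 0" using less.prems[of "Q *v x"] by (simp add: k0 funpow_swap1)
      finally show ?thesis .
    qed
    have rng: "range ((*v) (M ** Q)) = (*v) M ` R"
    proof
      show "range ((*v) (M ** Q)) \<subseteq> (*v) M ` R"
        using Q(1) by (auto simp: matrix_vector_mul_assoc[symmetric])
      show "(*v) M ` R \<subseteq> range ((*v) (M ** Q))"
      proof
        fix y assume "y \<in> (*v) M ` R"
        then obtain x where x: "x \<in> R" "y = M *v x" by blast
        then have "y = (M ** Q) *v x" using Q(2) by (simp add: matrix_vector_mul_assoc[symmetric])
        then show "y \<in> range ((*v) (M ** Q))" by blast
      qed
    qed
    have "\<exists>x\<in>R. x \<noteq> 0 \<and> M *v x = 0"
    proof (rule ccontr)
      assume *: "\<not> ?thesis"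
      have "(((*v) M) ^^ j) x \<noteq> 0" if "x \<in> R" "x \<noteq> 0" for j x
        using that
      proof (induction j arbitrary: x)
        case (Suc j)
        have "M *v x \<in> R" "M *v x \<noteq> 0" using * Suc.prems by (auto simp: R_def)
        then show ?case using Suc.IH by (simp add: funpow_swap1)
      qed simp
      moreover obtain x where "M *v x \<noteq> 0" using False by (auto simp: matrix_eq)
      ultimately show False using less.prems[of "M *v x"] by (auto simp: R_def)
    qed
    then obtain x where "x \<in> R" "x \<noteq> 0" "M *v x = 0" by blast
    then have "vec.dim ((*v) M ` R) < vec.dim R" by (rule dim_image_less_if_kernel[OF R])
    then show ?thesis
      using less.hyps[of "M ** Q"] nil rng tr by (simp add: R_def)
  qed
qed

text \<open>The usual proof that eigenvectors exist, carried out modulo \<open>W\<close>: split off a linear factor from a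
  polynomial \<open>p\<close> of least degree such that \<open>p(M) y0\<close> lies in \<open>W\<close>.\<close>

lemma eigenvector_mod_subspace:
  fixes M :: "'k::alg_closed_field^'n^'n"
  assumes W: "vec.subspace W" "\<And>x. x \<in> W \<Longrightarrow> M *v x \<in> W"
    and Y: "vec.subspace Y" "\<And>x. x \<in> Y \<Longrightarrow> M *v x \<in> Y" and y0: "y0 \<in> Y" "y0 \<notin> W"
  obtains c y where "y \<in> Y" "y \<notin> W" "M *v y - c *s y \<in> W"
proof -
  \<comment> \<open>Horner's scheme for \<open>p(M) y0\<close>.\<close>
  define ev :: "'k poly \<Rightarrow> 'k^'n" where "ev p = fold_coeffs (\<lambda>a v. a *s y0 + M *v v) p 0" for p
  have ev_pCons: "ev (pCons a p) = a *s y0 + M *v ev p" for a p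
    by (cases "a = 0 \<and> p = 0") (auto simp: ev_def)
  have ev0 [simp]: "ev 0 = 0" by (simp add: ev_def)
  have ev_add: "ev (p + q) = ev p + ev q" for p q
    by (induction p q rule: poly_induct2)
       (simp_all add: ev_pCons vec.scale_left_distrib matrix_vector_right_distrib algebra_simps)
  have ev_smult: "ev (Polynomial.smult c p) = c *s ev p" for c p
    by (induction p) (simp_all add: ev_pCons vec.scale_right_distrib vector_scalar_commute)
  have ev_sum: "ev (sum f A) = (\<Sum>i\<in>A. ev (f i))" if "finite A" for f :: "'k^'n \<Rightarrow> _" and A
    using that by (induction A rule: finite_induct) (simp_all add: ev_add)
  have evY: "ev p \<in> Y" for p
    using Y y0(1) by (induction p) (auto simp: ev_pCons vec.subspace_add vec.subspace_scale vec.subspace_0)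
  \<comment> \<open>The vectors \<open>M\<^sup>i y0\<close> lie in a finite-dimensional space, so some nonzero polynomial kills \<open>y0\<close>.\<close>
  have "\<exists>p. p \<noteq> 0 \<and> ev p = 0"
  proof (cases "inj_on (\<lambda>i. ev (Polynomial.monom 1 i)) {..CARD('n)}")
    case False
    then obtain i j where "i \<noteq> j" "ev (Polynomial.monom 1 i) = ev (Polynomial.monom 1 j)" by (auto simp: inj_on_def)
    then have "ev (Polynomial.monom 1 i + Polynomial.smult (-1) (Polynomial.monom 1 j)) = 0"
      by (simp only: ev_add ev_smult) (simp add: vec_eq_iff)
    moreover have "Polynomial.monom 1 i + Polynomial.smult (-1) (Polynomial.monom 1 j) \<noteq> (0::'k poly)"
    proof
      assume "Polynomial.monom 1 i + Polynomial.smult (-1) (Polynomial.monom 1 j) = (0::'k poly)"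
      then have "poly.coeff (Polynomial.monom 1 i + Polynomial.smult (-1) (Polynomial.monom 1 j)) i = (0::'k)" by simp
      then show False using \<open>i \<noteq> j\<close> by simp
    qed
    ultimately show ?thesis by blast
  next
    case True
    define B where "B = (\<lambda>i. ev (Polynomial.monom 1 i)) ` {..CARD('n)}"
    have card: "card B = Suc (CARD('n))" by (simp add: B_def card_image True)
    have "vec.dependent B"
      using vec.dependent_biggerset_general[of B] vec.dim_subset_UNIV[of B] card card_cart_basis[where 'a='k and 'i='n] by (simp add: vec.dimension_def)
    then obtain t u v where t: "finite t" "t \<subseteq> B" "(\<Sum>w\<in>t. u w *s w) = 0" "v \<in> t" "u v \<noteq> 0"
      unfolding vec.dependent_explicit by blast
    define h where "h = the_inv_into {..CARD('n)} (\<lambda>i. ev (Polynomial.monom 1 i))"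
    have h: "ev (Polynomial.monom 1 (h w)) = w" if "w \<in> t" for w
      using that t(2) True f_the_inv_into_f[OF True] unfolding h_def B_def by blast
    define p where "p = (\<Sum>w\<in>t. Polynomial.smult (u w) (Polynomial.monom 1 (h w)))"
    have "ev p = (\<Sum>w\<in>t. u w *s w)"
      unfolding p_def by (simp add: ev_sum[OF t(1)] ev_smult h cong: sum.cong)
    moreover have "poly.coeff p (h v) = u v"
    proof -
      have "poly.coeff p (h v) = (\<Sum>w\<in>t. if w = v then u v else 0)"
        unfolding p_def Polynomial.coeff_sum Polynomial.coeff_smult Polynomial.coeff_monom
        using h t(4) by (intro sum.cong) (auto, metis)
      then show ?thesis using t by simp
    qed
    ultimately show ?thesis using t(3,5) by (intro exI[of _ p]) auto
  qed
  then have ex: "\<exists>p. p \<noteq> 0 \<and> ev p \<in> W" using vec.subspace_0[OF W(1)] by metis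
  define p where "p = arg_min Polynomial.degree (\<lambda>p. p \<noteq> 0 \<and> ev p \<in> W)"
  have p: "p \<noteq> 0" "ev p \<in> W" and min: "\<And>q. q \<noteq> 0 \<Longrightarrow> ev q \<in> W \<Longrightarrow> Polynomial.degree p \<le> Polynomial.degree q"
    using arg_min_natI[of "\<lambda>p. p \<noteq> 0 \<and> ev p \<in> W" _ Polynomial.degree] arg_min_nat_le[of "\<lambda>p. p \<noteq> 0 \<and> ev p \<in> W" _ Polynomial.degree] ex
    unfolding p_def by blast+
  have "Polynomial.degree p > 0"
  proof (rule ccontr)
    assume "\<not> Polynomial.degree p > 0"
    then obtain a where a: "p = [:a:]" by (metis degree_eq_zeroE gr0I)
    then have "a \<noteq> 0" "a *s y0 \<in> W" using p ev_pCons[of a 0] by auto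
    then have "inverse a *s (a *s y0) \<in> W" using vec.subspace_scale[OF W(1)] by blast
    then show False using y0(2) \<open>a \<noteq> 0\<close> by (simp add: vec.scale_scale)
  qed
  then obtain c where "poly p c = 0" using alg_closed_imp_poly_has_root by blast
  then obtain q where q: "p = [:-c, 1:] * q" using poly_eq_0_iff_dvd by (metis dvdE)
  have q0: "q \<noteq> 0" using p(1) q by auto
  have deg: "Polynomial.degree q < Polynomial.degree p" using q0 unfolding q by (subst degree_mult_eq) auto
  have "ev q \<notin> W" using min[OF q0] deg by linarith
  moreover have "p = Polynomial.smult (-c) q + pCons 0 q" by (simp add: q)
  then have "ev p = M *v ev q - c *s ev q"
    by (simp add: ev_add ev_smult ev_pCons del: smult_minus_left)
  ultimately show ?thesis using that[of "ev q" c] evY p(2) by simp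
qed

lemma mscale_mult_vec: "mscale c M *v x = c *s (M *v x)"
  by (simp add: mscale_def map_matrix_def matrix_vector_mult_def vec_eq_iff sum_distrib_left mult.assoc)

lemma mscale_nth: "mscale c M $ i $ j = c * M $ i $ j"
  by (simp add: mscale_def map_matrix_def)

inductive_set matrix_span :: "('k::field^'n^'n) set \<Rightarrow> ('k^'n^'n) set" for U where
  zero: "0 \<in> matrix_span U"
| step: "u \<in> U \<Longrightarrow> M \<in> matrix_span U \<Longrightarrow> mscale c u + M \<in> matrix_span U"

lemma matrix_span_base: "u \<in> U \<Longrightarrow> u \<in> matrix_span U"
  using matrix_span.step[of u U 0 1] matrix_span.zero[of U]
  by (simp add: mscale_def map_matrix_def)

lemma matrix_span_add: "M \<in> matrix_span U \<Longrightarrow> N \<in> matrix_span U \<Longrightarrow> M + N \<in> matrix_span U"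
  by (induction M rule: matrix_span.induct) (auto simp: add.assoc intro: matrix_span.intros)

lemma matrix_span_scale: "M \<in> matrix_span U \<Longrightarrow> mscale c M \<in> matrix_span U"
proof (induction M rule: matrix_span.induct)
  case zero
  have "mscale c 0 = (0::'a^'b^'b)" by (simp add: vec_eq_iff mscale_nth)
  then show ?case by (simp add: matrix_span.zero)
next
  case (step u M d)
  have "mscale c (mscale d u + M) = mscale (c * d) u + mscale c M"
    by (simp add: vec_eq_iff mscale_nth algebra_simps)
  then show ?case using step by (simp add: matrix_span.step)
qed

lemma matrix_span_mult:
  assumes "\<And>u v. u \<in> U \<Longrightarrow> v \<in> U \<Longrightarrow> u ** v \<in> U" "M \<in> matrix_span U" "N \<in> matrix_span U"
  shows "M ** N \<in> matrix_span U"
  using assms(2)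
proof (induction M rule: matrix_span.induct)
  case zero
  then show ?case by (simp add: matrix_span.zero)
next
  case (step u M d)
  have "u ** N \<in> matrix_span U" using assms(3)
  proof (induction N rule: matrix_span.induct)
    case zero
    then show ?case by (simp add: matrix_span.zero)
  next
    case (step v N d)
    have "u ** (mscale d v + N) = mscale d (u ** v) + u ** N"
      by (simp add: matrix_eq mscale_mult_vec matrix_vector_mul_assoc[symmetric] algebra_simps vector_scalar_commute)
    then show ?case using step assms(1) \<open>u \<in> U\<close> by (simp add: matrix_span.step)
  qed
  moreover have "(mscale d u + M) ** N = mscale d (u ** N) + M ** N"
    by (simp add: matrix_eq mscale_mult_vec matrix_vector_mul_assoc[symmetric] algebra_simps)
  ultimately show ?case using step by (simp add: matrix_span_add matrix_span_scale)
qed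

lemma matrix_span_invariant:
  assumes "M \<in> matrix_span U" "vec.subspace V" "\<And>u x. u \<in> U \<Longrightarrow> x \<in> V \<Longrightarrow> u *v x \<in> V" "x \<in> V"
  shows "M *v x \<in> V"
  using assms(1)
  by (induction M rule: matrix_span.induct)
     (auto simp: matrix_vector_mult_add_rdistrib mscale_mult_vec assms vec.subspace_add vec.subspace_scale vec.subspace_0)

text \<open>The projection to a complement of \<open>W\<close> in \<open>V\<close> turns \<open>trace (E ** S ** E)\<close> into the trace of the
  operator that \<open>S\<close> induces on the quotient \<open>V/W\<close>.\<close>

lemma exists_quotient_projection:
  fixes V W :: "('k::field^'n) set"
  assumes "vec.subspace V" "vec.subspace W" "W \<subseteq> V"
  obtains E :: "'k^'n^'n" where "\<And>x. E *v x \<in> V" "\<And>x. x \<in> W \<Longrightarrow> E *v x = 0"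
    "\<And>x. x \<in> V \<Longrightarrow> x - E *v x \<in> W" "\<And>x. E *v (E *v x) = E *v x"
proof -
  obtain P where P: "\<And>x. P *v x \<in> V" "\<And>x. x \<in> V \<Longrightarrow> P *v x = x"
    using exists_projection_matrix[OF assms(1)] by blast
  obtain Q where Q: "\<And>x. Q *v x \<in> W" "\<And>x. x \<in> W \<Longrightarrow> Q *v x = x"
    using exists_projection_matrix[OF assms(2)] by blast
  define E where "E = P - Q ** P"
  have E: "E *v x = P *v x - Q *v (P *v x)" for x
    by (simp add: E_def matrix_vector_mult_diff_rdistrib matrix_vector_mul_assoc)
  have EV: "E *v x \<in> V" for x unfolding E using P(1) Q(1) assms by (intro vec.subspace_diff) auto
  show ?thesis
  proof (rule that[of E])
    fix x
    show "x \<in> W \<Longrightarrow> E *v x = 0" using assms(3) P(2) Q(2) by (auto simp: E)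
    show "x \<in> V \<Longrightarrow> x - E *v x \<in> W" using P(2) Q(1) by (auto simp: E)
    have "Q *v (E *v x) = 0" by (simp add: E algebra_simps Q)
    then show "E *v (E *v x) = E *v x" using P(2)[OF EV[of x]] by (simp add: E[of "E *v x"])
  qed (rule EV)
qed

lemma trace_rank_one:
  fixes M :: "'k::field^'n^'n" and r y :: "'k^'n"
  assumes "\<And>v. M *v v = (\<Sum>j\<in>UNIV. r $ j * v $ j) *s y"
  shows "trace M = (\<Sum>j\<in>UNIV. r $ j * y $ j)"
proof -
  have "M $ i $ i = r $ i * y $ i" for i
  proof -
    have "M $ i $ i = (M *v axis i 1) $ i"
      by (simp add: matrix_vector_mult_def axis_def if_distrib cong: if_cong)
    also have "\<dots> = (\<Sum>j\<in>UNIV. r $ j * axis i 1 $ j) * y $ i" by (simp add: assms)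
    also have "(\<Sum>j\<in>UNIV. r $ j * axis i 1 $ j) = r $ i" by (simp add: axis_def if_distrib cong: if_cong)
    finally show ?thesis .
  qed
  then show ?thesis by (simp add: trace_def)
qed

text \<open>Kolchin's theorem, relative to an invariant subspace \<open>W\<close>, by the trace argument of Burnside. One may
  assume that \<open>V/W\<close> is irreducible. All elements of \<open>U\<close> have the same trace on \<open>V/W\<close>, so \<open>(u - 1) S\<close> has trace
  \<open>0\<close> for every \<open>S\<close> in the algebra spanned by \<open>U\<close>. An element \<open>T\<close> of this algebra that has minimal nonzero rank
  on \<open>V/W\<close> has rank one there, because the field is algebraically closed: it is \<open>v \<mapsto> \<phi>(v) y\<close>. The algebra
  moves \<open>y\<close> to every vector of \<open>V/W\<close>, so taking \<open>S = D T\<close> shows that \<open>\<phi>\<close> vanishes on all \<open>u v - v\<close>. Then the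
  kernel of \<open>\<phi>\<close> is invariant, hence equal to \<open>W\<close>, and \<open>U\<close> acts trivially on the line \<open>V/W\<close>.\<close>

lemma unipotent_group_fixes_vector_of_quotient:
  fixes U :: "('k::alg_closed_field^'n^'n) set"
  assumes one: "mat 1 \<in> U" and mult: "\<And>u v. u \<in> U \<Longrightarrow> v \<in> U \<Longrightarrow> u ** v \<in> U"
    and unip: "\<And>u. u \<in> U \<Longrightarrow> unipotent u"
    and W: "vec.subspace W" "\<And>u x. u \<in> U \<Longrightarrow> x \<in> W \<Longrightarrow> u *v x \<in> W"
    and V: "vec.subspace V" "\<And>u x. u \<in> U \<Longrightarrow> x \<in> V \<Longrightarrow> u *v x \<in> V" and WV: "W \<subset> V"
  shows "\<exists>v\<in>V - W. \<forall>u\<in>U. u *v v - v \<in> W"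
  using V WV
proof (induction "vec.dim V" arbitrary: V rule: less_induct)
  case less
  note V = less.prems(1,2) and WV = less.prems(3)
  define A where "A = matrix_span U"
  have A_mult: "M ** N \<in> A" if "M \<in> A" "N \<in> A" for M N
    using that matrix_span_mult[OF mult] by (simp add: A_def)
  have A_V: "M *v x \<in> V" if "M \<in> A" "x \<in> V" for M x
    using matrix_span_invariant[of M U V x] V that by (simp add: A_def)
  have A_W: "M *v x \<in> W" if "M \<in> A" "x \<in> W" for M x
    using matrix_span_invariant[of M U W x] W that by (simp add: A_def)
  have U_A: "u \<in> A" if "u \<in> U" for u using that by (simp add: A_def matrix_span_base)
  show ?case
  proof (cases "\<exists>V'. vec.subspace V' \<and> W \<subset> V' \<and> V' \<subset> V \<and> (\<forall>u\<in>U. \<forall>x\<in>V'. u *v x \<in> V')")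
    case True
    then obtain V' where V': "vec.subspace V'" "W \<subset> V'" "V' \<subset> V" "\<And>u x. u \<in> U \<Longrightarrow> x \<in> V' \<Longrightarrow> u *v x \<in> V'"
      by blast
    have "vec.dim V' < vec.dim V"
      using V' V(1) vec.dim_psubset[of V' V] vec.span_eq_iff[of V'] vec.span_eq_iff[of V] by metis
    from less.hyps[OF this V'(1,4,2)] show ?thesis using V'(3) by blast
  next
    case False
    then have irred: "V' = W" if "vec.subspace V'" "W \<subseteq> V'" "V' \<subseteq> V" "V' \<noteq> V"
      "\<And>u x. u \<in> U \<Longrightarrow> x \<in> V' \<Longrightarrow> u *v x \<in> V'" for V'
      using that by blast
    obtain E where E: "\<And>x. E *v x \<in> V" "\<And>x. x \<in> W \<Longrightarrow> E *v x = 0"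
      "\<And>x. x \<in> V \<Longrightarrow> x - E *v x \<in> W" "\<And>x. E *v (E *v x) = E *v x"
      using exists_quotient_projection[OF V(1) W(1)] WV by blast
    have E_W: "x \<in> W" if "x \<in> V" "E *v x = 0" for x using E(3)[OF that(1)] that(2) by simp
    \<comment> \<open>As \<open>V/W\<close> is irreducible, the algebra moves every nonzero vector of it to every vector.\<close>
    have trans: "\<exists>C\<in>A. C *v x - y \<in> W" if x: "x \<in> V" "x \<notin> W" and y: "y \<in> V" for x y
    proof -
      define V' where "V' = {z. \<exists>C\<in>A. C *v x - z \<in> W}"
      have sub: "vec.subspace V'"
      proof (rule vec.subspaceI)
        show "0 \<in> V'" using matrix_span.zero[of U] vec.subspace_0[OF W(1)]
          by (auto simp: V'_def A_def intro!: bexI[of _ 0])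
        fix a b assume "a \<in> V'" "b \<in> V'"
        then obtain C D where CD: "C \<in> A" "C *v x - a \<in> W" "D \<in> A" "D *v x - b \<in> W"
          by (auto simp: V'_def)
        then have "(C + D) *v x - (a + b) \<in> W"
          using vec.subspace_add[OF W(1) CD(2,4)] by (simp add: algebra_simps)
        then show "a + b \<in> V'" using CD matrix_span_add[of C U D] by (auto simp: V'_def A_def)
      next
        fix c a assume "a \<in> V'"
        then obtain C where C: "C \<in> A" "C *v x - a \<in> W" by (auto simp: V'_def)
        then have "mscale c C *v x - c *s a \<in> W"
          using vec.subspace_scale[OF W(1) C(2), of c] by (simp add: mscale_mult_vec vec.scale_right_diff_distrib)
        then show "c *s a \<in> V'" using C matrix_span_scale[of C U c] by (auto simp: V'_def A_def)
      qed
      have 1: "W \<subseteq> V'"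
      proof
        fix w assume "w \<in> W"
        then have "0 *v x - w \<in> W" using vec.subspace_neg[OF W(1)] by simp
        then show "w \<in> V'" using matrix_span.zero[of U] unfolding V'_def A_def by blast
      qed
      have 2: "V' \<subseteq> V"
      proof
        fix z assume "z \<in> V'"
        then obtain C where C: "C \<in> A" "C *v x - z \<in> W" by (auto simp: V'_def)
        then have "C *v x - (C *v x - z) \<in> V"
          using A_V[OF C(1) x(1)] C(2) psubset_imp_subset[OF WV] by (rule_tac vec.subspace_diff[OF V(1)]) blast+
        then show "z \<in> V" by simp
      qed
      have 3: "u *v z \<in> V'" if u: "u \<in> U" and z: "z \<in> V'" for u z
      proof -
        obtain C where C: "C \<in> A" "C *v x - z \<in> W" using z by (auto simp: V'_def)
        then have "(u ** C) *v x - u *v z \<in> W"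
          using W(2)[OF u C(2)] by (simp add: matrix_vector_mul_assoc[symmetric] algebra_simps)
        then show ?thesis using A_mult[OF U_A[OF u] C(1)] by (auto simp: V'_def)
      qed
      have "x \<in> V'" using U_A[OF one] vec.subspace_0[OF W(1)] by (auto simp: V'_def intro!: bexI[of _ "mat 1"])
      then have "V' = V" using irred[OF sub 1 2 _ 3] x by blast
      then show ?thesis using y by (auto simp: V'_def)
    qed
    \<comment> \<open>An element of the algebra of minimal nonzero rank on the quotient has rank one there.\<close>
    define rk where "rk T = vec.dim ((*v) (E ** T) ` V)" for T
    define ok where "ok T \<longleftrightarrow> T \<in> A \<and> (\<exists>x\<in>V. T *v x \<notin> W)" for T
    have "ok (mat 1)" using U_A[OF one] WV by (auto simp: ok_def)
    then obtain T where T: "ok T" and T_min: "\<And>T'. ok T' \<Longrightarrow> rk T \<le> rk T'"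
      using ex_has_least_nat[of ok "mat 1" rk] by blast
    have TA: "T \<in> A" using T by (simp add: ok_def)
    obtain x0 where x0: "x0 \<in> V" "T *v x0 \<notin> W" using T by (auto simp: ok_def)
    have rank_one: "\<exists>c. T *v v - c *s (T *v x0) \<in> W" if v: "v \<in> V" for v
    proof (rule ccontr)
      assume *: "\<nexists>c. T *v v - c *s (T *v x0) \<in> W"
      obtain C where C: "C \<in> A" "C *v (T *v x0) - v \<in> W" using trans[OF A_V[OF TA x0(1)] x0(2) v] by blast
      \<comment> \<open>The image \<open>Y\<close> of \<open>T\<close> is stable under \<open>T ** C\<close>. If \<open>c\<close>
        is an eigenvalue of \<open>T ** C\<close> on \<open>Y/W\<close>, then \<open>(T ** C - c) ** T\<close> has smaller rank
        than \<open>T\<close>, but it does not map \<open>x0\<close> into \<open>W\<close>, because \<open>T v\<close> is not a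
        multiple of \<open>T x0\<close> modulo \<open>W\<close>.\<close>
      define Y where "Y = {T *v x + w | x w. x \<in> V \<and> w \<in> W}"
      have Y: "vec.subspace Y"
      proof (rule vec.subspaceI)
        show "0 \<in> Y" unfolding Y_def using vec.subspace_0[OF V(1)] vec.subspace_0[OF W(1)]
          by (force intro!: exI[of _ 0])
        fix a b assume "a \<in> Y" "b \<in> Y"
        then obtain x w x' w' where "a = T *v x + w" "b = T *v x' + w'" "x \<in> V" "x' \<in> V" "w \<in> W" "w' \<in> W"
          by (auto simp: Y_def)
        then have "a + b = T *v (x + x') + (w + w')" "x + x' \<in> V" "w + w' \<in> W"
          using V(1) W(1) by (auto simp: algebra_simps vec.subspace_add)
        then show "a + b \<in> Y" unfolding Y_def by blast
      next
        fix c a assume "a \<in> Y"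
        then obtain x w where "a = T *v x + w" "x \<in> V" "w \<in> W" by (auto simp: Y_def)
        then have "c *s a = T *v (c *s x) + c *s w" "c *s x \<in> V" "c *s w \<in> W"
          using V(1) W(1) by (auto simp: vec.scale_right_distrib vector_scalar_commute vec.subspace_scale)
        then show "c *s a \<in> Y" unfolding Y_def by blast
      qed
      have TC: "T ** C \<in> A" using TA C(1) by (rule A_mult)
      have Y_inv: "(T ** C) *v y \<in> Y" if yY: "y \<in> Y" for y
      proof -
        obtain x w where y: "y = T *v x + w" "x \<in> V" "w \<in> W" using yY by (auto simp: Y_def)
        then have "(T ** C) *v y = T *v (C *v (T *v x)) + T *v (C *v w)"
          by (simp add: matrix_vector_mul_assoc[symmetric] algebra_simps)
        then show ?thesis unfolding Y_def using y A_V A_W TA C(1) by blast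
      qed
      have "T *v x0 \<in> Y" unfolding Y_def using x0 vec.subspace_0[OF W(1)] by force
      from eigenvector_mod_subspace[OF W(1) A_W[OF TC] Y Y_inv this x0(2)]
      obtain c y0 where y0: "y0 \<in> Y" "y0 \<notin> W" "(T ** C) *v y0 - c *s y0 \<in> W" by blast
      define g where "g = T ** C + mscale (-c) (mat 1)"
      have g: "g *v y = T *v (C *v y) - c *s y" for y
        by (simp add: g_def matrix_vector_mult_add_rdistrib mscale_mult_vec matrix_vector_mul_assoc vec.scale_minus_left)
      have gA: "g \<in> A" unfolding g_def A_def
        using TC U_A[OF one] by (intro matrix_span_add matrix_span_scale) (simp_all add: A_def)
      have gT: "g ** T \<in> A" using gA TA by (rule A_mult)
      have "(g ** T) *v x0 \<notin> W"
      proof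
        assume "(g ** T) *v x0 \<in> W"
        then have "T *v (C *v (T *v x0)) - c *s (T *v x0) \<in> W"
          by (simp add: matrix_vector_mul_assoc[symmetric] g)
        moreover have "T *v (C *v (T *v x0) - v) \<in> W" using A_W[OF TA C(2)] .
        ultimately have "(T *v (C *v (T *v x0)) - c *s (T *v x0)) - T *v (C *v (T *v x0) - v) \<in> W"
          by (rule vec.subspace_diff[OF W(1)])
        then show False using * by (auto simp: algebra_simps)
      qed
      then have "ok (g ** T)" using gT x0(1) by (auto simp: ok_def)
      moreover have "rk (g ** T) < rk T"
      proof -
        have Eg: "E *v (g *v y) = E *v (g *v (E *v y))" if "y \<in> V" for y
        proof -
          have "g *v (y - E *v y) \<in> W" using A_W[OF gA E(3)[OF that]] .
          then have "E *v (g *v (y - E *v y)) = 0" by (rule E(2))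
          then show ?thesis by (simp add: algebra_simps)
        qed
        have sub: "vec.subspace ((*v) (E ** T) ` V)" using V(1) by (metis vec.subspace_image)
        obtain x w where xw: "y0 = T *v x + w" "x \<in> V" "w \<in> W" using y0(1) by (auto simp: Y_def)
        have TxV: "T *v x \<in> V" using A_V TA xw by blast
        have y0V: "y0 \<in> V" using TxV xw(1,3) WV V(1) vec.subspace_add by blast
        have "E *v y0 = (E ** T) *v x" using E(2)[OF xw(3)] by (simp add: xw(1) algebra_simps matrix_vector_mul_assoc)
        then have m: "E *v y0 \<in> (*v) (E ** T) ` V" using xw(2) by blast
        have nz: "E *v y0 \<noteq> 0" using E_W[OF y0V] y0(2) by blast
        have "E *v (g *v y0) = 0" using y0(3) by (intro E(2)) (simp add: g matrix_vector_mul_assoc)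
        then have z: "(E ** g) *v (E *v y0) = 0" using Eg[OF y0V] by (simp add: matrix_vector_mul_assoc[symmetric])
        have "(*v) (E ** (g ** T)) ` V = (*v) (E ** g) ` ((*v) (E ** T) ` V)"
          unfolding image_image using Eg A_V[OF TA] by (intro image_cong) (auto simp: matrix_vector_mul_assoc[symmetric])
        then show ?thesis unfolding rk_def using dim_image_less_if_kernel[OF sub m nz z] by simp
      qed
      ultimately show False using T_min by (meson leD)
    qed
    have "E *v (T *v x0) \<noteq> 0" using E_W A_V[OF TA x0(1)] x0(2) by blast
    then obtain i0 where i0: "(E *v (T *v x0)) $ i0 \<noteq> 0" by (auto simp: vec_eq_iff)
    \<comment> \<open>The functional \<open>\<phi>\<close> with \<open>T v = \<phi> v *s (T x0)\<close> modulo \<open>W\<close>,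
      read off at a coordinate \<open>i0\<close>.\<close>
    define r where "r = (\<chi> j. (E ** T) $ i0 $ j / (E *v (T *v x0)) $ i0)"
    define \<phi> where "\<phi> v = (\<Sum>j\<in>UNIV. r $ j * v $ j)" for v
    have \<phi>_eq: "\<phi> v = (E *v (T *v v)) $ i0 / (E *v (T *v x0)) $ i0" for v
      unfolding \<phi>_def r_def matrix_vector_mul_assoc by (simp add: matrix_vector_mult_def sum_divide_distrib)
    have \<phi>_add: "\<phi> (v + w) = \<phi> v + \<phi> w" "\<phi> (c *s v) = c * \<phi> v" "\<phi> (v - w) = \<phi> v - \<phi> w" for v w c
      unfolding \<phi>_eq by (simp_all add: algebra_simps add_divide_distrib diff_divide_distrib vector_scalar_commute)
    have \<phi>_W: "\<phi> w = 0" if "w \<in> W" for w unfolding \<phi>_eq using E(2)[OF A_W[OF TA that]] by simp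
    have \<phi>_E: "\<phi> (E *v v) = \<phi> v" if "v \<in> V" for v
      using \<phi>_W[OF E(3)[OF that]] by (simp add: \<phi>_add)
    have T_mod: "T *v v - \<phi> v *s (T *v x0) \<in> W" if v: "v \<in> V" for v
    proof -
      obtain c where c: "T *v v - c *s (T *v x0) \<in> W" using rank_one[OF v] by blast
      then have "E *v (T *v v) = c *s (E *v (T *v x0))"
        using E(2)[OF c] by (simp add: algebra_simps vector_scalar_commute)
      then have "\<phi> v = c" unfolding \<phi>_eq using i0 by simp
      then show ?thesis using c by simp
    qed
    \<comment> \<open>The trace on the quotient is constant on \<open>U\<close>, as the elements of \<open>U\<close> are unipotent.\<close>
    define tr where "tr S = trace (E ** S ** E)" for S
    have tr_add: "tr (S + S') = tr S + tr S'" and tr_scale: "tr (mscale c S) = c * tr S" for S S' c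
    proof -
      have "E ** (S + S') ** E = E ** S ** E + E ** S' ** E"
        by (simp add: matrix_eq matrix_vector_mul_assoc[symmetric] algebra_simps)
      then show "tr (S + S') = tr S + tr S'" by (simp add: tr_def trace_add)
      have "E ** mscale c S ** E = mscale c (E ** S ** E)"
        by (simp add: matrix_eq matrix_vector_mul_assoc[symmetric] mscale_mult_vec vector_scalar_commute)
      then show "tr (mscale c S) = c * tr S" by (simp add: tr_def trace_def mscale_nth sum_distrib_left)
    qed
    have tr_U: "tr u = trace E" if u: "u \<in> U" for u
    proof -
      define N where "N = E ** (u - mat 1) ** E"
      have N: "N *v x = E *v (u *v (E *v x) - E *v x)" for x
        by (simp add: N_def matrix_vector_mul_assoc[symmetric] matrix_vector_mult_diff_rdistrib)
      obtain k where "(((**) (u - mat 1)) ^^ k) (mat 1) = 0" using unip[OF u] by (auto simp: unipotent_def)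
      then have k: "(((*v) (u - mat 1)) ^^ k) x = 0" for x
        using funpow_mult_vec[of k "u - mat 1" "mat 1" x] by simp
      have inV: "(((*v) (u - mat 1)) ^^ j) x \<in> V" if "x \<in> V" for j x
        using that V u by (induction j) (auto simp: matrix_vector_mult_diff_rdistrib vec.subspace_diff)
      have pow: "(((*v) N) ^^ j) (E *v x) = E *v ((((*v) (u - mat 1)) ^^ j) x)" if x: "x \<in> V" for j x
      proof (induction j)
        case (Suc j)
        define y where "y = (((*v) (u - mat 1)) ^^ j) x"
        have y: "y \<in> V" using inV[OF x] by (simp add: y_def)
        have "u *v (y - E *v y) - (y - E *v y) \<in> W"
          by (rule vec.subspace_diff[OF W(1) W(2)[OF u E(3)[OF y]] E(3)[OF y]])
        then have "E *v (u *v (y - E *v y) - (y - E *v y)) = 0" by (rule E(2))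
        then have "N *v (E *v y) = E *v ((u - mat 1) *v y)" by (simp add: N E(4) algebra_simps)
        then show ?case using Suc by (simp add: y_def del: matrix_vector_mult_diff_rdistrib)
      qed simp
      have "(((*v) N) ^^ Suc k) x = 0" for x
      proof -
        have "N *v x \<in> V" using E(1) by (simp add: N)
        moreover have "N *v x = E *v (N *v x)" by (simp add: N E(4))
        ultimately have "(((*v) N) ^^ k) (N *v x) = E *v ((((*v) (u - mat 1)) ^^ k) (N *v x))" by (metis pow)
        then show ?thesis unfolding funpow_Suc_right o_def k by simp
      qed
      then have "trace N = 0" by (rule trace_nilpotent_eq_0)
      moreover have "E ** u ** E = E + N"
        by (simp add: matrix_eq matrix_vector_mul_assoc[symmetric] N algebra_simps E(4))
      ultimately show ?thesis by (simp add: tr_def trace_add)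
    qed
    have tr_mult: "tr (u ** S) = tr S" if u: "u \<in> U" and S: "S \<in> A" for u S
      using S unfolding A_def
    proof (induction S rule: matrix_span.induct)
      case (step v S c)
      have "u ** (mscale c v + S) = mscale c (u ** v) + u ** S"
        by (simp add: matrix_eq mscale_mult_vec matrix_vector_mul_assoc[symmetric] algebra_simps vector_scalar_commute)
      then show ?case using step u by (simp add: tr_add tr_scale tr_U mult)
    qed simp
    have tr_DT: "tr (D ** T) = \<phi> (D *v (T *v x0))" if D: "D \<in> A" for D
    proof -
      define r' where "r' = (\<chi> j. \<phi> (E *v axis j 1))"
      have r': "(\<Sum>j\<in>UNIV. r' $ j * v $ j) = \<phi> (E *v v)" for v
      proof -
        have sum: "\<phi> (\<Sum>j\<in>F. f j) = (\<Sum>j\<in>F. \<phi> (f j))" if "finite F" for F and f :: "'n \<Rightarrow> _"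
          using that \<phi>_W[OF vec.subspace_0[OF W(1)]] by (induction F rule: finite_induct) (auto simp: \<phi>_add)
        have "E *v v = E *v (\<Sum>j\<in>UNIV. v $ j *s axis j 1)" by (simp only: basis_expansion)
        also have "\<dots> = (\<Sum>j\<in>UNIV. v $ j *s (E *v axis j 1))"
          by (simp add: vec.sum vector_scalar_commute)
        finally show ?thesis by (simp add: sum \<phi>_add r'_def mult.commute)
      qed
      have "(E ** (D ** T) ** E) *v v = (\<Sum>j\<in>UNIV. r' $ j * v $ j) *s (E *v (D *v (T *v x0)))" for v
      proof -
        have "D *v (T *v (E *v v) - \<phi> (E *v v) *s (T *v x0)) \<in> W" by (intro A_W D T_mod E(1))
        then have "E *v (D *v (T *v (E *v v) - \<phi> (E *v v) *s (T *v x0))) = 0" by (rule E(2))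
        then show ?thesis
          by (simp add: r' matrix_vector_mul_assoc[symmetric] algebra_simps vector_scalar_commute)
      qed
      then have "tr (D ** T) = (\<Sum>j\<in>UNIV. r' $ j * (E *v (D *v (T *v x0))) $ j)"
        unfolding tr_def by (rule trace_rank_one)
      then show ?thesis using \<phi>_E[OF A_V[OF D A_V[OF TA x0(1)]]] by (simp add: r' E(4))
    qed
    have \<phi>_inv: "\<phi> (u *v v) = \<phi> v" if u: "u \<in> U" and v: "v \<in> V" for u v
    proof -
      obtain D where D: "D \<in> A" "D *v (T *v x0) - v \<in> W" using trans[OF A_V[OF TA x0(1)] x0(2) v] by blast
      have "\<phi> (u *v (D *v (T *v x0))) = \<phi> (D *v (T *v x0))"
        using tr_DT[OF D(1)] tr_DT[OF A_mult[OF U_A[OF u] D(1)]] tr_mult[OF u A_mult[OF D(1) TA]]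
        by (simp add: matrix_mul_assoc matrix_vector_mul_assoc)
      moreover have "\<phi> (D *v (T *v x0)) = \<phi> v" using \<phi>_W[OF D(2)] by (simp add: \<phi>_add)
      moreover have "\<phi> (u *v (D *v (T *v x0))) = \<phi> (u *v v)"
        using \<phi>_W[OF W(2)[OF u D(2)]] by (simp add: \<phi>_add matrix_vector_mult_diff_distrib)
      ultimately show ?thesis by simp
    qed
    define V' where "V' = {v \<in> V. \<phi> v = 0}"
    have "vec.subspace V'"
      using V(1) \<phi>_W[OF vec.subspace_0[OF W(1)]] unfolding V'_def
      by (auto intro!: vec.subspaceI simp: \<phi>_add vec.subspace_add vec.subspace_scale vec.subspace_0)
    moreover have \<phi>1: "\<phi> x0 = 1" using i0 by (simp add: \<phi>_eq)
    moreover have "x0 \<notin> V'" using \<phi>1 by (simp add: V'_def)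
    then have "V' \<noteq> V" using x0(1) by blast
    moreover have "W \<subseteq> V'" using WV \<phi>_W by (auto simp: V'_def)
    moreover have "u *v x \<in> V'" if "u \<in> U" "x \<in> V'" for u x
      using that V(2) \<phi>_inv by (simp add: V'_def)
    ultimately have "V' = W" by (intro irred) (auto simp: V'_def)
    moreover have "x0 \<notin> W" using A_W[OF TA] x0(2) by blast
    moreover have "u *v x0 - x0 \<in> V'" if "u \<in> U" for u
      using \<phi>_inv[OF that x0(1)] V that x0(1) by (simp add: V'_def \<phi>_add vec.subspace_diff)
    ultimately show ?thesis using x0(1) by blast
  qed
qed

text \<open>Several unipotent groups normalized by a common \<open>P\<close> are treated one after the other: the vectors of
  \<open>V/W\<close> fixed by one of them are again stable under \<open>P\<close>, and Kolchin's theorem applies to them.\<close>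

lemma normal_unipotent_groups_fix_vector_of_quotient:
  fixes P :: "('k::alg_closed_field^'n^'n) set"
  assumes fin: "finite \<U>"
    and \<U>: "\<And>U. U \<in> \<U> \<Longrightarrow> mat 1 \<in> U" "\<And>U u v. U \<in> \<U> \<Longrightarrow> u \<in> U \<Longrightarrow> v \<in> U \<Longrightarrow> u ** v \<in> U"
      "\<And>U u. U \<in> \<U> \<Longrightarrow> u \<in> U \<Longrightarrow> unipotent u" "\<And>U. U \<in> \<U> \<Longrightarrow> U \<subseteq> P"
    and normal: "\<And>U u g. U \<in> \<U> \<Longrightarrow> u \<in> U \<Longrightarrow> g \<in> P \<Longrightarrow> \<exists>u'\<in>U. u ** g = g ** u'"
    and W: "vec.subspace W" "\<And>u x. u \<in> P \<Longrightarrow> x \<in> W \<Longrightarrow> u *v x \<in> W"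
    and V: "vec.subspace V" "\<And>u x. u \<in> P \<Longrightarrow> x \<in> V \<Longrightarrow> u *v x \<in> V" and WV: "W \<subset> V"
  shows "\<exists>v\<in>V - W. \<forall>U\<in>\<U>. \<forall>u\<in>U. u *v v - v \<in> W"
proof -
  define good where "good \<F> V' \<longleftrightarrow> vec.subspace V' \<and> (\<forall>u\<in>P. \<forall>x\<in>V'. u *v x \<in> V') \<and> W \<subset> V' \<and> V' \<subseteq> V \<and>
      (\<forall>U\<in>\<F>. \<forall>u\<in>U. \<forall>v\<in>V'. u *v v - v \<in> W)" for \<F> V'
  have "\<exists>V'. good \<F> V'" if "\<F> \<subseteq> \<U>" for \<F>
    using finite_subset[OF that fin] that
  proof (induction \<F> rule: finite_induct)
    case empty
    then show ?case using V WV by (intro exI[of _ V]) (simp add: good_def)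
  next
    case (insert U \<F>)
    then have "\<F> \<subseteq> \<U>" by blast
    from insert.IH[OF this] obtain V1 where "good \<F> V1" by blast
    then have V1: "vec.subspace V1" "\<And>u x. u \<in> P \<Longrightarrow> x \<in> V1 \<Longrightarrow> u *v x \<in> V1" "W \<subset> V1" "V1 \<subseteq> V"
      "\<And>U u v. U \<in> \<F> \<Longrightarrow> u \<in> U \<Longrightarrow> v \<in> V1 \<Longrightarrow> u *v v - v \<in> W" by (simp_all add: good_def)
    have UU: "U \<in> \<U>" using insert by blast
    have UP: "u \<in> P" if "u \<in> U" for u using \<U>(4)[OF UU] that by blast
    define V2 where "V2 = {v \<in> V1. \<forall>u\<in>U. u *v v - v \<in> W}"
    have "vec.subspace V2"
    proof (rule vec.subspaceI)
      show "0 \<in> V2" using vec.subspace_0[OF V1(1)] vec.subspace_0[OF W(1)] by (simp add: V2_def)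
      fix x y assume "x \<in> V2" "y \<in> V2"
      then show "x + y \<in> V2"
        using V1(1) vec.subspace_add[OF W(1), of "u *v x - x" "u *v y - y" for u] unfolding V2_def
        by (simp add: vec.subspace_add algebra_simps)
    next
      fix c x assume "x \<in> V2"
      then show "c *s x \<in> V2"
        using V1(1) vec.subspace_scale[OF W(1), of "u *v x - x" c for u] unfolding V2_def
        by (simp add: vec.subspace_scale vector_scalar_commute vec.scale_right_diff_distrib)
    qed
    moreover have "g *v x \<in> V2" if g: "g \<in> P" and x: "x \<in> V2" for g x
    proof -
      have "u *v (g *v x) - g *v x \<in> W" if u: "u \<in> U" for u
      proof -
        obtain u' where u': "u' \<in> U" "u ** g = g ** u'" using normal[OF UU u g] by blast
        have "u *v (g *v x) - g *v x = g *v (u' *v x - x)"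
          by (simp add: matrix_vector_mul_assoc u'(2) algebra_simps)
        then show ?thesis using W(2)[OF g] x u'(1) by (simp add: V2_def)
      qed
      then show ?thesis using V1(2)[OF g] x by (simp add: V2_def)
    qed
    moreover have "W \<subset> V2"
    proof -
      have "W \<subseteq> V2" using V1(3) W UP by (auto simp: V2_def intro!: vec.subspace_diff)
      moreover have "\<exists>v\<in>V1 - W. \<forall>u\<in>U. u *v v - v \<in> W"
        using \<U>[OF UU] W V1(1,2,3) UP by (intro unipotent_group_fixes_vector_of_quotient) auto
      ultimately show ?thesis by (auto simp: V2_def)
    qed
    ultimately show ?case using V1(4,5) unfolding good_def
      by (intro exI[of _ V2]) (auto simp: V2_def)
  qed
  from this[OF subset_refl] obtain V' where "good \<U> V'" by blast
  then have V': "W \<subset> V'" "V' \<subseteq> V" "\<And>U u v. U \<in> \<U> \<Longrightarrow> u \<in> U \<Longrightarrow> v \<in> V' \<Longrightarrow> u *v v - v \<in> W"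
    by (simp_all add: good_def)
  then obtain v where "v \<in> V' - W" by blast
  then show ?thesis using V'(2,3) by (intro bexI[of _ v]) auto
qed

definition matrix_prod :: "('k::semiring_1^'n^'n) list \<Rightarrow> 'k^'n^'n" where
  "matrix_prod Ms = foldr (**) Ms (mat 1)"

lemma matrix_prod_simps [simp]:
  "matrix_prod [] = mat 1" "matrix_prod (M # Ms) = M ** matrix_prod Ms"
  by (simp_all add: matrix_prod_def)

lemma matrix_prod_append: "matrix_prod (Ms @ Ns) = matrix_prod Ms ** matrix_prod Ns"
  by (induction Ms) (simp_all add: matrix_mul_assoc)

text \<open>Fixed vectors of successive quotients give a filtration of the whole space by subspaces stable under
  \<open>P\<close>, and each \<open>u - 1\<close> lowers the degree of the filtration.\<close>

lemma normal_unipotent_groups_nilpotent: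
  fixes P :: "('k::alg_closed_field^'n^'n) set"
  assumes fin: "finite \<U>"
    and \<U>: "\<And>U. U \<in> \<U> \<Longrightarrow> mat 1 \<in> U" "\<And>U u v. U \<in> \<U> \<Longrightarrow> u \<in> U \<Longrightarrow> v \<in> U \<Longrightarrow> u ** v \<in> U"
      "\<And>U u. U \<in> \<U> \<Longrightarrow> u \<in> U \<Longrightarrow> unipotent u" "\<And>U. U \<in> \<U> \<Longrightarrow> U \<subseteq> P"
    and normal: "\<And>U u g. U \<in> \<U> \<Longrightarrow> u \<in> U \<Longrightarrow> g \<in> P \<Longrightarrow> \<exists>u'\<in>U. u ** g = g ** u'"
    and len: "length us = CARD('n)" and us: "set us \<subseteq> \<Union>\<U>"
  shows "matrix_prod (map (\<lambda>u. u - mat 1) us) = 0"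
proof -
  define F where "F = rec_nat ({0} :: ('k^'n) set) (\<lambda>_ W. {v. \<forall>u\<in>\<Union>\<U>. u *v v - v \<in> W})"
  have F0: "F 0 = {0}" and F_Suc: "F (Suc j) = {v. \<forall>u\<in>\<Union>\<U>. u *v v - v \<in> F j}" for j
    by (simp_all add: F_def)
  have F: "vec.subspace (F j) \<and> (\<forall>g\<in>P. \<forall>x\<in>F j. g *v x \<in> F j) \<and> F j \<subseteq> F (Suc j)" for j
  proof (induction j)
    case 0
    then show ?case by (auto simp: F0 F_Suc vec.subspace_single_0)
  next
    case (Suc j)
    then have sub: "vec.subspace (F j)" and inv: "\<And>g x. g \<in> P \<Longrightarrow> x \<in> F j \<Longrightarrow> g *v x \<in> F j"
      and mono: "F j \<subseteq> F (Suc j)" by auto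
    have "vec.subspace (F (Suc j))"
    proof (rule vec.subspaceI)
      show "0 \<in> F (Suc j)" using vec.subspace_0[OF sub] by (simp add: F_Suc)
      fix x y assume "x \<in> F (Suc j)" "y \<in> F (Suc j)"
      then show "x + y \<in> F (Suc j)"
        using vec.subspace_add[OF sub, of "u *v x - x" "u *v y - y" for u] unfolding F_Suc
        by (simp add: algebra_simps)
    next
      fix c x assume "x \<in> F (Suc j)"
      then show "c *s x \<in> F (Suc j)"
        using vec.subspace_scale[OF sub, of "u *v x - x" c for u] unfolding F_Suc
        by (simp add: vector_scalar_commute vec.scale_right_diff_distrib)
    qed
    moreover have "g *v x \<in> F (Suc j)" if g: "g \<in> P" and x: "x \<in> F (Suc j)" for g x
      unfolding F_Suc
    proof (intro CollectI ballI)
      fix u assume "u \<in> \<Union>\<U>"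
      then obtain U where U: "U \<in> \<U>" "u \<in> U" by blast
      obtain u' where u': "u' \<in> U" "u ** g = g ** u'" using normal[OF U g] by blast
      have "u *v (g *v x) - g *v x = g *v (u' *v x - x)"
        by (simp add: matrix_vector_mul_assoc u'(2) algebra_simps)
      then show "u *v (g *v x) - g *v x \<in> F j" using inv[OF g] x u'(1) U(1) by (auto simp: F_Suc)
    qed
    moreover have "F (Suc j) \<subseteq> F (Suc (Suc j))" using mono unfolding F_Suc[of "Suc j"] by (auto simp: F_Suc[of j])
    ultimately show ?case by blast
  qed
  \<comment> \<open>The filtration grows strictly until it is everything, so it has at most \<open>n\<close> steps.\<close>
  have "F j = UNIV \<or> j \<le> vec.dim (F j)" for j
  proof (induction j)
    case (Suc j)
    show ?case
    proof (cases "F j = UNIV")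
      case True
      then show ?thesis using F[of j] by auto
    next
      case False
      have "\<exists>v\<in>UNIV - F j. \<forall>U\<in>\<U>. \<forall>u\<in>U. u *v v - v \<in> F j"
        using F[of j] False by (intro normal_unipotent_groups_fix_vector_of_quotient[OF fin \<U> normal]) auto
      then have "F j \<subset> F (Suc j)" using F[of j] by (auto simp: F_Suc)
      then have "vec.dim (F j) < vec.dim (F (Suc j))"
        using F[of j] F[of "Suc j"] vec.dim_psubset[of "F j" "F (Suc j)"] vec.span_eq_iff by metis
      then show ?thesis using Suc False by linarith
    qed
  qed simp
  moreover have "F j = UNIV" if "CARD('n) \<le> vec.dim (F j)" for j
    using that F[of j] vec.dim_eq_full[of "F j"] vec.dim_subset_UNIV[of "F j"] vec.span_eq_iff[of "F j"]
      vec_dim_card[where 'a='k and 'n='n] vec.dim_UNIV card_cart_basis[where 'a='k and 'i='n]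
    by (simp add: vec.dimension_def)
  ultimately have top: "F CARD('n) = UNIV" by blast
  have "matrix_prod (map (\<lambda>u. u - mat 1) ws) *v x = 0" if "x \<in> F (length ws)" "set ws \<subseteq> \<Union>\<U>" for ws x
    using that
  proof (induction ws arbitrary: x rule: rev_induct)
    case (snoc w ws)
    have "w *v x - x \<in> F (length ws)" using snoc.prems by (auto simp: F_Suc)
    then have "matrix_prod (map (\<lambda>u. u - mat 1) ws) *v (w *v x - x) = 0" using snoc by simp
    then show ?case
      by (simp add: matrix_prod_append matrix_vector_mul_assoc[symmetric] matrix_vector_mult_diff_rdistrib
          del: matrix_vector_mult_diff_distrib)
  qed (simp add: F0)
  then show ?thesis using top len us by (simp add: matrix_eq)
qed

section \<open>Matrix groups and their rational points\<close>

lemma emb_nth [simp]: "emb A $ i $ j = to_ac (A $ i $ j)"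
  by (simp add: emb_def map_matrix_def)

lemma emb_mult: "emb (A ** B) = emb A ** emb B"
  by (simp add: vec_eq_iff matrix_matrix_mult_def to_ac_sum)

lemma emb_one [simp]: "emb (mat 1) = mat 1"
  by (simp add: vec_eq_iff mat_def)

lemma emb_diff: "emb (A - B) = emb A - emb B"
  by (simp add: vec_eq_iff)

lemma emb_zero: "emb 0 = 0"
  by (simp add: vec_eq_iff)

lemma emb_eq_iff [simp]: "emb A = emb B \<longleftrightarrow> A = B"
  by (simp add: vec_eq_iff)

lemma det_emb: "det (emb A) = to_ac (det A)"
  by (simp add: det_def to_ac_sum to_ac_prod)

lemma invertible_emb_iff [simp]: "invertible (emb A) \<longleftrightarrow> invertible A"
  by (simp add: invertible_det_nz det_emb)

lemma matrix_inv_mult: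
  fixes A :: "'k::field^'n^'n"
  assumes "invertible A"
  shows "matrix_inv A ** A = mat 1" "A ** matrix_inv A = mat 1"
  using assms someI_ex[of "\<lambda>B. A ** B = mat 1 \<and> B ** A = mat 1"]
  by (auto simp: invertible_def matrix_inv_def)

lemma matrix_inv_unique_left:
  fixes A :: "'k::field^'n^'n"
  assumes "invertible A" "B ** A = mat 1"
  shows "B = matrix_inv A"
  using assms by (metis matrix_inv_mult(2) matrix_mul_assoc matrix_mul_lid matrix_mul_rid)

lemma emb_matrix_inv: "invertible A \<Longrightarrow> emb (matrix_inv A) = matrix_inv (emb A)"
  by (rule matrix_inv_unique_left) (simp_all add: emb_mult[symmetric] matrix_inv_mult)

lemma invertible_matrix_inv:
  fixes A :: "'k::field^'n^'n"
  shows "invertible A \<Longrightarrow> invertible (matrix_inv A)"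
  using matrix_inv_mult[of A] unfolding invertible_def by blast

lemma matrix_inv_matrix_inv:
  fixes A :: "'k::field^'n^'n"
  shows "invertible A \<Longrightarrow> matrix_inv (matrix_inv A) = A"
  by (rule matrix_inv_unique_left[symmetric]) (simp_all add: invertible_matrix_inv matrix_inv_mult)

lemma matrix_inv_prod:
  fixes A B :: "'k::field^'n^'n"
  assumes "invertible A" "invertible B"
  shows "matrix_inv (A ** B) = matrix_inv B ** matrix_inv A"
proof -
  have "invertible (A ** B)" using assms by (simp add: invertible_mult)
  moreover
  have "matrix_inv B ** matrix_inv A ** (A ** B) = matrix_inv B ** (matrix_inv A ** A) ** B"
    by (simp add: matrix_mul_assoc)
  then have "matrix_inv B ** matrix_inv A ** (A ** B) = mat 1" by (simp add: matrix_inv_mult assms)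
  ultimately show ?thesis using matrix_inv_unique_left by metis
qed

lemma matrix_inv_one [simp]: "matrix_inv (mat 1 :: 'k::field^'n^'n) = mat 1"
  by (rule matrix_inv_unique_left[symmetric]) (auto simp: invertible_def)

lemma group_matgrp_GL: "group (matgrp (GL :: ('k::field^'n^'n) set))"
proof (rule groupI)
  fix x :: "'k^'n^'n" assume "x \<in> carrier (matgrp GL)"
  then show "\<exists>y\<in>carrier (matgrp GL). y \<otimes>\<^bsub>matgrp GL\<^esub> x = \<one>\<^bsub>matgrp GL\<^esub>"
    by (intro bexI[of _ "matrix_inv x"]) (auto simp: matgrp_def GL_def matrix_inv_mult invertible_matrix_inv)
qed (auto simp: matgrp_def GL_def matrix_mul_assoc invertible_mult invertible_def[of "mat 1"])

lemma inv_matgrp_GL: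
  fixes x :: "'k::field^'n^'n"
  assumes "invertible x"
  shows "inv\<^bsub>matgrp GL\<^esub> x = matrix_inv x"
  using assms group.inv_equality[OF group_matgrp_GL, of "matrix_inv x" x]
  by (auto simp: matgrp_def GL_def matrix_inv_mult invertible_matrix_inv)

lemma subgroup_matgrp_GL:
  fixes H :: "('k::field^'n^'n) set"
  shows "subgroup H (matgrp GL) \<longleftrightarrow> H \<subseteq> GL \<and> mat 1 \<in> H \<and> (\<forall>g\<in>H. \<forall>h\<in>H. g ** h \<in> H) \<and> (\<forall>g\<in>H. matrix_inv g \<in> H)"
    (is "?l \<longleftrightarrow> ?r")
proof
  assume ?l
  then interpret subgroup H "matgrp GL" .
  have "H \<subseteq> GL" using subset by (simp add: matgrp_def)
  moreover have "matrix_inv g \<in> H" if "g \<in> H" for g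
  proof -
    have "invertible g" using \<open>H \<subseteq> GL\<close> that by (auto simp: GL_def)
    then show ?thesis using m_inv_closed[OF that] inv_matgrp_GL[of g] by simp
  qed
  moreover have "mat 1 \<in> H" using one_closed by (simp add: matgrp_def)
  moreover have "g ** h \<in> H" if "g \<in> H" "h \<in> H" for g h using m_closed[OF that] by (simp add: matgrp_def)
  ultimately show ?r by blast
next
  assume r: ?r
  show ?l
  proof
    show "inv\<^bsub>matgrp GL\<^esub> x \<in> H" if "x \<in> H" for x
      using r that inv_matgrp_GL[of x] by (auto simp: GL_def)
  qed (use r in \<open>auto simp: matgrp_def\<close>)
qed

lemma alg_groupD:
  fixes H :: "('k::field^'n^'n) set"
  assumes "alg_group H"
  shows "mat 1 \<in> H" "\<And>g h. g \<in> H \<Longrightarrow> h \<in> H \<Longrightarrow> g ** h \<in> H" "\<And>g. g \<in> H \<Longrightarrow> matrix_inv g \<in> H"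
    "\<And>g. g \<in> H \<Longrightarrow> invertible g"
  using assms unfolding alg_group_def subgroup_matgrp_GL by (auto simp: GL_def)

lemma FptsD:
  fixes H :: "('f::field alg_closure^'n^'n) set"
  assumes "alg_group H"
  shows "mat 1 \<in> Fpts H" "\<And>g h. g \<in> Fpts H \<Longrightarrow> h \<in> Fpts H \<Longrightarrow> g ** h \<in> Fpts H"
    "\<And>g. g \<in> Fpts H \<Longrightarrow> matrix_inv g \<in> Fpts H" "\<And>g. g \<in> Fpts H \<Longrightarrow> invertible g"
proof -
  show inv: "\<And>g. g \<in> Fpts H \<Longrightarrow> invertible g" using alg_groupD(4)[OF assms] invertible_emb_iff unfolding Fpts_def by blast
  show "\<And>g. g \<in> Fpts H \<Longrightarrow> matrix_inv g \<in> Fpts H"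
    using alg_groupD(3)[OF assms] inv by (simp add: Fpts_def emb_matrix_inv)
  show "mat 1 \<in> Fpts H" using alg_groupD(1)[OF assms] by (simp add: Fpts_def)
  show "\<And>g h. g \<in> Fpts H \<Longrightarrow> h \<in> Fpts H \<Longrightarrow> g ** h \<in> Fpts H"
    using alg_groupD(2)[OF assms] by (simp add: Fpts_def emb_mult)
qed

lemma group_matgrp_Fpts:
  assumes "alg_group H"
  shows "group (matgrp (Fpts H))"
proof (rule groupI)
  fix x assume "x \<in> carrier (matgrp (Fpts H))"
  then show "\<exists>y\<in>carrier (matgrp (Fpts H)). y \<otimes>\<^bsub>matgrp (Fpts H)\<^esub> x = \<one>\<^bsub>matgrp (Fpts H)\<^esub>"
    using FptsD[OF assms] by (intro bexI[of _ "matrix_inv x"]) (auto simp: matgrp_def matrix_inv_mult)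
qed (use FptsD[OF assms] in \<open>auto simp: matgrp_def matrix_mul_assoc\<close>)

lemma subgroup_matgrp_Fpts:
  fixes H :: "('f::field alg_closure^'n^'n) set"
  assumes "alg_group H" "K \<subseteq> Fpts H" "mat 1 \<in> K" "\<And>g h. g \<in> K \<Longrightarrow> h \<in> K \<Longrightarrow> g ** h \<in> K"
    "\<And>g. g \<in> K \<Longrightarrow> matrix_inv g \<in> K"
  shows "subgroup K (matgrp (Fpts H))"
proof
  fix x assume x: "x \<in> K"
  have "inv\<^bsub>matgrp (Fpts H)\<^esub> x = matrix_inv x"
    using x assms(2,5) FptsD[OF assms(1)]
    by (intro group.inv_equality[OF group_matgrp_Fpts[OF assms(1)]]) (auto simp: matgrp_def matrix_inv_mult)
  then show "inv\<^bsub>matgrp (Fpts H)\<^esub> x \<in> K" using assms(5) x by simp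
qed (use assms in \<open>auto simp: matgrp_def\<close>)

lemma conj_set_conj_set:
  fixes H :: "('k::field^'n^'n) set"
  assumes "invertible g" "invertible h"
  shows "conj_set g (conj_set h H) = conj_set (g ** h) H"
  unfolding conj_set_def image_image matrix_inv_prod[OF assms] by (simp add: matrix_mul_assoc)

lemma conj_set_one: "conj_set (mat 1) H = (H :: ('k::field^'n^'n) set)"
  by (simp add: conj_set_def)

lemma conj_set_inverse:
  fixes H :: "('k::field^'n^'n) set"
  assumes "invertible g"
  shows "conj_set (matrix_inv g) (conj_set g H) = H" "conj_set g (conj_set (matrix_inv g) H) = H"
  using assms by (simp_all add: conj_set_conj_set invertible_matrix_inv matrix_inv_mult conj_set_one)

lemma conj_conj_inverse:
  fixes g a :: "'k::field^'n^'n"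
  assumes "invertible g"
  shows "matrix_inv g ** (g ** a ** matrix_inv g) ** g = a" "g ** (matrix_inv g ** a ** g) ** matrix_inv g = a"
proof -
  have "matrix_inv g ** (g ** a ** matrix_inv g) ** g = (matrix_inv g ** g) ** a ** (matrix_inv g ** g)"
    by (simp add: matrix_mul_assoc)
  then show "matrix_inv g ** (g ** a ** matrix_inv g) ** g = a" by (simp add: matrix_inv_mult[OF assms])
  have "g ** (matrix_inv g ** a ** g) ** matrix_inv g = (g ** matrix_inv g) ** a ** (g ** matrix_inv g)"
    by (simp add: matrix_mul_assoc)
  then show "g ** (matrix_inv g ** a ** g) ** matrix_inv g = a" by (simp add: matrix_inv_mult[OF assms])
qed

lemma mem_conj_set_iff:
  fixes H :: "('k::field^'n^'n) set"
  assumes "invertible g"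
  shows "a \<in> conj_set g H \<longleftrightarrow> matrix_inv g ** a ** g \<in> H"
proof
  assume "a \<in> conj_set g H"
  then show "matrix_inv g ** a ** g \<in> H" using conj_conj_inverse[OF assms] by (auto simp: conj_set_def)
next
  assume "matrix_inv g ** a ** g \<in> H"
  then show "a \<in> conj_set g H" unfolding conj_set_def
    using conj_conj_inverse(2)[OF assms, of a] by (intro image_eqI[of _ _ "matrix_inv g ** a ** g"]) auto
qed

lemma conj_mult:
  fixes g a b :: "'k::field^'n^'n"
  assumes "invertible g"
  shows "g ** (a ** b) ** matrix_inv g = (g ** a ** matrix_inv g) ** (g ** b ** matrix_inv g)"
proof -
  have "(g ** a ** matrix_inv g) ** (g ** b ** matrix_inv g) = g ** a ** (matrix_inv g ** g) ** b ** matrix_inv g"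
    by (simp add: matrix_mul_assoc)
  then show ?thesis by (simp add: matrix_inv_mult[OF assms] matrix_mul_assoc)
qed

lemma conj_inverse:
  fixes g a :: "'k::field^'n^'n"
  assumes "invertible g" "invertible a"
  shows "matrix_inv (g ** a ** matrix_inv g) = g ** matrix_inv a ** matrix_inv g"
  using assms by (simp add: matrix_inv_prod invertible_mult invertible_matrix_inv matrix_inv_matrix_inv matrix_mul_assoc)

section \<open>The topology on matrices over a local field\<close>

lemma nonarchD:
  assumes "nonarch_local_field v"
  shows "0 \<le> v x" "v x = 0 \<longleftrightarrow> x = 0" "v (x * y) = v x * v y" "v (x + y) \<le> max (v x) (v y)"
    "v 0 = 0" "v 1 = 1" "v (- x) = v x" "v (x - y) \<le> max (v x) (v y)" "v (x - y) = v (y - x)"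
proof -
  have n: "0 \<le> v x" "v x = 0 \<longleftrightarrow> x = 0" "v (x * y) = v x * v y" "v (x + y) \<le> max (v x) (v y)" for x y
    using assms by (simp_all only: nonarch_local_field_def)
  show "0 \<le> v x" "v x = 0 \<longleftrightarrow> x = 0" "v (x * y) = v x * v y" "v (x + y) \<le> max (v x) (v y)" "v 0 = 0"
    using n by simp_all
  have "v 1 = v 1 * v 1" using n(3)[of 1 1] by simp
  moreover have "v 1 \<noteq> 0" using n(2)[of 1] by simp
  ultimately show v1: "v 1 = 1" by simp
  have "v (-1) * v (-1) = 1" using n(3)[of "-1" "-1"] v1 by simp
  then have "v (-1) = 1" using n(1)[of "-1"] by (metis abs_of_nonneg abs_mult_self_eq abs_one mult.left_neutral power2_eq_iff_nonneg power2_eq_square zero_le_one)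
  then have neg: "v (- x) = v x" for x using n(3)[of "-1" x] by simp
  then show "v (- x) = v x" .
  show "v (x - y) \<le> max (v x) (v y)" using n(4)[of x "-y"] neg by simp
  show "v (x - y) = v (y - x)" using neg[of "x - y"] by simp
qed

lemma nonarch_sum_less:
  assumes v: "nonarch_local_field v" and "finite A" "0 < e" "\<And>i. i \<in> A \<Longrightarrow> v (f i) < e"
  shows "v (sum f A) < e"
  using assms(2,4)
proof (induction A rule: finite_induct)
  case (insert i A)
  then have "v (f i) < e" "v (sum f A) < e" by auto
  then show ?case using nonarchD(4)[OF v, of "f i" "sum f A"] insert.hyps by simp
qed (use assms nonarchD(5)[OF v] in simp)

lemma openin_field_top:
  assumes v: "nonarch_local_field v"
  shows "openin (field_top v) U \<longleftrightarrow> (\<forall>x\<in>U. \<exists>r>0. \<forall>y. v (y - x) < r \<longrightarrow> y \<in> U)"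
proof -
  interpret Metric_space UNIV "\<lambda>x y. v (x - y)"
  proof
    fix x y z
    show "v (x - z) \<le> v (x - y) + v (y - z)"
      using nonarchD(4)[OF v, of "x - y" "y - z"] nonarchD(1)[OF v, of "x - y"] nonarchD(1)[OF v, of "y - z"] by simp
  qed (use nonarchD[OF v] in auto)
  have "mball x r \<subseteq> U \<longleftrightarrow> (\<forall>y. v (y - x) < r \<longrightarrow> y \<in> U)" for x r
    using nonarchD(9)[OF v, of x] by (auto simp: mball_def)
  then show ?thesis unfolding field_top_def openin_mtopology by auto
qed

lemma topspace_field_top:
  assumes "nonarch_local_field v"
  shows "topspace (field_top v) = UNIV"
proof -
  have "openin (field_top v) UNIV" using openin_field_top[OF assms] by (auto intro: exI[of _ 1])
  then show ?thesis using openin_subset by blast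
qed

lemma openin_mat_top:
  fixes S :: "('f::field^'n::finite^'n) set"
  assumes v: "nonarch_local_field v"
  shows "openin (mat_top v) S \<longleftrightarrow> (\<forall>g\<in>S. \<exists>e>0. \<forall>g'. (\<forall>i j. v (g' $ i $ j - g $ i $ j) < e) \<longrightarrow> g' \<in> S)"
    (is "?l \<longleftrightarrow> ?r")
proof
  assume ?l
  then obtain U where U: "openin (product_topology (\<lambda>_. field_top v) (UNIV :: ('n \<times> 'n) set)) U"
    "S = (\<lambda>A (i, j). A $ i $ j) -` U"
    by (auto simp: mat_top_def openin_pullback_topology)
  show ?r
  proof
    fix g assume "g \<in> S"
    then have "(\<lambda>(i, j). g $ i $ j) \<in> U" using U(2) by simp
    from product_topology_open_contains_basis[OF U(1) this]
    obtain N where N: "(\<lambda>(i, j). g $ i $ j) \<in> PiE UNIV N" "\<And>p. openin (field_top v) (N p)" "PiE UNIV N \<subseteq> U"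
      by blast
    have "\<exists>r>0. \<forall>y. v (y - g $ fst p $ snd p) < r \<longrightarrow> y \<in> N p" for p
    proof -
      have "g $ fst p $ snd p \<in> N p" using PiE_mem[OF N(1), of p] by (simp add: case_prod_beta)
      then show ?thesis using N(2)[of p] unfolding openin_field_top[OF v] by blast
    qed
    then obtain r where r: "\<And>p. r p > 0" "\<And>p y. v (y - g $ fst p $ snd p) < r p \<Longrightarrow> y \<in> N p" by metis
    define e where "e = Min (range r)"
    have "e > 0" using r by (simp add: e_def)
    moreover have "g' \<in> S" if "\<forall>i j. v (g' $ i $ j - g $ i $ j) < e" for g'
    proof -
      have "e \<le> r p" for p by (simp add: e_def)
      then have "g' $ i $ j \<in> N (i, j)" for i j
        using that r(2)[of "g' $ i $ j" "(i, j)"] by (metis fst_conv snd_conv less_le_trans)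
      then have "(\<lambda>(i, j). g' $ i $ j) \<in> PiE UNIV N" by auto
      then show ?thesis using N(3) U(2) by auto
    qed
    ultimately show "\<exists>e>0. \<forall>g'. (\<forall>i j. v (g' $ i $ j - g $ i $ j) < e) \<longrightarrow> g' \<in> S" by blast
  qed
next
  assume r: ?r
  define U where "U = {x :: 'n \<times> 'n \<Rightarrow> 'f. (\<chi> i j. x (i, j)) \<in> S}"
  have "openin (product_topology (\<lambda>_. field_top v) UNIV) U"
    unfolding openin_product_topology_alt
  proof (intro ballI)
    fix x assume "x \<in> U"
    then obtain e where e: "e > 0" "\<And>g'. (\<And>i j. v (g' $ i $ j - x (i, j)) < e) \<Longrightarrow> g' \<in> S"
      using r by (fastforce simp: U_def)
    define N where "N p = {y. v (y - x p) < e}" for p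
    have "openin (field_top v) (N p)" for p
      unfolding openin_field_top[OF v]
    proof
      fix y assume y: "y \<in> N p"
      have "z \<in> N p" if "v (z - y) < e" for z
        using nonarchD(4)[OF v, of "z - y" "y - x p"] y that by (auto simp: N_def)
      then show "\<exists>r>0. \<forall>z. v (z - y) < r \<longrightarrow> z \<in> N p" using e by blast
    qed
    moreover have "x \<in> PiE UNIV N" using e nonarchD(5)[OF v] by (auto simp: N_def)
    moreover have "PiE UNIV N \<subseteq> U" using e(2) by (auto simp: U_def N_def PiE_iff)
    ultimately show "\<exists>N. finite {i \<in> UNIV. N i \<noteq> topspace (field_top v)} \<and> (\<forall>i\<in>UNIV. openin (field_top v) (N i)) \<and>
        x \<in> Pi\<^sub>E UNIV N \<and> Pi\<^sub>E UNIV N \<subseteq> U" by (intro exI[of _ N]) auto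
  qed
  moreover have "S = (\<lambda>A (i, j). A $ i $ j) -` U" by (auto simp: U_def)
  ultimately show ?l by (auto simp: mat_top_def openin_pullback_topology)
qed

lemma openin_Fpts_top:
  assumes v: "nonarch_local_field v"
  shows "openin (Fpts_top v H) S \<longleftrightarrow> S \<subseteq> Fpts H \<and>
    (\<forall>g\<in>S. \<exists>e>0. \<forall>g'\<in>Fpts H. (\<forall>i j. v (g' $ i $ j - g $ i $ j) < e) \<longrightarrow> g' \<in> S)"
    (is "?l \<longleftrightarrow> ?r")
proof
  assume ?l
  then obtain T where T: "openin (mat_top v) T" "S = T \<inter> Fpts H" by (auto simp: Fpts_top_def openin_subtopology)
  then have "\<exists>e>0. \<forall>g'. (\<forall>i j. v (g' $ i $ j - g $ i $ j) < e) \<longrightarrow> g' \<in> T" if "g \<in> S" for g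
    using openin_mat_top[OF v, of T] that by blast
  then show ?r using T(2) by fast
next
  assume r: ?r
  then have "\<forall>g\<in>S. \<exists>e. 0 < e \<and> (\<forall>g'\<in>Fpts H. (\<forall>i j. v (g' $ i $ j - g $ i $ j) < e) \<longrightarrow> g' \<in> S)"
    by blast
  from bchoice[OF this] obtain e where e: "\<And>g. g \<in> S \<Longrightarrow> e g > 0"
    "\<And>g g'. g \<in> S \<Longrightarrow> g' \<in> Fpts H \<Longrightarrow> (\<And>i j. v (g' $ i $ j - g $ i $ j) < e g) \<Longrightarrow> g' \<in> S"
    by blast
  define T where "T = {g'. \<exists>g\<in>S. \<forall>i j. v (g' $ i $ j - g $ i $ j) < e g}"
  have "openin (mat_top v) T" unfolding openin_mat_top[OF v]
  proof
    fix g' assume "g' \<in> T"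
    then obtain g where g: "g \<in> S" "\<And>i j. v (g' $ i $ j - g $ i $ j) < e g" by (auto simp: T_def)
    have "h \<in> T" if "\<forall>i j. v (h $ i $ j - g' $ i $ j) < e g" for h
    proof -
      have "v (h $ i $ j - g $ i $ j) < e g" for i j
        using nonarchD(4)[OF v, of "h $ i $ j - g' $ i $ j" "g' $ i $ j - g $ i $ j"] g(2)[of i j]
          spec[OF spec[OF that, of i], of j] by (auto simp: le_max_iff_disj)
      then show ?thesis using g(1) by (auto simp: T_def)
    qed
    then show "\<exists>d>0. \<forall>h. (\<forall>i j. v (h $ i $ j - g' $ i $ j) < d) \<longrightarrow> h \<in> T" using e(1)[OF g(1)] by blast
  qed
  moreover have "S = T \<inter> Fpts H"
  proof
    show "S \<subseteq> T \<inter> Fpts H"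
    proof
      fix g assume g: "g \<in> S"
      then have "\<forall>i j. v (g $ i $ j - g $ i $ j) < e g" using e(1) nonarchD(5)[OF v] by simp
      then show "g \<in> T \<inter> Fpts H" using g r unfolding T_def by blast
    qed
    show "T \<inter> Fpts H \<subseteq> S" using e(2) by (auto simp: T_def)
  qed
  ultimately show ?l by (auto simp: Fpts_top_def openin_subtopology)
qed

text \<open>Dividing by a power of an element of absolute value greater than \<open>1\<close> moves a bounded set into a
  neighbourhood of \<open>0\<close> that is contained in a compact set.\<close>

lemma bounded_imp_totally_bounded:
  assumes v: "nonarch_local_field v" and \<delta>: "0 < \<delta>"
  shows "\<exists>F. finite F \<and> (\<forall>x. v x \<le> C \<longrightarrow> (\<exists>y\<in>F. v (x - y) < \<delta>))"
proof -
  have "locally_compact_space (field_top v)" using v by (simp add: nonarch_local_field_def)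
  then obtain U K where K: "openin (field_top v) U" "compactin (field_top v) K" "0 \<in> U" "U \<subseteq> K"
    unfolding locally_compact_space_def topspace_field_top[OF v] by blast
  obtain r where r: "r > 0" "\<And>y. v y < r \<Longrightarrow> y \<in> K"
    using K openin_field_top[OF v, of U] by (metis diff_zero subsetD)
  obtain x where x: "x \<noteq> 0" "v x \<noteq> 1" using v by (auto simp: nonarch_local_field_def)
  obtain z where z: "v z > 1"
  proof (cases "v x > 1")
    case False
    have "v x * v (inverse x) = 1" using nonarchD(3)[OF v, of x "inverse x"] nonarchD(6)[OF v] x by simp
    moreover have "0 < v x" using nonarchD(1,2)[OF v, of x] x by linarith
    ultimately have "v (inverse x) = 1 / v x" "v x < 1" using False x(2) by (auto simp: field_simps)
    then have "v (inverse x) > 1" using \<open>0 < v x\<close> by simp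
    then show ?thesis by (rule that)
  qed (rule that)
  have vp: "v (a ^ m) = v a ^ m" for a m using nonarchD(3,6)[OF v] by (induction m) auto
  obtain m where m: "C / r < v z ^ m" using real_arch_pow[OF z] by blast
  define c where "c = z ^ m"
  have c: "C < r * v c" "0 < v c" using m r z vp[of z m] by (auto simp: c_def field_simps)
  then have "c \<noteq> 0" using nonarchD(5)[OF v] by auto
  define d where "d = \<delta> / v c"
  have "d > 0" using \<delta> c by (simp add: d_def)
  define B where "B y = {x. v (x - y) < d}" for y
  have "openin (field_top v) (B y)" for y
    unfolding openin_field_top[OF v]
  proof
    fix x assume x: "x \<in> B y"
    have "z \<in> B y" if "v (z - x) < d" for z
      using nonarchD(4)[OF v, of "z - x" "x - y"] x that by (auto simp: B_def)
    then show "\<exists>r>0. \<forall>z. v (z - x) < r \<longrightarrow> z \<in> B y" using \<open>d > 0\<close> by blast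
  qed
  moreover have "x \<in> B x" for x using \<open>d > 0\<close> nonarchD(5)[OF v] by (simp add: B_def)
  then have "K \<subseteq> \<Union>(range B)" by blast
  ultimately obtain \<F> where \<F>: "finite \<F>" "\<F> \<subseteq> range B" "K \<subseteq> \<Union>\<F>"
    using K(2) unfolding compactin_def by (metis (no_types, lifting) imageE)
  then obtain Y where Y: "finite Y" "K \<subseteq> (\<Union>y\<in>Y. B y)" by (metis finite_subset_image)
  show ?thesis
  proof (intro exI conjI allI impI)
    show "finite ((*) c ` Y)" using Y by simp
    fix x assume x: "v x \<le> C"
    have inv: "v (inverse c) * v c = 1" using nonarchD(3)[OF v, of "inverse c" c] nonarchD(6)[OF v] \<open>c \<noteq> 0\<close> by simp
    have "v (inverse c) = 1 / v c" using inv c by (simp add: eq_divide_eq)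
    then have "v (inverse c * x) = v x / v c" by (simp add: nonarchD(3)[OF v])
    also have "\<dots> < r" using x c by (simp add: field_simps)
    finally obtain y where y: "y \<in> Y" "v (inverse c * x - y) < d" using r(2) Y(2) by (force simp: B_def)
    have "x - c * y = c * (inverse c * x - y)" using \<open>c \<noteq> 0\<close> by (simp add: algebra_simps)
    then have "v (x - c * y) = v c * v (inverse c * x - y)" by (simp add: nonarchD(3)[OF v])
    also have "\<dots> < v c * d" using y c by simp
    also have "\<dots> = \<delta>" using c by (simp add: d_def)
    finally show "\<exists>y\<in>(*) c ` Y. v (x - y) < \<delta>" using y(1) by blast
  qed
qed

section \<open>Complex modules given by records\<close>

lemma complex_ring_simps [simp]:
  "carrier \<CC> = UNIV" "a \<oplus>\<^bsub>\<CC>\<^esub> b = a + b" "a \<otimes>\<^bsub>\<CC>\<^esub> b = a * b" "\<zero>\<^bsub>\<CC>\<^esub> = 0" "\<one>\<^bsub>\<CC>\<^esub> = 1"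
  by (simp_all add: ring_of_type_algebra_def)

lemma cring_complex: "cring \<CC>"
  by (rule cring_from_type_algebra)

lemma complex_module_closed:
  fixes M (structure)
  assumes "Module.module \<CC> M"
  shows "\<zero> \<in> carrier M" "\<And>x y. x \<in> carrier M \<Longrightarrow> y \<in> carrier M \<Longrightarrow> x \<oplus> y \<in> carrier M"
    "\<And>c x. x \<in> carrier M \<Longrightarrow> c \<odot> x \<in> carrier M"
proof -
  interpret Module.module \<CC> M by fact
  show "\<zero> \<in> carrier M" "\<And>x y. x \<in> carrier M \<Longrightarrow> y \<in> carrier M \<Longrightarrow> x \<oplus> y \<in> carrier M"
    "\<And>c x. x \<in> carrier M \<Longrightarrow> c \<odot> x \<in> carrier M" by auto
qed

lemma complex_module_laws:
  fixes M (structure)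
  assumes "Module.module \<CC> M"
  shows "\<And>x. x \<in> carrier M \<Longrightarrow> \<zero> \<oplus> x = x" "\<And>x. x \<in> carrier M \<Longrightarrow> x \<oplus> \<zero> = x"
    "\<And>x y. x \<in> carrier M \<Longrightarrow> y \<in> carrier M \<Longrightarrow> x \<oplus> y = y \<oplus> x"
    "\<And>x y z. x \<in> carrier M \<Longrightarrow> y \<in> carrier M \<Longrightarrow> z \<in> carrier M \<Longrightarrow> (x \<oplus> y) \<oplus> z = x \<oplus> (y \<oplus> z)"
    "\<And>x y z. x \<in> carrier M \<Longrightarrow> y \<in> carrier M \<Longrightarrow> z \<in> carrier M \<Longrightarrow> x \<oplus> (y \<oplus> z) = y \<oplus> (x \<oplus> z)"
    "\<And>a b x. x \<in> carrier M \<Longrightarrow> (a + b) \<odot> x = a \<odot> x \<oplus> b \<odot> x"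
    "\<And>a x y. x \<in> carrier M \<Longrightarrow> y \<in> carrier M \<Longrightarrow> a \<odot> (x \<oplus> y) = a \<odot> x \<oplus> a \<odot> y"
    "\<And>a b x. x \<in> carrier M \<Longrightarrow> a \<odot> (b \<odot> x) = (a * b) \<odot> x"
    "\<And>x. x \<in> carrier M \<Longrightarrow> 1 \<odot> x = x" "\<And>x. x \<in> carrier M \<Longrightarrow> 0 \<odot> x = \<zero>" "\<And>c. c \<odot> \<zero> = \<zero>"
    "\<And>x y. x \<in> carrier M \<Longrightarrow> y \<in> carrier M \<Longrightarrow> x \<ominus> y = x \<oplus> (-1) \<odot> y"
    "\<And>x. x \<in> carrier M \<Longrightarrow> x \<oplus> (-1) \<odot> x = \<zero>"
proof -
  interpret Module.module \<CC> M by fact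
  show "\<And>x. x \<in> carrier M \<Longrightarrow> \<zero> \<oplus> x = x" "\<And>x. x \<in> carrier M \<Longrightarrow> x \<oplus> \<zero> = x"
    "\<And>x y. x \<in> carrier M \<Longrightarrow> y \<in> carrier M \<Longrightarrow> x \<oplus> y = y \<oplus> x"
    "\<And>x y z. x \<in> carrier M \<Longrightarrow> y \<in> carrier M \<Longrightarrow> z \<in> carrier M \<Longrightarrow> (x \<oplus> y) \<oplus> z = x \<oplus> (y \<oplus> z)"
    "\<And>x y z. x \<in> carrier M \<Longrightarrow> y \<in> carrier M \<Longrightarrow> z \<in> carrier M \<Longrightarrow> x \<oplus> (y \<oplus> z) = y \<oplus> (x \<oplus> z)"
    by (simp_all add: M.a_ac)
  show "\<And>a b x. x \<in> carrier M \<Longrightarrow> (a + b) \<odot> x = a \<odot> x \<oplus> b \<odot> x"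
    "\<And>a x y. x \<in> carrier M \<Longrightarrow> y \<in> carrier M \<Longrightarrow> a \<odot> (x \<oplus> y) = a \<odot> x \<oplus> a \<odot> y"
    "\<And>a b x. x \<in> carrier M \<Longrightarrow> a \<odot> (b \<odot> x) = (a * b) \<odot> x"
    using smult_l_distr smult_r_distr smult_assoc1 by auto
  show one: "\<And>x. x \<in> carrier M \<Longrightarrow> 1 \<odot> x = x" and "\<And>x. x \<in> carrier M \<Longrightarrow> 0 \<odot> x = \<zero>" "\<And>c. c \<odot> \<zero> = \<zero>"
    using smult_one smult_l_null smult_r_null by auto
  have minus1: "\<ominus>\<^bsub>\<CC>\<^esub> 1 = -1"
    using cring.sum_zero_eq_neg[OF cring_complex, of "-1" 1] by simp
  have neg: "(-1) \<odot> x = \<ominus> x" if "x \<in> carrier M" for x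
    using smult_l_minus[of 1 x] that one by (simp add: minus1)
  show "\<And>x y. x \<in> carrier M \<Longrightarrow> y \<in> carrier M \<Longrightarrow> x \<ominus> y = x \<oplus> (-1) \<odot> y"
    "\<And>x. x \<in> carrier M \<Longrightarrow> x \<oplus> (-1) \<odot> x = \<zero>"
    by (simp_all add: neg a_minus_def M.r_neg)
qed

lemma complex_moduleI:
  fixes M (structure)
  assumes closed: "\<zero> \<in> carrier M" "\<And>x y. x \<in> carrier M \<Longrightarrow> y \<in> carrier M \<Longrightarrow> x \<oplus> y \<in> carrier M"
      "\<And>c x. x \<in> carrier M \<Longrightarrow> c \<odot> x \<in> carrier M"
    and laws: "\<And>x. x \<in> carrier M \<Longrightarrow> \<zero> \<oplus> x = x"
      "\<And>x y. x \<in> carrier M \<Longrightarrow> y \<in> carrier M \<Longrightarrow> x \<oplus> y = y \<oplus> x"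
      "\<And>x y z. x \<in> carrier M \<Longrightarrow> y \<in> carrier M \<Longrightarrow> z \<in> carrier M \<Longrightarrow> (x \<oplus> y) \<oplus> z = x \<oplus> (y \<oplus> z)"
      "\<And>x. x \<in> carrier M \<Longrightarrow> (-1) \<odot> x \<oplus> x = \<zero>"
      "\<And>a b x. x \<in> carrier M \<Longrightarrow> (a + b) \<odot> x = a \<odot> x \<oplus> b \<odot> x"
      "\<And>a x y. x \<in> carrier M \<Longrightarrow> y \<in> carrier M \<Longrightarrow> a \<odot> (x \<oplus> y) = a \<odot> x \<oplus> a \<odot> y"
      "\<And>a b x. x \<in> carrier M \<Longrightarrow> (a * b) \<odot> x = a \<odot> (b \<odot> x)"
      "\<And>x. x \<in> carrier M \<Longrightarrow> 1 \<odot> x = x"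
  shows "Module.module \<CC> M"
proof (rule moduleI)
  show "abelian_group M"
  proof (rule abelian_groupI)
    fix x assume x: "x \<in> carrier M"
    show "\<exists>y\<in>carrier M. y \<oplus> x = \<zero>" using closed(3)[OF x, of "-1"] laws(4)[OF x] by blast
  qed (fact closed(1,2) laws(1,2,3))+
qed (use cring_complex closed(3) laws(5-8) in simp_all)

lemma submodule_complexD:
  fixes M (structure)
  assumes "submodule W \<CC> M"
  shows "W \<subseteq> carrier M" "\<zero> \<in> W" "\<And>x y. x \<in> W \<Longrightarrow> y \<in> W \<Longrightarrow> x \<oplus> y \<in> W" "\<And>c x. x \<in> W \<Longrightarrow> c \<odot> x \<in> W"
proof -
  interpret submodule W \<CC> M by fact
  show "W \<subseteq> carrier M" "\<zero> \<in> W" "\<And>x y. x \<in> W \<Longrightarrow> y \<in> W \<Longrightarrow> x \<oplus> y \<in> W" "\<And>c x. x \<in> W \<Longrightarrow> c \<odot> x \<in> W"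
    using subset one_closed m_closed smult_closed by auto
qed

lemma submodule_complexI:
  fixes M (structure)
  assumes "Module.module \<CC> M" "W \<subseteq> carrier M" "\<zero> \<in> W" "\<And>x y. x \<in> W \<Longrightarrow> y \<in> W \<Longrightarrow> x \<oplus> y \<in> W"
    "\<And>c x. x \<in> W \<Longrightarrow> c \<odot> x \<in> W"
  shows "submodule W \<CC> M"
proof -
  interpret Module.module \<CC> M by fact
  have "\<ominus> x \<in> W" if "x \<in> W" for x
  proof -
    have "\<ominus> x = \<zero> \<oplus> \<ominus> x" using assms(2) that by (simp add: subsetD)
    also have "\<dots> = \<zero> \<oplus> (-1) \<odot> x"
      using complex_module_laws(12)[OF assms(1), of \<zero> x] assms(2) that by (auto simp: a_minus_def)
    finally show ?thesis using assms(3,4,5) that by simp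
  qed
  then show ?thesis using assms by (intro submoduleI) auto
qed

lemma submodule_complex_iff:
  fixes M (structure)
  assumes "Module.module \<CC> M"
  shows "submodule W \<CC> M \<longleftrightarrow> W \<subseteq> carrier M \<and> \<zero> \<in> W \<and> (\<forall>x\<in>W. \<forall>y\<in>W. x \<oplus> y \<in> W) \<and> (\<forall>c. \<forall>x\<in>W. c \<odot> x \<in> W)"
  using submodule_complexD[of W M] submodule_complexI[OF assms, of W] by blast

lemma module_restrict_submodule:
  fixes M (structure)
  assumes "Module.module \<CC> M" "submodule W \<CC> M"
  shows "Module.module \<CC> (M\<lparr>carrier := W\<rparr>)"
  using submodule.submodule_is_module[OF assms(2,1)] .

lemma submodule_restrict_iff:
  fixes M (structure)
  assumes "Module.module \<CC> M" "submodule W \<CC> M"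
  shows "submodule W' \<CC> (M\<lparr>carrier := W\<rparr>) \<longleftrightarrow> submodule W' \<CC> M \<and> W' \<subseteq> W"
  using submodule_complexD(1)[OF assms(2)]
  unfolding submodule_complex_iff[OF assms(1)] submodule_complex_iff[OF module_restrict_submodule[OF assms]]
  by auto

lemma zero_submodule:
  fixes M (structure)
  assumes "Module.module \<CC> M"
  shows "submodule {\<zero>} \<CC> M"
  using complex_module_closed[OF assms] complex_module_laws[OF assms] by (intro submodule_complexI[OF assms]) auto

lemma carrier_submodule:
  fixes M (structure)
  assumes "Module.module \<CC> M"
  shows "submodule (carrier M) \<CC> M"
  using complex_module_closed[OF assms] by (intro submodule_complexI[OF assms]) auto

lemma complex_module_minus:
  fixes M (structure)
  assumes "Module.module \<CC> M"
  shows "\<And>x y. x \<in> carrier M \<Longrightarrow> y \<in> carrier M \<Longrightarrow> x \<ominus> y \<in> carrier M"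
    "\<And>w x. w \<in> carrier M \<Longrightarrow> x \<in> carrier M \<Longrightarrow> (w \<oplus> x) \<ominus> x = w"
    "\<And>y x. y \<in> carrier M \<Longrightarrow> x \<in> carrier M \<Longrightarrow> (y \<ominus> x) \<oplus> x = y"
    "\<And>x. x \<in> carrier M \<Longrightarrow> x \<ominus> x = \<zero>"
    "\<And>x. x \<in> carrier M \<Longrightarrow> x \<ominus> \<zero> = x"
    "\<And>x y. x \<in> carrier M \<Longrightarrow> y \<in> carrier M \<Longrightarrow> (-1) \<odot> (x \<ominus> y) = y \<ominus> x"
    "\<And>x y z. x \<in> carrier M \<Longrightarrow> y \<in> carrier M \<Longrightarrow> z \<in> carrier M \<Longrightarrow> (x \<ominus> y) \<oplus> (y \<ominus> z) = x \<ominus> z"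
    "\<And>x y. x \<in> carrier M \<Longrightarrow> y \<in> carrier M \<Longrightarrow> x \<ominus> y = \<zero> \<longleftrightarrow> x = y"
    "\<And>a b c d. a \<in> carrier M \<Longrightarrow> b \<in> carrier M \<Longrightarrow> c \<in> carrier M \<Longrightarrow> d \<in> carrier M \<Longrightarrow>
      (a \<oplus> b) \<ominus> (c \<oplus> d) = (a \<ominus> c) \<oplus> (b \<ominus> d)"
    "\<And>c x y. x \<in> carrier M \<Longrightarrow> y \<in> carrier M \<Longrightarrow> c \<odot> (x \<ominus> y) = c \<odot> x \<ominus> c \<odot> y"
proof -
  interpret Module.module \<CC> M by fact
  show c: "\<And>x y. x \<in> carrier M \<Longrightarrow> y \<in> carrier M \<Longrightarrow> x \<ominus> y \<in> carrier M" by simp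
  show "\<And>w x. w \<in> carrier M \<Longrightarrow> x \<in> carrier M \<Longrightarrow> (w \<oplus> x) \<ominus> x = w"
    "\<And>y x. y \<in> carrier M \<Longrightarrow> x \<in> carrier M \<Longrightarrow> (y \<ominus> x) \<oplus> x = y"
    "\<And>x. x \<in> carrier M \<Longrightarrow> x \<ominus> x = \<zero>" "\<And>x. x \<in> carrier M \<Longrightarrow> x \<ominus> \<zero> = x"
    by (simp_all add: a_minus_def M.a_assoc M.l_neg M.r_neg)
  show "\<And>x y z. x \<in> carrier M \<Longrightarrow> y \<in> carrier M \<Longrightarrow> z \<in> carrier M \<Longrightarrow> (x \<ominus> y) \<oplus> (y \<ominus> z) = x \<ominus> z"
    by (simp add: a_minus_def M.a_assoc M.r_neg1)
  show "\<And>a b c d. a \<in> carrier M \<Longrightarrow> b \<in> carrier M \<Longrightarrow> c \<in> carrier M \<Longrightarrow> d \<in> carrier M \<Longrightarrow>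
      (a \<oplus> b) \<ominus> (c \<oplus> d) = (a \<ominus> c) \<oplus> (b \<ominus> d)"
    by (simp add: a_minus_def M.minus_add M.a_ac)
  note L = complex_module_laws[OF assms] and C = complex_module_closed[OF assms]
  show d: "\<And>c x y. x \<in> carrier M \<Longrightarrow> y \<in> carrier M \<Longrightarrow> c \<odot> (x \<ominus> y) = c \<odot> x \<ominus> c \<odot> y"
    using L(7,8,12) C by simp
  show "\<And>x y. x \<in> carrier M \<Longrightarrow> y \<in> carrier M \<Longrightarrow> (-1) \<odot> (x \<ominus> y) = y \<ominus> x"
    using L(3,7,8,9,12) C by simp
  show "\<And>x y. x \<in> carrier M \<Longrightarrow> y \<in> carrier M \<Longrightarrow> x \<ominus> y = \<zero> \<longleftrightarrow> x = y"
    by (metis L(1) \<open>\<And>y x. y \<in> carrier M \<Longrightarrow> x \<in> carrier M \<Longrightarrow> (y \<ominus> x) \<oplus> x = y\<close> \<open>\<And>x. x \<in> carrier M \<Longrightarrow> x \<ominus> x = \<zero>\<close>)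
qed

lemma coset_mem_iff:
  fixes M (structure)
  assumes "Module.module \<CC> M" "submodule W \<CC> M" "x \<in> carrier M"
  shows "y \<in> W +> x \<longleftrightarrow> y \<in> carrier M \<and> y \<ominus> x \<in> W"
proof -
  note W = submodule_complexD[OF assms(2)] and M = complex_module_minus[OF assms(1)] and C = complex_module_closed[OF assms(1)]
  have mem: "y \<in> W +> x \<longleftrightarrow> (\<exists>w\<in>W. y = w \<oplus> x)" by (auto simp: a_r_coset_def')
  show ?thesis
  proof
    assume "y \<in> W +> x"
    then obtain w where w: "w \<in> W" "y = w \<oplus> x" using mem by blast
    then have wM: "w \<in> carrier M" using W by blast
    then show "y \<in> carrier M \<and> y \<ominus> x \<in> W" using w C M(2)[OF wM assms(3)] assms(3) by simp
  next
    assume y: "y \<in> carrier M \<and> y \<ominus> x \<in> W"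
    then show "y \<in> W +> x" unfolding mem using M(3)[of y x] assms(3) by (intro bexI[of _ "y \<ominus> x"]) auto
  qed
qed

lemma coset_eq_iff:
  fixes M (structure)
  assumes "Module.module \<CC> M" "submodule W \<CC> M" "x \<in> carrier M" "y \<in> carrier M"
  shows "W +> x = W +> y \<longleftrightarrow> x \<ominus> y \<in> W"
proof
  note W = submodule_complexD[OF assms(2)] and M = complex_module_minus[OF assms(1)]
  note mem = coset_mem_iff[OF assms(1,2)]
  have "x \<in> W +> x" using mem[OF assms(3)] assms(3) M(4) W(2) by simp
  then show "W +> x = W +> y \<Longrightarrow> x \<ominus> y \<in> W" using mem[OF assms(4)] by simp
  assume xy: "x \<ominus> y \<in> W"
  have yx: "y \<ominus> x \<in> W" using W(4)[OF xy, of "-1"] M(6)[OF assms(3,4)] by simp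
  have tr: "z \<ominus> b \<in> W" if "z \<in> carrier M" "a \<in> carrier M" "b \<in> carrier M" "a \<ominus> b \<in> W" "z \<ominus> a \<in> W" for z a b
    using W(3)[OF that(5,4)] M(7)[OF that(1,2,3)] by simp
  show "W +> x = W +> y"
  proof (rule Set.set_eqI)
    fix z
    show "z \<in> W +> x \<longleftrightarrow> z \<in> W +> y"
      using mem[OF assms(3), of z] mem[OF assms(4), of z] tr[OF _ assms(3,4) xy, of z] tr[OF _ assms(4,3) yx, of z] by blast
  qed
qed

lemma coset_nonempty_mem:
  fixes M (structure)
  assumes "Module.module \<CC> M" "submodule W \<CC> M" "x \<in> carrier M"
  shows "x \<in> W +> x"
  using coset_mem_iff[OF assms] complex_module_minus(4)[OF assms(1,3)] submodule_complexD(2)[OF assms(2)] assms(3) by simp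

lemma coset_zero:
  fixes M (structure)
  assumes "Module.module \<CC> M" "submodule W \<CC> M"
  shows "W +> \<zero> = W"
proof -
  note W = submodule_complexD[OF assms(2)] and M = complex_module_laws[OF assms(1)]
  have "W +> \<zero> = {w \<oplus> \<zero> | w. w \<in> W}" by (auto simp: a_r_coset_def')
  also have "\<dots> = W" using W(1) M(2) by (force dest: subsetD)
  finally show ?thesis .
qed

lemma coset_add:
  fixes M (structure)
  assumes "Module.module \<CC> M" "submodule W \<CC> M" "x \<in> carrier M" "y \<in> carrier M"
  shows "(W +> x) <+> (W +> y) = W +> (x \<oplus> y)"
proof -
  note W = submodule_complexD[OF assms(2)] and M = complex_module_laws[OF assms(1)] and C = complex_module_closed[OF assms(1)]
  have *: "(w \<oplus> x) \<oplus> (w' \<oplus> y) = (w \<oplus> w') \<oplus> (x \<oplus> y)" if "w \<in> W" "w' \<in> W" for w w'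
  proof -
    have "w \<in> carrier M" "w' \<in> carrier M" using that W(1) by auto
    then show ?thesis using assms(3,4) C M(4,5) by simp
  qed
  have 1: "(W +> x) <+> (W +> y) = {(w \<oplus> x) \<oplus> (w' \<oplus> y) | w w'. w \<in> W \<and> w' \<in> W}"
    by (auto simp: a_r_coset_def' set_add_def')
  also have "\<dots> = {w \<oplus> (x \<oplus> y) | w. w \<in> W}"
  proof safe
    fix w w' assume "w \<in> W" "w' \<in> W"
    then show "\<exists>w''. (w \<oplus> x) \<oplus> (w' \<oplus> y) = w'' \<oplus> (x \<oplus> y) \<and> w'' \<in> W" using * W(3) by blast
  next
    fix w assume w: "w \<in> W"
    then have "(w \<oplus> x) \<oplus> (\<zero> \<oplus> y) = w \<oplus> (x \<oplus> y)" using *[OF w W(2)] M(2)[of w] W(1) by auto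
    then show "\<exists>w' w''. w \<oplus> (x \<oplus> y) = (w' \<oplus> x) \<oplus> (w'' \<oplus> y) \<and> w' \<in> W \<and> w'' \<in> W"
      using w W(2) by metis
  qed
  also have "\<dots> = W +> (x \<oplus> y)" by (auto simp: a_r_coset_def')
  finally show ?thesis .
qed

text \<open>The map \<open>f\<close> is constant modulo \<open>W'\<close> on each coset of \<open>W\<close>, so the union in the definition of \<open>coset_map\<close> is
  a single coset.\<close>

lemma coset_map_coset:
  fixes M N
  assumes M: "Module.module \<CC> M" "submodule W \<CC> M" and N: "Module.module \<CC> N" "submodule W' \<CC> N"
    and f: "f \<in> carrier M \<rightarrow> carrier N" "\<And>x y. x \<in> carrier M \<Longrightarrow> y \<in> carrier M \<Longrightarrow> f (x \<oplus>\<^bsub>M\<^esub> y) = f x \<oplus>\<^bsub>N\<^esub> f y"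
      "f ` W \<subseteq> W'" and x: "x \<in> carrier M"
  shows "coset_map N W' f (W +>\<^bsub>M\<^esub> x) = W' +>\<^bsub>N\<^esub> f x"
proof -
  note W = submodule_complexD[OF M(2)] and lM = complex_module_laws[OF M(1)] and CM = complex_module_closed[OF M(1)]
  note lN = complex_module_laws[OF N(1)] and CN = complex_module_closed[OF N(1)]
  have "W' +>\<^bsub>N\<^esub> f y = W' +>\<^bsub>N\<^esub> f x" if "y \<in> W +>\<^bsub>M\<^esub> x" for y
  proof -
    obtain w where w: "w \<in> W" "y = w \<oplus>\<^bsub>M\<^esub> x" using \<open>y \<in> W +>\<^bsub>M\<^esub> x\<close> by (auto simp: a_r_coset_def')
    have wM: "w \<in> carrier M" using w W by blast
    have fy: "f y = f w \<oplus>\<^bsub>N\<^esub> f x" using f(2) wM x w(2) by simp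
    have fN: "f w \<in> carrier N" "f x \<in> carrier N" using f(1) wM x by auto
    have "f y \<ominus>\<^bsub>N\<^esub> f x = f w" using complex_module_minus(2)[OF N(1) fN] by (simp add: fy)
    then have "f y \<ominus>\<^bsub>N\<^esub> f x \<in> W'" using f(3) w(1) by auto
    then show ?thesis using coset_eq_iff[OF N, of "f y" "f x"] fN CN fy by simp
  qed
  then have "coset_map N W' f (W +>\<^bsub>M\<^esub> x) = (\<Union>y\<in>W +>\<^bsub>M\<^esub> x. W' +>\<^bsub>N\<^esub> f x)"
    unfolding coset_map_def by (intro SUP_cong) auto
  then show ?thesis using coset_nonempty_mem[OF M x] by auto
qed

section \<open>Subrepresentations, quotients and induction from the whole group\<close>

lemma smooth_repD:
  fixes \<pi> (structure)
  assumes "smooth_rep v H \<pi>"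
  shows "Module.module \<CC> \<pi>"
    "\<And>g x. g \<in> Fpts H \<Longrightarrow> x \<in> carrier \<pi> \<Longrightarrow> act \<pi> g x \<in> carrier \<pi>"
    "\<And>g x y. g \<in> Fpts H \<Longrightarrow> x \<in> carrier \<pi> \<Longrightarrow> y \<in> carrier \<pi> \<Longrightarrow> act \<pi> g (x \<oplus> y) = act \<pi> g x \<oplus> act \<pi> g y"
    "\<And>g c x. g \<in> Fpts H \<Longrightarrow> x \<in> carrier \<pi> \<Longrightarrow> act \<pi> g (c \<odot> x) = c \<odot> act \<pi> g x"
    "\<And>x. x \<in> carrier \<pi> \<Longrightarrow> act \<pi> (mat 1) x = x"
    "\<And>g h x. g \<in> Fpts H \<Longrightarrow> h \<in> Fpts H \<Longrightarrow> x \<in> carrier \<pi> \<Longrightarrow> act \<pi> (g ** h) x = act \<pi> g (act \<pi> h x)"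
    "\<And>x. x \<in> carrier \<pi> \<Longrightarrow> openin (Fpts_top v H) {g\<in>Fpts H. act \<pi> g x = x}"
  using assms unfolding smooth_rep_def by (auto dest: funcset_mem)

lemma smooth_rep_act_zero:
  assumes "smooth_rep v H \<pi>" "g \<in> Fpts H"
  shows "act \<pi> g \<zero>\<^bsub>\<pi>\<^esub> = \<zero>\<^bsub>\<pi>\<^esub>"
proof -
  note S = smooth_repD[OF assms(1)]
  have z: "\<zero>\<^bsub>\<pi>\<^esub> \<in> carrier \<pi>" by (rule complex_module_closed(1)[OF S(1)])
  have "act \<pi> g (0 \<odot>\<^bsub>\<pi>\<^esub> \<zero>\<^bsub>\<pi>\<^esub>) = 0 \<odot>\<^bsub>\<pi>\<^esub> act \<pi> g \<zero>\<^bsub>\<pi>\<^esub>" using S(4)[OF assms(2) z] .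
  then show ?thesis using complex_module_laws(10)[OF S(1)] z S(2)[OF assms(2) z] by simp
qed

lemma smooth_rep_inverse:
  assumes "smooth_rep v H \<pi>" "alg_group H" "g \<in> Fpts H" "x \<in> carrier \<pi>"
  shows "act \<pi> (matrix_inv g) (act \<pi> g x) = x" "act \<pi> g (act \<pi> (matrix_inv g) x) = x"
proof -
  note S = smooth_repD[OF assms(1)] and H = FptsD[OF assms(2)]
  show "act \<pi> (matrix_inv g) (act \<pi> g x) = x"
    using S(6)[of "matrix_inv g" g x] S(5) H(3,4) matrix_inv_mult[of g] assms(3,4) by simp
  show "act \<pi> g (act \<pi> (matrix_inv g) x) = x"
    using S(6)[of g "matrix_inv g" x] S(5) H(3,4) matrix_inv_mult[of g] assms(3,4) by simp
qed

text \<open>Normalized induction twists the action by the modulus character. Where this twist is trivial, it changes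
  the record but not the representation.\<close>

lemma smooth_rep_cong:
  assumes "smooth_rep v H \<pi>" "alg_group H" "\<And>g x. g \<in> Fpts H \<Longrightarrow> x \<in> carrier \<pi> \<Longrightarrow> a g x = act \<pi> g x"
  shows "smooth_rep v H (\<pi>\<lparr>act := a\<rparr>)"
proof -
  note S = smooth_repD[OF assms(1)]
  have mod1: "Module.module \<CC> (\<pi>\<lparr>act := a\<rparr>)"
    using complex_module_closed[OF S(1)] complex_module_laws[OF S(1)]
    by (intro complex_moduleI) (simp_all add: mult.commute)
  have mod2: "{g \<in> Fpts H. a g x = x} = {g \<in> Fpts H. act \<pi> g x = x}" if "x \<in> carrier \<pi>" for x
    using assms(3) that by auto
  show ?thesis unfolding smooth_rep_def
  proof (intro conjI ballI allI)
    show "Module.module \<CC> (\<pi>\<lparr>act := a\<rparr>)" by (fact mod1)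
    fix g assume g: "g \<in> Fpts H"
    show "act (\<pi>\<lparr>act := a\<rparr>) g \<in> carrier (\<pi>\<lparr>act := a\<rparr>) \<rightarrow> carrier (\<pi>\<lparr>act := a\<rparr>)"
      using assms(3)[OF g] S(2)[OF g] by auto
    fix x y assume "x \<in> carrier (\<pi>\<lparr>act := a\<rparr>)" "y \<in> carrier (\<pi>\<lparr>act := a\<rparr>)"
    then show "act (\<pi>\<lparr>act := a\<rparr>) g (x \<oplus>\<^bsub>\<pi>\<lparr>act := a\<rparr>\<^esub> y) =
        act (\<pi>\<lparr>act := a\<rparr>) g x \<oplus>\<^bsub>\<pi>\<lparr>act := a\<rparr>\<^esub> act (\<pi>\<lparr>act := a\<rparr>) g y"
      using assms(3)[OF g] S(3)[OF g] complex_module_closed(2)[OF S(1)] by simp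
  next
    fix g c x assume g: "g \<in> Fpts H" and "x \<in> carrier (\<pi>\<lparr>act := a\<rparr>)"
    then show "act (\<pi>\<lparr>act := a\<rparr>) g (c \<odot>\<^bsub>\<pi>\<lparr>act := a\<rparr>\<^esub> x) = c \<odot>\<^bsub>\<pi>\<lparr>act := a\<rparr>\<^esub> act (\<pi>\<lparr>act := a\<rparr>) g x"
      using assms(3)[OF g] S(4)[OF g] complex_module_closed(3)[OF S(1)] by simp
  next
    fix x assume x: "x \<in> carrier (\<pi>\<lparr>act := a\<rparr>)"
    then show "act (\<pi>\<lparr>act := a\<rparr>) (mat 1) x = x" using assms(3)[OF FptsD(1)[OF assms(2)]] S(5) by simp
    show "openin (Fpts_top v H) {g\<in>Fpts H. act (\<pi>\<lparr>act := a\<rparr>) g x = x}" using mod2[of x] S(7)[of x] x by simp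
  next
    fix g h x assume g: "g \<in> Fpts H" "h \<in> Fpts H" and x: "x \<in> carrier (\<pi>\<lparr>act := a\<rparr>)"
    then show "act (\<pi>\<lparr>act := a\<rparr>) (g ** h) x = act (\<pi>\<lparr>act := a\<rparr>) g (act (\<pi>\<lparr>act := a\<rparr>) h x)"
      using assms(3)[OF FptsD(2)[OF assms(2) g]] assms(3)[OF g(1)] assms(3)[OF g(2)] S(2)[OF g(2)] S(6)[OF g] by simp
  qed
qed

lemma subrepD:
  assumes "subrep H \<pi> W"
  shows "submodule W \<CC> \<pi>" "\<And>g x. g \<in> Fpts H \<Longrightarrow> x \<in> W \<Longrightarrow> act \<pi> g x \<in> W"
  using assms by (auto simp: subrep_def)

lemma subrepI:
  assumes "submodule W \<CC> \<pi>" "\<And>g x. g \<in> Fpts H \<Longrightarrow> x \<in> W \<Longrightarrow> act \<pi> g x \<in> W"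
  shows "subrep H \<pi> W"
  using assms by (auto simp: subrep_def)

lemma zero_subrep: "smooth_rep v H \<pi> \<Longrightarrow> subrep H \<pi> {\<zero>\<^bsub>\<pi>\<^esub>}"
  by (rule subrepI) (auto simp: zero_submodule smooth_repD(1) smooth_rep_act_zero)

lemma carrier_subrep: "smooth_rep v H \<pi> \<Longrightarrow> subrep H \<pi> (carrier \<pi>)"
  by (rule subrepI) (auto simp: carrier_submodule smooth_repD)

lemma subrep_restrict_iff:
  assumes "Module.module \<CC> \<pi>" "subrep H \<pi> W"
  shows "subrep H (\<pi>\<lparr>carrier := W\<rparr>) W' \<longleftrightarrow> subrep H \<pi> W' \<and> W' \<subseteq> W"
  using submodule_restrict_iff[OF assms(1) subrepD(1)[OF assms(2)]] by (auto simp: subrep_def)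

lemma smooth_rep_subrep:
  assumes "smooth_rep v H \<pi>" "subrep H \<pi> W"
  shows "smooth_rep v H (\<pi>\<lparr>carrier := W\<rparr>)"
proof -
  note W = subrepD[OF assms(2)] and S = smooth_repD[OF assms(1)]
  have "x \<in> carrier \<pi>" if "x \<in> W" for x using submodule_complexD(1)[OF W(1)] that by blast
  then show ?thesis using W(2) S(3-7) module_restrict_submodule[OF S(1) W(1)] unfolding smooth_rep_def by auto
qed

lemma openin_fixators:
  assumes v: "nonarch_local_field v" and H: "alg_group H" and "smooth_rep v H \<pi>" "x \<in> carrier \<pi>"
  shows "\<exists>e>0. \<forall>g\<in>Fpts H. (\<forall>i j. v (g $ i $ j - mat 1 $ i $ j) < e) \<longrightarrow> act \<pi> g x = x"
  using smooth_repD(7)[OF assms(3,4)] smooth_repD(5)[OF assms(3,4)] FptsD(1)[OF H]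
  unfolding openin_Fpts_top[OF v] by blast

text \<open>This transports neighbourhoods from \<open>1\<close> to \<open>g\<close>, uniformly in all \<open>g\<close> whose inverse has entries bounded
  by \<open>B\<close>.\<close>

lemma near_one:
  fixes g g' :: "'f::field^'n^'n"
  assumes v: "nonarch_local_field v" and g: "invertible g" "\<And>i j. v (matrix_inv g $ i $ j) \<le> B"
    and e: "e > 0" "\<And>i j. v (g' $ i $ j - g $ i $ j) < e / (B + 1)"
  shows "v ((matrix_inv g ** g') $ i $ j - mat 1 $ i $ j) < e"
proof -
  have B: "0 \<le> B" using g(2) nonarchD(1)[OF v] order_trans by blast
  have "matrix_inv g ** (g' - g) = matrix_inv g ** g' - mat 1"
    using matrix_inv_mult(1)[OF g(1)]
    by (simp add: matrix_eq matrix_vector_mul_assoc[symmetric] matrix_vector_mult_diff_rdistrib)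
       (metis matrix_vector_mul_assoc matrix_vector_mult_diff_distrib matrix_vector_mul_lid)
  then have "(matrix_inv g ** g') $ i $ j - mat 1 $ i $ j = (\<Sum>k\<in>UNIV. matrix_inv g $ i $ k * (g' $ k $ j - g $ k $ j))"
    by (simp add: vec_eq_iff matrix_matrix_mult_def)
  also have "v \<dots> < e"
  proof (rule nonarch_sum_less[OF v finite e(1)])
    fix k
    have "v (matrix_inv g $ i $ k * (g' $ k $ j - g $ k $ j)) \<le> B * (e / (B + 1))"
      unfolding nonarchD(3)[OF v] using g(2)[of i k] less_imp_le[OF e(2)[of k j]] B nonarchD(1)[OF v]
      by (intro mult_mono) auto
    also have "\<dots> < e" using B e(1) by (simp add: field_simps)
    finally show "v (matrix_inv g $ i $ k * (g' $ k $ j - g $ k $ j)) < e" .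
  qed
  finally show ?thesis .
qed

lemma quot_simps:
  fixes \<pi> :: "('g, 'v) rep"
  assumes "Module.module \<CC> \<pi>" "submodule W \<CC> \<pi>"
  shows "carrier (quot \<pi> W) = (\<lambda>x. W +>\<^bsub>\<pi>\<^esub> x) ` carrier \<pi>"
    "\<zero>\<^bsub>quot \<pi> W\<^esub> = W +>\<^bsub>\<pi>\<^esub> \<zero>\<^bsub>\<pi>\<^esub>"
    "\<And>x y. x \<in> carrier \<pi> \<Longrightarrow> y \<in> carrier \<pi> \<Longrightarrow> (W +>\<^bsub>\<pi>\<^esub> x) \<oplus>\<^bsub>quot \<pi> W\<^esub> (W +>\<^bsub>\<pi>\<^esub> y) = W +>\<^bsub>\<pi>\<^esub> (x \<oplus>\<^bsub>\<pi>\<^esub> y)"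
    "\<And>c x. x \<in> carrier \<pi> \<Longrightarrow> c \<odot>\<^bsub>quot \<pi> W\<^esub> (W +>\<^bsub>\<pi>\<^esub> x) = W +>\<^bsub>\<pi>\<^esub> (c \<odot>\<^bsub>\<pi>\<^esub> x)"
proof -
  note W = submodule_complexD[OF assms(2)]
  show "carrier (quot \<pi> W) = (\<lambda>x. W +>\<^bsub>\<pi>\<^esub> x) ` carrier \<pi>" by (auto simp: quot_def A_RCOSETS_def')
  show "\<zero>\<^bsub>quot \<pi> W\<^esub> = W +>\<^bsub>\<pi>\<^esub> \<zero>\<^bsub>\<pi>\<^esub>" by (simp add: quot_def coset_zero[OF assms])
  show "\<And>x y. x \<in> carrier \<pi> \<Longrightarrow> y \<in> carrier \<pi> \<Longrightarrow> (W +>\<^bsub>\<pi>\<^esub> x) \<oplus>\<^bsub>quot \<pi> W\<^esub> (W +>\<^bsub>\<pi>\<^esub> y) = W +>\<^bsub>\<pi>\<^esub> (x \<oplus>\<^bsub>\<pi>\<^esub> y)"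
    by (simp add: quot_def coset_add[OF assms])
  show "c \<odot>\<^bsub>quot \<pi> W\<^esub> (W +>\<^bsub>\<pi>\<^esub> x) = W +>\<^bsub>\<pi>\<^esub> (c \<odot>\<^bsub>\<pi>\<^esub> x)" if "x \<in> carrier \<pi>" for c x
  proof -
    have "coset_map \<pi> W (\<lambda>x. c \<odot>\<^bsub>\<pi>\<^esub> x) (W +>\<^bsub>\<pi>\<^esub> x) = W +>\<^bsub>\<pi>\<^esub> (c \<odot>\<^bsub>\<pi>\<^esub> x)"
      using W(4) complex_module_closed(3)[OF assms(1)] complex_module_laws(7)[OF assms(1)]
      by (intro coset_map_coset[OF assms assms _ _ _ that]) auto
    then show ?thesis by (simp add: quot_def)
  qed
qed

lemma quot_act:
  assumes "smooth_rep v H \<pi>" "subrep H \<pi> W" "g \<in> Fpts H" "x \<in> carrier \<pi>"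
  shows "act (quot \<pi> W) g (W +>\<^bsub>\<pi>\<^esub> x) = W +>\<^bsub>\<pi>\<^esub> act \<pi> g x"
proof -
  note W = subrepD[OF assms(2)] and S = smooth_repD[OF assms(1)]
  have "coset_map \<pi> W (act \<pi> g) (W +>\<^bsub>\<pi>\<^esub> x) = W +>\<^bsub>\<pi>\<^esub> act \<pi> g x"
    using S(2,3) W(2) assms(3) by (intro coset_map_coset[OF S(1) W(1) S(1) W(1) _ _ _ assms(4)]) auto
  then show ?thesis by (simp add: quot_def)
qed

lemma module_image:
  assumes M: "Module.module \<CC> M"
    and f: "f ` carrier M = carrier N" "\<And>x y. x \<in> carrier M \<Longrightarrow> y \<in> carrier M \<Longrightarrow> f (x \<oplus>\<^bsub>M\<^esub> y) = f x \<oplus>\<^bsub>N\<^esub> f y"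
      "\<And>c x. x \<in> carrier M \<Longrightarrow> f (c \<odot>\<^bsub>M\<^esub> x) = c \<odot>\<^bsub>N\<^esub> f x" "f \<zero>\<^bsub>M\<^esub> = \<zero>\<^bsub>N\<^esub>"
  shows "Module.module \<CC> N"
proof -
  note C = complex_module_closed[OF M] and L = complex_module_laws[OF M]
  have ex: "\<exists>x'\<in>carrier M. x = f x'" if "x \<in> carrier N" for x using that f(1) by blast
  have mem: "f x \<in> carrier N" if "x \<in> carrier M" for x using that f(1) by blast
  show ?thesis
  proof (rule complex_moduleI)
    show "\<zero>\<^bsub>N\<^esub> \<in> carrier N" using mem[OF C(1)] f(4) by simp
  next
    fix x assume "x \<in> carrier N"
    then obtain x' where x': "x' \<in> carrier M" "x = f x'" using ex by blast
    show "\<zero>\<^bsub>N\<^esub> \<oplus>\<^bsub>N\<^esub> x = x" unfolding x'(2) f(4)[symmetric] using f(2)[OF C(1) x'(1)] L(1)[OF x'(1)] by simp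
    show "1 \<odot>\<^bsub>N\<^esub> x = x" unfolding x'(2) using f(3)[OF x'(1), of 1] L(9)[OF x'(1)] by simp
    show "(-1) \<odot>\<^bsub>N\<^esub> x \<oplus>\<^bsub>N\<^esub> x = \<zero>\<^bsub>N\<^esub>"
      unfolding x'(2) using f(2)[OF C(3)[OF x'(1), of "-1"] x'(1)] f(3)[OF x'(1), of "-1"] f(4) L(13)[OF x'(1)]
        L(3)[OF C(3)[OF x'(1), of "-1"] x'(1)] by simp
    fix a b
    show "a \<odot>\<^bsub>N\<^esub> x \<in> carrier N" unfolding x'(2) using f(3)[OF x'(1), of a] mem[OF C(3)[OF x'(1), of a]] by simp
    show "(a + b) \<odot>\<^bsub>N\<^esub> x = a \<odot>\<^bsub>N\<^esub> x \<oplus>\<^bsub>N\<^esub> b \<odot>\<^bsub>N\<^esub> x"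
      unfolding x'(2) using f(2)[OF C(3)[OF x'(1), of a] C(3)[OF x'(1), of b]] f(3)[OF x'(1)] L(6)[OF x'(1), of a b] by metis
    show "(a * b) \<odot>\<^bsub>N\<^esub> x = a \<odot>\<^bsub>N\<^esub> (b \<odot>\<^bsub>N\<^esub> x)"
      unfolding x'(2) using f(3)[OF x'(1)] f(3)[OF C(3)[OF x'(1), of b], of a] L(8)[OF x'(1), of a b] by simp
  next
    fix x y assume "x \<in> carrier N" "y \<in> carrier N"
    then obtain x' y' where x': "x' \<in> carrier M" "x = f x'" and y': "y' \<in> carrier M" "y = f y'" using ex by blast
    show "x \<oplus>\<^bsub>N\<^esub> y \<in> carrier N" "x \<oplus>\<^bsub>N\<^esub> y = y \<oplus>\<^bsub>N\<^esub> x"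
      unfolding x'(2) y'(2) using f(2)[OF x'(1) y'(1)] f(2)[OF y'(1) x'(1)] mem[OF C(2)[OF x'(1) y'(1)]] L(3)[OF x'(1) y'(1)]
      by simp_all
    fix a
    show "a \<odot>\<^bsub>N\<^esub> (x \<oplus>\<^bsub>N\<^esub> y) = a \<odot>\<^bsub>N\<^esub> x \<oplus>\<^bsub>N\<^esub> a \<odot>\<^bsub>N\<^esub> y"
      unfolding x'(2) y'(2) using f(2)[OF x'(1) y'(1)] f(3)[OF C(2)[OF x'(1) y'(1)], of a] f(3)[OF x'(1)] f(3)[OF y'(1)]
        f(2)[OF C(3)[OF x'(1), of a] C(3)[OF y'(1), of a]] L(7)[OF x'(1) y'(1), of a] by simp
  next
    fix x y z assume xyz: "x \<in> carrier N" "y \<in> carrier N" "z \<in> carrier N"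
    obtain x' where x': "x' \<in> carrier M" "x = f x'" using ex[OF xyz(1)] by blast
    obtain y' where y': "y' \<in> carrier M" "y = f y'" using ex[OF xyz(2)] by blast
    obtain z' where z': "z' \<in> carrier M" "z = f z'" using ex[OF xyz(3)] by blast
    show "x \<oplus>\<^bsub>N\<^esub> y \<oplus>\<^bsub>N\<^esub> z = x \<oplus>\<^bsub>N\<^esub> (y \<oplus>\<^bsub>N\<^esub> z)"
      unfolding x'(2) y'(2) z'(2)
      using f(2)[OF x'(1) y'(1)] f(2)[OF C(2)[OF x'(1) y'(1)] z'(1)] f(2)[OF y'(1) z'(1)]
        f(2)[OF x'(1) C(2)[OF y'(1) z'(1)]] L(4)[OF x'(1) y'(1) z'(1)] by (simp only:)
  qed
qed

lemma module_quot:
  fixes \<pi> :: "('g, 'v) rep"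
  assumes "Module.module \<CC> \<pi>" "submodule W \<CC> \<pi>"
  shows "Module.module \<CC> (quot \<pi> W)"
  by (rule module_image[OF assms(1), of "\<lambda>x. W +>\<^bsub>\<pi>\<^esub> x"]) (simp_all add: quot_simps[OF assms])

lemma quot_minus:
  fixes \<pi> :: "('g, 'v) rep"
  assumes "Module.module \<CC> \<pi>" "submodule W \<CC> \<pi>" "x \<in> carrier \<pi>" "y \<in> carrier \<pi>"
  shows "(W +>\<^bsub>\<pi>\<^esub> x) \<ominus>\<^bsub>quot \<pi> W\<^esub> (W +>\<^bsub>\<pi>\<^esub> y) = W +>\<^bsub>\<pi>\<^esub> (x \<ominus>\<^bsub>\<pi>\<^esub> y)"
proof -
  note q = quot_simps[OF assms(1,2)]
  have "W +>\<^bsub>\<pi>\<^esub> x \<in> carrier (quot \<pi> W)" "W +>\<^bsub>\<pi>\<^esub> y \<in> carrier (quot \<pi> W)" using assms(3,4) q(1) by auto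
  then show ?thesis using complex_module_laws(12)[OF module_quot[OF assms(1,2)]] complex_module_laws(12)[OF assms(1)]
    assms(3,4) q complex_module_closed[OF assms(1)] by simp
qed

text \<open>Smoothness passes to the quotient because a coset is fixed by every element that fixes one of its
  representatives.\<close>

lemma smooth_rep_quot:
  assumes v: "nonarch_local_field v" and H: "alg_group H" and \<pi>: "smooth_rep v H \<pi>" and W: "subrep H \<pi> W"
  shows "smooth_rep v H (quot \<pi> W)"
proof -
  note S = smooth_repD[OF \<pi>] and W1 = subrepD[OF W] and HF = FptsD[OF H]
  note q = quot_simps[OF S(1) W1(1)] and qa = quot_act[OF \<pi> W] and C = complex_module_closed[OF S(1)]
  have ex: "\<exists>x\<in>carrier \<pi>. c = W +>\<^bsub>\<pi>\<^esub> x" if "c \<in> carrier (quot \<pi> W)" for c using that q(1) by auto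
  have mem: "W +>\<^bsub>\<pi>\<^esub> x \<in> carrier (quot \<pi> W)" if "x \<in> carrier \<pi>" for x using that q(1) by auto
  have op: "openin (Fpts_top v H) {g\<in>Fpts H. act (quot \<pi> W) g c = c}" if "c \<in> carrier (quot \<pi> W)" for c
    unfolding openin_Fpts_top[OF v]
  proof (intro conjI ballI)
    obtain x where x: "x \<in> carrier \<pi>" "c = W +>\<^bsub>\<pi>\<^esub> x" using ex[OF \<open>c \<in> carrier (quot \<pi> W)\<close>] by blast
    fix g assume "g \<in> {g\<in>Fpts H. act (quot \<pi> W) g c = c}"
    then have g: "g \<in> Fpts H" "act (quot \<pi> W) g c = c" by auto
    obtain e where e: "e > 0" "\<And>g. g \<in> Fpts H \<Longrightarrow> (\<And>i j. v (g $ i $ j - mat 1 $ i $ j) < e) \<Longrightarrow> act \<pi> g x = x"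
      using openin_fixators[OF v H \<pi> x(1)] by blast
    define B where "B = Max (range (\<lambda>(i, j). v (matrix_inv g $ i $ j)))"
    have B: "v (matrix_inv g $ i $ j) \<le> B" for i j unfolding B_def by (rule Max_ge) auto
    then have B0: "0 \<le> B" using nonarchD(1)[OF v] order_trans by blast
    show "\<exists>e>0. \<forall>g'\<in>Fpts H. (\<forall>i j. v (g' $ i $ j - g $ i $ j) < e) \<longrightarrow> g' \<in> {g\<in>Fpts H. act (quot \<pi> W) g c = c}"
    proof (intro exI[of _ "e / (B + 1)"] conjI ballI impI)
      show "0 < e / (B + 1)" using e(1) B0 by simp
      fix g' assume g': "g' \<in> Fpts H" "\<forall>i j. v (g' $ i $ j - g $ i $ j) < e / (B + 1)"
      define k where "k = matrix_inv g ** g'"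
      have k: "k \<in> Fpts H" using g g' HF by (simp add: k_def)
      have "act \<pi> k x = x"
        using near_one[OF v HF(4)[OF g(1)] B e(1)] g'(2) by (intro e(2)[OF k]) (simp add: k_def)
      moreover have "g' = g ** k" using matrix_inv_mult[OF HF(4)[OF g(1)]] by (simp add: k_def matrix_mul_assoc)
      ultimately have "act \<pi> g' x = act \<pi> g x" using S(6)[OF g(1) k x(1)] by simp
      then have "act (quot \<pi> W) g' c = act (quot \<pi> W) g c" using qa g(1) g'(1) x by simp
      then show "g' \<in> {g\<in>Fpts H. act (quot \<pi> W) g c = c}" using g g'(1) by simp
    qed
  qed auto
  show ?thesis unfolding smooth_rep_def
  proof (intro conjI ballI allI)
    show "Module.module \<CC> (quot \<pi> W)" by (rule module_quot[OF S(1) W1(1)])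
  next
    fix g assume g: "g \<in> Fpts H"
    show "act (quot \<pi> W) g \<in> carrier (quot \<pi> W) \<rightarrow> carrier (quot \<pi> W)"
      using qa[OF g] S(2)[OF g] mem by (auto simp: q(1))
    fix a b assume "a \<in> carrier (quot \<pi> W)" "b \<in> carrier (quot \<pi> W)"
    then obtain x y where x: "x \<in> carrier \<pi>" "a = W +>\<^bsub>\<pi>\<^esub> x" "y \<in> carrier \<pi>" "b = W +>\<^bsub>\<pi>\<^esub> y" using ex by meson
    then show "act (quot \<pi> W) g (a \<oplus>\<^bsub>quot \<pi> W\<^esub> b) = act (quot \<pi> W) g a \<oplus>\<^bsub>quot \<pi> W\<^esub> act (quot \<pi> W) g b"
      using q(3) qa[OF g] S(2,3)[OF g] C by simp
  next
    fix g c a assume g: "g \<in> Fpts H" and "a \<in> carrier (quot \<pi> W)"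
    then obtain x where x: "x \<in> carrier \<pi>" "a = W +>\<^bsub>\<pi>\<^esub> x" using ex by meson
    then show "act (quot \<pi> W) g (c \<odot>\<^bsub>quot \<pi> W\<^esub> a) = c \<odot>\<^bsub>quot \<pi> W\<^esub> act (quot \<pi> W) g a"
      using q(4) qa[OF g] S(2,4)[OF g] C by simp
  next
    fix a assume a: "a \<in> carrier (quot \<pi> W)"
    then obtain x where x: "x \<in> carrier \<pi>" "a = W +>\<^bsub>\<pi>\<^esub> x" using ex by meson
    show "act (quot \<pi> W) (mat 1) a = a" using qa[OF HF(1) x(1)] S(5) x by simp
    show "openin (Fpts_top v H) {g\<in>Fpts H. act (quot \<pi> W) g a = a}" by (rule op[OF a])
  next
    fix g h a assume g: "g \<in> Fpts H" "h \<in> Fpts H" and "a \<in> carrier (quot \<pi> W)"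
    then obtain x where x: "x \<in> carrier \<pi>" "a = W +>\<^bsub>\<pi>\<^esub> x" using ex by meson
    then show "act (quot \<pi> W) (g ** h) a = act (quot \<pi> W) g (act (quot \<pi> W) h a)"
      using qa S(2,6) g HF(2) by simp
  qed
qed

lemma zero_coset:
  fixes M (structure)
  assumes "Module.module \<CC> M" "x \<in> carrier M"
  shows "{\<zero>} +> x = {x}"
  using complex_module_laws(1)[OF assms] by (simp add: a_r_coset_def')

lemma quot_zero_simps:
  fixes M :: "('g, 'v) rep"
  assumes "Module.module \<CC> M"
  shows "carrier (quot M {\<zero>\<^bsub>M\<^esub>}) = (\<lambda>x. {x}) ` carrier M"
    "\<And>x y. x \<in> carrier M \<Longrightarrow> y \<in> carrier M \<Longrightarrow> {x} \<oplus>\<^bsub>quot M {\<zero>\<^bsub>M\<^esub>}\<^esub> {y} = {x \<oplus>\<^bsub>M\<^esub> y}"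
    "\<And>c x. x \<in> carrier M \<Longrightarrow> c \<odot>\<^bsub>quot M {\<zero>\<^bsub>M\<^esub>}\<^esub> {x} = {c \<odot>\<^bsub>M\<^esub> x}"
    "\<And>f x. f x \<in> carrier M \<Longrightarrow> coset_map M {\<zero>\<^bsub>M\<^esub>} f {x} = {f x}"
    "\<And>g x. act M g x \<in> carrier M \<Longrightarrow> act (quot M {\<zero>\<^bsub>M\<^esub>}) g {x} = {act M g x}"
proof -
  note C = complex_module_closed[OF assms]
  note z = zero_coset[OF assms] and q = quot_simps[OF assms zero_submodule[OF assms]]
  show "carrier (quot M {\<zero>\<^bsub>M\<^esub>}) = (\<lambda>x. {x}) ` carrier M" unfolding q(1) using z by (rule image_cong[OF refl])
  show "{x} \<oplus>\<^bsub>quot M {\<zero>\<^bsub>M\<^esub>}\<^esub> {y} = {x \<oplus>\<^bsub>M\<^esub> y}" if "x \<in> carrier M" "y \<in> carrier M" for x y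
    using q(3)[OF that] z that C(2)[OF that] by simp
  show "c \<odot>\<^bsub>quot M {\<zero>\<^bsub>M\<^esub>}\<^esub> {x} = {c \<odot>\<^bsub>M\<^esub> x}" if "x \<in> carrier M" for c x
    using q(4)[OF that] z that C(3)[OF that] by simp
  show cm: "coset_map M {\<zero>\<^bsub>M\<^esub>} f {x} = {f x}" if "f x \<in> carrier M" for f x
    using z[OF that] by (simp add: coset_map_def)
  show "act (quot M {\<zero>\<^bsub>M\<^esub>}) g {x} = {act M g x}" if "act M g x \<in> carrier M" for g x
    using cm[of "act M g" x, OF that] by (simp add: quot_def)
qed

lemma rep_iso_quot_zero:
  assumes M: "Module.module \<CC> \<pi>" and a: "\<And>g x. g \<in> Fpts H \<Longrightarrow> x \<in> carrier \<pi> \<Longrightarrow> act \<pi> g x \<in> carrier \<pi>"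
  shows "rep_iso H \<pi> (quot \<pi> {\<zero>\<^bsub>\<pi>\<^esub>}) (\<lambda>x. {x})"
  unfolding rep_iso_def rep_hom_def using quot_zero_simps[OF M] a by (auto simp: bij_betw_def)

lemma irreducible_rep_iso:
  assumes \<pi>: "smooth_rep v H \<pi>" and \<sigma>: "Module.module \<CC> \<sigma>" and f: "rep_iso H \<pi> \<sigma> f" and irr: "irreducible_rep H \<pi>"
  shows "irreducible_rep H \<sigma>"
proof -
  note S = smooth_repD[OF \<pi>] and C = complex_module_closed[OF S(1)]
  have bij: "bij_betw f (carrier \<pi>) (carrier \<sigma>)" and hom: "rep_hom H \<pi> \<sigma> f" using f by (auto simp: rep_iso_def)
  have im: "f ` carrier \<pi> = carrier \<sigma>" using bij by (simp add: bij_betw_def)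
  have add: "f (x \<oplus>\<^bsub>\<pi>\<^esub> y) = f x \<oplus>\<^bsub>\<sigma>\<^esub> f y" if "x \<in> carrier \<pi>" "y \<in> carrier \<pi>" for x y
    using hom that by (simp add: rep_hom_def)
  have sc: "f (c \<odot>\<^bsub>\<pi>\<^esub> x) = c \<odot>\<^bsub>\<sigma>\<^esub> f x" if "x \<in> carrier \<pi>" for x c
    using hom that by (simp add: rep_hom_def)
  have fact: "f (act \<pi> g x) = act \<sigma> g (f x)" if "g \<in> Fpts H" "x \<in> carrier \<pi>" for g x
    using hom that by (simp add: rep_hom_def)
  have "f (0 \<odot>\<^bsub>\<pi>\<^esub> \<zero>\<^bsub>\<pi>\<^esub>) = 0 \<odot>\<^bsub>\<sigma>\<^esub> f \<zero>\<^bsub>\<pi>\<^esub>" by (rule sc[OF C(1)])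
  moreover have "f \<zero>\<^bsub>\<pi>\<^esub> \<in> carrier \<sigma>" using im C(1) by blast
  ultimately have f0: "f \<zero>\<^bsub>\<pi>\<^esub> = \<zero>\<^bsub>\<sigma>\<^esub>"
    using complex_module_laws(10)[OF S(1) C(1)] complex_module_laws(10)[OF \<sigma>] by simp
  show ?thesis unfolding irreducible_rep_def
  proof (intro conjI allI impI)
    show "carrier \<sigma> \<noteq> {\<zero>\<^bsub>\<sigma>\<^esub>}"
    proof
      assume eq: "carrier \<sigma> = {\<zero>\<^bsub>\<sigma>\<^esub>}"
      have "x = \<zero>\<^bsub>\<pi>\<^esub>" if "x \<in> carrier \<pi>" for x
      proof -
        have "f x \<in> carrier \<sigma>" using im that by blast
        then have "f x = f \<zero>\<^bsub>\<pi>\<^esub>" using eq f0 by simp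
        then show ?thesis using bij that C(1) by (simp add: bij_betw_def inj_on_def)
      qed
      then show False using irr C(1) unfolding irreducible_rep_def by blast
    qed
    fix Q assume Q: "subrep H \<sigma> Q"
    note Q1 = subrepD[OF Q] and Q2 = submodule_complexD[OF subrepD(1)[OF Q]]
    define P where "P = {x \<in> carrier \<pi>. f x \<in> Q}"
    have "subrep H \<pi> P"
    proof (rule subrepI)
      show "submodule P \<CC> \<pi>"
        using Q2 C add sc f0 by (intro submodule_complexI[OF S(1)]) (auto simp: P_def)
      show "\<And>g x. g \<in> Fpts H \<Longrightarrow> x \<in> P \<Longrightarrow> act \<pi> g x \<in> P" using Q1(2) fact S(2) by (simp add: P_def)
    qed
    then have P: "P = {\<zero>\<^bsub>\<pi>\<^esub>} \<or> P = carrier \<pi>" using irr by (simp add: irreducible_rep_def)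
    have fP: "f ` P = Q"
    proof
      show "Q \<subseteq> f ` P"
      proof
        fix y assume y: "y \<in> Q"
        then obtain x where "x \<in> carrier \<pi>" "y = f x" using Q2(1) im by blast
        then show "y \<in> f ` P" using y by (auto simp: P_def)
      qed
    qed (auto simp: P_def)
    then show "Q = {\<zero>\<^bsub>\<sigma>\<^esub>} \<or> Q = carrier \<sigma>" using P im f0 by auto
  qed
qed

lemma irreducible_imp_finite_length:
  assumes \<pi>: "smooth_rep v H \<pi>" and irr: "irreducible_rep H \<pi>"
  shows "finite_length H \<pi>"
proof -
  note S = smooth_repD[OF \<pi>]
  define W where "W i = (if i = 0 then {\<zero>\<^bsub>\<pi>\<^esub>} else carrier \<pi>)" for i :: nat
  have "irreducible_rep H (quot \<pi> {\<zero>\<^bsub>\<pi>\<^esub>})"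
    by (rule irreducible_rep_iso[OF \<pi> module_quot[OF S(1) zero_submodule[OF S(1)]] rep_iso_quot_zero[OF smooth_repD(1,2)[OF \<pi>]] irr])
  then show ?thesis unfolding finite_length_def
    using zero_subrep[OF \<pi>] carrier_subrep[OF \<pi>] complex_module_closed(1)[OF S(1)]
    by (intro exI[of _ 1] exI[of _ W]) (auto simp: W_def)
qed

lemma open_subgroup_stabilizer:
  assumes v: "nonarch_local_field v" and H: "alg_group H" and \<pi>: "smooth_rep v H \<pi>" and x: "x \<in> carrier \<pi>"
  shows "open_subgroup v H {g\<in>Fpts H. act \<pi> g x = x}"
  unfolding open_subgroup_def
proof
  note S = smooth_repD[OF \<pi>] and HF = FptsD[OF H]
  show "openin (Fpts_top v H) {g\<in>Fpts H. act \<pi> g x = x}" by (rule S(7)[OF x])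
  show "subgroup {g\<in>Fpts H. act \<pi> g x = x} (matgrp (Fpts H))"
  proof (rule subgroup_matgrp_Fpts[OF H])
    fix g assume "g \<in> {g\<in>Fpts H. act \<pi> g x = x}"
    then have g: "g \<in> Fpts H" "act \<pi> g x = x" by auto
    show "matrix_inv g \<in> {g\<in>Fpts H. act \<pi> g x = x}"
      using smooth_rep_inverse(1)[OF \<pi> H g(1) x] g HF(3) by simp
  qed (use HF S x in auto)
qed

text \<open>A function in the representation induced from the whole group is determined by its value at \<open>1\<close>. Every
  vector \<open>x\<close> occurs as such a value, because its stabilizer is an open subgroup.\<close>

lemma rep_iso_ind_self:
  fixes \<sigma> :: "('f::field^'n^'n, 'v) rep"
  assumes v: "nonarch_local_field v" and H: "alg_group H" and \<sigma>: "smooth_rep v H \<sigma>"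
  shows "rep_iso H \<sigma> (ind v H H \<sigma>) (\<lambda>x. \<lambda>g\<in>Fpts H. act \<sigma> g x)" "Module.module \<CC> (ind v H H \<sigma>)"
    "(\<lambda>g\<in>Fpts H. act \<sigma> g \<zero>\<^bsub>\<sigma>\<^esub>) = \<zero>\<^bsub>ind v H H \<sigma>\<^esub>"
proof -
  note S = smooth_repD[OF \<sigma>] and C = complex_module_closed[OF smooth_repD(1)[OF \<sigma>]] and HF = FptsD[OF H]
  let ?E = "\<lambda>x. \<lambda>g\<in>Fpts H. act \<sigma> g x"
  have E_mem: "?E x \<in> carrier (ind v H H \<sigma>)" if x: "x \<in> carrier \<sigma>" for x
  proof -
    have "?E x (g ** k) = ?E x g" if "g \<in> Fpts H" "k \<in> {g\<in>Fpts H. act \<sigma> g x = x}" for g k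
      using that HF(2) S(6) x by simp
    then have "\<exists>K. open_subgroup v H K \<and> (\<forall>g\<in>Fpts H. \<forall>k\<in>K. ?E x (g ** k) = ?E x g)"
      using open_subgroup_stabilizer[OF v H \<sigma> x] by blast
    then show ?thesis using S(2,6) HF(2) x by (simp add: ind_def)
  qed
  have surj: "\<exists>x\<in>carrier \<sigma>. f = ?E x" if "f \<in> carrier (ind v H H \<sigma>)" for f
  proof -
    have f: "f \<in> Fpts H \<rightarrow>\<^sub>E carrier \<sigma>" "\<And>p g. p \<in> Fpts H \<Longrightarrow> g \<in> Fpts H \<Longrightarrow> f (p ** g) = act \<sigma> p (f g)"
      using that by (auto simp: ind_def)
    have "f = ?E (f (mat 1))"
    proof
      fix g show "f g = ?E (f (mat 1)) g"
      proof (cases "g \<in> Fpts H")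
        case True
        then show ?thesis using f(2)[OF True HF(1)] by (simp only: matrix_mul_rid restrict_apply' True)
      next
        case False
        then show ?thesis using PiE_arb[OF f(1) False] by simp
      qed
    qed
    then show ?thesis using f(1) HF(1) by (intro bexI[of _ "f (mat 1)"]) auto
  qed
  have bij: "bij_betw ?E (carrier \<sigma>) (carrier (ind v H H \<sigma>))"
    unfolding bij_betw_def
  proof
    show "inj_on ?E (carrier \<sigma>)"
    proof (rule inj_onI)
      fix x y assume xy: "x \<in> carrier \<sigma>" "y \<in> carrier \<sigma>" "?E x = ?E y"
      then have "?E x (mat 1) = ?E y (mat 1)" by simp
      then show "x = y" using S(5) HF(1) xy(1,2) by simp
    qed
    show "?E ` carrier \<sigma> = carrier (ind v H H \<sigma>)" using E_mem surj by blast
  qed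
  have add: "?E (x \<oplus>\<^bsub>\<sigma>\<^esub> y) = ?E x \<oplus>\<^bsub>ind v H H \<sigma>\<^esub> ?E y" if "x \<in> carrier \<sigma>" "y \<in> carrier \<sigma>" for x y
    using that S(3) by (auto simp: ind_def)
  have sc: "?E (c \<odot>\<^bsub>\<sigma>\<^esub> x) = c \<odot>\<^bsub>ind v H H \<sigma>\<^esub> ?E x" if "x \<in> carrier \<sigma>" for c x
    using that S(4) by (auto simp: ind_def)
  show z: "?E \<zero>\<^bsub>\<sigma>\<^esub> = \<zero>\<^bsub>ind v H H \<sigma>\<^esub>" using smooth_rep_act_zero[OF \<sigma>] by (auto simp: ind_def)
  show "Module.module \<CC> (ind v H H \<sigma>)"
    using bij add sc z by (intro module_image[OF S(1), of ?E]) (auto simp: bij_betw_def)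
  have "?E (act \<sigma> g x) = act (ind v H H \<sigma>) g (?E x)" if "g \<in> Fpts H" "x \<in> carrier \<sigma>" for g x
    using that S(6) HF(2) by (auto simp: ind_def)
  then show "rep_iso H \<sigma> (ind v H H \<sigma>) ?E"
    unfolding rep_iso_def rep_hom_def using bij add sc E_mem by auto
qed

section \<open>Finitely generated groups of unipotent elements are bounded\<close>

text \<open>The monoid generated by \<open>T\<close>; it is the generated group as soon as \<open>T\<close> is closed under inverses.\<close>

inductive_set generated :: "('f::field^'n^'n) set \<Rightarrow> ('f^'n^'n) set" for T where
  one: "mat 1 \<in> generated T"
| mult: "t \<in> T \<Longrightarrow> g \<in> generated T \<Longrightarrow> t ** g \<in> generated T"

lemma generated_mult: "g \<in> generated T \<Longrightarrow> h \<in> generated T \<Longrightarrow> g ** h \<in> generated T"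
  by (induction g rule: generated.induct) (auto simp: matrix_mul_assoc[symmetric] intro: generated.mult)

lemma generated_base: "t \<in> T \<Longrightarrow> t \<in> generated T"
  using generated.mult[OF _ generated.one, of t T] by simp

lemma generated_mono: "T \<subseteq> T' \<Longrightarrow> g \<in> generated T \<Longrightarrow> g \<in> generated T'"
  by (rotate_tac, induction g rule: generated.induct) (auto intro: generated.intros)

lemma generated_inverse:
  assumes "\<And>t. t \<in> T \<Longrightarrow> invertible t" "\<And>t. t \<in> T \<Longrightarrow> matrix_inv t \<in> T" "g \<in> generated T"
  shows "invertible g" "matrix_inv g \<in> generated T"
proof -
  have "invertible g \<and> matrix_inv g \<in> generated T"
    using assms(3)
  proof (induction g rule: generated.induct)
    case one
    then show ?case by (auto simp: invertible_def intro: generated.one)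
  next
    case (mult t g)
    then show ?case using assms(1,2)
        generated_mult[OF _ generated_base, of "matrix_inv g" T "matrix_inv t"] by (auto simp: matrix_inv_prod invertible_mult)
  qed
  then show "invertible g" "matrix_inv g \<in> generated T" by auto
qed

lemma generated_Fpts: "alg_group H \<Longrightarrow> T \<subseteq> Fpts H \<Longrightarrow> g \<in> generated T \<Longrightarrow> g \<in> Fpts H"
  by (rotate_tac 2, induction g rule: generated.induct) (auto intro: FptsD)

inductive_set word_sums :: "('f::field^'n^'n) set \<Rightarrow> ('f^'n^'n) set" for B where
  zero: "0 \<in> word_sums B"
| step: "set ws \<subseteq> B \<Longrightarrow> M \<in> word_sums B \<Longrightarrow> matrix_prod ws + M \<in> word_sums B"

lemma word_sums_add: "M \<in> word_sums B \<Longrightarrow> N \<in> word_sums B \<Longrightarrow> M + N \<in> word_sums B"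
  by (induction M rule: word_sums.induct) (auto simp: add.assoc intro: word_sums.intros)

lemma word_sums_mult: "M \<in> word_sums B \<Longrightarrow> w \<in> B \<Longrightarrow> w ** M \<in> word_sums B"
proof (induction M rule: word_sums.induct)
  case (step ws M)
  have "w ** (matrix_prod ws + M) = matrix_prod (w # ws) + w ** M"
    by (simp add: matrix_add_ldistrib)
  then show ?case using step word_sums.step[of "w # ws" B] by simp
qed (simp add: word_sums.zero)

text \<open>Writing every generator as \<open>1 + x\<close> and expanding, each element of the generated monoid is a sum of
  words in the \<open>x\<close>. Only finitely many words are nonzero, and for a non-archimedean absolute value the
  number of summands does not matter.\<close>

lemma generated_bounded:
  fixes T :: "('f::field^'n^'n) set"
  assumes v: "nonarch_local_field v" and fin: "finite T"
    and nil: "\<And>us. set us \<subseteq> T \<Longrightarrow> length us = N \<Longrightarrow> matrix_prod (map (\<lambda>u. u - mat 1) us) = 0"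
  shows "\<exists>C. \<forall>g\<in>generated T. \<forall>i j. v (g $ i $ j) \<le> C"
proof -
  define B where "B = (\<lambda>u. u - mat 1) ` T"
  have long: "matrix_prod ws = 0" if "set ws \<subseteq> B" "N \<le> length ws" for ws
  proof -
    have "set (take N ws) \<subseteq> B" using that(1) set_take_subset by fastforce
    define us where "us = map (\<lambda>M. M + mat 1) (take N ws)"
    have "set us \<subseteq> T" using \<open>set (take N ws) \<subseteq> B\<close> by (auto simp: us_def B_def)
    moreover have "take N ws = map (\<lambda>u. u - mat 1) us" by (simp add: us_def o_def)
    ultimately have us: "set us \<subseteq> T" "take N ws = map (\<lambda>u. u - mat 1) us" by auto
    then have "length us = N" using that(2) by (metis length_map length_take min.absorb2)
    then have "matrix_prod (take N ws) = 0" using nil us by simp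
    then show ?thesis using matrix_prod_append[of "take N ws" "drop N ws"] by simp
  qed
  \<comment> \<open>The bound \<open>C\<close> holds for the finitely many short words, all longer words vanish, and sums stay
    below \<open>C\<close>.\<close>
  define short where "short = matrix_prod ` {ws. set ws \<subseteq> B \<and> length ws \<le> N}"
  have "finite short" unfolding short_def using fin by (intro finite_imageI finite_lists_length_le) (simp add: B_def)
  define C where "C = Max (insert 0 ((\<lambda>(M, i, j). v (M $ i $ j)) ` (short \<times> UNIV)))"
  have finC: "finite (insert 0 ((\<lambda>(M, i, j). v (M $ i $ j)) ` (short \<times> (UNIV :: ('n \<times> 'n) set))))"
    using \<open>finite short\<close> by simp
  have C0: "0 \<le> C" unfolding C_def using finC by (intro Max_ge) auto
  have C_short: "v (M $ i $ j) \<le> C" if "M \<in> short" for M :: "'f^'n^'n" and i j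
    unfolding C_def using finC that by (intro Max_ge insertI2 image_eqI[of _ _ "(M, i, j)"]) auto
  have C_word: "v (matrix_prod ws $ i $ j) \<le> C" if "set ws \<subseteq> B" for ws i j
    using C_short[of "matrix_prod ws"] long[OF that] that C0 nonarchD(5)[OF v]
    by (cases "length ws \<le> N") (auto simp: short_def)
  have bound: "\<forall>i j. v (M $ i $ j) \<le> C" if "M \<in> word_sums B" for M :: "'f^'n^'n"
    using that
  proof (induction M rule: word_sums.induct)
    case zero
    then show ?case using C0 nonarchD(5)[OF v] by simp
  next
    case (step ws M)
    then show ?case using C_word[OF step(1)] nonarchD(4)[OF v] by (fastforce intro: order_trans)
  qed
  have "g \<in> word_sums B" if "g \<in> generated T" for g
    using that
  proof (induction g rule: generated.induct)
    case one
    then show ?case using word_sums.step[of "[]" B 0] word_sums.zero[of B] by simp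
  next
    case (mult t g)
    have "t ** g = g + (t - mat 1) ** g"
      by (simp add: matrix_eq matrix_vector_mul_assoc[symmetric] matrix_vector_mult_diff_rdistrib matrix_vector_mult_add_rdistrib)
    then show ?case using mult word_sums_add[of g B "(t - mat 1) ** g"] word_sums_mult[of g B "t - mat 1"]
      by (simp add: B_def)
  qed
  then show ?thesis using bound by blast
qed

text \<open>A bounded set of matrices is covered by finitely many small balls, and two group elements in one of these
  balls differ by an element that fixes \<open>x\<close>.\<close>

lemma finite_orbit:
  fixes \<Gamma> :: "('f::field^'n^'n) set"
  assumes v: "nonarch_local_field v" and H: "alg_group H" and \<pi>: "smooth_rep v H \<pi>" and x: "x \<in> carrier \<pi>"
    and \<Gamma>: "\<Gamma> \<subseteq> Fpts H" "\<And>g. g \<in> \<Gamma> \<Longrightarrow> matrix_inv g \<in> \<Gamma>" and C: "\<And>g i j. g \<in> \<Gamma> \<Longrightarrow> v (g $ i $ j) \<le> C"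
  shows "finite ((\<lambda>g. act \<pi> g x) ` \<Gamma>)"
proof (cases "\<Gamma> = {}")
  case False
  note S = smooth_repD[OF \<pi>] and HF = FptsD[OF H]
  obtain g0 where g0: "g0 \<in> \<Gamma>" using False by blast
  have C0: "0 \<le> C" using C[OF g0] nonarchD(1)[OF v] order_trans by blast
  obtain e where e: "e > 0" "\<And>g. g \<in> Fpts H \<Longrightarrow> (\<And>i j. v (g $ i $ j - mat 1 $ i $ j) < e) \<Longrightarrow> act \<pi> g x = x"
    using openin_fixators[OF v H \<pi> x] by blast
  have "e / (C + 1) > 0" using e C0 by simp
  then obtain F where F: "finite F" "\<And>z. v z \<le> C \<Longrightarrow> \<exists>y\<in>F. v (z - y) < e / (C + 1)"
    using bounded_imp_totally_bounded[OF v, of "e / (C + 1)" C] by blast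
  \<comment> \<open>Two elements of \<open>\<Gamma>\<close> whose entries lie in the same small balls map \<open>x\<close> to the same vector.\<close>
  define cell where "cell z = (SOME y. y \<in> F \<and> v (z - y) < e / (C + 1))" for z
  have cell: "cell z \<in> F" "v (z - cell z) < e / (C + 1)" if "v z \<le> C" for z
    using someI_ex[of "\<lambda>y. y \<in> F \<and> v (z - y) < e / (C + 1)"] F(2)[OF that] unfolding cell_def by blast+
  define \<kappa> where "\<kappa> g = (\<lambda>(i, j). cell (g $ i $ j))" for g :: "'f^'n^'n"
  have same: "act \<pi> g x = act \<pi> g' x" if g: "g \<in> \<Gamma>" "g' \<in> \<Gamma>" "\<kappa> g = \<kappa> g'" for g g'
  proof -
    have "v (g' $ i $ j - g $ i $ j) < e / (C + 1)" for i j
    proof -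
      have "cell (g $ i $ j) = cell (g' $ i $ j)" using fun_cong[OF g(3), of "(i, j)"] by (simp add: \<kappa>_def)
      then have "v (g' $ i $ j - cell (g $ i $ j)) < e / (C + 1)" "v (g $ i $ j - cell (g $ i $ j)) < e / (C + 1)"
        using cell(2) C g by metis+
      then show ?thesis
        using nonarchD(8)[OF v, of "g' $ i $ j - cell (g $ i $ j)" "g $ i $ j - cell (g $ i $ j)"]
        by (auto simp: le_max_iff_disj)
    qed
    moreover have gH: "g \<in> Fpts H" "g' \<in> Fpts H" using g \<Gamma>(1) by auto
    moreover have k: "matrix_inv g ** g' \<in> Fpts H" using gH HF by simp
    ultimately have "act \<pi> (matrix_inv g ** g') x = x"
      using near_one[OF v HF(4)[OF gH(1)] C[OF \<Gamma>(2)[OF g(1)]] e(1)] by (intro e(2)) auto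
    then have "act \<pi> (g ** (matrix_inv g ** g')) x = act \<pi> g x" using S(6)[OF gH(1) k x] by simp
    then show ?thesis using matrix_inv_mult(2)[OF HF(4)[OF gH(1)]] by (simp add: matrix_mul_assoc)
  qed
  have "finite (\<kappa> ` \<Gamma>)"
  proof (rule finite_subset)
    show "\<kappa> ` \<Gamma> \<subseteq> PiE UNIV (\<lambda>_. F)" using cell(1) C by (auto simp: \<kappa>_def)
    show "finite (PiE (UNIV :: ('n \<times> 'n) set) (\<lambda>_. F))" using F(1) by (intro finite_PiE) auto
  qed
  moreover have "(\<lambda>g. act \<pi> g x) ` \<Gamma> \<subseteq> (\<lambda>c. act \<pi> (SOME g. g \<in> \<Gamma> \<and> \<kappa> g = c) x) ` (\<kappa> ` \<Gamma>)"
  proof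
    fix y assume "y \<in> (\<lambda>g. act \<pi> g x) ` \<Gamma>"
    then obtain g where g: "g \<in> \<Gamma>" "y = act \<pi> g x" by blast
    define g' where "g' = (SOME g'. g' \<in> \<Gamma> \<and> \<kappa> g' = \<kappa> g)"
    have "g' \<in> \<Gamma> \<and> \<kappa> g' = \<kappa> g" unfolding g'_def by (rule someI[of _ g]) (simp add: g(1))
    then have "y = act \<pi> g' x" using same[of g' g] g by simp
    then show "y \<in> (\<lambda>c. act \<pi> (SOME g. g \<in> \<Gamma> \<and> \<kappa> g = c) x) ` (\<kappa> ` \<Gamma>)"
      using g(1) unfolding g'_def by (intro image_eqI[of _ _ "\<kappa> g"]) auto
  qed
  ultimately show ?thesis by (meson finite_imageI finite_subset)
qed simp

lemma emb_matrix_prod: "emb (matrix_prod Ms) = matrix_prod (map emb Ms)"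
  by (induction Ms) (simp_all add: emb_mult)

lemma unip_radicalD:
  assumes "alg_group P" "u \<in> unip_radical P"
  shows "\<exists>U. u \<in> U \<and> U \<subseteq> unip_radical P \<and> U \<subseteq> P \<and> alg_group U \<and> (\<forall>u\<in>U. unipotent u) \<and>
    (\<forall>w\<in>U. \<forall>g\<in>P. \<exists>w'\<in>U. w ** g = g ** w')"
proof -
  obtain U where U: "alg_group U" "connectedin zariski U" "U \<subseteq> P" "\<forall>h\<in>P. conj_set h U = U"
    "\<forall>u\<in>U. unipotent u" "u \<in> U"
    using assms(2) by (auto simp: unip_radical_def)
  have "\<exists>w'\<in>U. w ** g = g ** w'" if w: "w \<in> U" and g: "g \<in> P" for w g
  proof -
    have g': "invertible g" "matrix_inv g \<in> P" using alg_groupD[OF assms(1)] g by auto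
    have "matrix_inv g ** w ** matrix_inv (matrix_inv g) \<in> conj_set (matrix_inv g) U"
      using w by (auto simp: conj_set_def)
    then have "matrix_inv g ** w ** g \<in> U" using U(4) g' by (simp add: matrix_inv_matrix_inv)
    moreover have "g ** (matrix_inv g ** w ** g) = w ** g"
      using matrix_inv_mult(2)[OF g'(1)] by (simp add: matrix_mul_assoc)
    ultimately show ?thesis by metis
  qed
  moreover have "U \<subseteq> unip_radical P" using U unfolding unip_radical_def by blast
  ultimately show ?thesis using U(1,3,5,6) by (intro exI[of _ U]) simp
qed

lemma unip_radical_Fpts:
  assumes P: "alg_group P"
  shows "Fpts (unip_radical P) \<subseteq> Fpts P" "\<And>u. u \<in> Fpts (unip_radical P) \<Longrightarrow> matrix_inv u \<in> Fpts (unip_radical P)"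
proof -
  show "Fpts (unip_radical P) \<subseteq> Fpts P" by (auto simp: Fpts_def unip_radical_def)
  fix u assume u: "u \<in> Fpts (unip_radical P)"
  then have "emb u \<in> unip_radical P" by (simp add: Fpts_def)
  then obtain U where U: "emb u \<in> U" "U \<subseteq> unip_radical P" "alg_group U" using unip_radicalD[OF P \<open>emb u \<in> unip_radical P\<close>] by (elim exE conjE)
  have "invertible u" using alg_groupD(4)[OF U(3,1)] by simp
  then have "emb (matrix_inv u) \<in> U" using alg_groupD(3)[OF U(3,1)] by (simp add: emb_matrix_inv)
  then show "matrix_inv u \<in> Fpts (unip_radical P)" using U(2) by (auto simp: Fpts_def)
qed

text \<open>Finitely many elements of the radical lie in finitely many of the normal unipotent groups whose union is
  the radical, so Kolchin's theorem for several groups applies over the algebraic closure.\<close>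

lemma unip_radical_nilpotent:
  fixes P :: "('f::field alg_closure^'n^'n) set"
  assumes P: "alg_group P" and T: "finite T" "T \<subseteq> Fpts (unip_radical P)"
    and us: "set us \<subseteq> T" "length us = CARD('n)"
  shows "matrix_prod (map (\<lambda>u. u - mat 1) us) = 0"
proof -
  have "\<forall>t\<in>T. \<exists>U. emb t \<in> U \<and> U \<subseteq> P \<and> alg_group U \<and> (\<forall>u\<in>U. unipotent u) \<and>
      (\<forall>w\<in>U. \<forall>g\<in>P. \<exists>w'\<in>U. w ** g = g ** w')"
  proof
    fix t assume "t \<in> T"
    then have "emb t \<in> unip_radical P" using T(2) by (auto simp: Fpts_def)
    from unip_radicalD[OF P this] show "\<exists>U. emb t \<in> U \<and> U \<subseteq> P \<and> alg_group U \<and> (\<forall>u\<in>U. unipotent u) \<and>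
      (\<forall>w\<in>U. \<forall>g\<in>P. \<exists>w'\<in>U. w ** g = g ** w')" by (elim exE conjE) (rule exI, intro conjI, assumption+)
  qed
  from bchoice[OF this] obtain U where U0: "\<forall>t\<in>T. emb t \<in> U t \<and> U t \<subseteq> P \<and> alg_group (U t) \<and>
      (\<forall>u\<in>U t. unipotent u) \<and> (\<forall>w\<in>U t. \<forall>g\<in>P. \<exists>w'\<in>U t. w ** g = g ** w')" by (elim exE)
  have U: "emb t \<in> U t" "U t \<subseteq> P" "alg_group (U t)" "u \<in> U t \<Longrightarrow> unipotent u"
    "w \<in> U t \<Longrightarrow> g \<in> P \<Longrightarrow> \<exists>w'\<in>U t. w ** g = g ** w'" if "t \<in> T" for t u w g
    using bspec[OF U0 that] by auto
  have "matrix_prod (map (\<lambda>u. u - mat 1) (map emb us)) = 0"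
  proof (rule normal_unipotent_groups_nilpotent[where \<U> = "U ` T" and P = P])
    show "finite (U ` T)" using T by simp
    show "length (map emb us) = CARD('n)" using us by simp
    show "set (map emb us) \<subseteq> \<Union> (U ` T)" using us(1) U(1) by auto
    fix V assume "V \<in> U ` T"
    then obtain t where t: "t \<in> T" "V = U t" by blast
    show "mat 1 \<in> V" "V \<subseteq> P" using alg_groupD(1)[OF U(3)] U(2) t by auto
    fix u assume u: "u \<in> V"
    show "unipotent u" using U(4) t u by blast
    show "u ** w \<in> V" if "w \<in> V" for w using alg_groupD(2)[OF U(3)] t u that by blast
    show "\<exists>u'\<in>V. u ** g = g ** u'" if "g \<in> P" for g using U(5) t u that by blast
  qed
  then have "matrix_prod (map emb (map (\<lambda>u. u - mat 1) us)) = 0" by (simp add: o_def emb_diff)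
  then have "emb (matrix_prod (map (\<lambda>u. u - mat 1) us)) = emb 0" by (simp only: emb_matrix_prod emb_zero)
  then show ?thesis by (simp only: emb_eq_iff)
qed

section \<open>Coinvariants of the unipotent radical and subquotients\<close>

lemma aug_submodule:
  assumes \<pi>: "smooth_rep v H \<pi>" and U: "Fpts U \<subseteq> Fpts H"
  shows "submodule (aug U \<pi>) \<CC> \<pi>"
    "\<And>u x. u \<in> Fpts U \<Longrightarrow> x \<in> carrier \<pi> \<Longrightarrow> act \<pi> u x \<ominus>\<^bsub>\<pi>\<^esub> x \<in> aug U \<pi>"
proof -
  note S = smooth_repD[OF \<pi>]
  define \<W> where "\<W> = {W. submodule W \<CC> \<pi> \<and> (\<forall>u\<in>Fpts U. \<forall>x\<in>carrier \<pi>. act \<pi> u x \<ominus>\<^bsub>\<pi>\<^esub> x \<in> W)}"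
  have aug: "aug U \<pi> = \<Inter>\<W>" by (simp add: aug_def \<W>_def)
  have car: "carrier \<pi> \<in> \<W>" using carrier_submodule[OF S(1)] complex_module_minus(1)[OF S(1)] S(2) U
    by (auto simp: \<W>_def)
  have sub: "submodule W \<CC> \<pi>" if "W \<in> \<W>" for W using that by (simp add: \<W>_def)
  show "submodule (aug U \<pi>) \<CC> \<pi>" unfolding aug
    using car submodule_complexD[OF sub] by (intro submodule_complexI[OF S(1)]) auto
  show "act \<pi> u x \<ominus>\<^bsub>\<pi>\<^esub> x \<in> aug U \<pi>" if "u \<in> Fpts U" "x \<in> carrier \<pi>" for u x
    using that by (simp add: aug \<W>_def)
qed

lemma aug_least:
  assumes "submodule W \<CC> \<pi>" "\<And>u x. u \<in> Fpts U \<Longrightarrow> x \<in> carrier \<pi> \<Longrightarrow> act \<pi> u x \<ominus>\<^bsub>\<pi>\<^esub> x \<in> W"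
  shows "aug U \<pi> \<subseteq> W"
  using assms by (auto simp: aug_def)

lemma aug_generated:
  assumes \<pi>: "smooth_rep v H \<pi>" and H: "alg_group H" and U: "Fpts U \<subseteq> Fpts H"
    and g: "g \<in> generated (Fpts U)" and x: "x \<in> carrier \<pi>"
  shows "act \<pi> g x \<ominus>\<^bsub>\<pi>\<^esub> x \<in> aug U \<pi>"
  using g
proof (induction g rule: generated.induct)
  note S = smooth_repD[OF \<pi>] and A = aug_submodule[OF \<pi> U]
  case one
  then show ?case using S(5)[OF x] complex_module_minus(4)[OF S(1) x] submodule_complexD(2)[OF A(1)] by simp
next
  note S = smooth_repD[OF \<pi>] and A = aug_submodule[OF \<pi> U]
  case (mult t g)
  have g: "g \<in> Fpts H" using generated_Fpts[OF H U mult.hyps(2)] .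
  have t: "t \<in> Fpts H" using mult.hyps U by blast
  have gx: "act \<pi> g x \<in> carrier \<pi>" using S(2)[OF g x] .
  have "act \<pi> (t ** g) x \<ominus>\<^bsub>\<pi>\<^esub> x = (act \<pi> t (act \<pi> g x) \<ominus>\<^bsub>\<pi>\<^esub> act \<pi> g x) \<oplus>\<^bsub>\<pi>\<^esub> (act \<pi> g x \<ominus>\<^bsub>\<pi>\<^esub> x)"
    using complex_module_minus(7)[OF S(1) S(2)[OF t gx] gx x] S(6)[OF t g x] by simp
  then show ?case using submodule_complexD(3)[OF A(1) A(2)[OF mult.hyps(1) gx] mult.IH] by simp
qed

text \<open>The group generated by \<open>T\<close> is bounded, hence has finite orbits, and it acts on the union of the orbits
  of \<open>Z\<close> through a finite group. The sum over representatives of this finite group is a multiple of the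
  average over it, so it does not distinguish \<open>z\<close> from \<open>u z\<close>.\<close>

lemma exists_balanced_family:
  fixes H P :: "('f::field alg_closure^'n^'n) set" and \<pi> :: "('f^'n^'n, 'v) rep"
  assumes v: "nonarch_local_field v" and H: "alg_group H" and \<pi>: "smooth_rep v H \<pi>"
    and P: "alg_group P" "P \<subseteq> H" and T: "finite T" "T \<subseteq> Fpts (unip_radical P)" and Z: "finite Z" "Z \<subseteq> carrier \<pi>"
  shows "\<exists>(m::nat) \<gamma>. 0 < m \<and> (\<forall>p<m. \<gamma> p \<in> generated (Fpts (unip_radical P))) \<and>
    (\<forall>u\<in>T. \<forall>z\<in>Z. finsum \<pi> (\<lambda>p. act \<pi> (\<gamma> p) (act \<pi> u z)) {..<m} = finsum \<pi> (\<lambda>p. act \<pi> (\<gamma> p) z) {..<m})"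
proof -
  note S = smooth_repD[OF \<pi>] and HF = FptsD[OF H]
  interpret M: Module.module \<CC> \<pi> by (rule S(1))
  define T' where "T' = T \<union> matrix_inv ` T"
  have radP: "Fpts (unip_radical P) \<subseteq> Fpts P" by (rule unip_radical_Fpts(1)[OF P(1)])
  have PH: "Fpts P \<subseteq> Fpts H" using P(2) by (auto simp: Fpts_def)
  have inv_ble: "invertible t" if "t \<in> Fpts (unip_radical P)" for t using that radP PH HF(4) by blast
  have T': "finite T'" "T' \<subseteq> Fpts (unip_radical P)"
    using T unip_radical_Fpts(2)[OF P(1)] by (auto simp: T'_def)
  have T'_inv: "matrix_inv t \<in> T'" if "t \<in> T'" for t
    using that T(2) inv_ble matrix_inv_matrix_inv by (fastforce simp: T'_def)
  define \<Gamma> where "\<Gamma> = generated T'"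
  have T'H: "T' \<subseteq> Fpts H" using T'(2) radP PH by blast
  have \<Gamma>H: "\<Gamma> \<subseteq> Fpts H" using generated_Fpts[OF H T'H] by (auto simp: \<Gamma>_def)
  have \<Gamma>_inv: "matrix_inv g \<in> \<Gamma>" if "g \<in> \<Gamma>" for g
    using generated_inverse(2)[of T' g] T'_inv T'(2) inv_ble that by (auto simp: \<Gamma>_def)
  have \<Gamma>_mult: "g ** h \<in> \<Gamma>" if "g \<in> \<Gamma>" "h \<in> \<Gamma>" for g h using that generated_mult by (simp add: \<Gamma>_def)
  have "\<exists>C. \<forall>g\<in>\<Gamma>. \<forall>i j. v (g $ i $ j) \<le> C"
    unfolding \<Gamma>_def by (rule generated_bounded[OF v T'(1)]) (rule unip_radical_nilpotent[OF P(1) T'])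
  then obtain C where C: "\<And>g i j. g \<in> \<Gamma> \<Longrightarrow> v (g $ i $ j) \<le> C" by blast
  define \<Omega> where "\<Omega> = (\<Union>z\<in>Z. (\<lambda>g. act \<pi> g z) ` \<Gamma>)"
  have fin_\<Omega>: "finite \<Omega>" unfolding \<Omega>_def
    using Z finite_orbit[OF v H \<pi> _ \<Gamma>H \<Gamma>_inv C] by auto
  have \<Omega>_car: "\<Omega> \<subseteq> carrier \<pi>" using Z(2) \<Gamma>H S(2) by (auto simp: \<Omega>_def)
  have one_\<Gamma>: "mat 1 \<in> \<Gamma>" by (simp add: \<Gamma>_def generated.one)
  have Z\<Omega>: "Z \<subseteq> \<Omega>"
  proof
    fix z assume z: "z \<in> Z"
    then have "z = act \<pi> (mat 1) z" using S(5) Z(2) by auto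
    then show "z \<in> \<Omega>" using z one_\<Gamma> unfolding \<Omega>_def by blast
  qed
  have \<Omega>_inv: "act \<pi> g w \<in> \<Omega>" if g: "g \<in> \<Gamma>" and w: "w \<in> \<Omega>" for g w
  proof -
    obtain z h where z: "z \<in> Z" "h \<in> \<Gamma>" "w = act \<pi> h z" using w by (auto simp: \<Omega>_def)
    then have "g \<in> Fpts H" "h \<in> Fpts H" "z \<in> carrier \<pi>" using g \<Gamma>H Z(2) by blast+
    then have "act \<pi> g w = act \<pi> (g ** h) z" using S(6)[of g h z] z(3) by simp
    then show ?thesis using z \<Gamma>_mult[OF g z(2)] unfolding \<Omega>_def by blast
  qed
  \<comment> \<open>The group acts on the finite set \<open>\<Omega>\<close> through a finite group; \<open>\<gamma>\<close> lists representatives.\<close>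
  define \<Phi> where "\<Phi> = (\<lambda>g. restrict (act \<pi> g) \<Omega>) ` \<Gamma>"
  have "\<Phi> \<subseteq> \<Omega> \<rightarrow>\<^sub>E \<Omega>" using \<Omega>_inv by (auto simp: \<Phi>_def)
  then have fin_\<Phi>: "finite \<Phi>" using finite_PiE[OF fin_\<Omega>, of "\<lambda>_. \<Omega>"] fin_\<Omega> finite_subset by blast
  obtain e where e: "bij_betw e {..<card \<Phi>} \<Phi>"
    using ex_bij_betw_nat_finite[OF fin_\<Phi>] by (auto simp: atLeast0LessThan)
  have e_mem: "e p \<in> \<Phi>" if "p < card \<Phi>" for p using e that by (auto simp: bij_betw_def)
  then have "\<forall>p\<in>{..<card \<Phi>}. \<exists>g. g \<in> \<Gamma> \<and> e p = restrict (act \<pi> g) \<Omega>" by (fastforce simp: \<Phi>_def)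
  from bchoice[OF this] obtain \<gamma> where \<gamma>0: "\<forall>p\<in>{..<card \<Phi>}. \<gamma> p \<in> \<Gamma> \<and> e p = restrict (act \<pi> (\<gamma> p)) \<Omega>" by (elim exE)
  then have \<gamma>: "\<gamma> p \<in> \<Gamma>" "e p = restrict (act \<pi> (\<gamma> p)) \<Omega>" if "p < card \<Phi>" for p using that by auto
  have \<Phi>_car: "(\<lambda>f. f w) \<in> \<Phi> \<rightarrow> carrier \<pi>" if "w \<in> \<Omega>" for w
    using that \<Omega>_inv \<Omega>_car by (auto simp: \<Phi>_def)
  have sum_eq: "finsum \<pi> (\<lambda>p. act \<pi> (\<gamma> p) w) {..<card \<Phi>} = finsum \<pi> (\<lambda>f. f w) \<Phi>" if w: "w \<in> \<Omega>" for w
  proof -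
    have "finsum \<pi> (\<lambda>f. f w) (e ` {..<card \<Phi>}) = finsum \<pi> (\<lambda>p. e p w) {..<card \<Phi>}"
      using e \<Phi>_car[OF w] by (intro M.finsum_reindex) (auto simp: bij_betw_def)
    moreover have "finsum \<pi> (\<lambda>p. e p w) {..<card \<Phi>} = finsum \<pi> (\<lambda>p. act \<pi> (\<gamma> p) w) {..<card \<Phi>}"
      using \<gamma> w \<Omega>_inv \<Omega>_car by (intro M.finsum_cong') auto
    ultimately show ?thesis using e by (simp add: bij_betw_def)
  qed
  have bal: "finsum \<pi> (\<lambda>f. f (act \<pi> u w)) \<Phi> = finsum \<pi> (\<lambda>f. f w) \<Phi>" if u: "u \<in> \<Gamma>" and w: "w \<in> \<Omega>" for u w
  proof -
    define h where "h f = restrict (\<lambda>x. f (act \<pi> u x)) \<Omega>" for f :: "'v \<Rightarrow> 'v"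
    have h_mem: "h f \<in> \<Phi>" if f: "f \<in> \<Phi>" for f
    proof -
      obtain g where g: "g \<in> \<Gamma>" "f = restrict (act \<pi> g) \<Omega>" using f by (auto simp: \<Phi>_def)
      have "h f = restrict (act \<pi> (g ** u)) \<Omega>"
        using S(6)[OF subsetD[OF \<Gamma>H g(1)] subsetD[OF \<Gamma>H u] subsetD[OF \<Omega>_car]] \<Omega>_inv[OF u]
        by (auto simp: h_def g(2) intro!: restrict_ext)
      then show ?thesis using \<Gamma>_mult[OF g(1) u] by (auto simp: \<Phi>_def)
    qed
    have h_inj: "inj_on h \<Phi>"
    proof (rule inj_onI)
      fix f f' assume f: "f \<in> \<Phi>" "f' \<in> \<Phi>" "h f = h f'"
      have "f x = f' x" if x: "x \<in> \<Omega>" for x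
      proof -
        have y: "act \<pi> (matrix_inv u) x \<in> \<Omega>" using \<Omega>_inv[OF \<Gamma>_inv[OF u] x] .
        have "h f (act \<pi> (matrix_inv u) x) = h f' (act \<pi> (matrix_inv u) x)" using f(3) by simp
        then show ?thesis using y smooth_rep_inverse(2)[OF \<pi> H subsetD[OF \<Gamma>H u] subsetD[OF \<Omega>_car x]] by (simp add: h_def)
      qed
      then show "f = f'" using f(1,2) by (auto simp: \<Phi>_def fun_eq_iff)
    qed
    have "h ` \<Phi> = \<Phi>" using h_mem h_inj fin_\<Phi> by (intro endo_inj_surj) auto
    then have "finsum \<pi> (\<lambda>f. f w) \<Phi> = finsum \<pi> (\<lambda>f. f w) (h ` \<Phi>)" by simp
    also have "\<dots> = finsum \<pi> (\<lambda>f. h f w) \<Phi>"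
      using h_inj \<Phi>_car[OF w] h_mem by (intro M.finsum_reindex) auto
    also have "\<dots> = finsum \<pi> (\<lambda>f. f (act \<pi> u w)) \<Phi>" using w by (simp add: h_def)
    finally show ?thesis by simp
  qed
  show ?thesis
  proof (intro exI conjI ballI allI impI)
    show "0 < card \<Phi>" using fin_\<Phi> one_\<Gamma> by (auto simp: card_gt_0_iff \<Phi>_def)
    show "\<gamma> p \<in> generated (Fpts (unip_radical P))" if "p < card \<Phi>" for p
      using \<gamma>(1)[OF that] generated_mono[OF T'(2)] by (simp add: \<Gamma>_def)
    fix u z assume u: "u \<in> T" and z: "z \<in> Z"
    have u\<Gamma>: "u \<in> \<Gamma>" using u generated_base[of u T'] by (simp add: \<Gamma>_def T'_def)
    have z\<Omega>: "z \<in> \<Omega>" using z Z\<Omega> by blast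
    show "finsum \<pi> (\<lambda>p. act \<pi> (\<gamma> p) (act \<pi> u z)) {..<card \<Phi>} = finsum \<pi> (\<lambda>p. act \<pi> (\<gamma> p) z) {..<card \<Phi>}"
      using sum_eq[OF z\<Omega>] sum_eq[OF \<Omega>_inv[OF u\<Gamma> z\<Omega>]] bal[OF u\<Gamma> z\<Omega>] by simp
  qed
qed

text \<open>Exactness of the coinvariants. An element \<open>x\<close> of \<open>aug\<close> is a combination of finitely many vectors
  \<open>u z - z\<close>, so the sum over a family balanced for these \<open>u\<close> and \<open>z\<close> kills \<open>x\<close>. On the other hand, a vector of
  \<open>W\<close> is changed by elements of \<open>U(F)\<close> only by the augmentation of \<open>W\<close>, so the sum over \<open>m\<close> elements multiplies
  it by \<open>m\<close> modulo this augmentation.\<close>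

lemma aug_restrict:
  fixes H P :: "('f::field alg_closure^'n^'n) set" and \<pi> :: "('f^'n^'n, 'v) rep"
  assumes v: "nonarch_local_field v" and H: "alg_group H" and \<pi>: "smooth_rep v H \<pi>"
    and P: "alg_group P" "P \<subseteq> H" and W: "subrep H \<pi> W" and x: "x \<in> W" "x \<in> aug (unip_radical P) \<pi>"
  shows "x \<in> aug (unip_radical P) (\<pi>\<lparr>carrier := W\<rparr>)"
proof -
  note S = smooth_repD[OF \<pi>] and HF = FptsD[OF H]
  interpret M: Module.module \<CC> \<pi> by (rule S(1))
  note L = complex_module_laws[OF S(1)] and C = complex_module_closed[OF S(1)]
  define U where "U = unip_radical P"
  have UH: "Fpts U \<subseteq> Fpts H"
    using unip_radical_Fpts(1)[OF P(1)] P(2) by (auto simp: U_def Fpts_def)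
  \<comment> \<open>\<open>K\<close> consists of the vectors that are killed by all families balanced for suitable finite sets
    \<open>T\<close> and \<open>Z\<close>. It is a submodule that contains all \<open>u y - y\<close>, hence it contains
    \<open>aug\<close>.\<close>
  define avg where "avg m \<gamma> y = finsum \<pi> (\<lambda>p. act \<pi> (\<gamma> p) y) {..<m}" for m :: nat and \<gamma> y
  define kills where "kills T Z y \<longleftrightarrow> (\<forall>m \<gamma>. (\<forall>p<m. \<gamma> p \<in> Fpts H) \<and> (\<forall>u\<in>T. \<forall>z\<in>Z. avg m \<gamma> (act \<pi> u z) = avg m \<gamma> z) \<longrightarrow>
      avg m \<gamma> y = \<zero>\<^bsub>\<pi>\<^esub>)" for T Z y
  define K where "K = {y \<in> carrier \<pi>. \<exists>T Z. finite T \<and> T \<subseteq> Fpts U \<and> finite Z \<and> Z \<subseteq> carrier \<pi> \<and> kills T Z y}"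
  have avg_add: "avg m \<gamma> (y \<oplus>\<^bsub>\<pi>\<^esub> z) = avg m \<gamma> y \<oplus>\<^bsub>\<pi>\<^esub> avg m \<gamma> z"
    if "\<forall>p<m. \<gamma> p \<in> Fpts H" "y \<in> carrier \<pi>" "z \<in> carrier \<pi>" for m \<gamma> y z
  proof -
    have "avg m \<gamma> (y \<oplus>\<^bsub>\<pi>\<^esub> z) = finsum \<pi> (\<lambda>p. act \<pi> (\<gamma> p) y \<oplus>\<^bsub>\<pi>\<^esub> act \<pi> (\<gamma> p) z) {..<m}"
      unfolding avg_def using that S(2,3) by (intro M.finsum_cong') auto
    also have "\<dots> = avg m \<gamma> y \<oplus>\<^bsub>\<pi>\<^esub> avg m \<gamma> z" unfolding avg_def using that S(2) by (intro M.finsum_addf) auto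
    finally show ?thesis .
  qed
  have avg_smult: "avg m \<gamma> (c \<odot>\<^bsub>\<pi>\<^esub> y) = c \<odot>\<^bsub>\<pi>\<^esub> avg m \<gamma> y"
    if "\<forall>p<m. \<gamma> p \<in> Fpts H" "y \<in> carrier \<pi>" for m \<gamma> y c
  proof -
    have "avg m \<gamma> (c \<odot>\<^bsub>\<pi>\<^esub> y) = finsum \<pi> (\<lambda>p. c \<odot>\<^bsub>\<pi>\<^esub> act \<pi> (\<gamma> p) y) {..<m}"
      unfolding avg_def using that S(2,4) by (intro M.finsum_cong') auto
    also have "\<dots> = c \<odot>\<^bsub>\<pi>\<^esub> avg m \<gamma> y" unfolding avg_def using that S(2)
      by (intro M.finsum_smult_ldistr[symmetric]) auto
    finally show ?thesis .
  qed
  have avg_car: "avg m \<gamma> y \<in> carrier \<pi>" if "\<forall>p<m. \<gamma> p \<in> Fpts H" "y \<in> carrier \<pi>" for m \<gamma> y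
    unfolding avg_def using that S(2) by (intro M.finsum_closed) auto
  have "submodule K \<CC> \<pi>"
  proof (rule submodule_complexI[OF S(1)])
    show "K \<subseteq> carrier \<pi>" by (auto simp: K_def)
    have "kills {} {} \<zero>\<^bsub>\<pi>\<^esub>" unfolding kills_def
    proof (intro allI impI)
      fix m and \<gamma> assume a: "(\<forall>p<m. \<gamma> p \<in> Fpts H) \<and> (\<forall>u\<in>{}. \<forall>z\<in>{}. avg m \<gamma> (act \<pi> u z) = avg m \<gamma> z)"
      then have "avg m \<gamma> (0 \<odot>\<^bsub>\<pi>\<^esub> \<zero>\<^bsub>\<pi>\<^esub>) = 0 \<odot>\<^bsub>\<pi>\<^esub> avg m \<gamma> \<zero>\<^bsub>\<pi>\<^esub>" using C(1) by (intro avg_smult) auto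
      then show "avg m \<gamma> \<zero>\<^bsub>\<pi>\<^esub> = \<zero>\<^bsub>\<pi>\<^esub>" using L(10)[OF C(1)] L(10)[OF avg_car, of m \<gamma> "\<zero>\<^bsub>\<pi>\<^esub>"] a C(1) by simp
    qed
    then show "\<zero>\<^bsub>\<pi>\<^esub> \<in> K" using C(1) unfolding K_def by blast
    fix y assume "y \<in> K"
    then obtain T Z where TZ: "y \<in> carrier \<pi>" "finite T" "T \<subseteq> Fpts U" "finite Z" "Z \<subseteq> carrier \<pi>" "kills T Z y"
      by (auto simp: K_def)
    {
      fix z assume "z \<in> K"
      then obtain T' Z' where TZ': "z \<in> carrier \<pi>" "finite T'" "T' \<subseteq> Fpts U" "finite Z'" "Z' \<subseteq> carrier \<pi>" "kills T' Z' z"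
        by (auto simp: K_def)
      have "kills (T \<union> T') (Z \<union> Z') (y \<oplus>\<^bsub>\<pi>\<^esub> z)" unfolding kills_def
      proof (intro allI impI)
        fix m and \<gamma> assume a: "(\<forall>p<m. \<gamma> p \<in> Fpts H) \<and> (\<forall>u\<in>T \<union> T'. \<forall>w\<in>Z \<union> Z'. avg m \<gamma> (act \<pi> u w) = avg m \<gamma> w)"
        then have "avg m \<gamma> y = \<zero>\<^bsub>\<pi>\<^esub>" "avg m \<gamma> z = \<zero>\<^bsub>\<pi>\<^esub>" using TZ(6) TZ'(6) unfolding kills_def by simp_all
        then show "avg m \<gamma> (y \<oplus>\<^bsub>\<pi>\<^esub> z) = \<zero>\<^bsub>\<pi>\<^esub>" using avg_add[of m \<gamma> y z] a TZ(1) TZ'(1) L(1)[OF C(1)] by simp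
      qed
      then show "y \<oplus>\<^bsub>\<pi>\<^esub> z \<in> K" using TZ TZ' C(2) unfolding K_def
        by (intro CollectI conjI exI[of _ "T \<union> T'"] exI[of _ "Z \<union> Z'"]) auto
    }
    fix c
    have "kills T Z (c \<odot>\<^bsub>\<pi>\<^esub> y)" unfolding kills_def
    proof (intro allI impI)
      fix m and \<gamma> assume a: "(\<forall>p<m. \<gamma> p \<in> Fpts H) \<and> (\<forall>u\<in>T. \<forall>w\<in>Z. avg m \<gamma> (act \<pi> u w) = avg m \<gamma> w)"
      then have "avg m \<gamma> y = \<zero>\<^bsub>\<pi>\<^esub>" using TZ(6) unfolding kills_def by simp
      then show "avg m \<gamma> (c \<odot>\<^bsub>\<pi>\<^esub> y) = \<zero>\<^bsub>\<pi>\<^esub>" using avg_smult[of m \<gamma> y c] a TZ(1) L(11) by simp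
    qed
    then show "c \<odot>\<^bsub>\<pi>\<^esub> y \<in> K" using TZ C(3) unfolding K_def
      by (intro CollectI conjI exI[of _ T] exI[of _ Z]) auto
  qed
  moreover have "act \<pi> u y \<ominus>\<^bsub>\<pi>\<^esub> y \<in> K" if u: "u \<in> Fpts U" and y: "y \<in> carrier \<pi>" for u y
  proof -
    have uy: "act \<pi> u y \<in> carrier \<pi>" using S(2) u UH y by blast
    have "kills {u} {y} (act \<pi> u y \<ominus>\<^bsub>\<pi>\<^esub> y)" unfolding kills_def
    proof (intro allI impI)
      fix m and \<gamma> assume a: "(\<forall>p<m. \<gamma> p \<in> Fpts H) \<and> (\<forall>u'\<in>{u}. \<forall>w\<in>{y}. avg m \<gamma> (act \<pi> u' w) = avg m \<gamma> w)"
      then show "avg m \<gamma> (act \<pi> u y \<ominus>\<^bsub>\<pi>\<^esub> y) = \<zero>\<^bsub>\<pi>\<^esub>"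
        using avg_add[of m \<gamma> "act \<pi> u y" "(-1) \<odot>\<^bsub>\<pi>\<^esub> y"] avg_smult[of m \<gamma> y "-1"] uy y C(3)[OF y] L(12)[OF uy y]
          L(13)[OF avg_car, of m \<gamma> y] by simp
    qed
    then show ?thesis using u y uy complex_module_minus(1)[OF S(1) uy y] unfolding K_def
      by (intro CollectI conjI exI[of _ "{u}"] exI[of _ "{y}"]) auto
  qed
  ultimately have "aug U \<pi> \<subseteq> K" by (rule aug_least)
  then have "x \<in> K" using x(2) by (auto simp: U_def)
  then obtain T Z where TZ: "x \<in> carrier \<pi>" "finite T" "T \<subseteq> Fpts U" "finite Z" "Z \<subseteq> carrier \<pi>" "kills T Z x"
    by (auto simp: K_def)
  from exists_balanced_family[OF v H \<pi> P TZ(2) TZ(3)[unfolded U_def] TZ(4,5)] obtain m :: nat and \<gamma> where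
    m: "0 < m" and \<gamma>: "\<forall>p<m. \<gamma> p \<in> generated (Fpts U)"
    and bal: "\<forall>u\<in>T. \<forall>z\<in>Z. avg m \<gamma> (act \<pi> u z) = avg m \<gamma> z" unfolding avg_def U_def by blast
  have \<gamma>H: "\<forall>p<m. \<gamma> p \<in> Fpts H" using \<gamma> generated_Fpts[OF H UH] by blast
  then have avg0: "avg m \<gamma> x = \<zero>\<^bsub>\<pi>\<^esub>" using TZ(6) bal unfolding kills_def by blast
  define A where "A = aug U (\<pi>\<lparr>carrier := W\<rparr>)"
  have W1: "submodule W \<CC> \<pi>" using subrepD(1)[OF W] .
  have sW: "smooth_rep v H (\<pi>\<lparr>carrier := W\<rparr>)" by (rule smooth_rep_subrep[OF \<pi> W])
  have A: "submodule A \<CC> \<pi>"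
    using aug_submodule(1)[OF sW UH] submodule_restrict_iff[OF S(1) W1] by (simp add: A_def)
  note A' = submodule_complexD[OF A]
  have gen: "act \<pi> g x \<ominus>\<^bsub>\<pi>\<^esub> x \<in> A" if g: "g \<in> generated (Fpts U)" for g
  proof -
    have gx: "act \<pi> g x \<in> W" using subrepD(2)[OF W generated_Fpts[OF H UH g] x(1)] .
    have "act \<pi> g x \<ominus>\<^bsub>\<pi>\<lparr>carrier := W\<rparr>\<^esub> x \<in> A"
      using aug_generated[OF sW H UH g] x(1) by (simp add: A_def)
    then show ?thesis
      using complex_module_laws(12)[OF smooth_repD(1)[OF sW]] L(12) gx x(1) submodule_complexD(1)[OF W1] by (simp add: subset_eq)
  qed
  \<comment> \<open>Modulo \<open>A\<close> each of the first \<open>k\<close> summands equals \<open>x\<close>.\<close>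
  have "finsum \<pi> (\<lambda>p. act \<pi> (\<gamma> p) x) {..<k} \<ominus>\<^bsub>\<pi>\<^esub> of_nat k \<odot>\<^bsub>\<pi>\<^esub> x \<in> A" if "k \<le> m" for k
    using that
  proof (induction k)
    case 0
    then show ?case using A'(2) L(10,12,13) TZ(1) C(1) complex_module_minus(4)[OF S(1) C(1)] by simp
  next
    case (Suc k)
    let ?s = "finsum \<pi> (\<lambda>p. act \<pi> (\<gamma> p) x) {..<k}"
    have gk: "act \<pi> (\<gamma> k) x \<in> carrier \<pi>" using S(2) \<gamma>H Suc.prems TZ(1) by auto
    have s: "?s \<in> carrier \<pi>" using S(2) \<gamma>H Suc.prems TZ(1) by (intro M.finsum_closed) auto
    have "finsum \<pi> (\<lambda>p. act \<pi> (\<gamma> p) x) {..<Suc k} = act \<pi> (\<gamma> k) x \<oplus>\<^bsub>\<pi>\<^esub> ?s"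
      unfolding lessThan_Suc using S(2) \<gamma>H Suc.prems TZ(1) gk by (intro M.finsum_insert) auto
    moreover have "(of_nat (Suc k) :: complex) \<odot>\<^bsub>\<pi>\<^esub> x = x \<oplus>\<^bsub>\<pi>\<^esub> of_nat k \<odot>\<^bsub>\<pi>\<^esub> x"
      using L(6)[OF TZ(1), of 1 "of_nat k"] L(9)[OF TZ(1)] by simp
    ultimately have "finsum \<pi> (\<lambda>p. act \<pi> (\<gamma> p) x) {..<Suc k} \<ominus>\<^bsub>\<pi>\<^esub> of_nat (Suc k) \<odot>\<^bsub>\<pi>\<^esub> x =
        (act \<pi> (\<gamma> k) x \<ominus>\<^bsub>\<pi>\<^esub> x) \<oplus>\<^bsub>\<pi>\<^esub> (?s \<ominus>\<^bsub>\<pi>\<^esub> of_nat k \<odot>\<^bsub>\<pi>\<^esub> x)"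
      using complex_module_minus(9)[OF S(1) gk s TZ(1) C(3)[OF TZ(1)]] by simp
    then show ?case using A'(3) gen \<gamma> Suc by simp
  qed
  from this[of m] have "\<zero>\<^bsub>\<pi>\<^esub> \<ominus>\<^bsub>\<pi>\<^esub> of_nat m \<odot>\<^bsub>\<pi>\<^esub> x \<in> A" using avg0 by (simp add: avg_def)
  then have "(- 1 / of_nat m) \<odot>\<^bsub>\<pi>\<^esub> (\<zero>\<^bsub>\<pi>\<^esub> \<ominus>\<^bsub>\<pi>\<^esub> of_nat m \<odot>\<^bsub>\<pi>\<^esub> x) \<in> A" by (rule A'(4))
  moreover have "(- 1 / of_nat m) \<odot>\<^bsub>\<pi>\<^esub> (\<zero>\<^bsub>\<pi>\<^esub> \<ominus>\<^bsub>\<pi>\<^esub> of_nat m \<odot>\<^bsub>\<pi>\<^esub> x) = x"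
    using m TZ(1) C L(1,7,8,9,11,12) by simp
  ultimately show ?thesis by (simp add: A_def U_def)
qed

text \<open>The augmentation of a subrepresentation \<open>W\<close> is all of \<open>W\<close> by exactness, and it maps into the
  augmentation of every quotient of \<open>W\<close>.\<close>

lemma supercuspidal_subquot:
  fixes H :: "('f::field alg_closure^'n^'n) set" and \<pi> :: "('f^'n^'n, 'v) rep"
  assumes v: "nonarch_local_field v" and H: "alg_group H" and sc: "supercuspidal v H \<pi>"
    and W: "subrep H \<pi> W" "subrep H \<pi> W'" "W' \<subseteq> W" and irr: "irreducible_rep H (subquot \<pi> W W')"
  shows "supercuspidal v H (subquot \<pi> W W')"
  unfolding supercuspidal_def
proof (intro conjI allI impI)
  have \<pi>: "smooth_rep v H \<pi>" using sc by (simp add: supercuspidal_def R_cat_def)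
  define \<sigma> where "\<sigma> = \<pi>\<lparr>carrier := W\<rparr>"
  have \<sigma>: "smooth_rep v H \<sigma>" using smooth_rep_subrep[OF \<pi> W(1)] by (simp add: \<sigma>_def)
  note S = smooth_repD[OF \<sigma>]
  have W': "subrep H \<sigma> W'" using subrep_restrict_iff[OF smooth_repD(1)[OF \<pi>] W(1)] W(2,3) by (simp add: \<sigma>_def)
  have \<tau>: "smooth_rep v H (quot \<sigma> W')" by (rule smooth_rep_quot[OF v H \<sigma> W'])
  then show "R_cat v H (subquot \<pi> W W')" using irreducible_imp_finite_length[OF \<tau>] irr by (simp add: R_cat_def \<sigma>_def)
  fix P assume P: "parabolic_F H P \<and> P \<noteq> H"
  then have P1: "alg_group P" "P \<subseteq> H" by (auto simp: parabolic_F_def F_group_def)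
  let ?U = "unip_radical P"
  have UH: "Fpts ?U \<subseteq> Fpts H" using unip_radical_Fpts(1)[OF P1(1)] P1(2) by (auto simp: Fpts_def)
  note q = quot_simps[OF S(1) subrepD(1)[OF W']] and qa = quot_act[OF \<sigma> W']
  note A = aug_submodule[OF \<tau> UH] and C = complex_module_closed[OF S(1)]
  define Q where "Q = {x \<in> carrier \<sigma>. W' +>\<^bsub>\<sigma>\<^esub> x \<in> aug ?U (quot \<sigma> W')}"
  have "submodule Q \<CC> \<sigma>"
  proof (rule submodule_complexI[OF S(1)])
    note A' = submodule_complexD[OF A(1)]
    show "Q \<subseteq> carrier \<sigma>" by (auto simp: Q_def)
    show "\<zero>\<^bsub>\<sigma>\<^esub> \<in> Q" using A'(2) C(1) q(2) by (simp add: Q_def)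
    show "x \<oplus>\<^bsub>\<sigma>\<^esub> y \<in> Q" if "x \<in> Q" "y \<in> Q" for x y
      using that A'(3)[of "W' +>\<^bsub>\<sigma>\<^esub> x" "W' +>\<^bsub>\<sigma>\<^esub> y"] C(2) q(3)[of x y] by (simp add: Q_def)
    show "c \<odot>\<^bsub>\<sigma>\<^esub> x \<in> Q" if "x \<in> Q" for c x
      using that A'(4)[of "W' +>\<^bsub>\<sigma>\<^esub> x" c] C(3) q(4)[of x c] by (simp add: Q_def)
  qed
  moreover have "act \<sigma> u x \<ominus>\<^bsub>\<sigma>\<^esub> x \<in> Q" if u: "u \<in> Fpts ?U" and x: "x \<in> carrier \<sigma>" for u x
  proof -
    have uH: "u \<in> Fpts H" using u UH by blast
    have ux: "act \<sigma> u x \<in> carrier \<sigma>" using S(2)[OF uH x] .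
    have "W' +>\<^bsub>\<sigma>\<^esub> x \<in> carrier (quot \<sigma> W')" using x q(1) by blast
    from A(2)[OF u this] have "W' +>\<^bsub>\<sigma>\<^esub> (act \<sigma> u x \<ominus>\<^bsub>\<sigma>\<^esub> x) \<in> aug ?U (quot \<sigma> W')"
      using qa[OF uH x] quot_minus[OF S(1) subrepD(1)[OF W'] ux x] by simp
    then show ?thesis using complex_module_minus(1)[OF S(1) ux x] by (simp add: Q_def)
  qed
  ultimately have "aug ?U \<sigma> \<subseteq> Q" by (rule aug_least)
  moreover have "W \<subseteq> aug ?U \<sigma>"
  proof
    fix x assume x: "x \<in> W"
    have "aug ?U \<pi> = carrier \<pi>" using sc P by (simp add: supercuspidal_def)
    then have "x \<in> aug ?U \<pi>" using x submodule_complexD(1)[OF subrepD(1)[OF W(1)]] by blast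
    then show "x \<in> aug ?U \<sigma>" using aug_restrict[OF v H \<pi> P1 W(1) x] by (simp add: \<sigma>_def)
  qed
  ultimately have "W \<subseteq> Q" by blast
  then have "carrier (quot \<sigma> W') \<subseteq> aug ?U (quot \<sigma> W')" unfolding q(1) by (auto simp: Q_def \<sigma>_def)
  then show "aug ?U (subquot \<pi> W W') = carrier (subquot \<pi> W W')"
    using submodule_complexD(1)[OF A(1)] by (simp add: \<sigma>_def subset_antisym)
qed

section \<open>Polynomial functions and Lie algebras\<close>

lemma polyfun_sum:
  assumes "0 \<in> R" "finite I" "\<And>i. i \<in> I \<Longrightarrow> f i \<in> polyfun R"
  shows "(\<lambda>A. \<Sum>i\<in>I. f i A) \<in> polyfun R"
  using assms(2,3) by (induction I rule: finite_induct) (auto intro: polyfun.const polyfun.add assms(1))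

lemma polyfun_prod:
  assumes "1 \<in> R" "finite I" "\<And>i. i \<in> I \<Longrightarrow> f i \<in> polyfun R"
  shows "(\<lambda>A. \<Prod>i\<in>I. f i A) \<in> polyfun R"
  using assms(2,3) by (induction I rule: finite_induct) (auto intro: polyfun.const polyfun.mult assms(1))

lemma polyfun_mult_entry:
  fixes g h :: "'k::field^'n^'n"
  assumes "0 \<in> R" "\<And>i j. g $ i $ j \<in> R" "\<And>i j. h $ i $ j \<in> R"
  shows "(\<lambda>A. (g ** A ** h) $ i $ j) \<in> polyfun R"
proof -
  have "(\<lambda>A. \<Sum>l\<in>UNIV. (\<Sum>k\<in>UNIV. g $ i $ k * A $ k $ l) * h $ l $ j) \<in> polyfun R"
    using assms by (intro polyfun_sum polyfun.mult polyfun.const polyfun.entry) auto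
  then show ?thesis by (simp add: matrix_matrix_mult_def)
qed

lemma polyfun_subst:
  fixes g h :: "'k::field^'n^'n"
  assumes "0 \<in> R" "\<And>i j. g $ i $ j \<in> R" "\<And>i j. h $ i $ j \<in> R" "p \<in> polyfun R"
  shows "(\<lambda>A. p (g ** A ** h)) \<in> polyfun R"
  using assms(4)
proof (induction p rule: polyfun.induct)
  case (entry i j)
  then show ?case by (rule polyfun_mult_entry[OF assms(1-3)])
next
  case (const c)
  then show ?case by (rule polyfun.const)
next
  case (add p q)
  from add.IH show ?case by (rule polyfun.add)
next
  case (mult p q)
  from mult.IH show ?case by (rule polyfun.mult)
qed

lemma infinite_alg_closure:
  assumes v: "nonarch_local_field (v :: 'f::field \<Rightarrow> real)"
  shows "infinite (UNIV :: 'f alg_closure set)"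
proof
  assume fin: "finite (UNIV :: 'f alg_closure set)"
  have "finite (UNIV :: 'f set)"
    by (rule finite_imageD[OF finite_subset[OF subset_UNIV fin] inj_to_ac])
  obtain x where x: "x \<noteq> 0" "v x \<noteq> 1" using v by (auto simp: nonarch_local_field_def)
  have vp: "v (x ^ m) = v x ^ m" for m using nonarchD(3,6)[OF v] by (induction m) auto
  have vx: "0 < v x" using nonarchD(1,2)[OF v, of x] x by linarith
  have "inj (\<lambda>m::nat. x ^ m)"
  proof (rule injI)
    fix m k assume "x ^ m = x ^ k"
    then have "v x ^ m = v x ^ k" using vp by metis
    then have "real m * ln (v x) = real k * ln (v x)" using ln_realpow by metis
    moreover have "ln (v x) \<noteq> 0" using vx x(2) by simp
    ultimately show "m = k" by simp
  qed
  then have "finite (UNIV :: nat set)"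
    by (rule finite_imageD[OF finite_subset[OF subset_UNIV \<open>finite (UNIV :: 'f set)\<close>]])
  then show False by simp
qed

lemma poly_eq_if_infinite:
  fixes p q :: "'k::field poly"
  assumes "infinite (UNIV :: 'k set)" "\<And>t. poly p t = poly q t"
  shows "p = q"
proof (rule ccontr)
  assume "p \<noteq> q"
  then have "finite {t. poly (p - q) t = 0}" by (intro poly_roots_finite) auto
  then show False using assms by simp
qed

text \<open>On the line \<open>1 + t Z\<close> a polynomial function is a polynomial in \<open>t\<close>. Its linear coefficient \<open>l Z\<close> is the
  derivative at \<open>1\<close> in the direction \<open>Z\<close>, so it is linear in \<open>Z\<close>.\<close>

lemma polyfun_derivative:
  assumes "p \<in> polyfun R"
  shows "\<exists>l. (\<forall>Z W. l (Z + W) = l Z + l W) \<and> (\<forall>c Z. l (mscale c Z) = c * l Z) \<and>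
    (\<forall>Z. \<exists>q. (\<forall>t. poly q t = p (mat 1 + mscale t Z)) \<and> poly.coeff q 1 = l Z)"
  using assms
proof (induction p rule: polyfun.induct)
  case (const c)
  have "\<exists>q. (\<forall>t. poly q t = c) \<and> poly.coeff q 1 = 0" by (intro exI[of _ "[:c:]"]) simp
  then show ?case by (intro exI[of _ "\<lambda>_. 0"]) auto
next
  case (entry i j)
  have "\<exists>q. (\<forall>t. poly q t = (mat 1 + mscale t Z) $ i $ j) \<and> poly.coeff q 1 = Z $ i $ j" for Z
    by (intro exI[of _ "[:mat 1 $ i $ j, Z $ i $ j:]"]) (simp add: mscale_nth)
  then show ?case by (intro exI[of _ "\<lambda>Z. Z $ i $ j"]) (auto simp: mscale_nth)
next
  case (add p1 p2)
  then obtain l1 l2 where l1: "\<forall>Z W. l1 (Z + W) = l1 Z + l1 W" "\<forall>c Z. l1 (mscale c Z) = c * l1 Z"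
      "\<forall>Z. \<exists>q. (\<forall>t. poly q t = p1 (mat 1 + mscale t Z)) \<and> poly.coeff q 1 = l1 Z"
    and l2: "\<forall>Z W. l2 (Z + W) = l2 Z + l2 W" "\<forall>c Z. l2 (mscale c Z) = c * l2 Z"
      "\<forall>Z. \<exists>q. (\<forall>t. poly q t = p2 (mat 1 + mscale t Z)) \<and> poly.coeff q 1 = l2 Z" by (elim exE conjE)
  show ?case
  proof (intro exI[of _ "\<lambda>Z. l1 Z + l2 Z"] conjI allI)
    fix Z
    obtain q1 q2 where "\<forall>t. poly q1 t = p1 (mat 1 + mscale t Z)" "poly.coeff q1 1 = l1 Z"
      "\<forall>t. poly q2 t = p2 (mat 1 + mscale t Z)" "poly.coeff q2 1 = l2 Z" using l1(3) l2(3) by meson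
    then show "\<exists>q. (\<forall>t. poly q t = p1 (mat 1 + mscale t Z) + p2 (mat 1 + mscale t Z)) \<and> poly.coeff q 1 = l1 Z + l2 Z"
      by (intro exI[of _ "q1 + q2"]) simp
  qed (simp_all add: l1 l2 algebra_simps)
next
  case (mult p1 p2)
  then obtain l1 l2 where l1: "\<forall>Z W. l1 (Z + W) = l1 Z + l1 W" "\<forall>c Z. l1 (mscale c Z) = c * l1 Z"
      "\<forall>Z. \<exists>q. (\<forall>t. poly q t = p1 (mat 1 + mscale t Z)) \<and> poly.coeff q 1 = l1 Z"
    and l2: "\<forall>Z W. l2 (Z + W) = l2 Z + l2 W" "\<forall>c Z. l2 (mscale c Z) = c * l2 Z"
      "\<forall>Z. \<exists>q. (\<forall>t. poly q t = p2 (mat 1 + mscale t Z)) \<and> poly.coeff q 1 = l2 Z" by (elim exE conjE)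
  show ?case
  proof (intro exI[of _ "\<lambda>Z. p1 (mat 1) * l2 Z + l1 Z * p2 (mat 1)"] conjI allI)
    fix Z
    obtain q1 q2 where q: "\<forall>t. poly q1 t = p1 (mat 1 + mscale t Z)" "poly.coeff q1 1 = l1 Z"
      "\<forall>t. poly q2 t = p2 (mat 1 + mscale t Z)" "poly.coeff q2 1 = l2 Z" using l1(3) l2(3) by meson
    have z: "mscale 0 Z = 0" by (simp add: vec_eq_iff mscale_nth)
    have "poly.coeff q1 0 = p1 (mat 1)" "poly.coeff q2 0 = p2 (mat 1)"
      using spec[OF q(1), of 0] spec[OF q(3), of 0] z by (simp_all add: poly_0_coeff_0)
    then have "poly.coeff (q1 * q2) 1 = p1 (mat 1) * l2 Z + l1 Z * p2 (mat 1)"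
      using q(2,4) by (simp add: Polynomial.coeff_mult)
    then show "\<exists>q. (\<forall>t. poly q t = p1 (mat 1 + mscale t Z) * p2 (mat 1 + mscale t Z)) \<and>
        poly.coeff q 1 = p1 (mat 1) * l2 Z + l1 Z * p2 (mat 1)"
      using q(1,3) by (intro exI[of _ "q1 * q2"]) simp
  qed (simp_all add: l1 l2 algebra_simps)
qed

text \<open>Over an infinite field there is only one polynomial \<open>q\<close> as in the definition of \<open>lie\<close>, so the Lie algebra
  is cut out by the derivatives of the vanishing functions.\<close>

lemma lie_linear_equations:
  fixes H :: "('k::field^'n^'n) set"
  assumes "infinite (UNIV :: 'k set)"
  obtains D where "\<And>p Z W. p \<in> vanishing H \<Longrightarrow> D p (Z + W) = D p Z + D p W"
    "\<And>p c Z. p \<in> vanishing H \<Longrightarrow> D p (mscale c Z) = c * D p Z"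
    "\<And>Z. Z \<in> lie H \<longleftrightarrow> (\<forall>p\<in>vanishing H. D p Z = 0)"
proof -
  have "\<forall>p\<in>vanishing H. \<exists>l. (\<forall>Z W. l (Z + W) = l Z + l W) \<and> (\<forall>c Z. l (mscale c Z) = c * l Z) \<and>
    (\<forall>Z. \<exists>q. (\<forall>t. poly q t = p (mat 1 + mscale t Z)) \<and> poly.coeff q 1 = l Z)"
    using polyfun_derivative by (auto simp: vanishing_def)
  from bchoice[OF this] obtain D where D0: "\<forall>p\<in>vanishing H. (\<forall>Z W. D p (Z + W) = D p Z + D p W) \<and>
    (\<forall>c Z. D p (mscale c Z) = c * D p Z) \<and>
    (\<forall>Z. \<exists>q. (\<forall>t. poly q t = p (mat 1 + mscale t Z)) \<and> poly.coeff q 1 = D p Z)" by (elim exE)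
  have D: "D p (Z + W) = D p Z + D p W" "D p (mscale c Z) = c * D p Z"
    "\<exists>q. (\<forall>t. poly q t = p (mat 1 + mscale t Z)) \<and> poly.coeff q 1 = D p Z" if "p \<in> vanishing H" for p Z W c
    using bspec[OF D0 that] by auto
  have "Z \<in> lie H \<longleftrightarrow> (\<forall>p\<in>vanishing H. D p Z = 0)" for Z
  proof -
    have "(\<forall>q::'k poly. (\<forall>t. poly q t = p (mat 1 + mscale t Z)) \<longrightarrow> poly.coeff q 1 = 0) \<longleftrightarrow> D p Z = 0"
      if p: "p \<in> vanishing H" for p
    proof -
      obtain q where q: "\<forall>t. poly q t = p (mat 1 + mscale t Z)" "poly.coeff q 1 = D p Z" using D(3)[OF p] by blast
      have "q' = q" if "\<forall>t. poly q' t = p (mat 1 + mscale t Z)" for q'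
        using that q(1) by (intro poly_eq_if_infinite[OF assms]) simp
      then show ?thesis using q by metis
    qed
    then show ?thesis unfolding lie_def by auto
  qed
  then show ?thesis using that D(1,2) by blast
qed

lemma lie_subspace:
  fixes H :: "('k::field^'n^'n) set"
  assumes "infinite (UNIV :: 'k set)"
  shows "0 \<in> lie H" "\<And>Z W. Z \<in> lie H \<Longrightarrow> W \<in> lie H \<Longrightarrow> Z + W \<in> lie H" "\<And>c Z. Z \<in> lie H \<Longrightarrow> mscale c Z \<in> lie H"
proof -
  obtain D where D: "\<And>p Z W. p \<in> vanishing H \<Longrightarrow> D p (Z + W) = D p Z + D p W"
    "\<And>p c Z. p \<in> vanishing H \<Longrightarrow> D p (mscale c Z) = c * D p Z"
    "\<And>Z. Z \<in> lie H \<longleftrightarrow> (\<forall>p\<in>vanishing H. D p Z = 0)" using lie_linear_equations[OF assms, of H] by blast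
  have "mscale 0 0 = (0 :: 'k^'n^'n)" by (simp add: vec_eq_iff mscale_nth)
  then have "D p 0 = 0" if "p \<in> vanishing H" for p using D(2)[OF that, of 0 0] by simp
  then show "0 \<in> lie H" by (simp add: D(3))
  show "\<And>Z W. Z \<in> lie H \<Longrightarrow> W \<in> lie H \<Longrightarrow> Z + W \<in> lie H" by (simp add: D)
  show "\<And>c Z. Z \<in> lie H \<Longrightarrow> mscale c Z \<in> lie H" by (simp add: D)
qed

lemma mscale_mult_left: "mscale c A ** B = mscale c (A ** B)"
  by (simp add: matrix_eq mscale_mult_vec matrix_vector_mul_assoc[symmetric])

lemma mscale_mult_right: "A ** mscale c B = mscale c (A ** B)"
  by (simp add: matrix_eq mscale_mult_vec matrix_vector_mul_assoc[symmetric] vector_scalar_commute)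

lemma lie_conj:
  fixes H :: "('k::field^'n^'n) set"
  assumes g: "invertible g" and Z: "Z \<in> lie H"
  shows "g ** Z ** matrix_inv g \<in> lie (conj_set g H)"
  unfolding lie_def
proof (intro CollectI ballI allI impI)
  fix p and q :: "'k poly"
  assume p: "p \<in> vanishing (conj_set g H)" and q: "\<forall>t. poly q t = p (mat 1 + mscale t (g ** Z ** matrix_inv g))"
  define p' where "p' A = p (g ** A ** matrix_inv g)" for A
  have "p' \<in> vanishing H"
    using p polyfun_subst[of UNIV g "matrix_inv g" p] unfolding vanishing_def p'_def[abs_def]
    by (auto simp: conj_set_def)
  moreover have "poly q t = p' (mat 1 + mscale t Z)" for t
  proof -
    have "g ** (mat 1 + mscale t Z) ** matrix_inv g = mat 1 + mscale t (g ** Z ** matrix_inv g)"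
      using matrix_inv_mult(2)[OF g]
      by (simp add: matrix_add_ldistrib mscale_mult_left mscale_mult_right matrix_mul_assoc)
         (simp add: matrix_eq matrix_vector_mult_add_rdistrib matrix_vector_mul_assoc[symmetric] mscale_mult_vec)
    then show ?thesis using q by (simp add: p'_def)
  qed
  ultimately show "poly.coeff q 1 = 0" using Z unfolding lie_def by blast
qed

lemma conj_set_self:
  fixes H :: "('k::field^'n^'n) set"
  assumes "alg_group H" "g \<in> H"
  shows "conj_set g H = H"
proof
  note H = alg_groupD[OF assms(1)]
  show "conj_set g H \<subseteq> H" using H assms(2) by (auto simp: conj_set_def)
  show "H \<subseteq> conj_set g H" using H assms(2) by (auto simp: mem_conj_set_iff)
qed

section \<open>Weights of a split torus on a Lie algebra\<close>

text \<open>Dedekind's argument: the relation at \<open>b ** a\<close> minus \<open>\<phi>0 b\<close> times the relation at \<open>a\<close> is a relation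
  between the remaining characters.\<close>

lemma characters_independent:
  fixes A :: "('k::field^'n^'n) set"
  assumes A: "A \<noteq> {}" "\<And>a b. a \<in> A \<Longrightarrow> b \<in> A \<Longrightarrow> a ** b \<in> A" and "finite \<Phi>"
    and "\<And>\<phi>. \<phi> \<in> \<Phi> \<Longrightarrow> \<phi> \<in> extensional A" "\<And>\<phi> a. \<phi> \<in> \<Phi> \<Longrightarrow> a \<in> A \<Longrightarrow> \<phi> a \<noteq> (0::'k)"
    and "\<And>\<phi> a b. \<phi> \<in> \<Phi> \<Longrightarrow> a \<in> A \<Longrightarrow> b \<in> A \<Longrightarrow> \<phi> (a ** b) = \<phi> a * \<phi> b"
    and "\<And>a. a \<in> A \<Longrightarrow> (\<Sum>\<phi>\<in>\<Phi>. c \<phi> * \<phi> a) = 0"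
  shows "\<forall>\<phi>\<in>\<Phi>. c \<phi> = 0"
  using assms(3-7)
proof (induction \<Phi> arbitrary: c rule: finite_induct)
  case (insert \<phi>0 \<Phi>)
  have c: "c \<phi> = 0" if \<phi>: "\<phi> \<in> \<Phi>" for \<phi>
  proof -
    have "\<phi> \<noteq> \<phi>0" using \<phi> insert.hyps by blast
    moreover have "\<phi> \<in> extensional A" "\<phi>0 \<in> extensional A" using insert.prems(1) \<phi> by auto
    ultimately obtain b where b: "b \<in> A" "\<phi> b \<noteq> \<phi>0 b" using extensionalityI[of \<phi> A \<phi>0] by blast
    have "(\<Sum>\<psi>\<in>\<Phi>. (c \<psi> * (\<psi> b - \<phi>0 b)) * \<psi> a) = 0" if a: "a \<in> A" for a
    proof -
      have "0 = (\<Sum>\<psi>\<in>insert \<phi>0 \<Phi>. c \<psi> * \<psi> (b ** a)) - \<phi>0 b * (\<Sum>\<psi>\<in>insert \<phi>0 \<Phi>. c \<psi> * \<psi> a)"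
        using insert.prems(4)[OF a] insert.prems(4)[OF A(2)[OF b(1) a]] by simp
      also have "\<dots> = (\<Sum>\<psi>\<in>insert \<phi>0 \<Phi>. (c \<psi> * (\<psi> b - \<phi>0 b)) * \<psi> a)"
        unfolding sum_distrib_left sum_subtractf[symmetric]
        using insert.prems(3)[OF _ b(1) a] by (intro sum.cong) (auto simp: algebra_simps)
      also have "\<dots> = (\<Sum>\<psi>\<in>\<Phi>. (c \<psi> * (\<psi> b - \<phi>0 b)) * \<psi> a)" using insert.hyps by simp
      finally show ?thesis by simp
    qed
    then have "\<forall>\<psi>\<in>\<Phi>. c \<psi> * (\<psi> b - \<phi>0 b) = 0"
      by (intro insert.IH) (use insert.prems(1-3) in auto)
    then show ?thesis using \<phi> b(2) by auto
  qed
  obtain a where a: "a \<in> A" using A(1) by blast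
  have "c \<phi>0 * \<phi>0 a = 0" using insert.prems(4)[OF a] insert.hyps c by simp
  then show ?case using insert.prems(2)[of \<phi>0 a] a c by auto
qed simp

text \<open>After conjugation by \<open>k\<close> the elements of \<open>A\<close> are diagonal, and each matrix entry of \<open>Z\<close> is a weight
  vector whose weight is a quotient of two diagonal entries. The sum \<open>Zf \<phi>\<close> of the entries of weight \<open>\<phi>\<close> lies in
  the Lie algebra of \<open>H\<close>: a linear equation \<open>D\<close> of the Lie algebra vanishes on all conjugates of \<open>Z\<close> by elements
  \<open>a\<close> of \<open>A\<close>, which reads \<open>\<Sum> D(Zf \<phi>) \<phi>(a) = 0\<close>, and characters are independent.\<close>

lemma weight_decomposition:
  fixes A H :: "('k::field^'n^'n) set" and k Z :: "'k^'n^'n"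
  assumes inf: "infinite (UNIV :: 'k set)" and A: "alg_group A" and H: "alg_group H" "A \<subseteq> H" and k: "invertible k"
    and diag: "\<And>t i j. t \<in> A \<Longrightarrow> i \<noteq> j \<Longrightarrow> (k ** t ** matrix_inv k) $ i $ j = 0" and Z: "Z \<in> lie H"
  shows "\<exists>\<Phi> Zf. finite \<Phi> \<and> (\<forall>\<phi>\<in>\<Phi>. \<phi> \<in> characters A \<and> Zf \<phi> \<in> weight_space A (lie H) \<phi>) \<and> Z = (\<Sum>\<phi>\<in>\<Phi>. Zf \<phi>)"
proof -
  note AD = alg_groupD[OF A] and kk = matrix_inv_mult[OF k]
  define \<chi>' where "\<chi>' i t = (k ** t ** matrix_inv k) $ i $ i" for i t
  note conj_mult = conj_mult[OF k]
  have left_diag: "((k ** t ** matrix_inv k) ** M) $ i $ j = \<chi>' i t * M $ i $ j" if t: "t \<in> A" for t M i j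
  proof -
    have "((k ** t ** matrix_inv k) ** M) $ i $ j = (\<Sum>l\<in>UNIV. (k ** t ** matrix_inv k) $ i $ l * M $ l $ j)"
      by (simp add: matrix_matrix_mult_def)
    also have "\<dots> = (\<Sum>l\<in>UNIV. if l = i then \<chi>' i t * M $ i $ j else 0)"
      using diag[OF t] by (intro sum.cong) (auto simp: \<chi>'_def)
    finally show ?thesis by simp
  qed
  have right_diag: "(M ** (k ** t ** matrix_inv k)) $ i $ j = M $ i $ j * \<chi>' j t" if t: "t \<in> A" for t M i j
  proof -
    have "(M ** (k ** t ** matrix_inv k)) $ i $ j = (\<Sum>l\<in>UNIV. M $ i $ l * (k ** t ** matrix_inv k) $ l $ j)"
      by (simp add: matrix_matrix_mult_def)
    also have "\<dots> = (\<Sum>l\<in>UNIV. if l = j then M $ i $ j * \<chi>' j t else 0)"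
      using diag[OF t] by (intro sum.cong) (auto simp: \<chi>'_def)
    finally show ?thesis by simp
  qed
  have \<chi>_mult: "\<chi>' i (s ** t) = \<chi>' i s * \<chi>' i t" if "s \<in> A" "t \<in> A" for i s t
    using left_diag[OF that(1), of "k ** t ** matrix_inv k" i i] by (simp add: \<chi>'_def conj_mult)
  have \<chi>_one: "\<chi>' i (mat 1) = 1" for i
  proof -
    have "k ** mat 1 ** matrix_inv k = mat 1" by (simp add: kk)
    then show ?thesis by (simp only: \<chi>'_def) (simp add: mat_def)
  qed
  have \<chi>_inv: "\<chi>' i t * \<chi>' i (matrix_inv t) = 1" if "t \<in> A" for i t
    using \<chi>_mult[of t "matrix_inv t" i] that AD matrix_inv_mult[OF AD(4)[OF that]] \<chi>_one by simp
  have \<chi>_nz: "\<chi>' i t \<noteq> 0" if "t \<in> A" for i t using \<chi>_inv[OF that, of i] by auto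
  have det: "det t = (\<Prod>i\<in>UNIV. \<chi>' i t)" if t: "t \<in> A" for t
  proof -
    have "det t = det (matrix_inv k ** k) * det t" by (simp add: kk)
    also have "\<dots> = det (k ** t ** matrix_inv k)" by (simp add: det_mul mult.commute mult.left_commute)
    also have "\<dots> = (\<Prod>i\<in>UNIV. \<chi>' i t)" unfolding \<chi>'_def using diag[OF t] by (intro det_diagonal) auto
    finally show ?thesis .
  qed
  define \<phi> where "\<phi> i j = (\<lambda>a\<in>A. \<chi>' i a / \<chi>' j a)" for i j
  have \<phi>_char: "\<phi> i j \<in> characters A" for i j
  proof -
    \<comment> \<open>The determinant is the product of the diagonal entries, so it can serve as denominator instead of
      \<open>\<chi>' j\<close>.\<close>
    have "\<exists>p\<in>polyfun UNIV. \<exists>m::nat. \<forall>a\<in>A. \<phi> i j a = p a / det a ^ m"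
    proof (intro bexI[of _ "\<lambda>a. \<chi>' i a * (\<Prod>l\<in>UNIV - {j}. \<chi>' l a)"] exI[of _ 1] ballI)
      fix a assume a: "a \<in> A"
      have "det a = \<chi>' j a * (\<Prod>l\<in>UNIV - {j}. \<chi>' l a)" unfolding det[OF a] by (intro prod.remove) auto
      then show "\<phi> i j a = \<chi>' i a * (\<Prod>l\<in>UNIV - {j}. \<chi>' l a) / det a ^ 1"
        using \<chi>_nz[OF a] a by (simp add: \<phi>_def)
    qed (auto simp: \<chi>'_def intro!: polyfun.mult polyfun_prod polyfun_mult_entry)
    then show ?thesis using \<chi>_nz \<chi>_mult AD(2) by (auto simp: characters_def \<phi>_def)
  qed
  define M where "M f = (\<chi> i j. if \<phi> i j = f then (k ** Z ** matrix_inv k) $ i $ j else 0)" for f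
  define Zf where "Zf f = matrix_inv k ** M f ** k" for f
  define \<Phi> where "\<Phi> = (\<lambda>(i, j). \<phi> i j) ` UNIV"
  have fin: "finite \<Phi>" by (simp add: \<Phi>_def)
  have kZf: "k ** Zf f ** matrix_inv k = M f" for f unfolding Zf_def by (rule conj_conj_inverse(2)[OF k])
  have conj_inj: "B = C" if "k ** B ** matrix_inv k = k ** C ** matrix_inv k" for B C
    using arg_cong[OF that, of "\<lambda>x. matrix_inv k ** x ** k"] unfolding conj_conj_inverse(1)[OF k] .
  have sum_mult: "C ** (\<Sum>f\<in>F. B f) ** C' = (\<Sum>f\<in>F. C ** B f ** C')" if "finite F" for F C C' and B :: "_ \<Rightarrow> 'k^'n^'n"
    using that by (induction F rule: finite_induct)
      (auto simp: matrix_add_ldistrib matrix_eq matrix_vector_mult_add_rdistrib matrix_vector_mul_assoc[symmetric] algebra_simps)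
  have sum: "Z = (\<Sum>f\<in>\<Phi>. Zf f)"
  proof (rule conj_inj)
    have "(\<Sum>f\<in>\<Phi>. M f) $ i $ j = (k ** Z ** matrix_inv k) $ i $ j" for i j
    proof -
      have "(\<Sum>f\<in>\<Phi>. M f) $ i $ j = (\<Sum>f\<in>\<Phi>. if \<phi> i j = f then (k ** Z ** matrix_inv k) $ i $ j else 0)"
        by (simp add: M_def)
      also have "\<dots> = (k ** Z ** matrix_inv k) $ i $ j" using fin by (auto simp: \<Phi>_def)
      finally show ?thesis .
    qed
    then show "k ** Z ** matrix_inv k = k ** (\<Sum>f\<in>\<Phi>. Zf f) ** matrix_inv k"
      by (simp add: sum_mult[OF fin] kZf vec_eq_iff)
  qed
  have wt: "a ** Zf f ** matrix_inv a = mscale (f a) (Zf f)" if a: "a \<in> A" for a f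
  proof (rule conj_inj)
    have "k ** (a ** Zf f ** matrix_inv a) ** matrix_inv k =
        (k ** a ** matrix_inv k) ** (k ** Zf f ** matrix_inv k) ** (k ** matrix_inv a ** matrix_inv k)"
      by (simp add: conj_mult)
    also have "\<dots> = mscale (f a) (M f)"
    proof -
      have "((k ** a ** matrix_inv k) ** M f ** (k ** matrix_inv a ** matrix_inv k)) $ i $ j = f a * M f $ i $ j" for i j
      proof -
        have inv: "\<chi>' j (matrix_inv a) = 1 / \<chi>' j a" using \<chi>_inv[OF a, of j] \<chi>_nz[OF a, of j] by (simp add: field_simps)
        have "((k ** a ** matrix_inv k) ** M f ** (k ** matrix_inv a ** matrix_inv k)) $ i $ j =
            (\<chi>' i a * M f $ i $ j) * \<chi>' j (matrix_inv a)"
          by (simp only: right_diag[OF AD(3)[OF a]] left_diag[OF a])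
        also have "\<dots> = (\<chi>' i a / \<chi>' j a) * M f $ i $ j" by (simp add: inv)
        also have "\<dots> = f a * M f $ i $ j" using a by (auto simp: M_def \<phi>_def)
        finally show ?thesis .
      qed
      then show ?thesis by (simp add: kZf vec_eq_iff mscale_nth)
    qed
    finally show "k ** (a ** Zf f ** matrix_inv a) ** matrix_inv k = k ** mscale (f a) (Zf f) ** matrix_inv k"
      by (simp add: mscale_mult_left mscale_mult_right kZf)
  qed
  obtain D where D: "\<And>p Z W. p \<in> vanishing H \<Longrightarrow> D p (Z + W) = D p Z + D p W"
    "\<And>p c Z. p \<in> vanishing H \<Longrightarrow> D p (mscale c Z) = c * D p Z"
    "\<And>Z. Z \<in> lie H \<longleftrightarrow> (\<forall>p\<in>vanishing H. D p Z = 0)" using lie_linear_equations[OF inf, of H] by blast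
  have Dsum: "D p (\<Sum>f\<in>F. B f) = (\<Sum>f\<in>F. D p (B f))" if "finite F" "p \<in> vanishing H" for F p and B :: "_ \<Rightarrow> 'k^'n^'n"
  proof -
    have "mscale 0 0 = (0 :: 'k^'n^'n)" by (simp add: vec_eq_iff mscale_nth)
    then have "D p 0 = 0" using D(2)[OF that(2), of 0 0] by simp
    with that(1) show ?thesis by (induction F rule: finite_induct) (auto simp: D(1)[OF that(2)])
  qed
  have "Zf f \<in> lie H" if f: "f \<in> \<Phi>" for f
    unfolding D(3)
  proof
    fix p assume p: "p \<in> vanishing H"
    have "\<forall>f\<in>\<Phi>. D p (Zf f) = 0"
    proof (rule characters_independent[of A])
      show "(\<Sum>f\<in>\<Phi>. D p (Zf f) * f a) = 0" if a: "a \<in> A" for a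
      proof -
        have "a ** Z ** matrix_inv a \<in> lie H"
          using lie_conj[OF AD(4)[OF a] Z] conj_set_self[OF H(1)] H(2) a by auto
        then have "0 = D p (a ** (\<Sum>f\<in>\<Phi>. Zf f) ** matrix_inv a)" using D(3) p sum by auto
        also have "\<dots> = (\<Sum>f\<in>\<Phi>. D p (Zf f) * f a)"
          by (simp add: sum_mult[OF fin] wt[OF a] Dsum[OF fin p] D(2)[OF p] mult.commute)
        finally show ?thesis by simp
      qed
    qed (use AD(1,2) fin \<phi>_char in \<open>auto simp: characters_def \<Phi>_def\<close>)
    then show "D p (Zf f) = 0" using f by blast
  qed
  then show ?thesis using fin sum wt \<phi>_char
    by (intro exI[of _ \<Phi>] exI[of _ Zf]) (auto simp: weight_space_def \<Phi>_def)
qed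

section \<open>Conjugates of algebraic groups and tori\<close>

lemma topspace_zariski: "topspace (zariski :: ('k::field^'n^'n) topology) = UNIV"
proof -
  have "UNIV \<in> {{A :: 'k^'n^'n. p A \<noteq> 0} | p. p \<in> polyfun UNIV}"
    using polyfun.const[of 1 UNIV] by (intro CollectI exI[of _ "\<lambda>_. 1"]) auto
  then show ?thesis unfolding zariski_def topology_generated_by_topspace by blast
qed

lemma continuous_map_conj:
  fixes g h :: "'k::field^'n^'n"
  shows "continuous_map zariski zariski (\<lambda>A. g ** A ** h)"
proof -
  have "openin zariski ((\<lambda>A. g ** A ** h) -` {A :: 'k^'n^'n. p A \<noteq> 0})" if "p \<in> polyfun UNIV" for p
  proof -
    have "(\<lambda>A. g ** A ** h) -` {A. p A \<noteq> 0} = {A. p (g ** A ** h) \<noteq> 0}" by auto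
    then show ?thesis unfolding zariski_def
      using polyfun_subst[of UNIV g h p] that by (intro topology_generated_by_Basis) auto
  qed
  moreover have "\<Union>{{A :: 'k^'n^'n. p A \<noteq> 0} | p. p \<in> polyfun UNIV} = UNIV"
    using topspace_zariski[where 'k='k and 'n='n] unfolding zariski_def topology_generated_by_topspace .
  ultimately show ?thesis
    by (subst (2) zariski_def, subst continuous_on_generated_topo_iff) (auto simp: topspace_zariski)
qed

lemma alg_group_conj:
  fixes H :: "('k::field^'n^'n) set"
  assumes H: "alg_group H" and g: "invertible g"
  shows "alg_group (conj_set g H)"
  unfolding alg_group_def subgroup_matgrp_GL
proof (intro conjI ballI)
  note HD = alg_groupD[OF H]
  show "conj_set g H \<subseteq> GL" using HD(4) g by (auto simp: conj_set_def GL_def intro!: invertible_mult invertible_matrix_inv)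
  show "mat 1 \<in> conj_set g H" using HD(1) by (simp add: mem_conj_set_iff[OF g] matrix_inv_mult[OF g])
  fix a assume "a \<in> conj_set g H"
  then obtain a' where a: "a' \<in> H" "a = g ** a' ** matrix_inv g" by (auto simp: conj_set_def)
  show "matrix_inv a \<in> conj_set g H" using a HD by (auto simp: conj_set_def conj_inverse[OF g])
  fix b assume "b \<in> conj_set g H"
  then obtain b' where b: "b' \<in> H" "b = g ** b' ** matrix_inv g" by (auto simp: conj_set_def)
  show "a ** b \<in> conj_set g H" unfolding a(2) b(2) conj_mult[OF g, symmetric] conj_set_def
    using HD(2)[OF a(1) b(1)] by blast
next
  have GL: "matrix_inv g ** A ** g \<in> GL" if "A \<in> GL" for A
    using that g by (auto simp: GL_def intro!: invertible_mult invertible_matrix_inv)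
  have "continuous_map (subtopology zariski GL) (subtopology zariski GL) (\<lambda>A. matrix_inv g ** A ** g)"
    using GL by (auto simp: continuous_map_in_subtopology topspace_zariski
        intro!: continuous_map_from_subtopology continuous_map_conj)
  moreover have "closedin (subtopology zariski GL) H" using H by (simp add: alg_group_def)
  ultimately have "closedin (subtopology zariski GL) {A \<in> topspace (subtopology zariski GL). matrix_inv g ** A ** g \<in> H}"
    by (rule closedin_continuous_map_preimage)
  moreover have "{A \<in> topspace (subtopology zariski GL). matrix_inv g ** A ** g \<in> H} = conj_set g H"
  proof -
    have "A \<in> GL" if "A \<in> conj_set g H" for A
      using that alg_groupD(4)[OF H] g by (auto simp: conj_set_def GL_def intro!: invertible_mult invertible_matrix_inv)
    then show ?thesis by (auto simp: topspace_zariski mem_conj_set_iff[OF g])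
  qed
  ultimately show "closedin (subtopology zariski GL) (conj_set g H)" by simp
qed

lemma identity_component_subset: "identity_component H \<subseteq> H"
proof
  fix a assume "a \<in> identity_component H"
  then obtain T where "connectedin (subtopology zariski H) T" "a \<in> T"
    by (auto simp: identity_component_def connected_component_of_def)
  then show "a \<in> H" by (auto simp: connectedin_subtopology)
qed

lemma identity_component_conj_subset:
  fixes H :: "('k::field^'n^'n) set"
  assumes H: "alg_group H" and g: "g \<in> H"
  shows "conj_set g (identity_component H) \<subseteq> identity_component H"
proof
  note HD = alg_groupD[OF H]
  fix b assume "b \<in> conj_set g (identity_component H)"
  then obtain a where a: "a \<in> identity_component H" "b = g ** a ** matrix_inv g" by (auto simp: conj_set_def)
  then obtain T where T: "connectedin (subtopology zariski H) T" "mat 1 \<in> T" "a \<in> T"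
    by (auto simp: identity_component_def connected_component_of_def)
  have "continuous_map (subtopology zariski H) (subtopology zariski H) (\<lambda>A. g ** A ** matrix_inv g)"
    using HD g by (auto simp: continuous_map_in_subtopology topspace_zariski
        intro!: continuous_map_from_subtopology continuous_map_conj)
  then have "connectedin (subtopology zariski H) ((\<lambda>A. g ** A ** matrix_inv g) ` T)"
    using T(1) by (rule connectedin_continuous_map_image)
  moreover have "mat 1 \<in> (\<lambda>A. g ** A ** matrix_inv g) ` T"
    using T(2) matrix_inv_mult[OF HD(4)[OF g]] by (intro image_eqI[of _ _ "mat 1"]) auto
  ultimately show "b \<in> identity_component H"
    using T(3) a(2) unfolding identity_component_def connected_component_of_def by blast
qed

lemma identity_component_normal:
  fixes H :: "('k::field^'n^'n) set"
  assumes H: "alg_group H" and g: "g \<in> H"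
  shows "conj_set g (identity_component H) = identity_component H"
proof
  note HD = alg_groupD[OF H]
  show "conj_set g (identity_component H) \<subseteq> identity_component H" by (rule identity_component_conj_subset[OF H g])
  have "conj_set g (conj_set (matrix_inv g) (identity_component H)) \<subseteq> conj_set g (identity_component H)"
    using identity_component_conj_subset[OF H HD(3)[OF g]] by (auto simp: conj_set_def)
  then show "identity_component H \<subseteq> conj_set g (identity_component H)"
    using conj_set_inverse(2)[OF HD(4)[OF g]] by simp
qed

lemma F_group_conj:
  fixes H :: "('f::field alg_closure^'n^'n) set"
  assumes H: "F_group H" and g: "invertible (g :: 'f^'n^'n)"
  shows "F_group (conj_set (emb g) H)"
  unfolding F_group_def
proof (intro conjI ballI)
  have eg: "invertible (emb g)" using g by simp
  show "alg_group (conj_set (emb g) H)" using H eg by (intro alg_group_conj) (auto simp: F_group_def)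
  fix p assume p: "p \<in> vanishing (conj_set (emb g) H)"
  have 0: "0 \<in> range (to_ac :: 'f \<Rightarrow> _)" by (metis rangeI to_ac_0)
  define p' where "p' = (\<lambda>A. p (emb g ** A ** matrix_inv (emb g)))"
  have "p' \<in> vanishing H"
    using p polyfun_subst[of UNIV "emb g" "matrix_inv (emb g)" p] by (auto simp: vanishing_def p'_def conj_set_def)
  then obtain m :: nat and c q where cq: "\<forall>i<m. c i \<in> polyfun UNIV \<and> q i \<in> vanishing H \<inter> polyfun (range to_ac)"
    "p' = (\<lambda>A. \<Sum>i<m. c i A * q i A)" using H unfolding F_group_def by meson
  let ?s = "\<lambda>f A. f (matrix_inv (emb g) ** A ** emb g)"
  have "p = (\<lambda>A. \<Sum>i<m. ?s (c i) A * ?s (q i) A)"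
  proof
    fix A
    have "p A = p' (matrix_inv (emb g) ** A ** emb g)" by (simp add: p'_def conj_conj_inverse(2)[OF eg])
    then show "p A = (\<Sum>i<m. ?s (c i) A * ?s (q i) A)" using cq(2) by simp
  qed
  note p_eq = this
  have mem: "?s (c i) \<in> polyfun UNIV \<and> ?s (q i) \<in> vanishing (conj_set (emb g) H) \<inter> polyfun (range to_ac)" if "i < m" for i
  proof -
    have c: "c i \<in> polyfun UNIV" and qi: "q i \<in> vanishing H" "q i \<in> polyfun (range to_ac)" using cq(1) that by auto
    have ent: "matrix_inv (emb g) $ a $ b \<in> range to_ac" "emb g $ a $ b \<in> range to_ac" for a b
      by (simp_all add: emb_matrix_inv[OF g, symmetric])
    have "?s (c i) \<in> polyfun UNIV" using polyfun_subst[of UNIV "matrix_inv (emb g)" "emb g", OF _ _ _ c] by simp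
    moreover have "?s (q i) \<in> polyfun (range to_ac)" by (rule polyfun_subst[OF 0 ent qi(2)])
    moreover have "?s (q i) \<in> polyfun UNIV"
      using polyfun_subst[of UNIV "matrix_inv (emb g)" "emb g" "q i"] qi(1) by (simp add: vanishing_def)
    moreover have "?s (q i) a = 0" if "a \<in> conj_set (emb g) H" for a
      using that qi(1) by (simp add: mem_conj_set_iff[OF eg] vanishing_def)
    ultimately show ?thesis by (simp add: vanishing_def)
  qed
  show "\<exists>(m::nat) c q. (\<forall>i<m. c i \<in> polyfun UNIV \<and>
      q i \<in> vanishing (conj_set (emb g) H) \<inter> polyfun (range to_ac)) \<and> p = (\<lambda>A. \<Sum>i<m. c i A * q i A)"
    using mem by (intro exI[of _ m] exI[of _ "\<lambda>i. ?s (c i)"] exI[of _ "\<lambda>i. ?s (q i)"] conjI allI impI p_eq) simp_all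
qed

lemma split_torus_conj:
  fixes T :: "('f::field alg_closure^'n^'n) set"
  assumes T: "split_torus T" and g: "invertible (g :: 'f^'n^'n)"
  shows "split_torus (conj_set (emb g) T)"
  unfolding split_torus_def
proof (intro conjI)
  have eg: "invertible (emb g)" using g by simp
  show "F_group (conj_set (emb g) T)" using T g by (intro F_group_conj) (auto simp: split_torus_def)
  show "connectedin zariski (conj_set (emb g) T)" unfolding conj_set_def
    using T connectedin_continuous_map_image[OF continuous_map_conj] by (auto simp: split_torus_def)
  obtain h :: "'f^'n^'n" where h: "invertible h"
    "\<forall>t\<in>T. \<forall>i j. i \<noteq> j \<longrightarrow> (emb h ** t ** emb (matrix_inv h)) $ i $ j = 0" using T by (auto simp: split_torus_def)
  have eq: "emb (h ** matrix_inv g) ** (emb g ** t ** matrix_inv (emb g)) ** emb (matrix_inv (h ** matrix_inv g)) =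
      emb h ** t ** emb (matrix_inv h)" for t
  proof -
    have "matrix_inv (h ** matrix_inv g) = g ** matrix_inv h"
      using g h(1) by (simp add: matrix_inv_prod invertible_matrix_inv matrix_inv_matrix_inv)
    then have "emb (h ** matrix_inv g) ** (emb g ** t ** matrix_inv (emb g)) ** emb (matrix_inv (h ** matrix_inv g)) =
        emb h ** (matrix_inv (emb g) ** (emb g ** t ** matrix_inv (emb g)) ** emb g) ** emb (matrix_inv h)"
      by (simp add: emb_mult emb_matrix_inv[OF g] matrix_mul_assoc)
    then show ?thesis by (simp add: conj_conj_inverse(1)[OF eg])
  qed
  have "\<forall>t\<in>conj_set (emb g) T. \<forall>i j. i \<noteq> j \<longrightarrow>
      (emb (h ** matrix_inv g) ** t ** emb (matrix_inv (h ** matrix_inv g))) $ i $ j = 0"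
    using h(2) unfolding conj_set_def ball_simps eq by blast
  then show "\<exists>h::'f^'n^'n. invertible h \<and> (\<forall>t\<in>conj_set (emb g) T. \<forall>i j. i \<noteq> j \<longrightarrow>
      (emb h ** t ** emb (matrix_inv h)) $ i $ j = 0)"
    using g h(1) by (intro exI[of _ "h ** matrix_inv g"]) (auto intro: invertible_mult invertible_matrix_inv)
qed

lemma center_conj:
  fixes H :: "('k::field^'n^'n) set"
  assumes g: "invertible g" and H: "conj_set g H = H"
  shows "conj_set g (center H) \<subseteq> center H"
proof
  fix b assume "b \<in> conj_set g (center H)"
  then obtain z where z: "z \<in> H" "\<And>h. h \<in> H \<Longrightarrow> z ** h = h ** z" "b = g ** z ** matrix_inv g"
    by (auto simp: conj_set_def center_def)
  have "b \<in> H" using z(1,3) H by (auto simp: conj_set_def)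
  moreover have "b ** h = h ** b" if "h \<in> H" for h
  proof -
    obtain h' where h': "h' \<in> H" "h = g ** h' ** matrix_inv g" using \<open>h \<in> H\<close> H by (auto simp: conj_set_def)
    show ?thesis unfolding z(3) h'(2) conj_mult[OF g, symmetric] using z(2)[OF h'(1)] by simp
  qed
  ultimately show "b \<in> center H" by (simp add: center_def)
qed

text \<open>A conjugate of \<open>A\<close> by an element normalizing \<open>M\<close> is again a split torus in the center of \<open>M\<close>, hence
  contained in \<open>A\<close>.\<close>

lemma maximal_split_central_torus_conj:
  fixes M A :: "('f::field alg_closure^'n^'n) set"
  assumes A: "maximal_split_central_torus M A" and g: "invertible (g :: 'f^'n^'n)" and M: "conj_set (emb g) M = M"
  shows "conj_set (emb g) A = A"
proof -
  have sub: "conj_set (emb h) A \<subseteq> A" if h: "invertible h" "conj_set (emb h) M = M" for h :: "'f^'n^'n"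
  proof -
    have "conj_set (emb h) A \<subseteq> conj_set (emb h) (center M)"
      using A by (auto simp: maximal_split_central_torus_def conj_set_def)
    then have "conj_set (emb h) A \<subseteq> center M" using center_conj[OF _ h(2)] h(1) by auto
    moreover have "split_torus (conj_set (emb h) A)"
      using A h(1) by (intro split_torus_conj) (auto simp: maximal_split_central_torus_def)
    ultimately show ?thesis using A by (auto simp: maximal_split_central_torus_def)
  qed
  have eg: "invertible (emb g)" using g by simp
  have M': "conj_set (emb (matrix_inv g)) M = M"
    using conj_set_inverse(1)[OF eg, of M] M by (simp add: emb_matrix_inv[OF g])
  have "conj_set (emb g) (conj_set (emb (matrix_inv g)) A) \<subseteq> conj_set (emb g) A"
    using sub[OF invertible_matrix_inv[OF g] M'] by (auto simp: conj_set_def)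
  then have "A \<subseteq> conj_set (emb g) A" using conj_set_inverse(2)[OF eg] by (simp add: emb_matrix_inv[OF g])
  then show ?thesis using sub[OF g M] by blast
qed

section \<open>The normalizer permutes the simple roots\<close>

definition char_conj :: "('k::field^'n^'n) set \<Rightarrow> 'k^'n^'n \<Rightarrow> ('k^'n^'n \<Rightarrow> 'k) \<Rightarrow> 'k^'n^'n \<Rightarrow> 'k" where
  "char_conj A g \<phi> = (\<lambda>a\<in>A. \<phi> (matrix_inv g ** a ** g))"

lemma char_conj_inverse:
  fixes A :: "('k::field^'n^'n) set"
  assumes g: "invertible g" and A: "conj_set g A = A" and \<phi>: "\<phi> \<in> extensional A"
  shows "char_conj A (matrix_inv g) (char_conj A g \<phi>) = \<phi>"
proof
  fix a
  have "g ** a ** matrix_inv g \<in> A" if "a \<in> A" using A that by (auto simp: conj_set_def)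
  then show "char_conj A (matrix_inv g) (char_conj A g \<phi>) a = \<phi> a"
    using conj_conj_inverse(1)[OF g, of a] extensional_arb[OF \<phi>, of a]
    by (cases "a \<in> A") (simp_all add: char_conj_def matrix_inv_matrix_inv[OF g])
qed

text \<open>If \<open>Z\<close> is a weight vector of weight \<open>\<phi>\<close>, then the conjugate of \<open>Z\<close> by \<open>g\<close> is one of weight
  \<open>char_conj A g \<phi>\<close>.\<close>

lemma char_conj_roots:
  fixes A H :: "('k::field^'n^'n) set"
  assumes inf: "infinite (UNIV :: 'k set)" and g: "invertible g" and A: "conj_set g A = A" and inv: "\<And>a. a \<in> A \<Longrightarrow> invertible a"
    and H: "conj_set g H = H" and \<phi>: "\<phi> \<in> roots H A"
  shows "char_conj A g \<phi> \<in> roots H A"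
proof -
  have gA: "matrix_inv g ** a ** g \<in> A" if "a \<in> A" for a using that A mem_conj_set_iff[OF g] by blast
  have ch: "\<phi> \<in> characters A" "\<phi> \<noteq> (\<lambda>a\<in>A. 1)" "weight_space A (lie H) \<phi> \<noteq> {0}" using \<phi> by (auto simp: roots_def)
  have mult: "matrix_inv g ** (a ** b) ** g = (matrix_inv g ** a ** g) ** (matrix_inv g ** b ** g)" for a b
    using conj_mult[OF invertible_matrix_inv[OF g], of a b] by (simp add: matrix_inv_matrix_inv[OF g])
  have "char_conj A g \<phi> \<in> characters A"
  proof -
    obtain p and m :: nat where p: "p \<in> polyfun UNIV" "\<forall>a\<in>A. \<phi> a = p a / det a ^ m"
      using ch(1) by (auto simp: characters_def)
    have "det (matrix_inv g ** a ** g) = det a" for a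
    proof -
      have "det (matrix_inv g ** a ** g) = det (matrix_inv g ** g) * det a" by (simp add: det_mul mult.commute mult.left_commute)
      then show ?thesis by (simp add: matrix_inv_mult[OF g])
    qed
    then have "\<forall>a\<in>A. char_conj A g \<phi> a = p (matrix_inv g ** a ** g) / det a ^ m"
      using p(2) gA by (simp add: char_conj_def)
    moreover have "(\<lambda>a. p (matrix_inv g ** a ** g)) \<in> polyfun UNIV" using polyfun_subst[of UNIV "matrix_inv g" g p] p(1) by simp
    ultimately have "\<exists>p\<in>polyfun UNIV. \<exists>m::nat. \<forall>a\<in>A. char_conj A g \<phi> a = p a / det a ^ m"
      by (intro bexI[of _ "\<lambda>a. p (matrix_inv g ** a ** g)"] exI[of _ m])
    moreover have "char_conj A g \<phi> (a ** b) = char_conj A g \<phi> a * char_conj A g \<phi> b" if "a \<in> A" "b \<in> A" for a b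
    proof (cases "a ** b \<in> A")
      case True
      then show ?thesis using that gA ch(1) by (simp add: char_conj_def mult characters_def)
    next
      case False
      \<comment> \<open>If \<open>a ** b\<close> lies outside \<open>A\<close>, both sides are the default value of
        \<open>\<phi>\<close> outside \<open>A\<close>.\<close>
      have "matrix_inv g ** (a ** b) ** g \<notin> A"
      proof
        assume "matrix_inv g ** (a ** b) ** g \<in> A"
        then have "a ** b \<in> conj_set g A" by (simp add: mem_conj_set_iff[OF g])
        then show False using False A by simp
      qed
      then have "\<phi> (matrix_inv g ** (a ** b) ** g) = undefined"
        using ch(1) by (intro extensional_arb[of \<phi> A]) (simp_all add: characters_def)
      moreover have "\<phi> (matrix_inv g ** (a ** b) ** g) = \<phi> (matrix_inv g ** a ** g) * \<phi> (matrix_inv g ** b ** g)"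
        using gA that ch(1) unfolding mult by (simp add: characters_def)
      ultimately show ?thesis using False that by (simp add: char_conj_def)
    qed
    ultimately show ?thesis using ch(1) gA by (auto simp: characters_def char_conj_def)
  qed
  moreover have "char_conj A g \<phi> \<noteq> (\<lambda>a\<in>A. 1)"
  proof
    assume "char_conj A g \<phi> = (\<lambda>a\<in>A. 1)"
    then have "\<phi> = char_conj A (matrix_inv g) (\<lambda>a\<in>A. 1)"
      using char_conj_inverse[OF g A, of \<phi>] ch(1) by (simp add: characters_def)
    also have "\<dots> = (\<lambda>a\<in>A. 1)"
      using A by (auto simp: char_conj_def matrix_inv_matrix_inv[OF g] conj_set_def intro!: restrict_ext)
    finally show False using ch(2) by simp
  qed
  moreover have "weight_space A (lie H) (char_conj A g \<phi>) \<noteq> {0}"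
  proof -
    have "0 \<in> weight_space A (lie H) \<phi>" using lie_subspace(1)[OF inf, of H]
      by (simp add: weight_space_def vec_eq_iff mscale_nth)
    then obtain Z where Z: "Z \<in> weight_space A (lie H) \<phi>" "Z \<noteq> 0" using ch(3) by blast
    define Y where "Y = g ** Z ** matrix_inv g"
    have "Y \<in> lie H" using lie_conj[OF g, of Z H] Z(1) H by (simp add: weight_space_def Y_def)
    moreover have "a ** Y ** matrix_inv a = mscale (char_conj A g \<phi> a) Y" if a: "a \<in> A" for a
    proof -
      let ?b = "matrix_inv g ** a ** g"
      have b: "?b \<in> A" "a = g ** ?b ** matrix_inv g" using gA[OF a] conj_conj_inverse(2)[OF g] by simp_all
      have "a ** Y ** matrix_inv a = g ** (?b ** Z ** matrix_inv ?b) ** matrix_inv g"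
      proof -
        have "matrix_inv a = g ** matrix_inv ?b ** matrix_inv g"
          by (subst b(2)) (rule conj_inverse[OF g inv[OF b(1)]])
        then show ?thesis using b(2) by (simp only: conj_mult[OF g] Y_def)
      qed
      also have "?b ** Z ** matrix_inv ?b = mscale (\<phi> ?b) Z" using Z(1) b(1) by (simp add: weight_space_def)
      finally show ?thesis using a by (simp add: char_conj_def Y_def mscale_mult_left mscale_mult_right)
    qed
    ultimately have "Y \<in> weight_space A (lie H) (char_conj A g \<phi>)" by (simp add: weight_space_def)
    moreover have "Y \<noteq> 0"
    proof
      assume "Y = 0"
      then have "matrix_inv g ** Y ** g = 0" by simp
      then show False using Z(2) conj_conj_inverse(1)[OF g, of Z] by (simp add: Y_def)
    qed
    ultimately show ?thesis by blast
  qed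
  ultimately show ?thesis by (simp add: roots_def)
qed

lemma simple_rootsD:
  assumes "simple_roots G P A S"
  shows "finite S" "S \<subseteq> roots G A" "\<And>\<alpha>. \<alpha> \<in> S \<Longrightarrow> \<alpha> \<in> extensional A" "\<And>\<alpha> a. \<alpha> \<in> S \<Longrightarrow> a \<in> A \<Longrightarrow> \<alpha> a \<noteq> 0"
proof -
  show "finite S" using assms[unfolded simple_roots_def] by (elim conjE)
  show S: "S \<subseteq> roots G A" using assms[unfolded simple_roots_def] by (elim conjE)
  have "\<alpha> \<in> characters A" if "\<alpha> \<in> S" for \<alpha> using S that unfolding roots_def by blast
  then show "\<And>\<alpha>. \<alpha> \<in> S \<Longrightarrow> \<alpha> \<in> extensional A" "\<And>\<alpha> a. \<alpha> \<in> S \<Longrightarrow> a \<in> A \<Longrightarrow> \<alpha> a \<noteq> 0"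
    unfolding characters_def by blast+
qed

lemma char_comb_eq_iff:
  fixes A :: "('k::field^'n^'n) set"
  assumes S: "simple_roots G P A S" and m: "char_comb A S m = char_comb A S m'" and \<alpha>: "\<alpha> \<in> S"
  shows "m \<alpha> = m' \<alpha>"
proof -
  note nz = simple_rootsD(4)[OF S]
  have "char_comb A S (\<lambda>\<alpha>. m \<alpha> - m' \<alpha>) = (\<lambda>a\<in>A. 1)"
  proof
    fix a show "char_comb A S (\<lambda>\<alpha>. m \<alpha> - m' \<alpha>) a = (\<lambda>a\<in>A. 1) a"
    proof (cases "a \<in> A")
      case a: True
      have "(\<Prod>\<alpha>\<in>S. \<alpha> a powi (m \<alpha> - m' \<alpha>)) = (\<Prod>\<alpha>\<in>S. \<alpha> a powi m \<alpha> / \<alpha> a powi m' \<alpha>)"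
        using nz[OF _ a] by (intro prod.cong) (auto simp: power_int_diff)
      also have "\<dots> = (\<Prod>\<alpha>\<in>S. \<alpha> a powi m \<alpha>) / (\<Prod>\<alpha>\<in>S. \<alpha> a powi m' \<alpha>)" by (simp add: prod_dividef)
      also have "(\<Prod>\<alpha>\<in>S. \<alpha> a powi m \<alpha>) = (\<Prod>\<alpha>\<in>S. \<alpha> a powi m' \<alpha>)"
        using fun_cong[OF m, of a] a by (simp add: char_comb_def)
      also have "(\<Prod>\<alpha>\<in>S. \<alpha> a powi m' \<alpha>) / (\<Prod>\<alpha>\<in>S. \<alpha> a powi m' \<alpha>) = 1"
        using nz[OF _ a] simple_rootsD(1)[OF S] by (simp add: prod_zero_iff)
      finally show ?thesis using a by (simp add: char_comb_def)
    qed (simp add: char_comb_def)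
  qed
  moreover have "\<forall>m. char_comb A S m = (\<lambda>a\<in>A. 1) \<longrightarrow> (\<forall>\<alpha>\<in>S. m \<alpha> = 0)" using S[unfolded simple_roots_def] by (elim conjE)
  ultimately have "m \<alpha> - m' \<alpha> = 0" using \<alpha> by blast
  then show ?thesis by simp
qed

lemma char_comb_single:
  assumes "finite S" "\<alpha> \<in> S" "\<alpha> \<in> extensional A"
  shows "char_comb A S (\<lambda>\<beta>. if \<beta> = \<alpha> then 1 else 0) = \<alpha>"
proof
  fix a
  have "(\<Prod>\<beta>\<in>S. \<beta> a powi (if \<beta> = \<alpha> then 1 else 0)) = (\<Prod>\<beta>\<in>S. if \<beta> = \<alpha> then \<alpha> a else 1)"
    by (intro prod.cong) auto
  also have "\<dots> = \<alpha> a" using assms by simp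
  finally show "char_comb A S (\<lambda>\<beta>. if \<beta> = \<alpha> then 1 else 0) a = \<alpha> a"
    using extensional_arb[OF assms(3), of a] by (cases "a \<in> A") (simp_all add: char_comb_def)
qed

text \<open>Both \<open>g\<close> and its inverse permute the roots of \<open>P\<close>, which are the roots that are combinations of
  simple roots with nonnegative coefficients. Let \<open>m\<close> be the coefficients of the conjugate of \<open>\<alpha>\<close> by \<open>g\<close>, and let
  \<open>ht \<gamma>\<close> be the height of the conjugate of \<open>\<gamma>\<close> by the inverse of \<open>g\<close>. Then \<open>\<alpha>\<close> has height \<open>1 = \<Sum> m \<gamma> * ht \<gamma>\<close>,
  where all \<open>ht \<gamma>\<close> are at least \<open>1\<close>, so the conjugate of \<open>\<alpha>\<close> is a single simple root.\<close>

lemma char_conj_simple_subset: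
  fixes A G P :: "('k::field^'n^'n) set"
  assumes inf: "infinite (UNIV :: 'k set)" and S: "simple_roots G P A S" and inv: "\<And>a. a \<in> A \<Longrightarrow> invertible a"
    and g: "invertible g" "conj_set g A = A" "conj_set g P = P" and \<alpha>: "\<alpha> \<in> S"
  shows "char_conj A g \<alpha> \<in> S"
proof -
  note fin = simple_rootsD(1)[OF S]
  have pos: "roots P A = {\<phi> \<in> roots G A. \<exists>m. \<phi> = char_comb A S m \<and> (\<forall>\<alpha>\<in>S. 0 \<le> m \<alpha>)}"
    using S by (simp add: simple_roots_def)
  note SG = simple_rootsD(2)[OF S] and ext = simple_rootsD(3)[OF S]
  have SP: "\<beta> \<in> roots P A" if "\<beta> \<in> S" for \<beta>
  proof -
    have "\<beta> = char_comb A S (\<lambda>\<gamma>. if \<gamma> = \<beta> then 1 else 0)" using char_comb_single[OF fin that ext[OF that]] by simp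
    moreover have "\<forall>\<alpha>\<in>S. 0 \<le> (if \<alpha> = \<beta> then 1 else 0 :: int)" by simp
    ultimately show ?thesis unfolding pos using SG that by blast
  qed
  have g': "invertible (matrix_inv g)" "conj_set (matrix_inv g) A = A" "conj_set (matrix_inv g) P = P"
    using g conj_set_inverse(1)[OF g(1), of A] conj_set_inverse(1)[OF g(1), of P] by (simp_all add: invertible_matrix_inv)
  obtain m where m: "char_conj A g \<alpha> = char_comb A S m" "\<forall>\<beta>\<in>S. 0 \<le> m \<beta>"
    using char_conj_roots[OF inf g(1,2) inv g(3) SP[OF \<alpha>]] unfolding pos by blast
  have "\<forall>\<gamma>\<in>S. \<exists>M. char_conj A (matrix_inv g) \<gamma> = char_comb A S M \<and> (\<forall>\<beta>\<in>S. 0 \<le> M \<beta>)"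
    using char_conj_roots[OF inf g'(1,2) inv g'(3) SP] unfolding pos by blast
  from bchoice[OF this] obtain M where M0: "\<forall>\<gamma>\<in>S. char_conj A (matrix_inv g) \<gamma> = char_comb A S (M \<gamma>) \<and> (\<forall>\<beta>\<in>S. 0 \<le> M \<gamma> \<beta>)"
    by (elim exE)
  note nz = simple_rootsD(4)[OF S]
  have "\<alpha> = char_comb A S (\<lambda>\<delta>. \<Sum>\<gamma>\<in>S. m \<gamma> * M \<gamma> \<delta>)"
  proof
    fix a show "\<alpha> a = char_comb A S (\<lambda>\<delta>. \<Sum>\<gamma>\<in>S. m \<gamma> * M \<gamma> \<delta>) a"
    proof (cases "a \<in> A")
      case a: True
      have ga: "g ** a ** matrix_inv g \<in> A" using g(2) a by (auto simp: conj_set_def)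
      have pow_sum: "x powi (\<Sum>\<gamma>\<in>F. f \<gamma>) = (\<Prod>\<gamma>\<in>F. x powi f \<gamma>)" if "finite F" "x \<noteq> 0" for x :: 'k and f F
        using that by (induction F rule: finite_induct) (simp_all add: power_int_add)
      have prod_pow: "(\<Prod>\<gamma>\<in>F. f \<gamma>) powi n = (\<Prod>\<gamma>\<in>F. f \<gamma> powi n)" for f :: "_ \<Rightarrow> 'k" and F n
        by (induction F rule: infinite_finite_induct) (simp_all add: power_int_mult_distrib)
      have "\<alpha> a = char_conj A (matrix_inv g) (char_conj A g \<alpha>) a" using char_conj_inverse[OF g(1,2) ext[OF \<alpha>]] by simp
      also have "\<dots> = (\<Prod>\<gamma>\<in>S. \<gamma> (g ** a ** matrix_inv g) powi m \<gamma>)"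
        using a ga by (simp add: m(1) char_conj_def[of A "matrix_inv g"] matrix_inv_matrix_inv[OF g(1)] char_comb_def)
      also have "\<dots> = (\<Prod>\<gamma>\<in>S. (\<Prod>\<delta>\<in>S. \<delta> a powi (m \<gamma> * M \<gamma> \<delta>)))"
      proof (rule prod.cong[OF refl])
        fix \<gamma> assume \<gamma>: "\<gamma> \<in> S"
        have "\<gamma> (g ** a ** matrix_inv g) = char_conj A (matrix_inv g) \<gamma> a"
          using a by (simp add: char_conj_def matrix_inv_matrix_inv[OF g(1)])
        also have "\<dots> = (\<Prod>\<delta>\<in>S. \<delta> a powi M \<gamma> \<delta>)" using bspec[OF M0 \<gamma>] a by (simp add: char_comb_def)
        finally show "\<gamma> (g ** a ** matrix_inv g) powi m \<gamma> = (\<Prod>\<delta>\<in>S. \<delta> a powi (m \<gamma> * M \<gamma> \<delta>))"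
          by (simp add: prod_pow power_int_mult[symmetric] mult.commute)
      qed
      also have "\<dots> = (\<Prod>\<delta>\<in>S. \<Prod>\<gamma>\<in>S. \<delta> a powi (m \<gamma> * M \<gamma> \<delta>))" by (rule prod.swap)
      also have "\<dots> = (\<Prod>\<delta>\<in>S. \<delta> a powi (\<Sum>\<gamma>\<in>S. m \<gamma> * M \<gamma> \<delta>))"
        using pow_sum[OF fin] nz[OF _ a] by (intro prod.cong) auto
      finally show ?thesis using a by (simp add: char_comb_def)
    qed (use extensional_arb[OF ext[OF \<alpha>], of a] in \<open>simp add: char_comb_def\<close>)
  qed
  then have eq: "(\<Sum>\<gamma>\<in>S. m \<gamma> * M \<gamma> \<delta>) = (if \<delta> = \<alpha> then 1 else 0)" if "\<delta> \<in> S" for \<delta>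
    using char_comb_eq_iff[OF S _ that, of "\<lambda>\<delta>. \<Sum>\<gamma>\<in>S. m \<gamma> * M \<gamma> \<delta>" "\<lambda>\<beta>. if \<beta> = \<alpha> then 1 else 0"]
      char_comb_single[OF fin \<alpha> ext[OF \<alpha>]] by simp
  define ht where "ht \<gamma> = (\<Sum>\<delta>\<in>S. M \<gamma> \<delta>)" for \<gamma>
  have ht: "1 \<le> ht \<gamma>" if \<gamma>: "\<gamma> \<in> S" for \<gamma>
  proof (rule ccontr)
    assume "\<not> 1 \<le> ht \<gamma>"
    moreover have nn: "\<forall>\<delta>\<in>S. 0 \<le> M \<gamma> \<delta>" using M0 \<gamma> by blast
    ultimately have "ht \<gamma> = 0" using sum_nonneg[of S "M \<gamma>"] unfolding ht_def by simp
    then have "\<forall>\<delta>\<in>S. M \<gamma> \<delta> = 0" using sum_nonneg_eq_0_iff[OF fin, of "M \<gamma>"] nn unfolding ht_def by simp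
    then have "char_comb A S (M \<gamma>) = (\<lambda>a\<in>A. 1)" by (auto simp: char_comb_def intro!: restrict_ext)
    then have "char_conj A (matrix_inv g) \<gamma> = (\<lambda>a\<in>A. 1)" using M0 \<gamma> by simp
    moreover have "char_conj A (matrix_inv g) \<gamma> \<in> roots P A" by (rule char_conj_roots[OF inf g'(1,2) inv g'(3) SP[OF \<gamma>]])
    ultimately show False by (simp add: roots_def)
  qed
  have "(\<Sum>\<gamma>\<in>S. m \<gamma> * ht \<gamma>) = (\<Sum>\<delta>\<in>S. \<Sum>\<gamma>\<in>S. m \<gamma> * M \<gamma> \<delta>)"
    unfolding ht_def sum_distrib_left by (rule sum.swap)
  also have "\<dots> = (\<Sum>\<delta>\<in>S. if \<delta> = \<alpha> then 1 else 0)" using eq by (intro sum.cong) auto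
  also have "\<dots> = 1" using fin \<alpha> by simp
  finally have total: "(\<Sum>\<gamma>\<in>S. m \<gamma> * ht \<gamma>) = 1" .
  have nn: "0 \<le> m \<gamma> * ht \<gamma>" if "\<gamma> \<in> S" for \<gamma> using m(2) ht[OF that] that by simp
  obtain \<gamma> where \<gamma>: "\<gamma> \<in> S" "m \<gamma> \<noteq> 0"
  proof (rule ccontr)
    assume "\<not> thesis"
    then have "\<forall>\<gamma>\<in>S. m \<gamma> = 0" using that by blast
    then show False using total by simp
  qed
  have m1: "1 \<le> m \<gamma>" using \<gamma> m(2) by force
  have rest: "(\<Sum>\<beta>\<in>S - {\<gamma>}. m \<beta> * ht \<beta>) = 1 - m \<gamma> * ht \<gamma>" using sum.remove[OF fin \<gamma>(1), of "\<lambda>\<gamma>. m \<gamma> * ht \<gamma>"] total by simp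
  have ge: "m \<gamma> \<le> m \<gamma> * ht \<gamma>" using m1 ht[OF \<gamma>(1)] by simp
  have "0 \<le> (\<Sum>\<beta>\<in>S - {\<gamma>}. m \<beta> * ht \<beta>)" using nn by (intro sum_nonneg) auto
  then have "m \<gamma> = 1" "(\<Sum>\<beta>\<in>S - {\<gamma>}. m \<beta> * ht \<beta>) = 0" using rest ge m1 by linarith+
  moreover from this(2) have "\<forall>\<beta>\<in>S - {\<gamma>}. m \<beta> * ht \<beta> = 0"
    using sum_nonneg_eq_0_iff[of "S - {\<gamma>}" "\<lambda>\<beta>. m \<beta> * ht \<beta>"] fin nn by simp
  then have "m \<beta> = 0" if "\<beta> \<in> S" "\<beta> \<noteq> \<gamma>" for \<beta> using that ht[OF that(1)] by auto
  ultimately have "char_comb A S m = char_comb A S (\<lambda>\<beta>. if \<beta> = \<gamma> then 1 else 0)"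
    unfolding char_comb_def by (intro restrict_ext prod.cong) auto
  then show ?thesis using m(1) char_comb_single[OF fin \<gamma>(1) ext[OF \<gamma>(1)]] \<gamma>(1) by simp
qed

lemma char_conj_simple_bij:
  fixes A G P :: "('k::field^'n^'n) set"
  assumes inf: "infinite (UNIV :: 'k set)" and S: "simple_roots G P A S" and inv: "\<And>a. a \<in> A \<Longrightarrow> invertible a"
    and g: "invertible g" "conj_set g A = A" "conj_set g P = P"
  shows "bij_betw (char_conj A g) S S"
proof -
  note fin = simple_rootsD(1)[OF S]
  have "inj_on (char_conj A g) S"
  proof (rule inj_onI)
    fix \<alpha> \<beta> assume ab: "\<alpha> \<in> S" "\<beta> \<in> S" "char_conj A g \<alpha> = char_conj A g \<beta>"
    show "\<alpha> = \<beta>"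
      using arg_cong[OF ab(3), of "char_conj A (matrix_inv g)"]
      unfolding char_conj_inverse[OF g(1,2) simple_rootsD(3)[OF S ab(1)]] char_conj_inverse[OF g(1,2) simple_rootsD(3)[OF S ab(2)]] .
  qed
  moreover have "char_conj A g ` S \<subseteq> S" using char_conj_simple_subset[OF inf S inv g] by (intro image_subsetI)
  ultimately show ?thesis using endo_inj_surj[OF fin] unfolding bij_betw_def by simp
qed

section \<open>The group \<open>G\<close> as the largest standard parabolic subgroup\<close>

text \<open>The standing assumptions on the groups, the torus and the simple roots.\<close>

definition admissible :: "('f::field, 'n::finite) datum \<Rightarrow> bool" where
  "admissible D \<longleftrightarrow> nonarch_local_field (absv D) \<and> F_group (Gt D) \<and> reductive_F_group (G0 D) \<and>
     minimal_parabolic_pair (G0 D) (M0 D) (P0 D) \<and> maximal_split_central_torus (M0 D) (A0 D) \<and>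
     simple_roots (G0 D) (P0 D) (A0 D) (simple D)"

lemma admissibleD:
  fixes D :: "('f::field, 'n::finite) datum"
  assumes "admissible D"
  shows "nonarch_local_field (absv D)" "alg_group (Gt D)" "F_group (G0 D)" "alg_group (G0 D)" "G0 D \<subseteq> Gt D"
    "unip_radical (G0 D) = {mat 1}" "M0 D \<subseteq> P0 D" "P0 D \<subseteq> G0 D" "A0 D \<subseteq> M0 D" "alg_group (A0 D)"
    "parabolic_F (G0 D) (P0 D)" "maximal_split_central_torus (M0 D) (A0 D)" "split_torus (A0 D)"
    "simple_roots (G0 D) (P0 D) (A0 D) (simple D)" "finite (simple D)"
proof -
  have a: "nonarch_local_field (absv D)" "F_group (Gt D)" "reductive_F_group (G0 D)"
     "minimal_parabolic_pair (G0 D) (M0 D) (P0 D)" "maximal_split_central_torus (M0 D) (A0 D)"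
     "simple_roots (G0 D) (P0 D) (A0 D) (simple D)" using assms by (simp_all add: admissible_def)
  show "nonarch_local_field (absv D)" "maximal_split_central_torus (M0 D) (A0 D)"
    "simple_roots (G0 D) (P0 D) (A0 D) (simple D)" by (fact a)+
  show "alg_group (Gt D)" using a(2) by (simp add: F_group_def)
  show "F_group (G0 D)" "unip_radical (G0 D) = {mat 1}" using a(3) by (simp_all add: reductive_F_group_def)
  then show "alg_group (G0 D)" by (simp add: F_group_def)
  show "G0 D \<subseteq> Gt D" by (rule identity_component_subset)
  show "parabolic_F (G0 D) (P0 D)" "M0 D \<subseteq> P0 D" using a(4) by (simp_all add: minimal_parabolic_pair_def levi_F_def)
  then show "P0 D \<subseteq> G0 D" by (simp add: parabolic_F_def)
  show "split_torus (A0 D)" "A0 D \<subseteq> M0 D" using a(5) by (auto simp: maximal_split_central_torus_def center_def)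
  then show "alg_group (A0 D)" by (simp add: split_torus_def F_group_def)
  show "finite (simple D)" by (rule simple_rootsD(1)[OF a(6)])
qed

lemma Fpts_mono: "H \<subseteq> K \<Longrightarrow> Fpts H \<subseteq> Fpts K"
  by (auto simp: Fpts_def)

lemma vector_space_mscale: "vector_space (mscale :: 'k::field \<Rightarrow> 'k^'n^'n \<Rightarrow> _)"
  by unfold_locales (simp_all add: vec_eq_iff mscale_nth algebra_simps)

text \<open>All weights of \<open>A\<^sub>0\<close> on the Lie algebra of \<open>G\<close> are integral combinations of the simple roots, and
  \<open>A\<^sub>0\<close> acts semisimply, so the Lie algebra attached to the full set of simple roots is everything.\<close>

lemma std_lie_simple:
  fixes D :: "('f::field, 'n::finite) datum"
  assumes D: "admissible D"
  shows "std_lie D (simple D) = lie (G0 D)"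
proof -
  note a = admissibleD[OF D]
  have inf: "infinite (UNIV :: 'f alg_closure set)" by (rule infinite_alg_closure[OF a(1)])
  interpret mscale: vector_space "mscale :: 'f alg_closure \<Rightarrow> 'f alg_closure^'n^'n \<Rightarrow> _" by (rule vector_space_mscale)
  define W where "W = \<Union>{weight_space (A0 D) (lie (G0 D)) (char_comb (A0 D) (simple D) m) | m :: _ \<Rightarrow> int. True}"
  have std: "std_lie D (simple D) = mscale.span W" by (simp add: std_lie_def W_def)
  have sub: "mscale.subspace (lie (G0 D))" using lie_subspace[OF inf] by (intro mscale.subspaceI)
  have "W \<subseteq> lie (G0 D)" by (auto simp: W_def weight_space_def)
  then have 1: "mscale.span W \<subseteq> lie (G0 D)" using sub by (rule mscale.span_minimal)
  have 2: "Z \<in> mscale.span W" if Z: "Z \<in> lie (G0 D)" for Z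
  proof -
    obtain h :: "'f^'n^'n" where h: "invertible h"
      "\<forall>t\<in>A0 D. \<forall>i j. i \<noteq> j \<longrightarrow> (emb h ** t ** emb (matrix_inv h)) $ i $ j = 0" using a(13) by (auto simp: split_torus_def)
    have diag: "(emb h ** t ** matrix_inv (emb h)) $ i $ j = 0" if "t \<in> A0 D" "i \<noteq> j" for t i j
      using h(2) that by (simp add: emb_matrix_inv[OF h(1), symmetric])
    have "A0 D \<subseteq> G0 D" using a(7,8,9) by blast
    from weight_decomposition[OF inf a(10,4) this _ diag Z] h(1) obtain \<Phi> Zf where
      Zf: "finite \<Phi>" "\<forall>\<phi>\<in>\<Phi>. \<phi> \<in> characters (A0 D) \<and> Zf \<phi> \<in> weight_space (A0 D) (lie (G0 D)) \<phi>" "Z = (\<Sum>\<phi>\<in>\<Phi>. Zf \<phi>)"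
      by (auto simp only: invertible_emb_iff)
    have "Zf \<phi> \<in> mscale.span W" if \<phi>: "\<phi> \<in> \<Phi>" for \<phi>
    proof (cases "Zf \<phi> = 0")
      case False
      have "\<exists>m. \<phi> = char_comb (A0 D) (simple D) m"
      proof (cases "\<phi> = (\<lambda>a\<in>A0 D. 1)")
        case True
        then show ?thesis by (intro exI[of _ "\<lambda>_. 0"]) (simp add: char_comb_def)
      next
        case nt: False
        have "\<phi> \<in> roots (G0 D) (A0 D)" using Zf(2) \<phi> nt False by (auto simp: roots_def)
        moreover have "\<forall>\<phi>\<in>roots (G0 D) (A0 D). \<exists>m. \<phi> = char_comb (A0 D) (simple D) m \<and>
            ((\<forall>\<alpha>\<in>simple D. 0 \<le> m \<alpha>) \<or> (\<forall>\<alpha>\<in>simple D. m \<alpha> \<le> 0))"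
          using a(14)[unfolded simple_roots_def] by (elim conjE)
        ultimately show ?thesis by blast
      qed
      then have "Zf \<phi> \<in> W" using Zf(2) \<phi> unfolding W_def by blast
      then show ?thesis by (rule mscale.span_base)
    qed (simp add: mscale.span_zero)
    then show ?thesis unfolding Zf(3) by (rule mscale.span_sum)
  qed
  show ?thesis unfolding std using 1 2 by blast
qed

lemma std_parabolic_subset: "std_parabolic D J \<subseteq> G0 D"
  by (auto simp: std_parabolic_def parabolic_F_def)

text \<open>The group \<open>G\<close> is itself a parabolic subgroup with the required Lie algebra, and it contains all others.\<close>

lemma std_parabolic_simple:
  fixes D :: "('f::field, 'n::finite) datum"
  assumes D: "admissible D"
  shows "std_parabolic D (simple D) = G0 D"
proof -
  note a = admissibleD[OF D]
  have "parabolic_F (G0 D) (G0 D)" using a(3,8,11) by (auto simp: parabolic_F_def)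
  then have "G0 D \<subseteq> std_parabolic D (simple D)"
    unfolding std_parabolic_def using a(8) std_lie_simple[OF D] by (intro Union_upper) simp
  then show ?thesis using std_parabolic_subset by blast
qed

lemma std_levi_simple:
  fixes D :: "('f::field, 'n::finite) datum"
  assumes D: "admissible D"
  shows "std_levi D (simple D) = G0 D"
proof -
  note a = admissibleD[OF D]
  have "levi_F (G0 D) (G0 D)" using a(3,6) alg_groupD(1)[OF a(4)] by (auto simp: levi_F_def)
  moreover have "M0 D \<subseteq> G0 D" using a(7,8) by blast
  moreover have "M = G0 D" if "levi_F (G0 D) M" for M
  proof -
    have "G0 D = {m ** u | m u. m \<in> M \<and> u \<in> unip_radical (G0 D)}" using that unfolding levi_F_def by (elim conjE)
    then have "G0 D = {m ** mat 1 | m. m \<in> M}" unfolding a(6) by simp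
    then show ?thesis by simp
  qed
  ultimately show ?thesis unfolding std_levi_def std_parabolic_simple[OF D] by (intro the_equality) auto
qed

lemma Fpts_one: "Fpts {mat 1} = {mat 1}"
  using emb_eq_iff[of _ "mat 1"] by (auto simp: Fpts_def)

lemma modulus_trivial_radical:
  fixes P :: "('f::field alg_closure^'n^'n) set"
  assumes v: "nonarch_local_field v" and U: "unip_radical P = {mat 1}" and p: "invertible p"
  shows "modulus v P p = 1"
proof -
  let ?Q = "\<lambda>K. open_subgroup v {mat 1 :: 'f alg_closure^'n^'n} K \<and> compactin (Fpts_top v {mat 1 :: 'f alg_closure^'n^'n}) K"
  have "group (matgrp {mat 1 :: 'f^'n^'n})" by (rule groupI) (auto simp: matgrp_def)
  then have self: "subgroup {mat 1} (matgrp {mat 1 :: 'f^'n^'n})" using group.subgroup_self by (fastforce simp: matgrp_def)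
  have one: "mat 1 \<in> K" "K \<subseteq> {mat 1}" if "?Q K" for K
  proof -
    have s: "subgroup K (matgrp (Fpts {mat 1 :: 'f alg_closure^'n^'n}))" using that by (simp add: open_subgroup_def)
    show "mat 1 \<in> K" using subgroup.one_closed[OF s] by (simp add: matgrp_def)
    show "K \<subseteq> {mat 1}" using subgroup.subset[OF s] by (simp add: matgrp_def Fpts_one)
  qed
  have "?Q {mat 1}"
  proof
    show "open_subgroup v {mat 1 :: 'f alg_closure^'n^'n} {mat 1}" unfolding open_subgroup_def
    proof
      show "subgroup {mat 1} (matgrp (Fpts {mat 1 :: 'f alg_closure^'n^'n}))"
        unfolding Fpts_one by (rule self)
      show "openin (Fpts_top v {mat 1 :: 'f alg_closure^'n^'n}) {mat 1}"
        unfolding openin_Fpts_top[OF v] Fpts_one by (auto intro: exI[of _ 1])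
    qed
    then have "openin (Fpts_top v {mat 1 :: 'f alg_closure^'n^'n}) {mat 1}" by (simp add: open_subgroup_def)
    then show "compactin (Fpts_top v {mat 1 :: 'f alg_closure^'n^'n}) {mat 1}"
      by (intro finite_imp_compactin) (auto dest: openin_subset)
  qed
  then have "?Q (SOME K. ?Q K)" by (rule someI)
  then have K: "(SOME K. ?Q K) = {mat 1}" using one by blast
  have conj: "conj_set p {mat 1} = {mat 1}" using matrix_inv_mult(2)[OF p] by (simp add: conj_set_def)
  show ?thesis unfolding modulus_def U Let_def K conj by (simp add: coset_index_def)
qed

lemma levi_part_trivial_radical:
  assumes "unip_radical P = {mat 1}" "p \<in> Fpts M"
  shows "levi_part P M p = p"
  unfolding levi_part_def assms(1) Fpts_one using assms(2) by (intro the_equality) auto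

lemma conj_Fpts_G0:
  fixes D :: "('f::field, 'n::finite) datum"
  assumes D: "admissible D" and n: "n \<in> Fpts (Gt D)" and h: "h \<in> Fpts (G0 D)"
  shows "matrix_inv n ** h ** n \<in> Fpts (G0 D)"
proof -
  note a = admissibleD[OF D]
  have n': "emb n \<in> Gt D" "invertible n" using n FptsD(4)[OF a(2) n] by (simp_all add: Fpts_def)
  have "conj_set (emb n) (G0 D) = G0 D" by (rule identity_component_normal[OF a(2) n'(1)])
  then have "emb h \<in> conj_set (emb n) (G0 D)" using h by (simp add: Fpts_def)
  then have "matrix_inv (emb n) ** emb h ** emb n \<in> G0 D" using n'(2) by (simp add: mem_conj_set_iff)
  then show ?thesis by (simp add: Fpts_def emb_mult emb_matrix_inv[OF n'(2)])
qed

lemma perm_bij: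
  fixes D :: "('f::field, 'n::finite) datum"
  assumes D: "admissible D" and n: "n \<in> Fpts (Gt D)"
  shows "bij_betw (perm D n) (simple D) (simple D)"
proof (cases "n \<in> Ntilde D")
  case True
  note a = admissibleD[OF D]
  have inf: "infinite (UNIV :: 'f alg_closure set)" by (rule infinite_alg_closure[OF a(1)])
  have n': "invertible n" using FptsD(4)[OF a(2) n] .
  have M: "conj_set (emb n) (M0 D) = M0 D" and P: "conj_set (emb n) (P0 D) = P0 D" using True by (simp_all add: Ntilde_def)
  have A: "conj_set (emb n) (A0 D) = A0 D" by (rule maximal_split_central_torus_conj[OF a(12) n' M])
  have "perm D n = char_conj (A0 D) (emb n)" using True by (auto simp: perm_def char_conj_def)
  then show ?thesis using char_conj_simple_bij[OF inf a(14) alg_groupD(4)[OF a(10)] _ A P] n' by simp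
next
  case False
  then have "perm D n = (\<lambda>\<alpha>. \<alpha>)" by (auto simp: perm_def)
  then show ?thesis by (simp add: bij_betw_def inj_on_def)
qed

text \<open>The factor \<open>n\<close> is only claimed to be a rational point of the whole group, which is true also for the
  default value of \<open>factorization\<close>. On the top term of the complex every such \<open>n\<close> acts through \<open>\<pi>\<close>.\<close>

lemma factorization_correct:
  fixes D :: "('f::field, 'n::finite) datum"
  assumes D: "admissible D" and x: "x \<in> Fpts (Gt D)"
  obtains g n where "factorization D x = (g, n)" "g \<in> Fpts (G0 D)" "n \<in> Fpts (Gt D)" "x = g ** n"
proof (cases "\<exists>g\<in>Fpts (G0 D). \<exists>n\<in>Ntilde D. x = g ** n")
  case True
  define p where "p = (SOME (g, n). g \<in> Fpts (G0 D) \<and> n \<in> Ntilde D \<and> x = g ** n)"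
  have "\<exists>p. case p of (g, n) \<Rightarrow> g \<in> Fpts (G0 D) \<and> n \<in> Ntilde D \<and> x = g ** n" using True by auto
  then have "case p of (g, n) \<Rightarrow> g \<in> Fpts (G0 D) \<and> n \<in> Ntilde D \<and> x = g ** n"
    unfolding p_def by (rule someI_ex)
  moreover have "factorization D x = p" using True by (simp add: factorization_def p_def)
  ultimately show ?thesis using that by (cases p) (auto simp: Ntilde_def)
next
  case False
  then have "factorization D x = (mat 1, x)" by (simp add: factorization_def)
  then show ?thesis using x FptsD(1)[OF admissibleD(4)[OF D]] by (intro that[of "mat 1" x]) simp_all
qed

section \<open>The top term of the complex\<close>

lemma smooth_rep_restrict_group:
  assumes v: "nonarch_local_field v" and \<pi>: "smooth_rep v H \<pi>" and K: "K \<subseteq> H"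
  shows "smooth_rep v K \<pi>"
proof -
  note S = smooth_repD[OF \<pi>]
  have KH: "Fpts K \<subseteq> Fpts H" by (rule Fpts_mono[OF K])
  have "openin (Fpts_top v K) {g\<in>Fpts K. act \<pi> g x = x}" if "x \<in> carrier \<pi>" for x
    using S(7)[OF that] KH unfolding openin_Fpts_top[OF v] by fastforce
  then show ?thesis unfolding smooth_rep_def using S(1-6) subsetD[OF KH] by (intro conjI ballI allI) auto
qed

lemma aug_trivial:
  assumes \<pi>: "smooth_rep v H \<pi>"
  shows "aug {mat 1} \<pi> = {\<zero>\<^bsub>\<pi>\<^esub>}"
proof -
  note S = smooth_repD[OF \<pi>]
  have "aug {mat 1} \<pi> \<subseteq> {\<zero>\<^bsub>\<pi>\<^esub>}"
    using S(5) complex_module_minus(4)[OF S(1)] by (intro aug_least[OF zero_submodule[OF S(1)]]) (simp add: Fpts_one)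
  moreover have "\<zero>\<^bsub>\<pi>\<^esub> \<in> aug {mat 1} \<pi>" by (auto simp: aug_def dest: submodule_complexD(2))
  ultimately show ?thesis by blast
qed

lemma rep_iso_comp:
  assumes "rep_iso H \<pi> \<sigma> f" "rep_iso H \<sigma> \<tau> g"
  shows "rep_iso H \<pi> \<tau> (\<lambda>x. g (f x))"
proof -
  have f: "f \<in> carrier \<pi> \<rightarrow> carrier \<sigma>" "\<And>x y. x \<in> carrier \<pi> \<Longrightarrow> y \<in> carrier \<pi> \<Longrightarrow> f (x \<oplus>\<^bsub>\<pi>\<^esub> y) = f x \<oplus>\<^bsub>\<sigma>\<^esub> f y"
    "\<And>c x. x \<in> carrier \<pi> \<Longrightarrow> f (c \<odot>\<^bsub>\<pi>\<^esub> x) = c \<odot>\<^bsub>\<sigma>\<^esub> f x"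
    "\<And>h x. h \<in> Fpts H \<Longrightarrow> x \<in> carrier \<pi> \<Longrightarrow> f (act \<pi> h x) = act \<sigma> h (f x)" "bij_betw f (carrier \<pi>) (carrier \<sigma>)"
    using assms(1) unfolding rep_iso_def rep_hom_def by blast+
  have g: "g \<in> carrier \<sigma> \<rightarrow> carrier \<tau>" "\<And>x y. x \<in> carrier \<sigma> \<Longrightarrow> y \<in> carrier \<sigma> \<Longrightarrow> g (x \<oplus>\<^bsub>\<sigma>\<^esub> y) = g x \<oplus>\<^bsub>\<tau>\<^esub> g y"
    "\<And>c x. x \<in> carrier \<sigma> \<Longrightarrow> g (c \<odot>\<^bsub>\<sigma>\<^esub> x) = c \<odot>\<^bsub>\<tau>\<^esub> g x"
    "\<And>h x. h \<in> Fpts H \<Longrightarrow> x \<in> carrier \<sigma> \<Longrightarrow> g (act \<sigma> h x) = act \<tau> h (g x)" "bij_betw g (carrier \<sigma>) (carrier \<tau>)"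
    using assms(2) unfolding rep_iso_def rep_hom_def by blast+
  have mem: "f x \<in> carrier \<sigma>" if "x \<in> carrier \<pi>" for x using f(1) that by blast
  have "bij_betw (g \<circ> f) (carrier \<pi>) (carrier \<tau>)" by (rule bij_betw_trans[OF f(5) g(5)])
  then show ?thesis unfolding rep_iso_def rep_hom_def using f(2-4) g(2-4) mem g(1) by (simp add: o_def Pi_iff)
qed

lemma rep_iso_cong:
  assumes \<pi>: "smooth_rep v H \<pi>" and f: "rep_iso H \<pi> \<sigma> f" and eq: "\<And>x. x \<in> carrier \<pi> \<Longrightarrow> f' x = f x"
  shows "rep_iso H \<pi> \<sigma> f'"
proof -
  note S = smooth_repD[OF \<pi>] and C = complex_module_closed[OF smooth_repD(1)[OF \<pi>]]
  have "bij_betw f' (carrier \<pi>) (carrier \<sigma>)" using f eq bij_betw_cong[of "carrier \<pi>" f' f] by (simp add: rep_iso_def)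
  moreover have "rep_hom H \<pi> \<sigma> f" using f by (simp add: rep_iso_def)
  ultimately show ?thesis unfolding rep_iso_def rep_hom_def using eq S(2) C(2,3) by (simp add: Pi_iff)
qed

definition orbit_map :: "('f::field, 'n::finite) datum \<Rightarrow> ('f^'n^'n, 'v) rep \<Rightarrow> 'v \<Rightarrow> 'f^'n^'n \<Rightarrow> 'v set" where
  "orbit_map D \<pi> x = (\<lambda>g\<in>Fpts (G0 D). {act \<pi> g x})"

text \<open>For \<open>J = S\<close> the coinvariants are taken for the trivial group, and the induction is from the whole group.\<close>

lemma X_rep_simple:
  fixes D :: "('f::field, 'n::finite) datum" and \<pi> :: "('f^'n^'n, 'v) rep"
  assumes D: "admissible D" and \<pi>: "smooth_rep (absv D) (G0 D) \<pi>"
  shows "rep_iso (G0 D) \<pi> (X_rep D \<pi> (simple D)) (orbit_map D \<pi>)" "Module.module \<CC> (X_rep D \<pi> (simple D))"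
    "orbit_map D \<pi> \<zero>\<^bsub>\<pi>\<^esub> = \<zero>\<^bsub>X_rep D \<pi> (simple D)\<^esub>" "aug (std_unip D (simple D)) \<pi> = {\<zero>\<^bsub>\<pi>\<^esub>}"
proof -
  note a = admissibleD[OF D] and S = smooth_repD[OF \<pi>]
  show aug: "aug (std_unip D (simple D)) \<pi> = {\<zero>\<^bsub>\<pi>\<^esub>}" using aug_trivial[OF \<pi>] by (simp add: std_parabolic_simple[OF D] a(6))
  define \<sigma> where "\<sigma> = quot \<pi> {\<zero>\<^bsub>\<pi>\<^esub>}"
  have X: "X_rep D \<pi> (simple D) = ind (absv D) (G0 D) (G0 D) \<sigma>"
    unfolding X_rep_def aug \<sigma>_def by (simp only: std_parabolic_simple[OF D])
  have \<sigma>: "smooth_rep (absv D) (G0 D) \<sigma>" unfolding \<sigma>_def by (rule smooth_rep_quot[OF a(1,4) \<pi> zero_subrep[OF \<pi>]])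
  have q: "rep_iso (G0 D) \<pi> \<sigma> (\<lambda>x. {x})" unfolding \<sigma>_def by (rule rep_iso_quot_zero[OF smooth_repD(1,2)[OF \<pi>]])
  note I = rep_iso_ind_self[OF a(1,4) \<sigma>]
  show "Module.module \<CC> (X_rep D \<pi> (simple D))" unfolding X by (rule I(2))
  have mem: "{x} \<in> carrier \<sigma>" if "x \<in> carrier \<pi>" for x using q that by (auto simp: rep_iso_def bij_betw_def)
  have act: "act \<sigma> g {x} = {act \<pi> g x}" if "g \<in> Fpts (G0 D)" "x \<in> carrier \<pi>" for g x
    using q that by (simp add: rep_iso_def rep_hom_def)
  have om: "orbit_map D \<pi> x = (\<lambda>g\<in>Fpts (G0 D). act \<sigma> g {x})" if "x \<in> carrier \<pi>" for x
    unfolding orbit_map_def using act[OF _ that] by (intro restrict_ext) simp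
  have z: "\<zero>\<^bsub>\<sigma>\<^esub> = {\<zero>\<^bsub>\<pi>\<^esub>}" by (simp add: \<sigma>_def quot_def)
  show "orbit_map D \<pi> \<zero>\<^bsub>\<pi>\<^esub> = \<zero>\<^bsub>X_rep D \<pi> (simple D)\<^esub>"
    using I(3) om[OF complex_module_closed(1)[OF S(1)]] by (simp add: X z)
  show "rep_iso (G0 D) \<pi> (X_rep D \<pi> (simple D)) (orbit_map D \<pi>)"
    unfolding X by (rule rep_iso_cong[OF \<pi> rep_iso_comp[OF q I(1)] om])
qed

lemma orderings_empty [simp]: "orderings {} = {[]}"
  by (auto simp: orderings_def)

lemma levels_top:
  assumes "finite (simple D)"
  shows "levels D (srank D) = {simple D}" "levels D (Suc (srank D)) = {}"
proof -
  show "levels D (srank D) = {simple D}" using card_subset_eq[OF assms] by (auto simp: levels_def)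
  show "levels D (Suc (srank D)) = {}" by (auto simp: levels_def dest: card_mono[OF assms])
qed

text \<open>The image of \<open>x\<close> in the top term: the only index set is \<open>S\<close>, and the only ordering of its empty
  complement is the empty list. In \<open>orbit_map\<close> the singletons are the cosets of the zero submodule.\<close>

definition top_elt :: "('f::field, 'n::finite) datum \<Rightarrow> ('f^'n^'n, 'v) rep \<Rightarrow> 'v \<Rightarrow> ('f, 'n, 'v) Yelt" where
  "top_elt D \<pi> x = (\<lambda>J\<in>levels D (srank D). \<lambda>l\<in>orderings (simple D - J). orbit_map D \<pi> x)"

lemma Y_rep_simps:
  "carrier (Y_rep D t \<pi>) = (\<Pi>\<^sub>E J\<in>levels D t. YJ D \<pi> J)"
  "\<zero>\<^bsub>Y_rep D t \<pi>\<^esub> = (\<lambda>J\<in>levels D t. \<lambda>l\<in>orderings (simple D - J). \<zero>\<^bsub>X_rep D \<pi> J\<^esub>)"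
  "y \<oplus>\<^bsub>Y_rep D t \<pi>\<^esub> z = (\<lambda>J\<in>levels D t. \<lambda>l\<in>orderings (simple D - J). y J l \<oplus>\<^bsub>X_rep D \<pi> J\<^esub> z J l)"
  "c \<odot>\<^bsub>Y_rep D t \<pi>\<^esub> y = (\<lambda>J\<in>levels D t. \<lambda>l\<in>orderings (simple D - J). c \<odot>\<^bsub>X_rep D \<pi> J\<^esub> y J l)"
  "act (Y_rep D t \<pi>) = (\<lambda>x y. case factorization D x of (g, n) \<Rightarrow> G_act D t \<pi> g (N_act D t \<pi> n y))"
  by (simp_all add: Y_rep_def)

text \<open>The normalizer acts as it should because \<open>\<pi>(n) \<pi>(n\<^sup>-\<^sup>1hn) x = \<pi>(h) \<pi>(n) x\<close>.\<close>

lemma Y_rep_top: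
  fixes D :: "('f::field, 'n::finite) datum" and \<pi> :: "('f^'n^'n, 'v) rep"
  assumes D: "admissible D" and \<pi>: "smooth_rep (absv D) (Gt D) \<pi>"
  shows "rep_iso (Gt D) \<pi> (Y_rep D (srank D) \<pi>) (top_elt D \<pi>)" "Module.module \<CC> (Y_rep D (srank D) \<pi>)"
    "top_elt D \<pi> \<zero>\<^bsub>\<pi>\<^esub> = \<zero>\<^bsub>Y_rep D (srank D) \<pi>\<^esub>" "d_image D (srank D) \<pi> = {\<zero>\<^bsub>Y_rep D (srank D) \<pi>\<^esub>}"
proof -
  note a = admissibleD[OF D] and S = smooth_repD[OF \<pi>]
  have \<pi>0: "smooth_rep (absv D) (G0 D) \<pi>" by (rule smooth_rep_restrict_group[OF a(1) \<pi> a(5)])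
  note X = X_rep_simple[OF D \<pi>0] and lev = levels_top[OF a(15)]
  let ?X = "X_rep D \<pi> (simple D)" and ?Y = "Y_rep D (srank D) \<pi>" and ?e = "top_elt D \<pi>"
  have hom: "rep_hom (G0 D) \<pi> ?X (orbit_map D \<pi>)" and bij: "bij_betw (orbit_map D \<pi>) (carrier \<pi>) (carrier ?X)"
    using X(1) by (auto simp: rep_iso_def)
  have YJ: "YJ D \<pi> (simple D) = {[]} \<rightarrow>\<^sub>E carrier ?X" by (auto simp: YJ_def)
  have e_mem: "?e x \<in> carrier ?Y" if "x \<in> carrier \<pi>" for x
    using bij that by (auto simp: Y_rep_simps lev YJ top_elt_def bij_betw_def)
  have e_surj: "\<exists>x\<in>carrier \<pi>. y = ?e x" if y: "y \<in> carrier ?Y" for y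
  proof -
    have y': "y \<in> (\<Pi>\<^sub>E J\<in>{simple D}. {[]} \<rightarrow>\<^sub>E carrier ?X)" using y by (auto simp: Y_rep_simps lev PiE_iff YJ)
    then have "y (simple D) [] \<in> carrier ?X" by auto
    then obtain x where x: "x \<in> carrier \<pi>" "y (simple D) [] = orbit_map D \<pi> x" using bij by (auto simp: bij_betw_def)
    have y1: "y (simple D) \<in> {[]} \<rightarrow>\<^sub>E carrier ?X" using y' by auto
    have "y J l = ?e x J l" for J l
    proof (cases "J = simple D")
      case True
      then show ?thesis using x(2) PiE_arb[OF y1, of l] by (cases "l = []") (simp_all add: top_elt_def lev)
    next
      case False
      then show ?thesis using PiE_arb[OF y', of J] by (simp add: top_elt_def lev)
    qed
    then show ?thesis using x(1) by blast
  qed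
  have e_inj: "inj_on ?e (carrier \<pi>)"
  proof (rule inj_onI)
    fix x y assume xy: "x \<in> carrier \<pi>" "y \<in> carrier \<pi>" "?e x = ?e y"
    have "orbit_map D \<pi> x = orbit_map D \<pi> y"
      using fun_cong[OF fun_cong[OF xy(3), of "simple D"], of "[]"] by (simp add: top_elt_def lev)
    then show "x = y" using bij xy(1,2) by (auto simp: bij_betw_def inj_on_def)
  qed
  have e_bij: "bij_betw ?e (carrier \<pi>) (carrier ?Y)" using e_inj e_mem e_surj by (auto simp: bij_betw_def)
  have add: "?e (x \<oplus>\<^bsub>\<pi>\<^esub> y) = ?e x \<oplus>\<^bsub>?Y\<^esub> ?e y" if "x \<in> carrier \<pi>" "y \<in> carrier \<pi>" for x y
    using hom that by (auto simp: Y_rep_simps top_elt_def lev rep_hom_def intro!: restrict_ext)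
  have sc: "?e (c \<odot>\<^bsub>\<pi>\<^esub> x) = c \<odot>\<^bsub>?Y\<^esub> ?e x" if "x \<in> carrier \<pi>" for c x
    using hom that by (auto simp: Y_rep_simps top_elt_def lev rep_hom_def intro!: restrict_ext)
  show e0: "?e \<zero>\<^bsub>\<pi>\<^esub> = \<zero>\<^bsub>?Y\<^esub>" by (auto simp: Y_rep_simps top_elt_def lev X(3) intro!: restrict_ext)
  show "Module.module \<CC> ?Y" using e_bij add sc e0 by (intro module_image[OF S(1), of ?e]) (auto simp: bij_betw_def)
  \<comment> \<open>The complex has no terms above the top one.\<close>
  show "d_image D (srank D) \<pi> = {\<zero>\<^bsub>?Y\<^esub>}"
  proof -
    have f0: "finsum ?X f {} = \<zero>\<^bsub>?X\<^esub>" for f :: "_ \<Rightarrow> 'f^'n^'n \<Rightarrow> 'v set"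
    proof -
      interpret M: Module.module \<CC> ?X by (rule X(2))
      show ?thesis by simp
    qed
    have "d_map D (Suc (srank D)) \<pi> y = \<zero>\<^bsub>?Y\<^esub>" for y
      by (auto simp: d_map_def Y_rep_simps lev f0 intro!: restrict_ext)
    then show ?thesis by (auto simp: d_image_def Y_rep_simps lev)
  qed
  have N: "N_act D (srank D) \<pi> n (?e x) = ?e (act \<pi> n x)" if n: "n \<in> Fpts (Gt D)" and x: "x \<in> carrier \<pi>" for n x
  proof -
    have n': "matrix_inv n \<in> Fpts (Gt D)" using FptsD(3)[OF a(2) n] .
    have b: "perm D (matrix_inv n) ` simple D = simple D" using perm_bij[OF D n'] by (simp add: bij_betw_def)
    have "(\<lambda>h\<in>Fpts (G0 D). coset_map \<pi> (aug (std_unip D (simple D)) \<pi>) (act \<pi> n) (orbit_map D \<pi> x (matrix_inv n ** h ** n))) =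
        orbit_map D \<pi> (act \<pi> n x)"
    proof -
      have "coset_map \<pi> {\<zero>\<^bsub>\<pi>\<^esub>} (act \<pi> n) (orbit_map D \<pi> x (matrix_inv n ** h ** n)) = {act \<pi> h (act \<pi> n x)}"
        if h: "h \<in> Fpts (G0 D)" for h
      proof -
        let ?k = "matrix_inv n ** h ** n"
        have k: "?k \<in> Fpts (G0 D)" by (rule conj_Fpts_G0[OF D n h])
        have kG: "?k \<in> Fpts (Gt D)" "h \<in> Fpts (Gt D)" using k h Fpts_mono[OF a(5)] by blast+
        have "n ** ?k = h ** n" using matrix_inv_mult(2)[OF FptsD(4)[OF a(2) n]] by (simp add: matrix_mul_assoc)
        then have "act \<pi> n (act \<pi> ?k x) = act \<pi> h (act \<pi> n x)"
          using S(6)[OF n kG(1) x] S(6)[OF kG(2) n x] by simp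
        moreover have "act \<pi> n (act \<pi> ?k x) \<in> carrier \<pi>" using S(2) n kG(1) x by simp
        ultimately show ?thesis using k zero_coset[OF S(1)] by (simp add: orbit_map_def coset_map_def)
      qed
      then show ?thesis unfolding X(4) orbit_map_def[of D \<pi> "act \<pi> n x"] by (intro restrict_ext)
    qed
    then show ?thesis using b by (auto simp: N_act_def Let_def lev top_elt_def intro!: restrict_ext)
  qed
  have G: "G_act D (srank D) \<pi> g (?e x) = ?e (act \<pi> g x)" if g: "g \<in> Fpts (G0 D)" and x: "x \<in> carrier \<pi>" for g x
    using hom g x by (auto simp: G_act_def lev top_elt_def rep_hom_def intro!: restrict_ext)
  have act: "?e (act \<pi> x y) = act ?Y x (?e y)" if x: "x \<in> Fpts (Gt D)" and y: "y \<in> carrier \<pi>" for x y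
  proof -
    obtain g n where f: "factorization D x = (g, n)" "g \<in> Fpts (G0 D)" "n \<in> Fpts (Gt D)" "x = g ** n"
      using factorization_correct[OF D x] by blast
    have gG: "g \<in> Fpts (Gt D)" using f(2) Fpts_mono[OF a(5)] by blast
    show ?thesis using N[OF f(3) y] G[OF f(2) S(2)[OF f(3) y]] S(6)[OF gG f(3) y] by (simp add: Y_rep_simps f(1)) (simp add: f(4))
  qed
  show "rep_iso (Gt D) \<pi> ?Y ?e" unfolding rep_iso_def rep_hom_def using e_bij e_mem add sc act by auto
qed

section \<open>The complex of the zero representation\<close>

text \<open>It keeps the zero vector of \<open>\<pi>\<close>; this is the form in which \<open>component\<close> yields the zero representation.\<close>

definition zero_rep :: "('g, 'v) rep \<Rightarrow> ('g, 'v) rep" where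
  "zero_rep \<pi> = \<pi>\<lparr>carrier := {\<zero>\<^bsub>\<pi>\<^esub>}\<rparr>"

lemma trivial_module:
  fixes M (structure)
  assumes "carrier M = {\<zero>}" "\<zero> \<oplus> \<zero> = \<zero>" "\<And>c. c \<odot> \<zero> = \<zero>"
  shows "Module.module \<CC> M"
  using assms by (intro complex_moduleI) auto

definition zero_elt :: "('f::field, 'n::finite) datum \<Rightarrow> nat \<Rightarrow> ('f^'n^'n, 'v) rep \<Rightarrow> ('f, 'n, 'v) Yelt" where
  "zero_elt D t \<pi> = (\<lambda>J\<in>levels D t. \<lambda>l\<in>orderings (simple D - J). \<lambda>g\<in>Fpts (G0 D). {\<zero>\<^bsub>\<pi>\<^esub>})"

lemma X_rep_zero:
  fixes D :: "('f::field, 'n::finite) datum" and \<pi> :: "('f^'n^'n, 'v) rep"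
  assumes D: "admissible D" and \<pi>: "smooth_rep (absv D) (Gt D) \<pi>"
  shows "aug (std_unip D J) (zero_rep \<pi>) = {\<zero>\<^bsub>\<pi>\<^esub>}"
    "carrier (X_rep D (zero_rep \<pi>) J) = {\<lambda>g\<in>Fpts (G0 D). {\<zero>\<^bsub>\<pi>\<^esub>}}" "\<zero>\<^bsub>X_rep D (zero_rep \<pi>) J\<^esub> = (\<lambda>g\<in>Fpts (G0 D). {\<zero>\<^bsub>\<pi>\<^esub>})"
    "Module.module \<CC> (X_rep D (zero_rep \<pi>) J)"
    "g \<in> Fpts (G0 D) \<Longrightarrow> act (X_rep D (zero_rep \<pi>) J) g (\<lambda>g\<in>Fpts (G0 D). {\<zero>\<^bsub>\<pi>\<^esub>}) = (\<lambda>g\<in>Fpts (G0 D). {\<zero>\<^bsub>\<pi>\<^esub>})"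
proof -
  note a = admissibleD[OF D]
  have \<pi>0: "smooth_rep (absv D) (G0 D) \<pi>" by (rule smooth_rep_restrict_group[OF a(1) \<pi> a(5)])
  define \<sigma> where "\<sigma> = zero_rep \<pi>"
  have \<sigma>: "smooth_rep (absv D) (G0 D) \<sigma>" unfolding \<sigma>_def zero_rep_def by (rule smooth_rep_subrep[OF \<pi>0 zero_subrep[OF \<pi>0]])
  have z: "\<zero>\<^bsub>\<sigma>\<^esub> = \<zero>\<^bsub>\<pi>\<^esub>" and car: "carrier \<sigma> = {\<zero>\<^bsub>\<sigma>\<^esub>}" by (simp_all add: \<sigma>_def zero_rep_def)
  note S = smooth_repD[OF \<sigma>]
  have U: "Fpts (std_unip D J) \<subseteq> Fpts (G0 D)"
    using std_parabolic_subset[of D J] by (intro Fpts_mono) (auto simp: unip_radical_def)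
  have "aug (std_unip D J) \<sigma> = {\<zero>\<^bsub>\<sigma>\<^esub>}"
    using submodule_complexD(1,2)[OF aug_submodule(1)[OF \<sigma> U]] car by auto
  then show aug: "aug (std_unip D J) (zero_rep \<pi>) = {\<zero>\<^bsub>\<pi>\<^esub>}" by (simp add: \<sigma>_def z[unfolded \<sigma>_def])
  define \<tau> where "\<tau> = quot \<sigma> {\<zero>\<^bsub>\<sigma>\<^esub>}"
  have \<tau>: "smooth_rep (absv D) (G0 D) \<tau>" unfolding \<tau>_def by (rule smooth_rep_quot[OF a(1,4) \<sigma> zero_subrep[OF \<sigma>]])
  have X: "X_rep D (zero_rep \<pi>) J = ind (absv D) (G0 D) (std_parabolic D J) \<tau>"
    unfolding X_rep_def aug by (simp add: \<tau>_def z flip: \<sigma>_def)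
  have \<tau>z: "\<zero>\<^bsub>\<tau>\<^esub> = {\<zero>\<^bsub>\<pi>\<^esub>}" by (simp add: \<tau>_def quot_def z)
  have \<tau>car: "carrier \<tau> = {{\<zero>\<^bsub>\<pi>\<^esub>}}"
  proof -
    have "carrier (quot \<sigma> {\<zero>\<^bsub>\<sigma>\<^esub>}) = (\<lambda>x. {x}) ` carrier \<sigma>" using rep_iso_quot_zero[OF smooth_repD(1,2)[OF \<sigma>]] by (simp add: rep_iso_def bij_betw_def)
    then show ?thesis unfolding \<tau>_def car z by simp
  qed
  have \<tau>act: "act \<tau> g {\<zero>\<^bsub>\<pi>\<^esub>} = {\<zero>\<^bsub>\<pi>\<^esub>}" if "g \<in> Fpts (G0 D)" for g
    using smooth_rep_act_zero[OF \<tau> that] by (simp add: \<tau>z)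
  let ?z = "\<lambda>g\<in>Fpts (G0 D). {\<zero>\<^bsub>\<pi>\<^esub>}"
  have PG: "Fpts (std_parabolic D J) \<subseteq> Fpts (G0 D)" by (intro Fpts_mono std_parabolic_subset)
  have GF: "\<And>g h. g \<in> Fpts (G0 D) \<Longrightarrow> h \<in> Fpts (G0 D) \<Longrightarrow> g ** h \<in> Fpts (G0 D)" by (rule FptsD(2)[OF a(4)])
  show Xz: "\<zero>\<^bsub>X_rep D (zero_rep \<pi>) J\<^esub> = ?z" by (simp add: X ind_def \<tau>z)
  show Xcar: "carrier (X_rep D (zero_rep \<pi>) J) = {?z}"
  proof
    show "carrier (X_rep D (zero_rep \<pi>) J) \<subseteq> {?z}"
    proof
      fix f assume "f \<in> carrier (X_rep D (zero_rep \<pi>) J)"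
      then have f: "f \<in> Fpts (G0 D) \<rightarrow>\<^sub>E {{\<zero>\<^bsub>\<pi>\<^esub>}}" by (simp add: X ind_def \<tau>car)
      have "f = ?z"
      proof
        fix g show "f g = ?z g" using PiE_mem[OF f, of g] PiE_arb[OF f, of g] by (cases "g \<in> Fpts (G0 D)") simp_all
      qed
      then show "f \<in> {?z}" by simp
    qed
    have stab: "open_subgroup (absv D) (G0 D) {g\<in>Fpts (G0 D). act \<tau> g \<zero>\<^bsub>\<tau>\<^esub> = \<zero>\<^bsub>\<tau>\<^esub>}"
      by (rule open_subgroup_stabilizer[OF a(1,4) \<tau> complex_module_closed(1)[OF smooth_repD(1)[OF \<tau>]]])
    have cov: "?z (p ** g) = act \<tau> p (?z g)" if "p \<in> Fpts (std_parabolic D J)" "g \<in> Fpts (G0 D)" for p g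
      using that subsetD[OF PG that(1)] GF \<tau>act by simp
    have inv: "?z (g ** k) = ?z g" if "g \<in> Fpts (G0 D)" "k \<in> {g\<in>Fpts (G0 D). act \<tau> g \<zero>\<^bsub>\<tau>\<^esub> = \<zero>\<^bsub>\<tau>\<^esub>}" for g k
      using that GF by simp
    have fn: "?z \<in> Fpts (G0 D) \<rightarrow>\<^sub>E carrier \<tau>" by (simp add: \<tau>car)
    have "?z \<in> carrier (ind (absv D) (G0 D) (std_parabolic D J) \<tau>)"
      unfolding ind_def rep.simps module.simps ring.simps partial_object.simps mem_Collect_eq
    proof (intro conjI ballI)
      show "\<exists>K. open_subgroup (absv D) (G0 D) K \<and> (\<forall>g\<in>Fpts (G0 D). \<forall>k\<in>K. ?z (g ** k) = ?z g)"
        by (rule exI, rule conjI[OF stab], intro ballI, rule inv)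
      show "?z \<in> Fpts (G0 D) \<rightarrow>\<^sub>E carrier \<tau>" by (fact fn)
    qed (rule cov)
    then have "?z \<in> carrier (X_rep D (zero_rep \<pi>) J)" by (simp only: X)
    then show "{?z} \<subseteq> carrier (X_rep D (zero_rep \<pi>) J)" by simp
  qed
  note Mt = complex_module_laws[OF smooth_repD(1)[OF \<tau>]] and Ct = complex_module_closed[OF smooth_repD(1)[OF \<tau>]]
  have "{\<zero>\<^bsub>\<pi>\<^esub>} \<oplus>\<^bsub>\<tau>\<^esub> {\<zero>\<^bsub>\<pi>\<^esub>} = {\<zero>\<^bsub>\<pi>\<^esub>}" "\<And>c. c \<odot>\<^bsub>\<tau>\<^esub> {\<zero>\<^bsub>\<pi>\<^esub>} = {\<zero>\<^bsub>\<pi>\<^esub>}"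
    using Mt(1)[OF Ct(1)] Mt(11) by (simp_all add: \<tau>z)
  then have "?z \<oplus>\<^bsub>X_rep D (zero_rep \<pi>) J\<^esub> ?z = ?z" "\<And>c. c \<odot>\<^bsub>X_rep D (zero_rep \<pi>) J\<^esub> ?z = ?z"
    by (auto simp: X ind_def intro!: restrict_ext)
  then show "Module.module \<CC> (X_rep D (zero_rep \<pi>) J)" by (intro trivial_module) (simp_all only: Xcar Xz)
  show "g \<in> Fpts (G0 D) \<Longrightarrow> act (X_rep D (zero_rep \<pi>) J) g ?z = ?z"
    using GF by (auto simp: X ind_def intro!: restrict_ext)
qed

lemma orderings_swap:
  assumes "l \<in> orderings T" "i < length l" "j < length l"
  shows "l[i := l ! j, j := l ! i] \<in> orderings T"
  using assms by (simp add: orderings_def)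

lemma orderings_map:
  assumes "bij_betw b S S" "J \<subseteq> S" "l \<in> orderings (S - J)"
  shows "map b l \<in> orderings (S - b ` J)"
proof -
  have inj: "inj_on b S" and im: "b ` S = S" using assms(1) by (auto simp: bij_betw_def)
  have l: "distinct l" "set l = S - J" using assms(3) by (auto simp: orderings_def)
  have "b ` (S - J) = S - b ` J" using inj_on_image_set_diff[OF inj, of S J] im assms(2) by auto
  moreover have "inj_on b (set l)" using l(2) inj by (auto intro: inj_on_subset)
  ultimately show ?thesis using l by (simp add: orderings_def distinct_map)
qed

text \<open>The normalizer and the differential evaluate elements of the complex at other index sets and other
  orderings. These stay in the range where elements of the complex are defined, so the zero element is mapped to
  the zero element.\<close>

lemma Y_rep_zero:
  fixes D :: "('f::field, 'n::finite) datum" and \<pi> :: "('f^'n^'n, 'v) rep"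
  assumes D: "admissible D" and \<pi>: "smooth_rep (absv D) (Gt D) \<pi>"
  shows "carrier (Y_rep D t (zero_rep \<pi>)) = {zero_elt D t \<pi>}" "\<zero>\<^bsub>Y_rep D t (zero_rep \<pi>)\<^esub> = zero_elt D t \<pi>"
    "Module.module \<CC> (Y_rep D t (zero_rep \<pi>))"
    "x \<in> Fpts (Gt D) \<Longrightarrow> act (Y_rep D t (zero_rep \<pi>)) x (zero_elt D t \<pi>) = zero_elt D t \<pi>"
    "d_image D t (zero_rep \<pi>) = {zero_elt D t \<pi>}"
proof -
  note a = admissibleD[OF D] and X = X_rep_zero[OF D \<pi>] and S = smooth_repD[OF \<pi>]
  let ?z = "\<lambda>g\<in>Fpts (G0 D). {\<zero>\<^bsub>\<pi>\<^esub>}" and ?\<sigma> = "zero_rep \<pi>"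
  note MX = complex_module_laws[OF X(4)] and CX = complex_module_closed[OF X(4)]
  have sm: "c \<odot>\<^bsub>X_rep D ?\<sigma> J\<^esub> ?z = ?z" for c J using MX(11)[of J c] by (simp only: X(3))
  have ad: "?z \<oplus>\<^bsub>X_rep D ?\<sigma> J\<^esub> ?z = ?z" for J using MX(1)[OF CX(1), of J] by (simp only: X(3))
  have YJ: "YJ D ?\<sigma> J = {\<lambda>l\<in>orderings (simple D - J). ?z}" for J
  proof
    show "YJ D ?\<sigma> J \<subseteq> {\<lambda>l\<in>orderings (simple D - J). ?z}"
    proof
      fix y assume "y \<in> YJ D ?\<sigma> J"
      then have y: "y \<in> orderings (simple D - J) \<rightarrow>\<^sub>E {?z}" by (simp add: YJ_def X(2))
      have "y = (\<lambda>l\<in>orderings (simple D - J). ?z)"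
      proof
        fix l show "y l = (\<lambda>l\<in>orderings (simple D - J). ?z) l"
          using PiE_mem[OF y, of l] PiE_arb[OF y, of l] by (cases "l \<in> orderings (simple D - J)") simp_all
      qed
      then show "y \<in> {\<lambda>l\<in>orderings (simple D - J). ?z}" by simp
    qed
    have "(\<lambda>l\<in>orderings (simple D - J). ?z) \<in> YJ D ?\<sigma> J"
      unfolding YJ_def X(2) by (auto simp: sm orderings_swap)
    then show "{\<lambda>l\<in>orderings (simple D - J). ?z} \<subseteq> YJ D ?\<sigma> J" by simp
  qed
  show car: "carrier (Y_rep D t ?\<sigma>) = {zero_elt D t \<pi>}" for t
  proof
    show "carrier (Y_rep D t ?\<sigma>) \<subseteq> {zero_elt D t \<pi>}"
    proof
      fix y assume "y \<in> carrier (Y_rep D t ?\<sigma>)"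
      then have y: "y \<in> (\<Pi>\<^sub>E J\<in>levels D t. {\<lambda>l\<in>orderings (simple D - J). ?z})" by (simp add: Y_rep_simps YJ)
      have "y = zero_elt D t \<pi>"
      proof
        fix J show "y J = zero_elt D t \<pi> J"
          using PiE_mem[OF y, of J] PiE_arb[OF y, of J] by (cases "J \<in> levels D t") (simp_all add: zero_elt_def)
      qed
      then show "y \<in> {zero_elt D t \<pi>}" by simp
    qed
    show "{zero_elt D t \<pi>} \<subseteq> carrier (Y_rep D t ?\<sigma>)" by (auto simp: Y_rep_simps YJ zero_elt_def)
  qed
  show z: "\<zero>\<^bsub>Y_rep D t ?\<sigma>\<^esub> = zero_elt D t \<pi>" unfolding Y_rep_simps zero_elt_def X(3) ..
  have "zero_elt D t \<pi> \<oplus>\<^bsub>Y_rep D t ?\<sigma>\<^esub> zero_elt D t \<pi> = zero_elt D t \<pi>"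
    unfolding Y_rep_simps by (subst (3) zero_elt_def, intro restrict_ext) (simp add: zero_elt_def ad)
  moreover have "c \<odot>\<^bsub>Y_rep D t ?\<sigma>\<^esub> zero_elt D t \<pi> = zero_elt D t \<pi>" for c
    unfolding Y_rep_simps by (subst (2) zero_elt_def, intro restrict_ext) (simp add: zero_elt_def sm)
  ultimately show "Module.module \<CC> (Y_rep D t ?\<sigma>)" by (intro trivial_module) (simp_all only: car z)
  have N: "N_act D t ?\<sigma> n (zero_elt D t \<pi>) = zero_elt D t \<pi>" if n: "n \<in> Fpts (Gt D)" for n
  proof -
    have b: "bij_betw (perm D (matrix_inv n)) (simple D) (simple D)" by (rule perm_bij[OF D FptsD(3)[OF a(2) n]])
    define b where "b = perm D (matrix_inv n)"
    note b = b[folded b_def]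
    have coset: "coset_map ?\<sigma> {\<zero>\<^bsub>\<pi>\<^esub>} (act \<pi> n) {\<zero>\<^bsub>\<pi>\<^esub>} = {\<zero>\<^bsub>\<pi>\<^esub>}"
    proof -
      have "act \<pi> n \<zero>\<^bsub>\<pi>\<^esub> = \<zero>\<^bsub>\<pi>\<^esub>" by (rule smooth_rep_act_zero[OF \<pi> n])
      moreover have "{\<zero>\<^bsub>\<pi>\<^esub>} +>\<^bsub>?\<sigma>\<^esub> \<zero>\<^bsub>\<pi>\<^esub> = {\<zero>\<^bsub>\<pi>\<^esub>}"
        using zero_coset[OF S(1) complex_module_closed(1)[OF S(1)]] by (simp add: a_r_coset_def' zero_rep_def)
      ultimately show ?thesis by (simp add: coset_map_def)
    qed
    have "zero_elt D t \<pi> (b ` J) (map b l) (matrix_inv n ** h ** n) = {\<zero>\<^bsub>\<pi>\<^esub>}"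
      if J: "J \<in> levels D t" and l: "l \<in> orderings (simple D - J)" and h: "h \<in> Fpts (G0 D)" for J l h
    proof -
      have JS: "J \<subseteq> simple D" "card J = t" using J by (auto simp: levels_def)
      have "b ` J \<subseteq> simple D" "card (b ` J) = t"
        using b JS card_image[OF inj_on_subset[OF bij_betw_imp_inj_on[OF b] JS(1)]] by (auto simp: bij_betw_def)
      then have "b ` J \<in> levels D t" by (simp add: levels_def)
      then show ?thesis using orderings_map[OF b JS(1) l] conj_Fpts_G0[OF D n h] by (simp add: zero_elt_def)
    qed
    moreover have "act ?\<sigma> n = act \<pi> n" by (simp add: zero_rep_def)
    ultimately show ?thesis
      unfolding N_act_def Let_def b_def[symmetric] X(1) zero_elt_def[of D t \<pi>, symmetric]
      by (subst (2) zero_elt_def) (auto simp: coset intro!: restrict_ext)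
  qed
  have G: "G_act D t ?\<sigma> g (zero_elt D t \<pi>) = zero_elt D t \<pi>" if g: "g \<in> Fpts (G0 D)" for g
    unfolding G_act_def using X(5)[OF g] by (subst (2) zero_elt_def) (auto simp: zero_elt_def intro!: restrict_ext)
  show "act (Y_rep D t ?\<sigma>) x (zero_elt D t \<pi>) = zero_elt D t \<pi>" if x: "x \<in> Fpts (Gt D)"
  proof -
    obtain g n where "factorization D x = (g, n)" "g \<in> Fpts (G0 D)" "n \<in> Fpts (Gt D)" "x = g ** n"
      using factorization_correct[OF D x] by blast
    then show ?thesis using N G by (simp add: Y_rep_simps)
  qed
  show "d_image D t ?\<sigma> = {zero_elt D t \<pi>}"
  proof -
    have psi: "psi D ?\<sigma> I i (zero_elt D (Suc t) \<pi> (insert i I)) m = ?z"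
      if I: "I \<in> levels D t" and i: "i \<in> simple D - I" and m: "m \<in> orderings (simple D - I)" for I i m
    proof -
      have fI: "finite I" using I a(15) finite_subset by (auto simp: levels_def)
      have "insert i I \<in> levels D (Suc t)" using I i fI by (auto simp: levels_def)
      moreover have "remove1 i m \<in> orderings (simple D - insert i I)" using m by (auto simp: orderings_def)
      moreover have "coset_map ?\<sigma> {\<zero>\<^bsub>\<pi>\<^esub>} (\<lambda>x. x) {\<zero>\<^bsub>\<pi>\<^esub>} = {\<zero>\<^bsub>\<pi>\<^esub>}"
        using zero_coset[OF S(1) complex_module_closed(1)[OF S(1)]] by (simp add: coset_map_def a_r_coset_def' zero_rep_def)
      ultimately have "(\<lambda>g\<in>Fpts (G0 D). coset_map ?\<sigma> (aug (std_unip D I) ?\<sigma>) (\<lambda>x. x)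
          (zero_elt D (Suc t) \<pi> (insert i I) (remove1 i m) g)) = ?z"
        unfolding X(1) by (intro restrict_ext) (simp add: zero_elt_def)
      then show ?thesis using m sm by (simp add: psi_def)
    qed
    have "finsum (X_rep D ?\<sigma> I) (\<lambda>i. psi D ?\<sigma> I i (zero_elt D (Suc t) \<pi> (insert i I)) m) (simple D - I) = ?z"
      if I: "I \<in> levels D t" and m: "m \<in> orderings (simple D - I)" for I m
    proof -
      interpret M: Module.module \<CC> "X_rep D ?\<sigma> I" by (rule X(4))
      have "finsum (X_rep D ?\<sigma> I) (\<lambda>i. psi D ?\<sigma> I i (zero_elt D (Suc t) \<pi> (insert i I)) m) (simple D - I) =
          finsum (X_rep D ?\<sigma> I) (\<lambda>i. \<zero>\<^bsub>X_rep D ?\<sigma> I\<^esub>) (simple D - I)"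
        using psi[OF I _ m] by (intro M.finsum_cong') (simp_all add: X(2,3) Pi_I)
      also have "\<dots> = \<zero>\<^bsub>X_rep D ?\<sigma> I\<^esub>" by (rule M.finsum_zero)
      finally show ?thesis by (simp only: X(3))
    qed
    then have "d_map D (Suc t) ?\<sigma> (zero_elt D (Suc t) \<pi>) = zero_elt D t \<pi>"
      unfolding d_map_def by (subst (2) zero_elt_def) (auto intro!: restrict_ext)
    then show ?thesis by (simp add: d_image_def car)
  qed
qed

section \<open>Objects of the top factor\<close>

text \<open>The condition on irreducible subquotients passes from \<open>\<pi>\<close> to \<open>W\<close>. That \<open>W\<close> has finite length is part of
  its belonging to some factor.\<close>

lemma Rt_restrict:
  fixes D :: "('f::field, 'n::finite) datum" and \<pi> :: "('f^'n^'n, 'v) rep"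
  assumes D: "admissible D" and \<pi>: "Rt D t \<pi>" and W: "subrep (Gt D) \<pi> W" and s: "Rt D s (\<pi>\<lparr>carrier := W\<rparr>)"
  shows "Rt D t (\<pi>\<lparr>carrier := W\<rparr>)"
proof -
  note a = admissibleD[OF D]
  have \<pi>1: "smooth_rep (absv D) (Gt D) \<pi>" using \<pi> by (simp add: Rt_def R_cat_def)
  have M: "Module.module \<CC> \<pi>" by (rule smooth_repD(1)[OF \<pi>1])
  have W0: "subrep (G0 D) \<pi> W" using W Fpts_mono[OF a(5)] by (auto simp: subrep_def)
  have cat: "R_cat (absv D) (Gt D) (\<pi>\<lparr>carrier := W\<rparr>)" "R_cat (absv D) (G0 D) (\<pi>\<lparr>carrier := W\<rparr>)"
    using s by (auto simp: Rt_def Rt_conn_def)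
  have "Rt_conn D t \<pi>" using \<pi> by (simp add: Rt_def)
  note c = conjunct2[OF this[unfolded Rt_conn_def], rule_format]
  have "Rt_conn D t (\<pi>\<lparr>carrier := W\<rparr>)"
    unfolding Rt_conn_def
  proof (intro conjI allI impI cat(2))
    fix W1 W2
    assume asm: "subrep (G0 D) (\<pi>\<lparr>carrier := W\<rparr>) W1 \<and> subrep (G0 D) (\<pi>\<lparr>carrier := W\<rparr>) W2 \<and> W2 \<subseteq> W1 \<and>
      irreducible_rep (G0 D) (subquot (\<pi>\<lparr>carrier := W\<rparr>) W1 W2)"
    have eq: "subquot (\<pi>\<lparr>carrier := W\<rparr>) W1 W2 = subquot \<pi> W1 W2" by simp
    have "subrep (G0 D) \<pi> W1 \<and> subrep (G0 D) \<pi> W2 \<and> W2 \<subseteq> W1 \<and> irreducible_rep (G0 D) (subquot \<pi> W1 W2)"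
      using asm subrep_restrict_iff[OF M W0] unfolding eq by blast
    note c' = c[OF this]
    show "\<exists>I (\<tau> :: ('f^'n^'n, 'v set) rep) Z Z' f. I \<subseteq> simple D \<and> card I = t \<and>
          supercuspidal (absv D) (std_levi D I) \<tau> \<and> irreducible_rep (std_levi D I) \<tau> \<and>
          (let \<iota> = parabolic_ind (absv D) (G0 D) (std_parabolic D I) (std_levi D I) \<tau>
           in subrep (G0 D) \<iota> Z \<and> subrep (G0 D) \<iota> Z' \<and> Z' \<subseteq> Z \<and>
              rep_iso (G0 D) (subquot (\<pi>\<lparr>carrier := W\<rparr>) W1 W2) (subquot \<iota> Z Z') f)"
      unfolding eq by (rule c')
  qed
  then show ?thesis using cat(1) by (simp add: Rt_def)
qed

lemma block_index_top:
  assumes "Rt D (srank D) \<pi>"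
  shows "block_index D \<pi> = srank D"
  unfolding block_index_def using assms by (intro Greatest_equality) auto

text \<open>Every subrepresentation that belongs to some factor belongs to the top factor, so \<open>block_index\<close> assigns it
  the index \<open>r\<close>. Hence for smaller \<open>t\<close> the component is the intersection of all subrepresentations.\<close>

lemma component_top_factor:
  fixes D :: "('f::field, 'n::finite) datum" and \<pi> :: "('f^'n^'n, 'v) rep"
  assumes D: "admissible D" and \<pi>: "Rt D (srank D) \<pi>"
  shows "component D (srank D) \<pi> = \<pi>" "t < srank D \<Longrightarrow> component D t \<pi> = zero_rep \<pi>"
proof -
  have \<pi>1: "smooth_rep (absv D) (Gt D) \<pi>" using \<pi> by (simp add: Rt_def R_cat_def)
  have self: "\<pi>\<lparr>carrier := carrier \<pi>\<rparr> = \<pi>" by simp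
  have car: "subrep (Gt D) \<pi> (carrier \<pi>)" by (rule carrier_subrep[OF \<pi>1])
  have sub: "W \<subseteq> carrier \<pi>" "\<zero>\<^bsub>\<pi>\<^esub> \<in> W" if "subrep (Gt D) \<pi> W" for W
    using submodule_complexD(1,2)[OF subrepD(1)[OF that]] by auto
  have "\<Inter>{W. subrep (Gt D) \<pi> W \<and>
     (\<forall>W'. subrep (Gt D) \<pi> W' \<and> (\<exists>s\<le>srank D. Rt D s (\<pi>\<lparr>carrier := W'\<rparr>)) \<and>
        block_index D (\<pi>\<lparr>carrier := W'\<rparr>) = srank D \<longrightarrow> W' \<subseteq> W)} = carrier \<pi>" (is "\<Inter>?A = _")
  proof
    have "carrier \<pi> \<in> ?A" using car sub(1) by simp
    then show "\<Inter>?A \<subseteq> carrier \<pi>" by (rule Inter_lower)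
    have "subrep (Gt D) \<pi> (carrier \<pi>) \<and> (\<exists>s\<le>srank D. Rt D s (\<pi>\<lparr>carrier := carrier \<pi>\<rparr>)) \<and>
        block_index D (\<pi>\<lparr>carrier := carrier \<pi>\<rparr>) = srank D"
      unfolding self using car \<pi> block_index_top[OF \<pi>] by blast
    then show "carrier \<pi> \<subseteq> \<Inter>?A" by (intro Inter_greatest) blast
  qed
  then show "component D (srank D) \<pi> = \<pi>" by (simp add: component_def)
  assume t: "t < srank D"
  have none: "block_index D (\<pi>\<lparr>carrier := W\<rparr>) \<noteq> t" if "subrep (Gt D) \<pi> W" "Rt D s (\<pi>\<lparr>carrier := W\<rparr>)" for s W
    using block_index_top[OF Rt_restrict[OF D \<pi> that]] t by simp
  have "\<Inter>{W. subrep (Gt D) \<pi> W \<and>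
     (\<forall>W'. subrep (Gt D) \<pi> W' \<and> (\<exists>s\<le>srank D. Rt D s (\<pi>\<lparr>carrier := W'\<rparr>)) \<and>
        block_index D (\<pi>\<lparr>carrier := W'\<rparr>) = t \<longrightarrow> W' \<subseteq> W)} = {\<zero>\<^bsub>\<pi>\<^esub>}" (is "\<Inter>?B = _")
  proof
    have "{\<zero>\<^bsub>\<pi>\<^esub>} \<in> ?B" using zero_subrep[OF \<pi>1] none by blast
    then show "\<Inter>?B \<subseteq> {\<zero>\<^bsub>\<pi>\<^esub>}" by (rule Inter_lower)
    show "{\<zero>\<^bsub>\<pi>\<^esub>} \<subseteq> \<Inter>?B" using sub(2) by blast
  qed
  then show "component D t \<pi> = zero_rep \<pi>" by (simp add: component_def zero_rep_def)
qed

section \<open>The isomorphism on the top factor\<close>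

text \<open>The singletons are the cosets modulo the image of the differential, which is zero in every factor.\<close>

definition unit_DA :: "('f::field, 'n::finite) datum \<Rightarrow> ('f^'n^'n, 'v) rep \<Rightarrow> 'v \<Rightarrow> ('f, 'n, 'v) DAelt" where
  "unit_DA D \<pi> x = (\<lambda>t\<in>{..srank D}. if t = srank D then {top_elt D \<pi> x} else {zero_elt D t \<pi>})"

lemma DA_simps:
  "carrier (DA D \<pi>) = (\<Pi>\<^sub>E t\<in>{..srank D}. carrier (DA_block D t (component D t \<pi>)))"
  "c \<oplus>\<^bsub>DA D \<pi>\<^esub> c' = (\<lambda>t\<in>{..srank D}. c t \<oplus>\<^bsub>DA_block D t (component D t \<pi>)\<^esub> c' t)"
  "z \<odot>\<^bsub>DA D \<pi>\<^esub> c = (\<lambda>t\<in>{..srank D}. z \<odot>\<^bsub>DA_block D t (component D t \<pi>)\<^esub> c t)"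
  "act (DA D \<pi>) g c = (\<lambda>t\<in>{..srank D}. act (DA_block D t (component D t \<pi>)) g (c t))"
  by (simp_all add: DA_def Let_def)

lemma DA_blocks:
  fixes D :: "('f::field, 'n::finite) datum" and \<pi> :: "('f^'n^'n, 'v) rep"
  assumes D: "admissible D" and \<pi>: "Rt D (srank D) \<pi>"
  shows "DA_block D (srank D) (component D (srank D) \<pi>) = quot (Y_rep D (srank D) \<pi>) {\<zero>\<^bsub>Y_rep D (srank D) \<pi>\<^esub>}"
    "t < srank D \<Longrightarrow> DA_block D t (component D t \<pi>) =
      quot (Y_rep D t (zero_rep \<pi>)) {\<zero>\<^bsub>Y_rep D t (zero_rep \<pi>)\<^esub>}"
proof -
  have \<pi>1: "smooth_rep (absv D) (Gt D) \<pi>" using \<pi> by (simp add: Rt_def R_cat_def)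
  show "DA_block D (srank D) (component D (srank D) \<pi>) = quot (Y_rep D (srank D) \<pi>) {\<zero>\<^bsub>Y_rep D (srank D) \<pi>\<^esub>}"
    by (simp add: DA_block_def component_top_factor(1)[OF D \<pi>] Y_rep_top(4)[OF D \<pi>1])
  show "t < srank D \<Longrightarrow> DA_block D t (component D t \<pi>) =
      quot (Y_rep D t (zero_rep \<pi>)) {\<zero>\<^bsub>Y_rep D t (zero_rep \<pi>)\<^esub>}"
    by (simp add: DA_block_def component_top_factor(2)[OF D \<pi>] Y_rep_zero(2,5)[OF D \<pi>1])
qed

lemma rep_iso_unit_DA:
  fixes D :: "('f::field, 'n::finite) datum" and \<pi> :: "('f^'n^'n, 'v) rep"
  assumes D: "admissible D" and \<pi>: "Rt D (srank D) \<pi>"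
  shows "rep_iso (Gt D) \<pi> (DA D \<pi>) (unit_DA D \<pi>)"
proof -
  note a = admissibleD[OF D]
  have \<pi>1: "smooth_rep (absv D) (Gt D) \<pi>" using \<pi> by (simp add: Rt_def R_cat_def)
  note S = smooth_repD[OF \<pi>1] and C = complex_module_closed[OF smooth_repD(1)[OF \<pi>1]]
  note T = Y_rep_top[OF D \<pi>1] and B = DA_blocks[OF D \<pi>]
  note Z = Y_rep_zero[OF D \<pi>1]
  note qT = quot_zero_simps[OF T(2)] and qZ = quot_zero_simps[OF Z(3)]
  let ?e = "top_elt D \<pi>" and ?Y = "Y_rep D (srank D) \<pi>"
  have e: "bij_betw ?e (carrier \<pi>) (carrier ?Y)" "?e x \<in> carrier ?Y" "?e (x \<oplus>\<^bsub>\<pi>\<^esub> y) = ?e x \<oplus>\<^bsub>?Y\<^esub> ?e y"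
      "?e (c \<odot>\<^bsub>\<pi>\<^esub> x) = c \<odot>\<^bsub>?Y\<^esub> ?e x" "g \<in> Fpts (Gt D) \<Longrightarrow> ?e (act \<pi> g x) = act ?Y g (?e x)"
    if "x \<in> carrier \<pi>" "y \<in> carrier \<pi>" for x y c g
    using T(1) that by (auto simp: rep_iso_def rep_hom_def)
  have bij: "bij_betw ?e (carrier \<pi>) (carrier ?Y)" using T(1) by (simp add: rep_iso_def)
  have top: "carrier (DA_block D (srank D) (component D (srank D) \<pi>)) = (\<lambda>x. {?e x}) ` carrier \<pi>"
    unfolding B(1) qT(1) using bij by (auto simp: bij_betw_def)
  have low: "carrier (DA_block D t (component D t \<pi>)) = {{zero_elt D t \<pi>}}" if "t < srank D" for t
    unfolding B(2)[OF that] qZ(1) Z(1) by simp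
  have mem: "unit_DA D \<pi> x \<in> carrier (DA D \<pi>)" if "x \<in> carrier \<pi>" for x
    unfolding DA_simps(1)
  proof (rule PiE_I)
    fix t assume "t \<in> {..srank D}"
    then consider "t = srank D" | "t < srank D" by fastforce
    then show "unit_DA D \<pi> x t \<in> carrier (DA_block D t (component D t \<pi>))"
      using top low that by cases (simp_all add: unit_DA_def)
  qed (simp add: unit_DA_def)
  have surj: "\<exists>x\<in>carrier \<pi>. c = unit_DA D \<pi> x" if c: "c \<in> carrier (DA D \<pi>)" for c
  proof -
    have c': "c \<in> (\<Pi>\<^sub>E t\<in>{..srank D}. carrier (DA_block D t (component D t \<pi>)))" using c by (simp only: DA_simps)
    have "c (srank D) \<in> (\<lambda>x. {?e x}) ` carrier \<pi>" using PiE_mem[OF c', of "srank D"] top by simp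
    then obtain x where x: "x \<in> carrier \<pi>" "c (srank D) = {?e x}" by blast
    have "c t = unit_DA D \<pi> x t" for t
    proof -
      consider "t = srank D" | "t < srank D" | "t \<notin> {..srank D}" by fastforce
      then show ?thesis
        using x PiE_mem[OF c', of t] low[of t] PiE_arb[OF c', of t] by cases (simp_all add: unit_DA_def)
    qed
    then show ?thesis using x(1) by blast
  qed
  have inj: "inj_on (unit_DA D \<pi>) (carrier \<pi>)"
  proof (rule inj_onI)
    fix x y assume xy: "x \<in> carrier \<pi>" "y \<in> carrier \<pi>" "unit_DA D \<pi> x = unit_DA D \<pi> y"
    have "?e x = ?e y" using fun_cong[OF xy(3), of "srank D"] by (simp add: unit_DA_def)
    then show "x = y" using bij xy(1,2) by (auto simp: bij_betw_def inj_on_def)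
  qed
  have zin: "zero_elt D t \<pi> \<in> carrier (Y_rep D t (zero_rep \<pi>))" for t by (simp add: Z(1))
  have split: "f = unit_DA D \<pi> w"
    if "f (srank D) = {?e w}" "\<And>t. t < srank D \<Longrightarrow> f t = {zero_elt D t \<pi>}" "\<And>t. t \<notin> {..srank D} \<Longrightarrow> f t = undefined" for f w
  proof
    fix t
    consider "t = srank D" | "t < srank D" | "t \<notin> {..srank D}" by fastforce
    then show "f t = unit_DA D \<pi> w t" using that by cases (simp_all add: unit_DA_def)
  qed
  have u: "unit_DA D \<pi> x (srank D) = {?e x}" "t < srank D \<Longrightarrow> unit_DA D \<pi> x t = {zero_elt D t \<pi>}" for x t
    by (simp_all add: unit_DA_def)
  have z1: "zero_elt D t \<pi> \<oplus>\<^bsub>Y_rep D t (zero_rep \<pi>)\<^esub> zero_elt D t \<pi> = zero_elt D t \<pi>"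
    "c \<odot>\<^bsub>Y_rep D t (zero_rep \<pi>)\<^esub> zero_elt D t \<pi> = zero_elt D t \<pi>" for t c
    using complex_module_closed(2)[OF Z(3) zin zin, of t] complex_module_closed(3)[OF Z(3) zin, of t c]
    by (simp_all only: Z(1) singleton_iff)
  have add: "unit_DA D \<pi> x \<oplus>\<^bsub>DA D \<pi>\<^esub> unit_DA D \<pi> y = unit_DA D \<pi> (x \<oplus>\<^bsub>\<pi>\<^esub> y)" if xy: "x \<in> carrier \<pi>" "y \<in> carrier \<pi>" for x y
  proof (rule split; unfold DA_simps)
    show "(\<lambda>t\<in>{..srank D}. unit_DA D \<pi> x t \<oplus>\<^bsub>DA_block D t (component D t \<pi>)\<^esub> unit_DA D \<pi> y t) (srank D) = {?e (x \<oplus>\<^bsub>\<pi>\<^esub> y)}"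
      using qT(2)[OF e(2)[OF xy(1,1)] e(2)[OF xy(2,2)]] e(3)[OF xy] by (simp add: u B(1))
    show "(\<lambda>t\<in>{..srank D}. unit_DA D \<pi> x t \<oplus>\<^bsub>DA_block D t (component D t \<pi>)\<^esub> unit_DA D \<pi> y t) t = {zero_elt D t \<pi>}"
      if "t < srank D" for t
      using qZ(2)[OF zin zin, of t] that by (simp add: u B(2) z1)
  qed simp
  have sc: "c \<odot>\<^bsub>DA D \<pi>\<^esub> unit_DA D \<pi> x = unit_DA D \<pi> (c \<odot>\<^bsub>\<pi>\<^esub> x)" if x: "x \<in> carrier \<pi>" for c x
  proof (rule split; unfold DA_simps)
    show "(\<lambda>t\<in>{..srank D}. c \<odot>\<^bsub>DA_block D t (component D t \<pi>)\<^esub> unit_DA D \<pi> x t) (srank D) = {?e (c \<odot>\<^bsub>\<pi>\<^esub> x)}"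
      using qT(3)[OF e(2)[OF x x], of c] e(4)[OF x x, of c] by (simp add: u B(1))
    show "(\<lambda>t\<in>{..srank D}. c \<odot>\<^bsub>DA_block D t (component D t \<pi>)\<^esub> unit_DA D \<pi> x t) t = {zero_elt D t \<pi>}"
      if "t < srank D" for t
      using qZ(3)[OF zin, of t c] that by (simp add: u B(2) z1)
  qed simp
  have act: "act (DA D \<pi>) g (unit_DA D \<pi> x) = unit_DA D \<pi> (act \<pi> g x)" if g: "g \<in> Fpts (Gt D)" and x: "x \<in> carrier \<pi>" for g x
  proof (rule split; unfold DA_simps)
    have gx: "act \<pi> g x \<in> carrier \<pi>" by (rule S(2)[OF g x])
    have "act ?Y g (?e x) \<in> carrier ?Y" using e(2)[OF gx gx] e(5)[OF x x g] by simp
    from qT(5)[OF this] show "(\<lambda>t\<in>{..srank D}. act (DA_block D t (component D t \<pi>)) g (unit_DA D \<pi> x t)) (srank D) = {?e (act \<pi> g x)}"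
      using e(5)[OF x x g] by (simp add: u B(1))
    show "(\<lambda>t\<in>{..srank D}. act (DA_block D t (component D t \<pi>)) g (unit_DA D \<pi> x t)) t = {zero_elt D t \<pi>}"
      if "t < srank D" for t
    proof -
      have zz: "act (Y_rep D t (zero_rep \<pi>)) g (zero_elt D t \<pi>) = zero_elt D t \<pi>" by (rule Z(4)[OF g])
      then have "act (Y_rep D t (zero_rep \<pi>)) g (zero_elt D t \<pi>) \<in> carrier (Y_rep D t (zero_rep \<pi>))" using zin by simp
      from qZ(5)[OF this] show ?thesis using that zz by (simp add: u B(2))
    qed
  qed simp
  have "bij_betw (unit_DA D \<pi>) (carrier \<pi>) (carrier (DA D \<pi>))" using inj mem surj by (auto simp: bij_betw_def)
  then show ?thesis
    unfolding rep_iso_def rep_hom_def by (intro conjI ballI allI funcsetI) (simp_all only: mem add sc act)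
qed

lemma unit_DA_natural:
  fixes D :: "('f::field, 'n::finite) datum" and \<pi> \<pi>' :: "('f^'n^'n, 'v) rep"
  assumes D: "admissible D" and \<pi>: "Rt D (srank D) \<pi>" "Rt D (srank D) \<pi>'"
    and f: "rep_hom (Gt D) \<pi> \<pi>' f" and x: "x \<in> carrier \<pi>"
  shows "DA_mor D \<pi>' f (unit_DA D \<pi> x) = unit_DA D \<pi>' (f x)"
proof
  note a = admissibleD[OF D]
  have s: "smooth_rep (absv D) (Gt D) \<pi>" "smooth_rep (absv D) (Gt D) \<pi>'" using \<pi> by (simp_all add: Rt_def R_cat_def)
  have s0: "smooth_rep (absv D) (G0 D) \<pi>'" by (rule smooth_rep_restrict_group[OF a(1) s(2) a(5)])
  note S = smooth_repD[OF s(1)] and S' = smooth_repD[OF s(2)] and C = complex_module_closed[OF smooth_repD(1)[OF s(1)]]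
    and C' = complex_module_closed[OF smooth_repD(1)[OF s(2)]]
  note T = Y_rep_top[OF D s(2)] and Z = Y_rep_zero[OF D s(2)] and X0 = X_rep_zero[OF D s(2)]
  have f1: "\<And>y. y \<in> carrier \<pi> \<Longrightarrow> f y \<in> carrier \<pi>'" "\<And>c y. y \<in> carrier \<pi> \<Longrightarrow> f (c \<odot>\<^bsub>\<pi>\<^esub> y) = c \<odot>\<^bsub>\<pi>'\<^esub> f y"
    "\<And>g y. g \<in> Fpts (Gt D) \<Longrightarrow> y \<in> carrier \<pi> \<Longrightarrow> f (act \<pi> g y) = act \<pi>' g (f y)"
    using f by (auto simp: rep_hom_def)
  have f0: "f \<zero>\<^bsub>\<pi>\<^esub> = \<zero>\<^bsub>\<pi>'\<^esub>"
    using f1(2)[OF C(1), of 0] complex_module_laws(10)[OF S(1) C(1)] complex_module_laws(10)[OF S'(1) f1(1)[OF C(1)]] by simp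
  have top: "Y_mor D (srank D) \<pi>' f (top_elt D \<pi> x) = top_elt D \<pi>' (f x)"
  proof -
    have "coset_map \<pi>' {\<zero>\<^bsub>\<pi>'\<^esub>} f {act \<pi> g x} = {act \<pi>' g (f x)}" if g: "g \<in> Fpts (G0 D)" for g
    proof -
      have gG: "g \<in> Fpts (Gt D)" using g Fpts_mono[OF a(5)] by blast
      show ?thesis
        using quot_zero_simps(4)[OF S'(1), of f "act \<pi> g x"] f1(3)[OF gG x] S'(2)[OF gG f1(1)[OF x]] by simp
    qed
    then show ?thesis
      unfolding Y_mor_def top_elt_def orbit_map_def levels_top(1)[OF a(15)]
      by (intro restrict_ext) (simp add: X_rep_simple(4)[OF D s0])
  qed
  have low: "Y_mor D t (zero_rep \<pi>') f (zero_elt D t \<pi>) = zero_elt D t \<pi>'" for t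
  proof -
    have "coset_map (zero_rep \<pi>') {\<zero>\<^bsub>\<pi>'\<^esub>} f {\<zero>\<^bsub>\<pi>\<^esub>} = {\<zero>\<^bsub>\<pi>'\<^esub>}"
      using zero_coset[OF S'(1) C'(1)] by (simp add: coset_map_def a_r_coset_def' zero_rep_def f0)
    then show ?thesis unfolding Y_mor_def X0(1) zero_elt_def by (intro restrict_ext) simp
  qed
  fix t
  consider "t = srank D" | "t < srank D" | "t \<notin> {..srank D}" by fastforce
  then show "DA_mor D \<pi>' f (unit_DA D \<pi> x) t = unit_DA D \<pi>' (f x) t"
  proof cases
    case 1
    have "top_elt D \<pi>' (f x) \<in> carrier (Y_rep D (srank D) \<pi>')"
      using T(1) f1(1)[OF x] by (auto simp: rep_iso_def rep_hom_def)
    then show ?thesis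
      using quot_zero_simps(4)[OF T(2), of "Y_mor D (srank D) \<pi>' f" "top_elt D \<pi> x"] 1
      by (simp add: DA_mor_def unit_DA_def DA_block_mor_def component_top_factor(1)[OF D \<pi>(2)] T(4) top)
  next
    case 2
    then show ?thesis
      using quot_zero_simps(4)[OF Z(3), of "Y_mor D t (zero_rep \<pi>') f" "zero_elt D t \<pi>" t]
      by (simp add: DA_mor_def unit_DA_def DA_block_mor_def component_top_factor(2)[OF D \<pi>(2)] Z(1,2,5) low)
  qed (simp add: DA_mor_def unit_DA_def)
qed

section \<open>Supercuspidal representations lie in the top factor\<close>

text \<open>An irreducible subquotient \<open>\<tau>\<close> of a supercuspidal representation is supercuspidal. It is its own
  parabolic induction from \<open>G\<close>, the standard Levi subgroup attached to all simple roots, because the normalizing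
  factor is \<open>1\<close> there.\<close>

lemma supercuspidal_imp_Rt:
  fixes D :: "('f::field, 'n::finite) datum" and \<pi> :: "('f^'n^'n, 'v) rep"
  assumes D: "admissible D" and \<pi>: "supercuspidal_ext D \<pi>"
  shows "Rt D (srank D) \<pi>"
proof -
  note a = admissibleD[OF D]
  have sc: "supercuspidal (absv D) (G0 D) \<pi>" and cat: "R_cat (absv D) (Gt D) \<pi>" using \<pi> by (auto simp: supercuspidal_ext_def)
  have "Rt_conn D (srank D) \<pi>"
    unfolding Rt_conn_def
  proof (intro conjI allI impI)
    show "R_cat (absv D) (G0 D) \<pi>" using sc by (simp add: supercuspidal_def)
    fix W W'
    assume "subrep (G0 D) \<pi> W \<and> subrep (G0 D) \<pi> W' \<and> W' \<subseteq> W \<and> irreducible_rep (G0 D) (subquot \<pi> W W')"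
    then have W: "subrep (G0 D) \<pi> W" "subrep (G0 D) \<pi> W'" "W' \<subseteq> W" "irreducible_rep (G0 D) (subquot \<pi> W W')" by blast+
    define \<tau> where "\<tau> = subquot \<pi> W W'"
    have \<tau>: "supercuspidal (absv D) (G0 D) \<tau>" unfolding \<tau>_def by (rule supercuspidal_subquot[OF a(1,4) sc W])
    have \<tau>1: "smooth_rep (absv D) (G0 D) \<tau>" using \<tau> by (simp add: supercuspidal_def R_cat_def)
    note S = smooth_repD[OF \<tau>1] and C = complex_module_closed[OF smooth_repD(1)[OF \<tau>1]]
    define b where "b = (\<lambda>p x. complex_of_real (sqrt (modulus (absv D) (G0 D) p)) \<odot>\<^bsub>\<tau>\<^esub> act \<tau> (levi_part (G0 D) (G0 D) p) x)"
    have b: "b g x = act \<tau> g x" if "g \<in> Fpts (G0 D)" "x \<in> carrier \<tau>" for g x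
      using modulus_trivial_radical[OF a(1,6) FptsD(4)[OF a(4) that(1)]] levi_part_trivial_radical[OF a(6) that(1)]
        complex_module_laws(9)[OF S(1) S(2)[OF that]] by (simp add: b_def)
    define \<tau>' where "\<tau>' = \<tau>\<lparr>act := b\<rparr>"
    have \<tau>': "smooth_rep (absv D) (G0 D) \<tau>'" unfolding \<tau>'_def by (rule smooth_rep_cong[OF \<tau>1 a(4) b])
    have id: "rep_iso (G0 D) \<tau> \<tau>' (\<lambda>x. x)"
      unfolding rep_iso_def rep_hom_def using b by (simp add: \<tau>'_def bij_betw_def)
    define \<iota> where "\<iota> = ind (absv D) (G0 D) (G0 D) \<tau>'"
    define E where "E = (\<lambda>x. \<lambda>g\<in>Fpts (G0 D). act \<tau>' g x)"
    have E: "rep_iso (G0 D) \<tau>' \<iota> E" "Module.module \<CC> \<iota>" "E \<zero>\<^bsub>\<tau>'\<^esub> = \<zero>\<^bsub>\<iota>\<^esub>"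
      using rep_iso_ind_self[OF a(1,4) \<tau>'] by (simp_all add: \<iota>_def E_def)
    have \<tau>E: "rep_iso (G0 D) \<tau> \<iota> E" using rep_iso_comp[OF id E(1)] by simp
    have par: "parabolic_ind (absv D) (G0 D) (std_parabolic D (simple D)) (std_levi D (simple D)) \<tau> = \<iota>"
      by (simp add: parabolic_ind_def std_parabolic_simple[OF D] std_levi_simple[OF D] \<iota>_def \<tau>'_def b_def)
    have ac: "act \<iota> g y \<in> carrier \<iota>" if "g \<in> Fpts (G0 D)" "y \<in> carrier \<iota>" for g y
    proof -
      obtain x where x: "x \<in> carrier \<tau>" "y = E x" using \<tau>E \<open>y \<in> carrier \<iota>\<close> by (auto simp: rep_iso_def bij_betw_def)
      then have "act \<iota> g y = E (act \<tau> g x)" using \<tau>E that(1) by (simp add: rep_iso_def rep_hom_def)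
      then show ?thesis using \<tau>E S(2)[OF that(1) x(1)] by (auto simp: rep_iso_def bij_betw_def)
    qed
    have a0: "act \<iota> g \<zero>\<^bsub>\<iota>\<^esub> = \<zero>\<^bsub>\<iota>\<^esub>" if g: "g \<in> Fpts (G0 D)" for g
    proof -
      have "E \<zero>\<^bsub>\<tau>\<^esub> = \<zero>\<^bsub>\<iota>\<^esub>" using E(3) by (simp add: \<tau>'_def)
      moreover have "E (act \<tau> g \<zero>\<^bsub>\<tau>\<^esub>) = act \<iota> g (E \<zero>\<^bsub>\<tau>\<^esub>)" using \<tau>E g C(1) by (simp add: rep_iso_def rep_hom_def)
      ultimately show ?thesis using smooth_rep_act_zero[OF \<tau>1 g] by simp
    qed
    have sub1: "subrep (G0 D) \<iota> (carrier \<iota>)" by (rule subrepI[OF carrier_submodule[OF E(2)] ac])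
    have sub0: "subrep (G0 D) \<iota> {\<zero>\<^bsub>\<iota>\<^esub>}" by (rule subrepI[OF zero_submodule[OF E(2)]]) (simp add: a0)
    have "rep_iso (G0 D) \<iota> (quot \<iota> {\<zero>\<^bsub>\<iota>\<^esub>}) (\<lambda>x. {x})" by (rule rep_iso_quot_zero[OF E(2) ac])
    then have "rep_iso (G0 D) \<tau> (subquot \<iota> (carrier \<iota>) {\<zero>\<^bsub>\<iota>\<^esub>}) (\<lambda>x. {E x})"
      using rep_iso_comp[OF \<tau>E] by simp
    then have "let \<iota> = parabolic_ind (absv D) (G0 D) (std_parabolic D (simple D)) (std_levi D (simple D)) \<tau>
           in subrep (G0 D) \<iota> (carrier \<iota>) \<and> subrep (G0 D) \<iota> {\<zero>\<^bsub>\<iota>\<^esub>} \<and> {\<zero>\<^bsub>\<iota>\<^esub>} \<subseteq> carrier \<iota> \<and>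
              rep_iso (G0 D) \<tau> (subquot \<iota> (carrier \<iota>) {\<zero>\<^bsub>\<iota>\<^esub>}) (\<lambda>x. {E x})"
      unfolding par Let_def using sub1 sub0 complex_module_closed(1)[OF E(2)] by simp
    then show "\<exists>I (\<tau> :: ('f^'n^'n, 'v set) rep) Z Z' f. I \<subseteq> simple D \<and> card I = srank D \<and>
          supercuspidal (absv D) (std_levi D I) \<tau> \<and> irreducible_rep (std_levi D I) \<tau> \<and>
          (let \<iota> = parabolic_ind (absv D) (G0 D) (std_parabolic D I) (std_levi D I) \<tau>
           in subrep (G0 D) \<iota> Z \<and> subrep (G0 D) \<iota> Z' \<and> Z' \<subseteq> Z \<and>
              rep_iso (G0 D) (subquot \<pi> W W') (subquot \<iota> Z Z') f)"
      using \<tau> W(4) unfolding \<tau>_def[symmetric] par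
      by (intro exI[of _ "simple D"] exI[of _ \<tau>] exI[of _ "carrier \<iota>"] exI[of _ "{\<zero>\<^bsub>\<iota>\<^esub>}"] exI[of _ "\<lambda>x. {E x}"] conjI)
         (simp_all add: std_levi_simple[OF D] par[unfolded std_levi_simple[OF D]] Let_def)
  qed
  then show ?thesis using cat by (simp add: Rt_def)
qed

theorem proposition3p1p12:
  fixes D :: "('f::field, 'n::finite) datum"
  assumes "nonarch_local_field (absv D)"
    and "F_group (Gt D)"
    and "reductive_F_group (identity_component (Gt D))"
    and "minimal_parabolic_pair (identity_component (Gt D)) (M0 D) (P0 D)"
    and "maximal_split_central_torus (M0 D) (A0 D)"
    and "simple_roots (identity_component (Gt D)) (P0 D) (A0 D) (simple D)"
  shows "\<exists>\<eta> :: ('f^'n^'n, 'v) rep \<Rightarrow> 'v \<Rightarrow> ('f, 'n, 'v) DAelt.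
           id_iso_DA D (Rt D (card (simple D))) \<eta> \<and>
           id_iso_DA D (supercuspidal_ext D) \<eta>"
proof -
  have D: "admissible D" using assms by (simp add: admissible_def)
  have iso: "id_iso_DA D C (unit_DA D)" if C: "\<And>\<pi> :: ('f^'n^'n, 'v) rep. C \<pi> \<Longrightarrow> Rt D (srank D) \<pi>" for C
    unfolding id_iso_DA_def
  proof (intro conjI allI impI ballI)
    show "rep_iso (Gt D) \<pi> (DA D \<pi>) (unit_DA D \<pi>)" if "C \<pi>" for \<pi> :: "('f^'n^'n, 'v) rep"
      by (rule rep_iso_unit_DA[OF D C[OF that]])
    fix \<pi> \<pi>' :: "('f^'n^'n, 'v) rep" and f x
    assume "C \<pi> \<and> C \<pi>' \<and> rep_hom (Gt D) \<pi> \<pi>' f" and x: "x \<in> carrier \<pi>"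
    then have "C \<pi>" "C \<pi>'" "rep_hom (Gt D) \<pi> \<pi>' f" by simp_all
    then show "DA_mor D \<pi>' f (unit_DA D \<pi> x) = unit_DA D \<pi>' (f x)" by (intro unit_DA_natural[OF D C C _ x])
  qed
  show ?thesis using iso[of "Rt D (srank D)"] iso[of "supercuspidal_ext D"] supercuspidal_imp_Rt[OF D] by blast
qed

end
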